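(* Let $z_i=t^{-\lambda_i}$ with $\lambda_i\in\mathbb C$ ($i=1,\dots,\ell+1$) and $t\in\mathbb R_+$, and for $x_j\in\mathbb R$ ($j=1,\dots,\ell+1$) let $n_j(t,x_j)$ be the integer part of $x_j/\log t$. In the limit $t\to1$ the $q=0$ specialization of the $q$-deformed $\mathfrak{gl}_{\ell+1}$-Whittaker function reduces to the elementary $\mathfrak{gl}_{\ell+1}$-Whittaker function: $$\Psi^{(0)}_{\lambda_1,\dots,\lambda_{\ell+1}}(x_1,\dots,x_{\ell+1})=\lim_{t\to1}\,(\log t)^{\ell(\ell+1)/2}\,\Psi^{q=0}_{t^{-\lambda_1},\dots,t^{-\lambda_{\ell+1}}}\big(n_1(t,x_1),\dots,n_{\ell+1}(t,x_{\ell+1})\big).$$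
   Context: The $q=0$ specialization of the $q$-deformed $\mathfrak{gl}_{\ell+1}$-Whittaker function is $$\Psi^{q=0}_{z_1,\dots,z_{\ell+1}}(n_1,\dots,n_{\ell+1})=\mathrm{Tr}_{V_{n_1,\dots,n_{\ell+1}}}z_1^{H_1}\cdots z_{\ell+1}^{H_{\ell+1}}$$ for integers $n_1\ge\dots\ge n_{\ell+1}$, where $V_{n_1,\dots,n_{\ell+1}}$ is the finite-dimensional irreducible representation of $\mathfrak{gl}_{\ell+1}$ corresponding to the partition $n_1\ge\dots\ge n_{\ell+1}$ and $H_j$ are the diagonal Cartan generators; it equals zero for $(n_1,\dots,n_{\ell+1})$ outside the domain $n_1\ge\dots\ge n_{\ell+1}$. The elementary $\mathfrak{gl}_{\ell+1}$-Whittaker function is (with $\imath=\sqrt{-1}$) $$\Psi^{(0)}_{\underline\lambda}(\underline x)=\imath^{-\ell(\ell+1)/2}\int_{\mathcal S}\prod_{n=1}^{\ell}\frac{\prod_{s\ne p}(\gamma_{ns}-\gamma_{np})}{n!\prod_{k=1}^n\prod_{m=1}^{n+1}(\gamma_{nk}-\gamma_{n+1,m})}\;e^{\imath\sum_{n=1}^{\ell+1}\sum_{j=1}^n(\gamma_{nj}-\gamma_{n-1,j})x_n}\prod_{n=1}^\ell\prod_{j=1}^n\frac{d\gamma_{nj}}{2\pi\imath},$$ where $(s,p)$ runs over ordered pairs of distinct indices in $\{1,\dots,n\}$, $\gamma_{\ell+1,j}:=\lambda_j$, $\gamma_{nj}=0$ for $j>n$, and the domain $\mathcal S$ is such that each integration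 variable satisfies $\gamma_{kj}+\imath\epsilon_{kj}\in\mathbb R$ with fixed real $\epsilon_{kj}$ such that $\max_j\mathrm{Im}\,\gamma_{kj}<\min_m\mathrm{Im}\,\gamma_{k+1,m}$ for all $k=1,\dots,\ell$.
   Formalization: The proved statement takes z_i = t^{iλ_i} instead of t^{-λ_i} (as stated it fails already for ℓ=0: e^{iλx} versus e^{-λx}) and reads t→1 as t→1 from above (for t<1 and ℓ=1, x_1>x_2, the right side vanishes). *)

theory Defs
  imports "HOL-Analysis.Analysis" "Jordan_Normal_Form.VS_Connect"
begin

section \<open>Finite-dimensional representations of $\mathfrak{gl}_N(\mathbb C)$\<close>

text \<open>Indices of weights, variables and matrix units run over \<open>1, ..., N\<close> as in the
  mathematical text, whereas entries of the type of matrices are addressed from \<open>0\<close>.\<close>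

definition gl_unit :: "nat \<Rightarrow> nat \<Rightarrow> nat \<Rightarrow> complex Matrix.mat" where
  "gl_unit N i j = Matrix.mat N N (\<lambda>(a, b). if a + 1 = i \<and> b + 1 = j then 1 else 0)"

definition gl_rep :: "nat \<Rightarrow> nat \<Rightarrow> (complex Matrix.mat \<Rightarrow> complex Matrix.mat) \<Rightarrow> bool" where
  "gl_rep N d \<rho> \<longleftrightarrow>
     (\<forall>X \<in> carrier_mat N N. \<rho> X \<in> carrier_mat d d) \<and>
     (\<forall>X \<in> carrier_mat N N. \<forall>Y \<in> carrier_mat N N. \<rho> (X + Y) = \<rho> X + \<rho> Y) \<and>
     (\<forall>c. \<forall>X \<in> carrier_mat N N. \<rho> (c \<cdot>\<^sub>m X) = c \<cdot>\<^sub>m \<rho> X) \<and>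
     (\<forall>X \<in> carrier_mat N N. \<forall>Y \<in> carrier_mat N N.
        \<rho> (X * Y - Y * X) = \<rho> X * \<rho> Y - \<rho> Y * \<rho> X)"

definition gl_irreducible :: "nat \<Rightarrow> nat \<Rightarrow> (complex Matrix.mat \<Rightarrow> complex Matrix.mat) \<Rightarrow> bool" where
  "gl_irreducible N d \<rho> \<longleftrightarrow> d > 0 \<and>
     (\<forall>W. VectorSpace.subspace class_ring W (module_vec TYPE(complex) d) \<and>
          (\<forall>X \<in> carrier_mat N N. \<forall>w \<in> W. \<rho> X *\<^sub>v w \<in> W)
        \<longrightarrow> W = {0\<^sub>v d} \<or> W = carrier_vec d)"

definition gl_highest_weight ::
    "nat \<Rightarrow> nat \<Rightarrow> (complex Matrix.mat \<Rightarrow> complex Matrix.mat) \<Rightarrow> (nat \<Rightarrow> int) \<Rightarrow> bool" where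
  "gl_highest_weight N d \<rho> n \<longleftrightarrow>
     (\<exists>v \<in> carrier_vec d. v \<noteq> 0\<^sub>v d \<and>
        (\<forall>i \<in> {1..N}. \<rho> (gl_unit N i i) *\<^sub>v v = of_int (n i) \<cdot>\<^sub>v v) \<and>
        (\<forall>i \<in> {1..N}. \<forall>j \<in> {1..N}. i < j \<longrightarrow> \<rho> (gl_unit N i j) *\<^sub>v v = 0\<^sub>v d))"

definition gl_dominant :: "nat \<Rightarrow> (nat \<Rightarrow> int) \<Rightarrow> bool" where
  "gl_dominant N n \<longleftrightarrow> (\<forall>i \<in> {1..N}. \<forall>j \<in> {1..N}. i \<le> j \<longrightarrow> n j \<le> n i)"

text \<open>A matrix model (dimension, action) of the irreducible representation of highest weight
  \<open>n\<close>, which is unique up to isomorphism. It is meaningful only for dominant \<open>n\<close>.\<close>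

definition gl_irrep :: "nat \<Rightarrow> (nat \<Rightarrow> int) \<Rightarrow> nat \<times> (complex Matrix.mat \<Rightarrow> complex Matrix.mat)" where
  "gl_irrep N n =
     (SOME (d, \<rho>). gl_rep N d \<rho> \<and> gl_irreducible N d \<rho> \<and> gl_highest_weight N d \<rho> n)"

section \<open>The $q = 0$ Whittaker function\<close>

definition mat_trace :: "complex Matrix.mat \<Rightarrow> complex" where
  "mat_trace A = (\<Sum>i < dim_row A. A $$ (i, i))"

definition mat_exp :: "complex Matrix.mat \<Rightarrow> complex Matrix.mat" where
  "mat_exp A = Matrix.mat (dim_row A) (dim_row A)
     (\<lambda>(i, j). \<Sum>k. (A ^\<^sub>m k) $$ (i, j) / fact k)"

text \<open>\<open>z\<^bsup>A\<^esup>\<close> for \<open>z \<noteq> 0\<close>. It is used for diagonalizable \<open>A\<close> with integer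
  eigenvalues, where the choice of the branch of the logarithm is immaterial.\<close>

definition mat_cpow :: "complex \<Rightarrow> complex Matrix.mat \<Rightarrow> complex Matrix.mat" where
  "mat_cpow z A = mat_exp (Ln z \<cdot>\<^sub>m A)"

definition whittaker_q0 :: "nat \<Rightarrow> (nat \<Rightarrow> complex) \<Rightarrow> (nat \<Rightarrow> int) \<Rightarrow> complex" where
  "whittaker_q0 N z n =
     (if gl_dominant N n
      then case gl_irrep N n of (d, \<rho>) \<Rightarrow>
             mat_trace (foldr (\<lambda>i M. mat_cpow (z i) (\<rho> (gl_unit N i i)) * M) [1..<N+1] (1\<^sub>m d))
      else 0)"

section \<open>The elementary Whittaker function\<close>

text \<open>The contour is \<open>\<gamma>\<^sub>n\<^sub>j = u\<^sub>n\<^sub>j - \<i> \<epsilon>\<^sub>n\<^sub>j\<close> with the real parts \<open>u\<^sub>n\<^sub>j\<close> as integration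
  variables, \<open>1 \<le> j \<le> n \<le> l\<close>. The exponential factors \<open>exp (\<i> \<gamma> x)\<close> fix the
  normalization of the spectral parameters: for \<open>l = 0\<close> the function is \<open>exp (\<i> \<lambda>\<^sub>1 x\<^sub>1)\<close>, so it
  is the limit of characters at \<open>z\<^sub>i = t powr (\<i> \<lambda>\<^sub>i)\<close>; at \<open>z\<^sub>i = t powr (- \<lambda>\<^sub>i)\<close> one
  obtains it with \<open>\<lambda>\<close> replaced by \<open>\<i> \<lambda>\<close>.\<close>

definition whittaker_index :: "nat \<Rightarrow> (nat \<times> nat) set" where
  "whittaker_index l = {(n, j). 1 \<le> j \<and> j \<le> n \<and> n \<le> l}"

definition whittaker_gamma ::
    "nat \<Rightarrow> (nat \<Rightarrow> complex) \<Rightarrow> (nat \<Rightarrow> nat \<Rightarrow> real) \<Rightarrow> (nat \<times> nat \<Rightarrow> real) \<Rightarrow> nat \<Rightarrow> nat \<Rightarrow> complex" where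
  "whittaker_gamma l lam \<epsilon> u n j =
     (if j < 1 \<or> n < j then 0
      else if n = l + 1 then lam j
      else complex_of_real (u (n, j)) - \<i> * complex_of_real (\<epsilon> n j))"

definition whittaker_contour :: "nat \<Rightarrow> (nat \<Rightarrow> complex) \<Rightarrow> (nat \<Rightarrow> nat \<Rightarrow> real) \<Rightarrow> bool" where
  "whittaker_contour l lam \<epsilon> \<longleftrightarrow>
     (\<forall>u. \<forall>k \<in> {1..l}.
        Max ((\<lambda>j. Im (whittaker_gamma l lam \<epsilon> u k j)) ` {1..k})
          < Min ((\<lambda>m. Im (whittaker_gamma l lam \<epsilon> u (k + 1) m)) ` {1..k + 1}))"

definition whittaker_integrand ::
    "nat \<Rightarrow> (nat \<Rightarrow> real) \<Rightarrow> (nat \<Rightarrow> nat \<Rightarrow> complex) \<Rightarrow> complex" where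
  "whittaker_integrand l x \<gamma> =
     (\<Prod>n = 1..l.
        (\<Prod>(s, p) \<in> {(s, p). s \<in> {1..n} \<and> p \<in> {1..n} \<and> s \<noteq> p}. \<gamma> n s - \<gamma> n p) /
        (fact n * (\<Prod>k = 1..n. \<Prod>m = 1..n + 1. \<gamma> n k - \<gamma> (n + 1) m))) *
     exp (\<i> * (\<Sum>n = 1..l + 1. \<Sum>j = 1..n. (\<gamma> n j - \<gamma> (n - 1) j) * complex_of_real (x n)))"

definition whittaker_elementary ::
    "nat \<Rightarrow> (nat \<Rightarrow> nat \<Rightarrow> real) \<Rightarrow> (nat \<Rightarrow> complex) \<Rightarrow> (nat \<Rightarrow> real) \<Rightarrow> complex" where
  "whittaker_elementary l \<epsilon> lam x =
     \<i> powi (- int (l * (l + 1) div 2)) *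
     (LINT u | PiM (whittaker_index l) (\<lambda>_. lborel).
        whittaker_integrand l x (whittaker_gamma l lam \<epsilon> u) *
        (\<Prod>(n, j) \<in> whittaker_index l. 1 / (2 * complex_of_real pi * \<i>)))"

lemma whittaker_contour_exists: "\<exists>\<epsilon>. whittaker_contour l lam \<epsilon>"
proof -
  define C where "C = (\<Sum>m = 1..l + 1. \<bar>Im (lam m)\<bar>)"
  define \<epsilon> :: "nat \<Rightarrow> nat \<Rightarrow> real" where "\<epsilon> = (\<lambda>k _. C + (real l + 1 - real k))"
  have C: "- C \<le> Im (lam m)" if "m \<in> {1..l + 1}" for m
  proof -
    have "\<bar>Im (lam m)\<bar> \<le> C"
      unfolding C_def by (rule member_le_sum) (use that in auto)
    then show ?thesis by linarith
  qed
  have "Im (whittaker_gamma l lam \<epsilon> u k j) < Im (whittaker_gamma l lam \<epsilon> u (k + 1) m)"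
    if "k \<in> {1..l}" "j \<in> {1..k}" "m \<in> {1..k + 1}" for u k j m
    using that C[of m] by (auto simp: whittaker_gamma_def \<epsilon>_def)
  then have "whittaker_contour l lam \<epsilon>"
    by (auto simp: whittaker_contour_def)
  then show ?thesis by blast
qed

end

theory Submission
  imports Defs "Jordan_Normal_Form.DL_Rank" "HOL-Complex_Analysis.Complex_Analysis"
begin

text \<open>Both sides are computed in closed form. For pairwise distinct spectral parameters \<open>\<lambda>\<close> the common value at a
weakly decreasing point \<open>x\<close> is
\<open>det (exp (\<i> \<lambda>\<^sub>a x\<^sub>b))\<close> divided by the product of the \<open>\<i> (\<lambda>\<^sub>a - \<lambda>\<^sub>b)\<close>, \<open>a < b\<close> (\<open>char_limit\<close>), and it is \<open>0\<close> elsewhere.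

On the side of the characters this is the scaling limit of the Weyl character formula: with
\<open>z\<^sub>a = exp (\<i> \<lambda>\<^sub>a h)\<close> and \<open>h = ln t \<rightarrow> 0\<close>, the numerator
\<open>det (z\<^sub>a powi (n\<^sub>b - b))\<close> converges because \<open>h n\<^sub>b \<rightarrow> x\<^sub>b\<close>, and each factor of the Weyl denominator divided by
\<open>h\<close> converges to a difference of spectral parameters; this explains the normalizing power
\<open>l (l + 1) div 2\<close>, the number of pairs. The Weyl formula itself (\<open>weyl_character_formula\<close>) follows
from three facts about an irreducible representation: it has a basis of weight vectors, obtained by lowering the
highest one (\<open>irreducible_weight_basis\<close>); its Casimir operator is a scalar, which, by the cyclicity of
the trace, makes the product of the Weyl denominator and the character an eigenfunction of the Laplacian
\<open>\<Sum> (z\<^sub>i \<partial>\<^sub>i)\<^sup>2\<close>; and this product is alternating. Its exponents therefore lie on one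
sphere, and dominance leaves only the permutations of the top exponent. That the representation exists at all
is shown in an exterior algebra (\<open>exists_highest_weight_rep\<close>), after which a representation of minimal
dimension with the given highest weight is irreducible (\<open>exists_irreducible\<close>).

On the side of the integral, the variables are integrated row by row: by Fubini's theorem the rows below a given
row give the closed formula with the entries \<open>\<gamma>\<close> of that row in the place
of \<open>\<lambda>\<close>; its denominator cancels against half of the numerator of the integrand, and what remains is a
product of two determinants divided by \<open>\<Prod> (\<gamma>\<^sub>a - \<lambda>\<^sub>m)\<close>. Expanded, it splits into one-dimensional
Fourier integrals of rational functions, evaluated by residues (\<open>row_integral\<close>). Fubini's theorem needs absolute
convergence, which is delicate since the factors decay only barely; \<open>cauchy_ratio_integral\<close> gives a bound
with an arbitrarily small loss in the exponent, so that it can be iterated (\<open>nested_integrand_bound\<close>).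

Coinciding \<open>\<lambda>\<^sub>i\<close> are reached by the real shifts \<open>\<lambda>\<^sub>i + \<delta> (i + 1)\<close> (\<open>shifted\<close>), which do not move the
contour. The integral is continuous in \<open>\<delta>\<close> by dominated convergence (\<open>nested_integral_limit\<close>). The
rescaled characters are Lipschitz in \<open>\<delta>\<close> uniformly in \<open>h\<close>, so the limits \<open>\<delta> \<rightarrow> 0\<close> and
\<open>h \<rightarrow> 0\<close> may be exchanged (\<open>q0_at_limit\<close>).

Internally all indices start at \<open>0\<close>.\<close>

section \<open>Determinants and Lagrange interpolation\<close>

text \<open>Determinants of families of entries indexed by natural numbers. The Leibniz expansion is the definition because
the sums over permutations are what gets integrated and compared term by term below; the algebraic rules are
imported from matrices through \<open>leibniz_det\<close>.\<close>

definition leibniz :: "nat \<Rightarrow> (nat \<Rightarrow> nat \<Rightarrow> complex) \<Rightarrow> complex" where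
  "leibniz n f = (\<Sum>p | p permutes {..<n}. of_int (sign p) * (\<Prod>i<n. f i (p i)))"

lemma leibniz_det: "leibniz n f = Determinant.det (Matrix.mat n n (\<lambda>(i, j). f i j))"
proof -
  have "Determinant.det (Matrix.mat n n (\<lambda>(i, j). f i j)) =
      (\<Sum>p | p permutes {0..<n}. of_int (sign p) * (\<Prod>i = 0..<n. f i (p i)))"
    unfolding det_def'[OF mat_carrier]
  proof (intro sum.cong refl arg_cong2[where f = "(*)"] prod.cong)
    fix p i assume "p \<in> {p. p permutes {0..<n}}" "i \<in> {0..<n}"
    then show "Matrix.mat n n (\<lambda>(i, j). f i j) $$ (i, p i) = f i (p i)"
      using permutes_in_image[of p "{0..<n}" i] by auto
  qed
  then show ?thesis
    by (simp add: leibniz_def lessThan_atLeast0)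
qed

lemma leibniz_cong:
  assumes "\<And>i j. i < n \<Longrightarrow> j < n \<Longrightarrow> f i j = g i j"
  shows "leibniz n f = leibniz n g"
  unfolding leibniz_def
proof (intro sum.cong refl arg_cong2[where f = "(*)"] prod.cong)
  fix p i assume "p \<in> {p. p permutes {..<n}}" "i \<in> {..<n}"
  then show "f i (p i) = g i (p i)"
    using permutes_in_image[of p "{..<n}" i] assms by auto
qed

lemma leibniz_transpose: "leibniz n (\<lambda>i j. f j i) = leibniz n f"
proof -
  have "Matrix.mat n n (\<lambda>(i, j). f j i) = transpose_mat (Matrix.mat n n (\<lambda>(i, j). f i j))"
    by (rule eq_matI) auto
  then show ?thesis
    unfolding leibniz_det by (simp add: Determinant.det_transpose[OF mat_carrier])
qed

lemma leibniz_mult: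
  "leibniz n (\<lambda>i j. \<Sum>k<n. f i k * g k j) = leibniz n f * leibniz n g"
proof -
  have "Matrix.mat n n (\<lambda>(i, j). \<Sum>k<n. f i k * g k j) =
      Matrix.mat n n (\<lambda>(i, j). f i j) * Matrix.mat n n (\<lambda>(i, j). g i j)"
    by (rule eq_matI) (auto simp: scalar_prod_def lessThan_atLeast0)
  then show ?thesis
    unfolding leibniz_det by (simp add: Determinant.det_mult[OF mat_carrier mat_carrier])
qed

lemma leibniz_scale_rows: "leibniz n (\<lambda>i j. c i * f i j) = (\<Prod>i<n. c i) * leibniz n f"
  by (simp add: leibniz_def prod.distrib sum_distrib_left mult_ac)

lemma leibniz_scale_cols: "leibniz n (\<lambda>i j. c j * f i j) = (\<Prod>i<n. c i) * leibniz n f"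
  using leibniz_scale_rows[of n c "\<lambda>i j. f j i"] leibniz_transpose[of n f]
    leibniz_transpose[of n "\<lambda>i j. c j * f i j"] by simp

lemma leibniz_permute_rows:
  assumes "p permutes {..<n}"
  shows "leibniz n (\<lambda>i j. f (p i) j) = of_int (sign p) * leibniz n f"
proof -
  have p: "p permutes {0..<n}"
    using assms by (simp add: lessThan_atLeast0)
  have "Matrix.mat n n (\<lambda>(i, j). f (p i) j) =
      Matrix.mat n n (\<lambda>(i, j). Matrix.mat n n (\<lambda>(i, j). f i j) $$ (p i, j))"
    by (rule eq_matI) (use permutes_in_image[OF p] in auto)
  then show ?thesis
    unfolding leibniz_det using Determinant.det_permute_rows[OF mat_carrier p] by simp
qed

lemma leibniz_identical_rows:
  assumes "a < n" "b < n" "a \<noteq> b" "\<And>j. j < n \<Longrightarrow> f a j = f b j"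
  shows "leibniz n f = 0"
  unfolding leibniz_det
  by (rule Determinant.det_identical_rows[OF mat_carrier assms(3,1,2)])
     (use assms in \<open>auto intro!: eq_vecI\<close>)

text \<open>With the last column a unit vector the determinant does not see the last row. It is used from right to left: a
determinant of sums over \<open>n + 1\<close> terms is enlarged to size \<open>n + 1\<close>, where it factors.\<close>

lemma leibniz_border:
  assumes "\<And>i. i < n \<Longrightarrow> f i n = 0" "f n n = 1"
  shows "leibniz (Suc n) f = leibniz n f"
proof -
  let ?A = "Matrix.mat (Suc n) (Suc n) (\<lambda>(i, j). f i j)"
  have "Determinant.det ?A = (\<Sum>i<Suc n. ?A $$ (i, n) * cofactor ?A i n)"
    by (rule laplace_expansion_column[OF mat_carrier]) simp
  also have "\<dots> = cofactor ?A n n"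
    using assms by simp
  also have "\<dots> = Determinant.det (mat_delete ?A n n)"
    by (simp add: cofactor_def)
  also have "mat_delete ?A n n = Matrix.mat n n (\<lambda>(i, j). f i j)"
    by (rule eq_matI) (auto simp: mat_delete_def)
  finally show ?thesis
    unfolding leibniz_det .
qed

lemma poly_eq_0_if_many_roots:
  fixes q :: "complex poly"
  assumes "finite B" "\<And>m. m \<in> B \<Longrightarrow> poly q m = 0" "degree q < card B"
  shows "q = 0"
proof (rule ccontr)
  assume "q \<noteq> 0"
  then have "card {x. poly q x = 0} \<le> degree q"
    by (rule card_poly_roots_bound)
  moreover have "card B \<le> card {x. poly q x = 0}"
    by (rule card_mono) (use assms poly_roots_finite[OF \<open>q \<noteq> 0\<close>] in auto)
  ultimately show False using assms by simp
qed

lemma vandermonde_det: "leibniz n (\<lambda>i j. z i ^ j) = (\<Prod>j<n. \<Prod>i<j. z j - z i)"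
proof (induction n)
  case 0
  then show ?case by (simp add: leibniz_def)
next
  case (Suc n)
  show ?case
  proof (cases "inj_on z {..<Suc n}")
    case False
    then obtain a b where ab: "a < b" "b < Suc n" "z a = z b"
      by (auto simp: inj_on_def) (metis linorder_neqE_nat)
    have "leibniz (Suc n) (\<lambda>i j. z i ^ j) = 0"
      by (rule leibniz_identical_rows[of a _ b]) (use ab in auto)
    moreover have "(\<Prod>i<b. z b - z i) = 0"
      by (rule prod_zero) (use ab in \<open>auto intro!: bexI[of _ a]\<close>)
    then have "(\<Prod>j<Suc n. \<Prod>i<j. z j - z i) = 0"
      using ab by - (rule prod_zero, simp, rule bexI[of _ b], simp_all)
    ultimately show ?thesis by simp
  next
    case True
    \<comment> \<open>As a polynomial in the last variable, the determinant has the leading coefficient of the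
      smaller determinant and vanishes at the other variables.\<close>
    define w where "w = (\<lambda>x. z(n := x))"
    define A where "A = (\<lambda>x. Matrix.mat (Suc n) (Suc n) (\<lambda>(i, j). w x i ^ j))"
    define P where "P = (\<Sum>j<Suc n. Polynomial.monom (cofactor (A 0) n j) j)"
    have cof: "cofactor (A x) n j = cofactor (A 0) n j" for x j
    proof -
      have "mat_delete (A x) n j = mat_delete (A 0) n j"
        by (rule eq_matI) (auto simp: mat_delete_def A_def w_def)
      then show ?thesis by (simp add: cofactor_def)
    qed
    have P: "poly P x = leibniz (Suc n) (\<lambda>i j. w x i ^ j)" for x
    proof -
      have "leibniz (Suc n) (\<lambda>i j. w x i ^ j) = (\<Sum>j<Suc n. A x $$ (n, j) * cofactor (A x) n j)"
        unfolding leibniz_det A_def by (rule laplace_expansion_row[OF mat_carrier]) simp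
      also have "\<dots> = (\<Sum>j<Suc n. x ^ j * cofactor (A 0) n j)"
        by (intro sum.cong refl arg_cong2[where f = "(*)"] cof) (auto simp: A_def w_def)
      finally show ?thesis
        by (simp add: P_def poly_sum poly_monom mult.commute)
    qed
    have c: "cofactor (A 0) n n = leibniz n (\<lambda>i j. z i ^ j)"
    proof -
      have "mat_delete (A 0) n n = Matrix.mat n n (\<lambda>(i, j). z i ^ j)"
        by (rule eq_matI) (auto simp: mat_delete_def A_def w_def)
      then show ?thesis by (simp add: cofactor_def leibniz_det)
    qed
    define Q where "Q = (\<Prod>i<n. [:- z i, 1:])"
    have dQ: "degree Q = n" "coeff Q n = 1"
    proof -
      show "degree Q = n"
        unfolding Q_def by (subst degree_prod_sum_eq) auto
      moreover have "lead_coeff Q = 1"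
        unfolding Q_def lead_coeff_prod by simp
      ultimately show "coeff Q n = 1" by simp
    qed
    have "P - Polynomial.smult (cofactor (A 0) n n) Q = 0"
    proof (cases "n = 0")
      case True
      then show ?thesis by (simp add: P_def Q_def monom_0)
    next
      case n: False
      show ?thesis
      proof (rule poly_eq_0_if_many_roots[of "z ` {..<n}"])
        fix m assume "m \<in> z ` {..<n}"
        then obtain i where i: "i < n" "m = z i" by auto
        have "poly Q m = 0"
          using i by (auto simp: Q_def poly_prod intro!: prod_zero bexI[of _ i])
        moreover have "leibniz (Suc n) (\<lambda>i j. w m i ^ j) = 0"
          by (rule leibniz_identical_rows[of i _ n]) (use i in \<open>auto simp: w_def\<close>)
        ultimately show "poly (P - Polynomial.smult (cofactor (A 0) n n) Q) m = 0"
          by (simp add: P)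
      next
        have "degree (P - Polynomial.smult (cofactor (A 0) n n) Q) \<le> n - 1"
        proof (rule degree_le, intro allI impI)
          fix i assume "n - 1 < i"
          then consider "i = n" | "i > n" by linarith
          then show "coeff (P - Polynomial.smult (cofactor (A 0) n n) Q) i = 0"
          proof cases
            case 1
            then show ?thesis using dQ by (simp add: P_def coeff_sum)
          next
            case 2
            then have "coeff Q i = 0" using dQ by (simp add: coeff_eq_0)
            then show ?thesis using 2 by (auto simp: P_def coeff_sum)
          qed
        qed
        with n have "degree (P - Polynomial.smult (cofactor (A 0) n n) Q) < n"
          by linarith
        moreover have "card (z ` {..<n}) = n"
          using True by (subst card_image) (auto simp: inj_on_def)
        ultimately show "degree (P - Polynomial.smult (cofactor (A 0) n n) Q) < card (z ` {..<n})"
          by simp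
      qed auto
    qed
    then have "poly P (z n) = cofactor (A 0) n n * poly Q (z n)"
      by (metis poly_diff poly_smult poly_0 right_minus_eq)
    moreover have "w (z n) = z" by (simp add: w_def)
    ultimately show ?thesis
      using Suc.IH c by (simp add: P Q_def poly_prod)
  qed
qed

text \<open>The second formula compares the coefficients of highest possible degree in the first one. Its case of a vanishing
coefficient is what makes the partial fractions below decay quadratically rather than linearly.\<close>

lemma lagrange_interpolation:
  fixes P :: "complex poly"
  assumes fin: "finite B" and inj: "inj_on lam B" and deg: "degree P < card B"
  shows "poly P x = (\<Sum>m\<in>B. poly P (lam m) / (\<Prod>k\<in>B - {m}. lam m - lam k) * (\<Prod>k\<in>B - {m}. x - lam k))"
    and "coeff P (card B - 1) = (\<Sum>m\<in>B. poly P (lam m) / (\<Prod>k\<in>B - {m}. lam m - lam k))"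
proof -
  define c where "c m = poly P (lam m) / (\<Prod>k\<in>B - {m}. lam m - lam k)" for m
  define L where "L m = (\<Prod>k\<in>B - {m}. [:- lam k, 1:])" for m
  define Q where "Q = (\<Sum>m\<in>B. Polynomial.smult (c m) (L m))"
  have dL: "degree (L m) = card B - 1" "coeff (L m) (card B - 1) = 1" if "m \<in> B" for m
  proof -
    show d: "degree (L m) = card B - 1"
      unfolding L_def using that fin by (subst degree_prod_sum_eq) auto
    have "lead_coeff (L m) = 1"
      unfolding L_def lead_coeff_prod by simp
    then show "coeff (L m) (card B - 1) = 1" using d by simp
  qed
  have pL: "poly (L m) x = (\<Prod>k\<in>B - {m}. x - lam k)" for m x
    by (simp add: L_def poly_prod)
  have nz: "(\<Prod>k\<in>B - {m}. lam m - lam k) \<noteq> 0" if "m \<in> B" for m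
    using that fin inj by (auto simp: inj_on_def)
  have "P - Q = 0"
  proof (rule poly_eq_0_if_many_roots[of "lam ` B"])
    have "degree Q \<le> card B - 1"
      unfolding Q_def
      by (rule degree_sum_le) (use fin dL in \<open>auto intro: order.trans[OF degree_smult_le]\<close>)
    then have "degree (P - Q) < card B"
      using deg by (intro degree_diff_less) auto
    then show "degree (P - Q) < card (lam ` B)"
      by (simp add: card_image inj)
  next
    fix y assume "y \<in> lam ` B"
    then obtain m where m: "m \<in> B" "y = lam m" by auto
    have "poly Q y = (\<Sum>k\<in>B. if k = m then c m * poly (L m) (lam m) else 0)"
      unfolding Q_def poly_sum poly_smult
    proof (intro sum.cong refl)
      fix k assume "k \<in> B"
      show "c k * poly (L k) y = (if k = m then c m * poly (L m) (lam m) else 0)"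
        using m fin by (auto simp: pL intro!: prod_zero)
    qed
    also have "\<dots> = poly P y"
      using m fin nz[OF m(1)] by (simp add: c_def pL)
    finally show "poly (P - Q) y = 0" by simp
  qed (use fin in auto)
  then have PQ: "P = Q" by simp
  show "poly P x = (\<Sum>m\<in>B. poly P (lam m) / (\<Prod>k\<in>B - {m}. lam m - lam k) * (\<Prod>k\<in>B - {m}. x - lam k))"
    by (subst PQ) (simp add: Q_def poly_sum pL c_def)
  have "coeff Q (card B - 1) = (\<Sum>m\<in>B. c m)"
    unfolding Q_def coeff_sum by (intro sum.cong refl) (use dL in auto)
  then show "coeff P (card B - 1) = (\<Sum>m\<in>B. poly P (lam m) / (\<Prod>k\<in>B - {m}. lam m - lam k))"
    by (simp add: PQ c_def)
qed

section \<open>Linear independence of monomials\<close>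

definition monom_at :: "nat \<Rightarrow> (nat \<Rightarrow> complex) \<Rightarrow> (nat \<Rightarrow> int) \<Rightarrow> complex" where
  "monom_at N z \<mu> = (\<Prod>i<N. z i powi \<mu> i)"

text \<open>The term with the largest exponent dominates as \<open>t \<rightarrow> \<infinity>\<close>.\<close>

lemma exponential_sums_independent:
  fixes C :: "real \<Rightarrow> complex"
  assumes fin: "finite K" and eq: "\<And>t. t > 0 \<Longrightarrow> (\<Sum>k\<in>K. C k * of_real (exp (t * k))) = 0"
  shows "\<forall>k\<in>K. C k = 0"
proof (rule ccontr)
  assume a: "\<not> (\<forall>k\<in>K. C k = 0)"
  define L where "L = {k\<in>K. C k \<noteq> 0}"
  have L: "finite L" "L \<noteq> {}" using fin a by (auto simp: L_def)
  define m where "m = Max L"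
  have m: "m \<in> L" "\<And>k. k \<in> L \<Longrightarrow> k \<le> m" using L by (auto simp: m_def)
  have sumL: "(\<Sum>k\<in>K. C k * of_real (exp (t * k))) = (\<Sum>k\<in>L. C k * of_real (exp (t * k)))" for t
    by (rule sum.mono_neutral_right) (use fin in \<open>auto simp: L_def\<close>)
  have "((\<lambda>t. \<Sum>k\<in>L. C k * of_real (exp (t * (k - m)))) \<longlongrightarrow> (\<Sum>k\<in>L. if k = m then C m else 0)) at_top"
  proof (rule tendsto_sum)
    fix k assume k: "k \<in> L"
    show "((\<lambda>t. C k * of_real (exp (t * (k - m)))) \<longlongrightarrow> (if k = m then C m else 0)) at_top"
    proof (cases "k = m")
      case False
      with m(2)[OF k] have "k - m < 0" by simp
      then have "((\<lambda>t::real. exp (t * (k - m))) \<longlongrightarrow> 0) at_top"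
        by (auto intro!: filterlim_compose[OF exp_at_bot] filterlim_at_top_mult_tendsto_pos
            simp: filterlim_uminus_at_bot
            intro: filterlim_tendsto_neg_mult_at_bot[OF tendsto_const _ filterlim_ident, of "k - m", simplified mult.commute])
      then have "((\<lambda>t. C k * of_real (exp (t * (k - m)))) \<longlongrightarrow> C k * of_real 0) at_top"
        by (intro tendsto_intros)
      then show ?thesis using False by simp
    qed simp
  qed
  moreover have "(\<Sum>k\<in>L. if k = m then C m else 0) = C m"
    using L m by simp
  moreover have "eventually (\<lambda>t. (\<Sum>k\<in>L. C k * of_real (exp (t * (k - m)))) = 0) at_top"
    using eventually_gt_at_top[of 0]
  proof eventually_elim
    case (elim t)
    have "(\<Sum>k\<in>L. C k * of_real (exp (t * (k - m)))) = of_real (exp (- t * m)) * (\<Sum>k\<in>L. C k * of_real (exp (t * k)))"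
      unfolding sum_distrib_left
      by (intro sum.cong refl) (simp add: right_diff_distrib exp_diff exp_minus field_simps)
    also have "\<dots> = 0" using eq[OF elim] sumL[of t] by simp
    finally show ?case .
  qed
  then have "((\<lambda>t. \<Sum>k\<in>L. C k * of_real (exp (t * (k - m)))) \<longlongrightarrow> 0) at_top"
    by (rule tendsto_eventually)
  ultimately have "C m = 0" 
    by (auto dest: tendsto_unique[OF trivial_limit_at_top_linorder])
  with m(1) show False by (simp add: L_def)
qed

text \<open>Equality of Laurent polynomials at distinct positive arguments forces equality of coefficients. The indexed form,
in which several indices may carry the same exponent \<open>\<nu>\<close>, is the one in which characters appear.\<close>

lemma monomials_independent:
  fixes c :: "'b \<Rightarrow> complex" and w :: "'b \<Rightarrow> nat \<Rightarrow> int"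
  assumes fin: "finite B" and supp: "\<And>b i. b \<in> B \<Longrightarrow> i \<ge> N \<Longrightarrow> w b i = 0"
    and eq: "\<And>y. (\<And>i. i < N \<Longrightarrow> y i > (0::real)) \<Longrightarrow> inj_on y {..<N} \<Longrightarrow>
      (\<Sum>b\<in>B. c b * monom_at N (\<lambda>i. of_real (y i)) (w b)) = 0"
  shows "(\<Sum>b | b \<in> B \<and> w b = \<nu>. c b) = 0"
proof -
  \<comment> \<open>Along the curve \<open>exp (t \<beta>\<^sup>i)\<close> with generic \<open>\<beta>\<close>, distinct monomials become distinct exponentials.\<close>
  define p where "p = (\<lambda>\<mu>::nat \<Rightarrow> int. \<Sum>i<N. Polynomial.monom (real_of_int (\<mu> i)) i)"
  have pz: "\<mu> i = 0" if "p \<mu> = 0" "i < N" for \<mu> i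
  proof -
    have "coeff (p \<mu>) i = real_of_int (\<mu> i)"
      using that(2) by (simp add: p_def coeff_sum)
    then show ?thesis using that(1) by simp
  qed
  \<comment> \<open>The finitely many values of the base for which two distinct exponents become equal.\<close>
  define R where "R = (\<Union>b\<in>B. \<Union>b'\<in>{b'\<in>B. p (\<lambda>i. w b i - w b' i) \<noteq> 0}. {x. poly (p (\<lambda>i. w b i - w b' i)) x = 0})"
  have "finite R"
    unfolding R_def by (intro finite_UN_I) (auto simp: fin poly_roots_finite)
  then have "infinite ({1<..<2} - R)"
    by (intro Diff_infinite_finite infinite_Ioo) auto
  then obtain \<beta> where \<beta>: "1 < \<beta>" "\<beta> < 2" "\<beta> \<notin> R"
    by (metis DiffE all_not_in_conv finite.emptyI greaterThanLessThan_iff)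
  define \<kappa> where "\<kappa> b = (\<Sum>i<N. real_of_int (w b i) * \<beta> ^ i)" for b
  have \<kappa>: "w b = w b'" if "b \<in> B" "b' \<in> B" "\<kappa> b = \<kappa> b'" for b b'
  proof -
    have "poly (p (\<lambda>i. w b i - w b' i)) \<beta> = \<kappa> b - \<kappa> b'"
      by (simp add: p_def poly_sum poly_monom \<kappa>_def sum_subtractf left_diff_distrib)
    with that have "p (\<lambda>i. w b i - w b' i) = 0"
      using \<beta>(3) by (auto simp: R_def)
    then have "w b i = w b' i" if "i < N" for i
      using pz that by fastforce
    then show ?thesis
      using supp that by (metis ext linorder_not_le)
  qed
  define C where "C k = (\<Sum>b | b \<in> B \<and> \<kappa> b = k. c b)" for k
  have "\<forall>k\<in>\<kappa> ` B. C k = 0"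
  proof (rule exponential_sums_independent)
    fix t :: real assume "t > 0"
    define y where "y i = exp (t * \<beta> ^ i)" for i
    have inj: "inj_on y {..<N}"
      using \<beta> \<open>t > 0\<close> by (auto simp: y_def inj_on_def)
    have mon: "monom_at N (\<lambda>i. of_real (y i)) (w b) = of_real (exp (t * \<kappa> b))" for b
    proof -
      have "monom_at N (\<lambda>i. of_real (y i)) (w b) = of_real (\<Prod>i<N. y i powi w b i)"
        by (simp add: monom_at_def of_real_power_int)
      also have "(\<Prod>i<N. y i powi w b i) = (\<Prod>i<N. exp (t * (real_of_int (w b i) * \<beta> ^ i)))"
        by (intro prod.cong refl) (simp add: y_def exp_power_int mult_ac)
      finally show ?thesis
        by (simp add: exp_sum \<kappa>_def sum_distrib_left)
    qed
    have "(\<Sum>k\<in>\<kappa> ` B. C k * of_real (exp (t * k))) =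
        (\<Sum>k\<in>\<kappa> ` B. \<Sum>b | b \<in> B \<and> \<kappa> b = k. c b * of_real (exp (t * \<kappa> b)))"
      unfolding C_def sum_distrib_right by (intro sum.cong refl) auto
    also have "\<dots> = (\<Sum>b\<in>B. c b * of_real (exp (t * \<kappa> b)))"
      by (rule sum.group) (use fin in auto)
    also have "\<dots> = 0"
      using eq[of y] inj by (simp add: mon) (simp add: y_def)
    finally show "(\<Sum>k\<in>\<kappa> ` B. C k * of_real (exp (t * k))) = 0" .
  qed (use fin in auto)
  show ?thesis
  proof (cases "\<exists>b\<in>B. w b = \<nu>")
    case True
    then obtain b where b: "b \<in> B" "w b = \<nu>" by auto
    have "{b' \<in> B. w b' = \<nu>} = {b' \<in> B. \<kappa> b' = \<kappa> b}"
    proof (intro Collect_cong conj_cong refl iffI)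
      show "\<kappa> b' = \<kappa> b" if "w b' = \<nu>" for b'
        using that b by (simp add: \<kappa>_def)
      show "w b' = \<nu>" if "b' \<in> B" "\<kappa> b' = \<kappa> b" for b'
        using \<kappa>[OF that(1) b(1) that(2)] b(2) by simp
    qed
    then show ?thesis
      using \<open>\<forall>k\<in>\<kappa> ` B. C k = 0\<close> b by (auto simp: C_def)
  next
    case False
    then have "{b \<in> B. w b = \<nu>} = {}" by auto
    then show ?thesis by (simp only: sum.empty)
  qed
qed

text \<open>The Euler operator \<open>y\<^sub>i \<partial>\<^sub>i\<close> applied to the Vandermonde determinant, computed once on the Leibniz expansion and once on
the product of differences.\<close>

lemma vandermonde_logderiv:
  fixes y :: "nat \<Rightarrow> complex"
  assumes inj: "inj_on y {..<N}" and i: "i < N"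
  shows "(\<Sum>p | p permutes {..<N}. of_int (sign p) * of_nat (p i) * (\<Prod>k<N. y k ^ p k)) =
    leibniz N (\<lambda>i j. y i ^ j) * (\<Sum>j\<in>{..<N} - {i}. y i / (y i - y j))"
proof -
  define u where "u t = y(i := t)" for t
  define D where "D = (\<Sum>j\<in>{..<N} - {i}. 1 / (y i - y j))"
  define f where "f j k t = u t j - u t k" for j k t
  define f' where "f' j k = (if j = i then 1 else if k = i then -1 else (0::complex))" for j k
  have f': "(f j k has_field_derivative f' j k) (at t)" if "k < j" for j k t
    using that unfolding f_def u_def f'_def
    by (auto intro!: derivative_eq_intros)
  have nz: "f j k (y i) \<noteq> 0" if "k < j" "j < N" for j k
    using that inj_onD[OF inj, of j k] by (auto simp: f_def u_def)
  have 0: "((\<lambda>t. \<Prod>k<j. f j k t) has_field_derivative (\<Prod>k<j. f j k (y i)) * (\<Sum>k<j. f' j k / f j k (y i))) (at (y i))"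
    if "j < N" for j
    by (rule has_field_derivative_prod') (use that nz f' in auto)
  have 1: "((\<lambda>t. \<Prod>j<N. \<Prod>k<j. f j k t) has_field_derivative
      (\<Prod>j<N. \<Prod>k<j. f j k (y i)) * (\<Sum>j<N. (\<Prod>k<j. f j k (y i)) * (\<Sum>k<j. f' j k / f j k (y i)) / (\<Prod>k<j. f j k (y i)))) (at (y i))"
    by (rule has_field_derivative_prod') (use nz 0 in auto)
  have nzp: "(\<Prod>k<j. f j k (y i)) \<noteq> 0" if "j < N" for j
    using that nz by auto
  have "(\<Sum>j<N. (\<Prod>k<j. f j k (y i)) * (\<Sum>k<j. f' j k / f j k (y i)) / (\<Prod>k<j. f j k (y i)))
      = (\<Sum>j<N. \<Sum>k<j. f' j k / f j k (y i))"
    by (intro sum.cong refl) (use nzp in auto)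
  also have "\<dots> = (\<Sum>j<N. if j = i then (\<Sum>k<i. 1 / (y i - y k)) else if i < j then 1 / (y i - y j) else 0)"
  proof (intro sum.cong refl)
    fix j assume "j \<in> {..<N}"
    have "(\<Sum>k<j. f' j k / f j k (y i)) = (\<Sum>k<j. if k = i then 1 / (y i - y j) else 0)" if "j \<noteq> i"
      by (intro sum.cong refl) (use that in \<open>auto simp: f'_def f_def u_def minus_divide_right\<close>)
    moreover have "(\<Sum>k<j. f' j k / f j k (y i)) = (\<Sum>k<i. 1 / (y i - y k))" if "j = i"
      unfolding that by (intro sum.cong refl) (auto simp: f'_def f_def u_def)
    ultimately show "(\<Sum>k<j. f' j k / f j k (y i)) =
        (if j = i then (\<Sum>k<i. 1 / (y i - y k)) else if i < j then 1 / (y i - y j) else 0)"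
      by (cases "j = i") (simp_all add: sum.delta)
  qed
  also have "\<dots> = (\<Sum>k<i. 1 / (y i - y k)) + (\<Sum>j\<in>{..<N} - {i}. if i < j then 1 / (y i - y j) else 0)"
    using i by (subst sum.remove[of _ i]) auto
  also have "(\<Sum>j\<in>{..<N} - {i}. if i < j then 1 / (y i - y j) else 0) = (\<Sum>j\<in>{i<..<N}. 1 / (y i - y j))"
    by (rule sum.mono_neutral_cong_right) auto
  also have "(\<Sum>k<i. 1 / (y i - y k)) + (\<Sum>j\<in>{i<..<N}. 1 / (y i - y j)) = D"
  proof -
    have eq: "{..<N} - {i} = {..<i} \<union> {i<..<N}" using i by auto
    show ?thesis unfolding D_def eq by (rule sum.union_disjoint[symmetric]) auto
  qed
  finally have "((\<lambda>t. \<Prod>j<N. \<Prod>k<j. f j k t) has_field_derivative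
      (\<Prod>j<N. \<Prod>k<j. f j k (y i)) * D) (at (y i))"
    using 1 by simp
  moreover have "(\<Prod>j<N. \<Prod>k<j. f j k t) = leibniz N (\<lambda>a b. u t a ^ b)" for t
    unfolding vandermonde_det f_def ..
  ultimately have 2: "((\<lambda>t. leibniz N (\<lambda>a b. u t a ^ b)) has_field_derivative
      leibniz N (\<lambda>a b. y a ^ b) * D) (at (y i))"
    by (simp add: u_def)
  have split: "(\<Prod>k<N. u t k ^ p k) = t ^ p i * (\<Prod>k\<in>{..<N} - {i}. y k ^ p k)" for t p
    using i by (subst prod.remove[of _ i]) (auto simp: u_def)
  have "((\<lambda>t. leibniz N (\<lambda>a b. u t a ^ b)) has_field_derivative
      (\<Sum>p | p permutes {..<N}. of_int (sign p) * (of_nat (p i) * y i ^ (p i - 1) * (\<Prod>k\<in>{..<N} - {i}. y k ^ p k)))) (at (y i))"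
    unfolding leibniz_def split
    by (intro DERIV_sum DERIV_cmult DERIV_cmult_right)
       (auto intro!: derivative_eq_intros)
  from DERIV_unique[OF this 2]
  have "(\<Sum>p | p permutes {..<N}. of_int (sign p) * (of_nat (p i) * y i ^ (p i - 1) * (\<Prod>k\<in>{..<N} - {i}. y k ^ p k)))
      = leibniz N (\<lambda>a b. y a ^ b) * D" .
  then have "y i * (\<Sum>p | p permutes {..<N}. of_int (sign p) * (of_nat (p i) * y i ^ (p i - 1) * (\<Prod>k\<in>{..<N} - {i}. y k ^ p k)))
      = leibniz N (\<lambda>a b. y a ^ b) * (y i * D)" by simp
  moreover have "y i * (\<Sum>p | p permutes {..<N}. of_int (sign p) * (of_nat (p i) * y i ^ (p i - 1) * (\<Prod>k\<in>{..<N} - {i}. y k ^ p k)))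
     = (\<Sum>p | p permutes {..<N}. of_int (sign p) * of_nat (p i) * (\<Prod>k<N. y k ^ p k))"
    unfolding sum_distrib_left
  proof (intro sum.cong refl)
    fix p
    have "(\<Prod>k<N. y k ^ p k) = y i ^ p i * (\<Prod>k\<in>{..<N} - {i}. y k ^ p k)"
      using i by (subst prod.remove[of _ i]) auto
    then show "y i * (of_int (sign p) * (of_nat (p i) * y i ^ (p i - 1) * (\<Prod>k\<in>{..<N} - {i}. y k ^ p k)))
       = of_int (sign p) * of_nat (p i) * (\<Prod>k<N. y k ^ p k)"
      by (cases "p i") (simp_all add: mult_ac)
  qed
  ultimately show ?thesis
    by (simp add: D_def sum_distrib_left)
qed

lemma sum_nat_ge_initial:
  fixes S :: "nat set"
  assumes "finite S"
  shows "(\<Sum>i<card S. i) \<le> \<Sum>S"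
  using assms
proof (induction "card S" arbitrary: S)
  case (Suc k)
  define m where "m = Max S"
  have ne: "S \<noteq> {}" using Suc.hyps(2) by auto
  have m: "m \<in> S" "\<And>x. x \<in> S \<Longrightarrow> x \<le> m" using Suc.prems ne by (auto simp: m_def)
  have "card S \<le> card {..m}" by (rule card_mono) (use m in auto)
  then have "k \<le> m" using Suc.hyps(2) by simp
  have "card (S - {m}) = k" using Suc m by simp
  then have "(\<Sum>i<k. i) \<le> \<Sum>(S - {m})" using Suc.hyps(1)[of "S - {m}"] Suc.prems by simp
  moreover have "\<Sum>S = m + \<Sum>(S - {m})" using m Suc.prems by (simp add: sum.remove)
  ultimately show ?case using \<open>k \<le> m\<close> by (simp flip: Suc.hyps(2))
qed auto

section \<open>The Weyl character formula from the Casimir relation\<close>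

text \<open>A permutation maximizing \<open>\<Sum> - k \<mu> (\<tau> k)\<close> sorts: a transposition of a wrongly ordered pair would increase the sum.\<close>

lemma exists_sorting_permutation:
  fixes \<mu> :: "nat \<Rightarrow> int"
  assumes inj: "inj_on \<mu> {..<N}"
  shows "\<exists>\<tau>. \<tau> permutes {..<N} \<and> (\<forall>i j. i < j \<longrightarrow> j < N \<longrightarrow> \<mu> (\<tau> j) < \<mu> (\<tau> i))"
proof -
  define g where "g \<tau> = (\<Sum>k<N. - int k * \<mu> (\<tau> k))" for \<tau> :: "nat \<Rightarrow> nat"
  define T where "T = {\<tau>. \<tau> permutes {..<N}}"
  have fin: "finite (g ` T)" "g ` T \<noteq> {}"
    using finite_permutations[of "{..<N}"] permutes_id[of "{..<N}"] unfolding T_def by blast+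
  obtain \<tau> where \<tau>: "\<tau> \<in> T" "g \<tau> = Max (g ` T)"
    using Max_in[OF fin] by auto
  have mx: "g \<tau>' \<le> g \<tau>" if "\<tau>' \<in> T" for \<tau>'
    using that fin \<tau> by auto
  have per: "\<tau> permutes {..<N}" using \<tau> by (simp add: T_def)
  have "\<mu> (\<tau> j) < \<mu> (\<tau> i)" if ij: "i < j" "j < N" for i j
  proof -
    define \<tau>' where "\<tau>' = \<tau> \<circ> Transposition.transpose i j"
    have "\<tau>' \<in> T"
      using per ij by (auto simp: T_def \<tau>'_def intro!: permutes_compose permutes_swap_id)
    then have le: "g \<tau>' \<le> g \<tau>" by (rule mx)
    have split: "(\<Sum>k<N. h k) = h i + (h j + (\<Sum>k\<in>{..<N} - {i} - {j}. h k))" for h :: "nat \<Rightarrow> int"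
      using ij by (simp add: sum.remove[of "{..<N}" i] sum.remove[of "{..<N} - {i}" j])
    have "(\<Sum>k\<in>{..<N} - {i} - {j}. - int k * \<mu> (\<tau>' k)) = (\<Sum>k\<in>{..<N} - {i} - {j}. - int k * \<mu> (\<tau> k))"
      by (intro sum.cong refl) (auto simp: \<tau>'_def transpose_apply_other)
    then have "g \<tau>' - g \<tau> = (int j - int i) * (\<mu> (\<tau> j) - \<mu> (\<tau> i))"
      unfolding g_def split[of "\<lambda>k. - int k * \<mu> (\<tau>' k)"] split[of "\<lambda>k. - int k * \<mu> (\<tau> k)"]
      by (simp add: \<tau>'_def algebra_simps)
    with le have "(int j - int i) * (\<mu> (\<tau> j) - \<mu> (\<tau> i)) \<le> 0" by simp
    then have "\<mu> (\<tau> j) \<le> \<mu> (\<tau> i)"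
      using ij by (simp add: mult_le_0_iff)
    moreover have "\<mu> (\<tau> j) \<noteq> \<mu> (\<tau> i)"
      using inj_onD[OF inj, of "\<tau> j" "\<tau> i"] permutes_in_image[OF per] ij
        injD[OF permutes_inj[OF per], of j i] by auto
    ultimately show ?thesis by simp
  qed
  with per show ?thesis by blast
qed

lemma abel_summation:
  fixes d q :: "nat \<Rightarrow> int"
  shows "(\<Sum>i<m. (d (Suc i) - d i) * q i) =
    d m * q m - d 0 * q 0 + (\<Sum>i<m. d (Suc i) * (q i - q (Suc i)))"
  by (induction m) (simp_all add: algebra_simps)

text \<open>A weight strictly below a strictly decreasing one in the dominance order has a smaller norm. By summation by
parts the difference of the squared norms is a sum of nonnegative terms \<open>d\<^sub>i\<^sub>+\<^sub>1 (q\<^sub>i - q\<^sub>i\<^sub>+\<^sub>1)\<close>, with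
\<open>d\<close> the differences of partial sums and \<open>q = T + M\<close>; so all \<open>d\<close> vanish.\<close>

lemma eq_if_dominated_and_equal_norm:
  fixes T M :: "nat \<Rightarrow> int"
  assumes dom: "\<And>k. k \<le> N \<Longrightarrow> (\<Sum>i<k. M i) \<le> (\<Sum>i<k. T i)"
    and tot: "(\<Sum>i<N. M i) = (\<Sum>i<N. T i)"
    and norm: "(\<Sum>i<N. (M i)\<^sup>2) = (\<Sum>i<N. (T i)\<^sup>2)"
    and decM: "\<And>i. Suc i < N \<Longrightarrow> M (Suc i) < M i"
    and decT: "\<And>i. Suc i < N \<Longrightarrow> T (Suc i) < T i"
    and i: "i < N"
  shows "M i = T i"
proof -
  define d where "d k = (\<Sum>i<k. T i - M i)" for k
  define q where "q i = T i + M i" for i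
  have d: "d k \<ge> 0" if "k \<le> N" for k
    using dom[OF that] by (simp add: d_def sum_subtractf)
  have dN: "d N = 0" "d 0 = 0" using tot by (simp_all add: d_def sum_subtractf)
  have "0 = (\<Sum>i<N. (T i)\<^sup>2 - (M i)\<^sup>2)" using norm by (simp add: sum_subtractf)
  also have "\<dots> = (\<Sum>i<N. (d (Suc i) - d i) * q i)"
    by (intro sum.cong refl) (simp add: d_def q_def power2_eq_square algebra_simps)
  also have "\<dots> = (\<Sum>i<N. d (Suc i) * (q i - q (Suc i)))"
    unfolding abel_summation dN by simp
  finally have s0: "(\<Sum>i<N. d (Suc i) * (q i - q (Suc i))) = 0" by simp
  have nonneg: "d (Suc i) * (q i - q (Suc i)) \<ge> 0" if "i < N" for i
  proof (cases "Suc i < N")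
    case True
    then show ?thesis using d[of "Suc i"] decM[OF True] decT[OF True] by (simp add: q_def)
  next
    case False
    with that have "Suc i = N" by simp
    then show ?thesis using dN by simp
  qed
  have "d (Suc i) * (q i - q (Suc i)) = 0" if "i < N" for i
    using s0 nonneg that by (subst (asm) sum_nonneg_eq_0_iff) auto
  then have d0: "d (Suc i) = 0" if "i < N" for i
  proof (cases "Suc i < N")
    case True
    then show ?thesis using \<open>\<And>i. i < N \<Longrightarrow> d (Suc i) * (q i - q (Suc i)) = 0\<close>[OF that] decM[OF True] decT[OF True]
      by (simp add: q_def)
  next
    case False
    with that have "Suc i = N" by simp
    then show ?thesis using dN by simp
  qed
  have "d i = 0" using d0[of "i - 1"] i dN by (cases i) auto
  moreover have "d (Suc i) = d i + (T i - M i)" by (simp add: d_def)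
  ultimately show ?thesis using d0[OF i] by simp
qed

text \<open>What the character formula needs to know about an irreducible representation: the weights \<open>w b\<close> of a basis, listed with
multiplicity, and the relation expressing that the Casimir operator is a scalar. Its left side is \<open>c\<close> times the
character \<open>\<chi>\<close>; on the right stand \<open>\<Sum> D\<^sub>i\<^sup>2 \<chi>\<close> and \<open>\<Sum>\<^sub>i\<^sub>\<noteq>\<^sub>j z\<^sub>i / (z\<^sub>i - z\<^sub>j) (D\<^sub>i - D\<^sub>j) \<chi>\<close> with
\<open>D\<^sub>i = z\<^sub>i \<partial>\<^sub>i\<close>.\<close>

locale highest_weight_character =
  fixes N d :: nat and w :: "nat \<Rightarrow> nat \<Rightarrow> int" and n :: "nat \<Rightarrow> int" and b\<^sub>0 :: nat
  assumes supp: "b < d \<Longrightarrow> i \<ge> N \<Longrightarrow> w b i = 0"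
    and dominated: "b < d \<Longrightarrow> k \<le> N \<Longrightarrow> (\<Sum>i<k. w b i) \<le> (\<Sum>i<k. n i)"
    and total: "b < d \<Longrightarrow> (\<Sum>i<N. w b i) = (\<Sum>i<N. n i)"
    and top: "b\<^sub>0 < d" "b < d \<Longrightarrow> (\<forall>i<N. w b i = n i) \<longleftrightarrow> b = b\<^sub>0"
    and decreasing: "Suc i < N \<Longrightarrow> n (Suc i) \<le> n i"
    and casimir: "\<exists>c. \<forall>z. (\<forall>i<N. z i \<noteq> 0) \<longrightarrow> inj_on z {..<N} \<longrightarrow>
      c * (\<Sum>b<d. monom_at N z (w b)) =
        (\<Sum>b<d. (\<Sum>i<N. (of_int (w b i))\<^sup>2) * monom_at N z (w b)) +
        (\<Sum>i<N. \<Sum>j<N. z i / (z i - z j) * (\<Sum>b<d. of_int (w b i - w b j) * monom_at N z (w b)))"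
begin

text \<open>The product of the Weyl denominator and the character is \<open>\<Sum>\<^sub>q sign (fst q) z powi (expo q)\<close> over the \<open>pairs\<close>
of a permutation \<open>\<sigma>\<close> and a basis index \<open>b\<close>; \<open>coef\<close> collects equal exponents. The denominator is written in the
inverse variables, so that the shift is \<open>- \<sigma> i\<close> and the top exponent is \<open>n i - i\<close>.\<close>

definition expo :: "(nat \<Rightarrow> nat) \<times> nat \<Rightarrow> nat \<Rightarrow> int" where
  "expo q i = (if i < N then w (snd q) i - int (fst q i) else 0)"

definition pairs :: "((nat \<Rightarrow> nat) \<times> nat) set" where
  "pairs = {\<sigma>. \<sigma> permutes {..<N}} \<times> {..<d}"

definition sqnorm :: "(nat \<Rightarrow> int) \<Rightarrow> int" where
  "sqnorm \<mu> = (\<Sum>i<N. (\<mu> i)\<^sup>2)"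

definition coef :: "(nat \<Rightarrow> int) \<Rightarrow> complex" where
  "coef \<mu> = (\<Sum>q | q \<in> pairs \<and> expo q = \<mu>. of_int (sign (fst q)))"

definition topw :: "nat \<Rightarrow> int" where
  "topw i = (if i < N then n i - int i else 0)"

lemma finite_pairs: "finite pairs"
  by (simp add: pairs_def finite_permutations)

lemma expo_outside: "i \<ge> N \<Longrightarrow> expo q i = 0"
  by (simp add: expo_def)

lemma monom_at_expo:
  assumes "\<And>i. i < N \<Longrightarrow> z i \<noteq> 0"
  shows "monom_at N z (expo (\<sigma>, b)) = (\<Prod>k<N. inverse (z k) ^ \<sigma> k) * monom_at N z (w b)"
  unfolding monom_at_def prod.distrib[symmetric]
  by (intro prod.cong refl) (use assms in \<open>simp add: expo_def power_int_diff power_inverse divide_inverse mult.commute\<close>)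

lemma denominator_mult_character:
  assumes "\<And>i. i < N \<Longrightarrow> z i \<noteq> 0"
  shows "(\<Sum>q\<in>pairs. of_int (sign (fst q)) * monom_at N z (expo q)) =
    leibniz N (\<lambda>i j. inverse (z i) ^ j) * (\<Sum>b<d. monom_at N z (w b))"
proof -
  have "(\<Sum>q\<in>pairs. of_int (sign (fst q)) * monom_at N z (expo q)) =
      (\<Sum>\<sigma> | \<sigma> permutes {..<N}. \<Sum>b<d. of_int (sign \<sigma>) * monom_at N z (expo (\<sigma>, b)))"
    unfolding pairs_def by (simp add: sum.cartesian_product case_prod_unfold)
  then show ?thesis
    by (simp add: monom_at_expo[OF assms] leibniz_def sum_distrib_left sum_distrib_right mult_ac)
qed

text \<open>Write \<open>\<Delta>\<close> for the denominator. Expanding \<open>(w - \<sigma>)\<^sup>2\<close>, the operator \<open>\<Sum> D\<^sub>i\<^sup>2\<close> sends \<open>\<Delta> \<chi>\<close> to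
\<open>\<Delta> \<Sum> D\<^sub>i\<^sup>2 \<chi>\<close>, plus the mixed terms \<open>2 \<Sum> D\<^sub>i \<Delta> D\<^sub>i \<chi>\<close>, plus a multiple of \<open>\<Delta> \<chi>\<close>. The mixed terms are known from
the logarithmic derivative of \<open>\<Delta>\<close>, and up to a multiple of \<open>\<Delta> \<chi>\<close> they are the
first-order part of the Casimir relation.\<close>

lemma laplacian_eigenfunction:
  "\<exists>K. \<forall>z. (\<forall>i<N. z i \<noteq> 0) \<longrightarrow> inj_on z {..<N} \<longrightarrow>
    (\<Sum>q\<in>pairs. of_int (sign (fst q)) * (of_int (sqnorm (expo q)) - K) * monom_at N z (expo q)) = 0"
proof -
  obtain c where c: "\<And>z. (\<forall>i<N. z i \<noteq> 0) \<Longrightarrow> inj_on z {..<N} \<Longrightarrow>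
      c * (\<Sum>b<d. monom_at N z (w b)) =
        (\<Sum>b<d. (\<Sum>i<N. (of_int (w b i))\<^sup>2) * monom_at N z (w b)) +
        (\<Sum>i<N. \<Sum>j<N. z i / (z i - z j) * (\<Sum>b<d. of_int (w b i - w b j) * monom_at N z (w b)))"
    using casimir by blast
  define t :: complex where "t = of_int (\<Sum>i<N. n i)"
  define R :: complex where "R = (\<Sum>i<N. (of_nat i)\<^sup>2)"
  define K where "K = c - (of_nat N - 1) * t + R"
  show ?thesis
  proof (intro exI[of _ K] allI impI)
    fix z :: "nat \<Rightarrow> complex"
    assume nz: "\<forall>i<N. z i \<noteq> 0" and inj: "inj_on z {..<N}"
    define y where "y = (\<lambda>i. inverse (z i))"
    define X where "X \<sigma> = of_int (sign \<sigma>) * (\<Prod>k<N. y k ^ \<sigma> k)" for \<sigma>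
    define Y where "Y b = monom_at N z (w b)" for b
    define D where "D = leibniz N (\<lambda>i j. y i ^ j)"
    define ch where "ch = (\<Sum>b<d. Y b)"
    define Q where "Q = (\<Sum>b<d. (\<Sum>i<N. (of_int (w b i))\<^sup>2) * Y b)"
    define H where "H i = (\<Sum>b<d. of_int (w b i) * Y b)" for i
    define S where "S = {\<sigma>. \<sigma> permutes {..<N}}"
    have yinj: "inj_on y {..<N}"
      using inj by (auto simp: y_def inj_on_def)
    have D: "D = (\<Sum>\<sigma>\<in>S. X \<sigma>)" by (simp add: D_def leibniz_def X_def S_def)
    \<comment> \<open>The inverse variables turn \<open>y\<^sub>i / (y\<^sub>i - y\<^sub>j)\<close> into \<open>- z\<^sub>j / (z\<^sub>i - z\<^sub>j)\<close>.\<close>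
    have XD: "(\<Sum>\<sigma>\<in>S. X \<sigma> * of_nat (\<sigma> i)) = - D * (\<Sum>j<N. z j / (z i - z j))" if "i < N" for i
    proof -
      have "(\<Sum>\<sigma>\<in>S. X \<sigma> * of_nat (\<sigma> i)) = D * (\<Sum>j\<in>{..<N} - {i}. y i / (y i - y j))"
        unfolding D_def vandermonde_logderiv[OF yinj that, symmetric] S_def X_def
        by (intro sum.cong refl) (simp add: mult_ac)
      also have "(\<Sum>j\<in>{..<N} - {i}. y i / (y i - y j)) = (\<Sum>j\<in>{..<N} - {i}. - (z j / (z i - z j)))"
      proof (intro sum.cong refl)
        fix j assume j: "j \<in> {..<N} - {i}"
        with nz inj that have "z i \<noteq> 0" "z j \<noteq> 0" "z i \<noteq> z j" by (auto simp: inj_on_def)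
        then show "y i / (y i - y j) = - (z j / (z i - z j))"
          by (simp add: y_def divide_simps) (simp add: algebra_simps)
      qed
      also have "\<dots> = (\<Sum>j<N. - (z j / (z i - z j)))"
        by (rule sum.mono_neutral_left) auto
      finally show ?thesis by (simp add: sum_negf)
    qed
    have R: "(\<Sum>i<N. (of_nat (\<sigma> i))\<^sup>2) = R" if "\<sigma> \<in> S" for \<sigma>
      using sum.permute[of \<sigma> "{..<N}" "\<lambda>i. (of_nat i :: complex)\<^sup>2"] that
      by (simp add: S_def R_def o_def)
    have tH: "(\<Sum>i<N. H i) = t * ch"
    proof -
      have "(\<Sum>i<N. H i) = (\<Sum>b<d. of_int (\<Sum>i<N. w b i) * Y b)"
        unfolding H_def by (subst sum.swap) (simp add: sum_distrib_right)
      also have "\<dots> = (\<Sum>b<d. t * Y b)"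
        by (intro sum.cong refl) (simp add: total t_def)
      finally show ?thesis by (simp add: ch_def sum_distrib_left)
    qed
    have "c * ch = Q + (\<Sum>i<N. \<Sum>j<N. z i / (z i - z j) * (H i - H j))"
      using c[OF nz inj]
      by (simp add: ch_def Q_def H_def Y_def sum_subtractf left_diff_distrib)
    also have "(\<Sum>i<N. \<Sum>j<N. z i / (z i - z j) * (H i - H j)) =
        (\<Sum>i<N. \<Sum>j<N. z i / (z i - z j) * H i) - (\<Sum>i<N. \<Sum>j<N. z i / (z i - z j) * H j)"
      by (simp add: right_diff_distrib sum_subtractf)
    also have "(\<Sum>i<N. \<Sum>j<N. z i / (z i - z j) * H j) = (\<Sum>i<N. \<Sum>j<N. z j / (z j - z i) * H i)"
      by (rule sum.swap)
    also have "(\<Sum>i<N. \<Sum>j<N. z i / (z i - z j) * H i) - (\<Sum>i<N. \<Sum>j<N. z j / (z j - z i) * H i)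
      = (\<Sum>i<N. \<Sum>j<N. (if i = j then 0 else H i) + 2 * (z j / (z i - z j)) * H i)"
      unfolding sum_subtractf[symmetric]
    proof (intro sum.cong refl)
      fix i j assume "i \<in> {..<N}" "j \<in> {..<N}"
      show "z i / (z i - z j) * H i - z j / (z j - z i) * H i =
          (if i = j then 0 else H i) + 2 * (z j / (z i - z j)) * H i"
      proof (cases "i = j")
        case False
        with inj \<open>i \<in> _\<close> \<open>j \<in> _\<close> have "z i \<noteq> z j" by (auto simp: inj_on_def)
        then have "z i / (z i - z j) - z j / (z j - z i) = 1 + 2 * (z j / (z i - z j))"
          by (simp add: divide_simps) (simp add: algebra_simps)
        then have "(z i / (z i - z j) - z j / (z j - z i)) * H i = (1 + 2 * (z j / (z i - z j))) * H i"
          by simp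
        then show ?thesis using False by (simp only: if_False ring_distribs mult_1)
      qed simp
    qed
    also have "\<dots> = (of_nat N - 1) * (t * ch) + 2 * (\<Sum>i<N. (\<Sum>j<N. z j / (z i - z j)) * H i)"
    proof -
      have "(\<Sum>j<N. if i = j then 0 else H i) = (of_nat N - 1) * H i" if "i < N" for i
        using that by (simp add: sum.remove[of "{..<N}" i] of_nat_diff)
      then have "(\<Sum>i<N. \<Sum>j<N. if i = j then 0 else H i) = (\<Sum>i<N. (of_nat N - 1) * H i)"
        by (intro sum.cong refl) auto
      also have "\<dots> = (of_nat N - 1) * (t * ch)"
        unfolding tH[symmetric] by (simp add: sum_distrib_left)
      finally show ?thesis
        by (simp add: sum.distrib sum_distrib_left sum_distrib_right mult_ac)
    qed
    \<comment> \<open>The terms with \<open>H j\<close> are renamed into terms with \<open>H i\<close>, and \<open>z\<^sub>i = (z\<^sub>i - z\<^sub>j) + z\<^sub>j\<close> separates the constant.\<close>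
    finally have cas: "2 * (\<Sum>i<N. (\<Sum>j<N. z j / (z i - z j)) * H i) = c * ch - Q - (of_nat N - 1) * (t * ch)"
      by (simp add: algebra_simps)
    have "(\<Sum>q\<in>pairs. of_int (sign (fst q)) * (of_int (sqnorm (expo q)) - K) * monom_at N z (expo q))
       = (\<Sum>\<sigma>\<in>S. \<Sum>b<d. of_int (sign \<sigma>) * (of_int (sqnorm (expo (\<sigma>, b))) - K) * monom_at N z (expo (\<sigma>, b)))"
      unfolding pairs_def S_def by (simp add: sum.cartesian_product case_prod_unfold)
    also have "\<dots> = (\<Sum>\<sigma>\<in>S. \<Sum>b<d. X \<sigma> * ((\<Sum>i<N. (of_int (w b i))\<^sup>2) * Y b)
          - 2 * (\<Sum>i<N. X \<sigma> * of_nat (\<sigma> i) * (of_int (w b i) * Y b)) + (R - K) * (X \<sigma> * Y b))"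
    proof (intro sum.cong refl)
      fix \<sigma> b assume \<sigma>: "\<sigma> \<in> S"
      have "of_int (sqnorm (expo (\<sigma>, b))) =
          (\<Sum>i<N. (of_int (w b i) :: complex)\<^sup>2 - 2 * (of_nat (\<sigma> i) * of_int (w b i)) + (of_nat (\<sigma> i))\<^sup>2)"
        unfolding sqnorm_def of_int_sum
        by (intro sum.cong refl) (simp add: expo_def power2_eq_square algebra_simps)
      also have "\<dots> = (\<Sum>i<N. (of_int (w b i))\<^sup>2) - 2 * (\<Sum>i<N. of_nat (\<sigma> i) * of_int (w b i)) + R"
        by (simp add: sum.distrib sum_subtractf sum_distrib_left R[OF \<sigma>])
      finally have sq: "of_int (sqnorm (expo (\<sigma>, b))) =
         (\<Sum>i<N. (of_int (w b i))\<^sup>2) - 2 * (\<Sum>i<N. of_nat (\<sigma> i) * of_int (w b i)) + R" .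
      have mon: "monom_at N z (expo (\<sigma>, b)) = (\<Prod>k<N. y k ^ \<sigma> k) * Y b"
        using monom_at_expo[of z \<sigma> b] nz by (simp add: Y_def y_def)
      have "(\<Sum>i<N. X \<sigma> * of_nat (\<sigma> i) * (of_int (w b i) * Y b)) =
          X \<sigma> * (\<Sum>i<N. of_nat (\<sigma> i) * of_int (w b i)) * Y b"
        by (simp add: sum_distrib_left sum_distrib_right mult_ac)
      then show "of_int (sign \<sigma>) * (of_int (sqnorm (expo (\<sigma>, b))) - K) * monom_at N z (expo (\<sigma>, b)) =
         X \<sigma> * ((\<Sum>i<N. (of_int (w b i))\<^sup>2) * Y b)
          - 2 * (\<Sum>i<N. X \<sigma> * of_nat (\<sigma> i) * (of_int (w b i) * Y b)) + (R - K) * (X \<sigma> * Y b)"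
        unfolding mon sq by (simp add: X_def algebra_simps)
    qed
    also have "\<dots> = D * Q - 2 * (\<Sum>i<N. (\<Sum>\<sigma>\<in>S. X \<sigma> * of_nat (\<sigma> i)) * H i) + (R - K) * (D * ch)"
    proof -
      have "(\<Sum>\<sigma>\<in>S. \<Sum>b<d. \<Sum>i<N. X \<sigma> * of_nat (\<sigma> i) * (of_int (w b i) * Y b)) =
          (\<Sum>\<sigma>\<in>S. \<Sum>i<N. \<Sum>b<d. X \<sigma> * of_nat (\<sigma> i) * (of_int (w b i) * Y b))"
        by (intro sum.cong refl sum.swap)
      also have "\<dots> = (\<Sum>i<N. \<Sum>\<sigma>\<in>S. \<Sum>b<d. X \<sigma> * of_nat (\<sigma> i) * (of_int (w b i) * Y b))"
        by (rule sum.swap)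
      also have "\<dots> = (\<Sum>i<N. (\<Sum>\<sigma>\<in>S. X \<sigma> * of_nat (\<sigma> i)) * H i)"
        by (simp add: H_def sum_product)
      finally show ?thesis
        by (simp add: sum.distrib sum_subtractf sum_distrib_left[symmetric] D Q_def ch_def sum_product)
    qed
    also have "(\<Sum>i<N. (\<Sum>\<sigma>\<in>S. X \<sigma> * of_nat (\<sigma> i)) * H i) =
        - D * (\<Sum>i<N. (\<Sum>j<N. z j / (z i - z j)) * H i)"
      unfolding sum_distrib_left by (intro sum.cong refl) (simp only: XD mult.assoc lessThan_iff)
    also have "D * Q - 2 * (- D * (\<Sum>i<N. (\<Sum>j<N. z j / (z i - z j)) * H i)) + (R - K) * (D * ch)
      = D * (Q + 2 * (\<Sum>i<N. (\<Sum>j<N. z j / (z i - z j)) * H i) + (R - K) * ch)"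
      by (simp add: algebra_simps)
    also have "\<dots> = 0"
      unfolding cas K_def by (simp add: algebra_simps)
    finally show "(\<Sum>q\<in>pairs. of_int (sign (fst q)) * (of_int (sqnorm (expo q)) - K) * monom_at N z (expo q)) = 0" .
  qed
qed

lemma coef_sphere: "\<exists>K. \<forall>\<mu>. coef \<mu> \<noteq> 0 \<longrightarrow> of_int (sqnorm \<mu>) = (K :: complex)"
proof -
  obtain K where K: "\<And>z. (\<forall>i<N. z i \<noteq> 0) \<Longrightarrow> inj_on z {..<N} \<Longrightarrow>
    (\<Sum>q\<in>pairs. of_int (sign (fst q)) * (of_int (sqnorm (expo q)) - K) * monom_at N z (expo q)) = 0"
    using laplacian_eigenfunction by blast
  have "coef \<mu> * (of_int (sqnorm \<mu>) - K) = 0" for \<mu>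
  proof -
    have "(\<Sum>q | q \<in> pairs \<and> expo q = \<mu>. of_int (sign (fst q)) * (of_int (sqnorm (expo q)) - K)) = 0"
    proof (rule monomials_independent[OF finite_pairs])
      fix y :: "nat \<Rightarrow> real" assume y: "\<And>i. i < N \<Longrightarrow> 0 < y i" "inj_on y {..<N}"
      have "y i \<noteq> 0" if "i < N" for i using y(1)[OF that] by simp
      with y(2) show "(\<Sum>q\<in>pairs. of_int (sign (fst q)) * (of_int (sqnorm (expo q)) - K) *
          monom_at N (\<lambda>i. complex_of_real (y i)) (expo q)) = 0"
        by (intro K) (auto simp: inj_on_def)
    qed (rule expo_outside)
    then show ?thesis
      by (simp add: coef_def sum_distrib_right)
  qed
  then show ?thesis by (intro exI[of _ K] allI impI) (metis mult_eq_0_iff right_minus_eq)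
qed


text \<open>Setting \<open>z\<^sub>j = z\<^sub>i\<close> kills the denominator, so the coefficients add up to zero along each line in the direction of the root
\<open>e\<^sub>i - e\<^sub>j\<close>. By \<open>coef_sphere\<close> only points of one sphere contribute, and such a line meets the sphere in at most two
points, which are exchanged by the reflection.\<close>

lemma coef_reflection:
  assumes i: "i < N" and j: "j < N" and ij: "i \<noteq> j"
  shows "coef (\<mu> \<circ> Transposition.transpose i j) = - coef \<mu>"
proof -
  define s where "s = Transposition.transpose i j"
  define fold where "fold = (\<lambda>\<nu> :: nat \<Rightarrow> int. \<nu>(i := \<nu> i + \<nu> j, j := 0))"
  obtain K :: complex where K: "\<And>\<mu>. coef \<mu> \<noteq> 0 \<Longrightarrow> of_int (sqnorm \<mu>) = K"
    using coef_sphere by blast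
  have split: "(\<Sum>k<N. h k) = h i + (h j + (\<Sum>k\<in>{..<N} - {i} - {j}. h k))" for h :: "nat \<Rightarrow> int"
    using i j ij by (simp add: sum.remove[of "{..<N}" i] sum.remove[of "{..<N} - {i}" j])
  have other: "(\<mu> \<circ> s) k = \<mu> k" if "k \<noteq> i" "k \<noteq> j" for k \<mu>
    using that by (simp add: s_def transpose_apply_other)
  have si: "(\<mu> \<circ> s) i = \<mu> j" "(\<mu> \<circ> s) j = \<mu> i" for \<mu> :: "nat \<Rightarrow> int"
    by (simp_all add: s_def)
  have sq: "sqnorm (\<mu> \<circ> s) = sqnorm \<mu>"
  proof -
    have "(\<Sum>k\<in>{..<N} - {i} - {j}. ((\<mu> \<circ> s) k)\<^sup>2) = (\<Sum>k\<in>{..<N} - {i} - {j}. (\<mu> k)\<^sup>2)"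
      by (intro sum.cong refl) (use other in auto)
    then show ?thesis
      unfolding sqnorm_def split[of "\<lambda>k. ((\<mu> \<circ> s) k)\<^sup>2"] split[of "\<lambda>k. (\<mu> k)\<^sup>2"] si by simp
  qed
  \<comment> \<open>The alternating sum vanishes where two variables coincide.\<close>
  have vanish: "(\<Sum>q | q \<in> pairs \<and> fold (expo q) = \<nu>. of_int (sign (fst q)) :: complex) = 0" for \<nu>
  proof (rule monomials_independent[OF finite_pairs])
    fix q k assume "N \<le> k"
    then show "fold (expo q) k = 0" using i j by (simp add: fold_def expo_outside)
  next
    fix y :: "nat \<Rightarrow> real" assume y: "\<And>i. i < N \<Longrightarrow> 0 < y i" "inj_on y {..<N}"
    define z where "z k = complex_of_real (if k = j then y i else y k)" for k
    have nz: "z k \<noteq> 0" if "k < N" for k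
      using y(1)[OF that] y(1)[OF i] by (auto simp: z_def)
    have mon: "monom_at N (\<lambda>k. of_real (y k)) (fold \<mu>) = monom_at N z \<mu>" for \<mu>
    proof -
      have split': "(\<Prod>k<N. h k) = h i * (h j * (\<Prod>k\<in>{..<N} - {i} - {j}. h k))" for h :: "nat \<Rightarrow> complex"
        using i j ij by (simp add: prod.remove[of "{..<N}" i] prod.remove[of "{..<N} - {i}" j])
      have "(\<Prod>k\<in>{..<N} - {i} - {j}. complex_of_real (y k) powi fold \<mu> k) = (\<Prod>k\<in>{..<N} - {i} - {j}. z k powi \<mu> k)"
        by (intro prod.cong refl) (auto simp: z_def fold_def)
      moreover have "complex_of_real (y i) powi fold \<mu> i * complex_of_real (y j) powi fold \<mu> j = z i powi \<mu> i * z j powi \<mu> j"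
        using ij y(1)[OF i] by (simp add: z_def fold_def power_int_add)
      ultimately show ?thesis
        unfolding monom_at_def split'[of "\<lambda>k. complex_of_real (y k) powi fold \<mu> k"] split'[of "\<lambda>k. z k powi \<mu> k"]
        by (simp add: mult.assoc[symmetric])
    qed
    have "leibniz N (\<lambda>i j. inverse (z i) ^ j) = 0"
      by (rule leibniz_identical_rows[of i _ j]) (use i j ij in \<open>auto simp: z_def\<close>)
    then show "(\<Sum>q\<in>pairs. of_int (sign (fst q)) * monom_at N (\<lambda>k. complex_of_real (y k)) (fold (expo q))) = 0"
      unfolding mon using denominator_mult_character[of z] nz by simp
  qed
  define M where "M = {\<mu>' \<in> expo ` pairs. fold \<mu>' = fold \<mu>}"
  have finM: "finite M" by (simp add: M_def finite_pairs)
  have "(\<Sum>\<mu>'\<in>M. coef \<mu>') = (\<Sum>\<mu>'\<in>M. \<Sum>q | q \<in> {q\<in>pairs. fold (expo q) = fold \<mu>} \<and> expo q = \<mu>'. of_int (sign (fst q)))"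
    unfolding coef_def by (intro sum.cong refl) (auto simp: M_def)
  also have "\<dots> = (\<Sum>q\<in>{q\<in>pairs. fold (expo q) = fold \<mu>}. of_int (sign (fst q)))"
    by (rule sum.group) (use finite_pairs finM in \<open>auto simp: M_def\<close>)
  finally have sumM: "(\<Sum>\<mu>'\<in>M. coef \<mu>') = 0" using vanish by simp
  \<comment> \<open>The line through \<open>\<mu>\<close> in the direction of the root meets the sphere in \<open>\<mu>\<close> and its reflection only.\<close>
  have line: "\<mu>' = \<mu> \<or> \<mu>' = \<mu> \<circ> s" if f: "fold \<mu>' = fold \<mu>" and n: "sqnorm \<mu>' = sqnorm \<mu>" for \<mu>'
  proof -
    have k: "\<mu>' k = \<mu> k" if "k \<noteq> i" "k \<noteq> j" for k
      using fun_cong[OF f, of k] that by (simp add: fold_def)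
    have sm: "\<mu>' i + \<mu>' j = \<mu> i + \<mu> j"
      using fun_cong[OF f, of i] ij by (simp add: fold_def)
    have "(\<Sum>k\<in>{..<N} - {i} - {j}. (\<mu>' k)\<^sup>2) = (\<Sum>k\<in>{..<N} - {i} - {j}. (\<mu> k)\<^sup>2)"
      by (intro sum.cong refl) (use k in auto)
    with n have "(\<mu>' i)\<^sup>2 + (\<mu>' j)\<^sup>2 = (\<mu> i)\<^sup>2 + (\<mu> j)\<^sup>2"
      unfolding sqnorm_def split[of "\<lambda>k. (\<mu>' k)\<^sup>2"] split[of "\<lambda>k. (\<mu> k)\<^sup>2"] by simp
    moreover have "\<mu>' j = \<mu> i + \<mu> j - \<mu>' i" using sm by simp
    ultimately have "(\<mu>' i - \<mu> i) * (\<mu>' i - \<mu> j) = 0"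
      by (simp add: power2_eq_square algebra_simps)
    then consider "\<mu>' i = \<mu> i" "\<mu>' j = \<mu> j" | "\<mu>' i = \<mu> j" "\<mu>' j = \<mu> i"
      using sm by auto
    then show ?thesis
    proof cases
      case 1
      then have "\<mu>' = \<mu>" using k by (intro ext) metis
      then show ?thesis ..
    next
      case 2
      have "\<mu>' = \<mu> \<circ> s"
      proof
        fix a
        show "\<mu>' a = (\<mu> \<circ> s) a"
        proof (cases "a = i \<or> a = j")
          case True
          then show ?thesis using 2 si[of \<mu>] by auto
        next
          case False
          then show ?thesis using k[of a] other[of a \<mu>] by simp
        qed
      qed
      then show ?thesis ..
    qed
  qed
  have notin: "coef \<mu>' = 0" if "\<mu>' \<notin> expo ` pairs" for \<mu>'
  proof -
    have "{q. q \<in> pairs \<and> expo q = \<mu>'} = {}" using that by blast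
    then show ?thesis unfolding coef_def by (simp only: sum.empty)
  qed
  have main: "coef (\<mu> \<circ> s) = - coef \<mu>" if c: "coef \<mu> \<noteq> 0 \<or> coef (\<mu> \<circ> s) \<noteq> 0"
  proof -
    have nK: "of_int (sqnorm \<mu>) = K" using c K[of \<mu>] K[of "\<mu> \<circ> s"] sq by auto
    have fs: "fold (\<mu> \<circ> s) = fold \<mu>"
      using ij other[of _ \<mu>] si[of \<mu>] by (auto simp: fold_def fun_eq_iff)
    have "(\<Sum>\<mu>'\<in>M. coef \<mu>') = (\<Sum>\<mu>'\<in>{\<mu>, \<mu> \<circ> s}. coef \<mu>')"
    proof (rule sum.mono_neutral_cong[OF _ finM])
      fix \<mu>' assume "\<mu>' \<in> {\<mu>, \<mu> \<circ> s} - M"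
      then show "coef \<mu>' = 0" using fs notin by (auto simp: M_def)
    next
      fix \<mu>' assume a: "\<mu>' \<in> M - {\<mu>, \<mu> \<circ> s}"
      show "coef \<mu>' = 0"
      proof (rule ccontr)
        assume "coef \<mu>' \<noteq> 0"
        then have "complex_of_int (sqnorm \<mu>') = of_int (sqnorm \<mu>)" using K nK by simp
        then have "sqnorm \<mu>' = sqnorm \<mu>" by simp
        with a line show False by (auto simp: M_def)
      qed
    qed auto
    with sumM have z: "(\<Sum>\<mu>'\<in>{\<mu>, \<mu> \<circ> s}. coef \<mu>') = 0" by simp
    show ?thesis
    proof (cases "\<mu> \<circ> s = \<mu>")
      case True
      with z have "coef \<mu> = 0" by simp
      then show ?thesis using True by simp
    next
      case False
      then have "\<mu> \<notin> {\<mu> \<circ> s}" by (metis singletonD)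
      then have "coef \<mu> + coef (\<mu> \<circ> s) = 0" using z by (subst (asm) sum.insert) simp_all
      then show ?thesis by (simp only: add_eq_0_iff)
    qed
  qed
  then show ?thesis unfolding s_def by (metis neg_equal_0_iff_equal)
qed

lemma coef_permute:
  assumes "\<tau> permutes {..<N}"
  shows "coef (\<mu> \<circ> \<tau>) = of_int (sign \<tau>) * coef \<mu>"
  using finite_lessThan assms
proof (induction rule: permutes_rev_induct)
  case (swap a b p)
  have "permutation p" using swap by (auto simp: permutation_permutes)
  then have "sign (p \<circ> Transposition.transpose a b) = - sign p"
    using swap by (simp add: sign_compose permutation_swap_id sign_swap_id)
  moreover have "coef (\<mu> \<circ> (p \<circ> Transposition.transpose a b)) = - coef (\<mu> \<circ> p)"
    unfolding o_assoc using swap by (intro coef_reflection) auto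
  ultimately show ?case by (simp only: swap.IH of_int_minus mult_minus_left)
qed auto

lemma expo_dominated:
  assumes "q \<in> pairs" "k \<le> N"
  shows "(\<Sum>i<k. expo q i) \<le> (\<Sum>i<k. topw i)"
    and "(\<Sum>i<k. expo q i) = (\<Sum>i<k. topw i) \<Longrightarrow> (\<Sum>i<k. int (fst q i)) = (\<Sum>i<k. int i)"
    and "(\<Sum>i<N. expo q i) = (\<Sum>i<N. topw i)"
proof -
  obtain \<sigma> b where q: "q = (\<sigma>, b)" by (cases q)
  have s: "\<sigma> permutes {..<N}" and b: "b < d" using assms(1) by (auto simp: pairs_def q)
  have e: "(\<Sum>i<k. expo q i) = (\<Sum>i<k. w b i) - (\<Sum>i<k. int (\<sigma> i))"
    unfolding sum_subtractf[symmetric] using assms(2) by (intro sum.cong refl) (auto simp: expo_def q)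
  have t: "(\<Sum>i<k. topw i) = (\<Sum>i<k. n i) - (\<Sum>i<k. int i)"
    unfolding sum_subtractf[symmetric] using assms(2) by (intro sum.cong refl) (auto simp: topw_def)
  have inj: "inj_on \<sigma> {..<k}" using permutes_inj[OF s] by (rule inj_on_subset) auto
  have "(\<Sum>i<k. i) \<le> \<Sum>(\<sigma> ` {..<k})"
    using sum_nat_ge_initial[of "\<sigma> ` {..<k}"] by (simp add: card_image inj)
  also have "\<Sum>(\<sigma> ` {..<k}) = (\<Sum>i<k. \<sigma> i)" by (simp add: sum.reindex inj)
  finally have le: "(\<Sum>i<k. int i) \<le> (\<Sum>i<k. int (\<sigma> i))"
    by (simp only: of_nat_sum[symmetric] of_nat_le_iff)
  show "(\<Sum>i<k. expo q i) \<le> (\<Sum>i<k. topw i)"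
    unfolding e t using le dominated[OF b assms(2)] by simp
  show "(\<Sum>i<k. int (fst q i)) = (\<Sum>i<k. int i)" if "(\<Sum>i<k. expo q i) = (\<Sum>i<k. topw i)"
    using that le dominated[OF b assms(2)] e t unfolding q by simp
  have "(\<Sum>i<N. expo q i) = (\<Sum>i<N. w b i) - (\<Sum>i<N. int (\<sigma> i))"
    unfolding sum_subtractf[symmetric] by (intro sum.cong refl) (auto simp: expo_def q)
  also have "(\<Sum>i<N. int (\<sigma> i)) = (\<Sum>i<N. int i)"
    using sum.permute[OF s, of int] by (simp add: o_def)
  also have "(\<Sum>i<N. w b i) - (\<Sum>i<N. int i) = (\<Sum>i<N. topw i)"
    unfolding total[OF b] sum_subtractf[symmetric] by (intro sum.cong refl) (auto simp: topw_def)
  finally show "(\<Sum>i<N. expo q i) = (\<Sum>i<N. topw i)" .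
qed

text \<open>The top exponent is attained by one pair: equality of all partial sums forces the permutation to be the identity,
and then the weight to be the highest one.\<close>

lemma coef_top: "coef topw = 1"
proof -
  have "{q. q \<in> pairs \<and> expo q = topw} = {(id :: nat \<Rightarrow> nat, b\<^sub>0)}"
  proof (intro equalityI subsetI)
    fix q assume "q \<in> {q. q \<in> pairs \<and> expo q = topw}"
    then have q: "q \<in> pairs" "expo q = topw" by auto
    obtain \<sigma> b where qs: "q = (\<sigma>, b)" by (cases q)
    have s: "\<sigma> permutes {..<N}" and b: "b < d" using q by (auto simp: pairs_def qs)
    have part: "(\<Sum>i<k. int (\<sigma> i)) = (\<Sum>i<k. int i)" if "k \<le> N" for k
      using expo_dominated(2)[OF q(1) that] q(2) by (simp add: qs)
    have si: "\<sigma> i = i" for i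
    proof (cases "i < N")
      case True
      then show ?thesis using part[of "Suc i"] part[of i] by simp
    next
      case False
      then show ?thesis using s by (auto simp: permutes_def)
    qed
    then have "\<sigma> = id" by auto
    moreover have "w b i = n i" if "i < N" for i
      using fun_cong[OF q(2), of i] that si by (simp add: expo_def topw_def qs)
    then have "b = b\<^sub>0" using top(2)[OF b] by simp
    ultimately show "q \<in> {(id :: nat \<Rightarrow> nat, b\<^sub>0)}" by (simp add: qs)
  next
    fix q assume "q \<in> {(id :: nat \<Rightarrow> nat, b\<^sub>0)}"
    then show "q \<in> {q. q \<in> pairs \<and> expo q = topw}"
      using top by (auto simp: pairs_def permutes_id expo_def topw_def fun_eq_iff)
  qed
  then show ?thesis unfolding coef_def by (simp add: sign_id)
qed

lemma topw_decreasing: "i < j \<Longrightarrow> j < N \<Longrightarrow> topw j < topw i"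
proof (induction j)
  case (Suc j)
  have "topw (Suc j) < topw j"
    using Suc.prems decreasing[of j] by (simp add: topw_def)
  with Suc show ?case by (cases "i = j") (auto simp: less_Suc_eq)
qed simp

text \<open>By the alternating symmetry the entries of \<open>\<mu>\<close> are distinct, so \<open>\<mu>\<close> can be sorted strictly. Sorted, it is dominated by
the top exponent and has the same norm, hence equals it.\<close>

lemma coef_nonzero_imp_permuted_top:
  assumes c: "coef \<mu> \<noteq> 0"
  shows "\<exists>\<tau>. \<tau> permutes {..<N} \<and> \<mu> = topw \<circ> \<tau>"
proof -
  have inj: "inj_on \<mu> {..<N}"
  proof (rule inj_onI, rule ccontr)
    fix i j assume ij: "i \<in> {..<N}" "j \<in> {..<N}" "\<mu> i = \<mu> j" "i \<noteq> j"
    then have "\<mu> \<circ> Transposition.transpose i j = \<mu>"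
      by (auto simp: fun_eq_iff Transposition.transpose_def)
    then show False using coef_reflection[of i j \<mu>] ij c by simp
  qed
  obtain \<tau> where \<tau>: "\<tau> permutes {..<N}" "\<And>i j. i < j \<Longrightarrow> j < N \<Longrightarrow> \<mu> (\<tau> j) < \<mu> (\<tau> i)"
    using exists_sorting_permutation[OF inj] by blast
  have c': "coef (\<mu> \<circ> \<tau>) \<noteq> 0"
    using coef_permute[OF \<tau>(1), of \<mu>] c by simp
  have "{q. q \<in> pairs \<and> expo q = \<mu> \<circ> \<tau>} \<noteq> {}"
  proof
    assume "{q. q \<in> pairs \<and> expo q = \<mu> \<circ> \<tau>} = {}"
    then have "coef (\<mu> \<circ> \<tau>) = 0" unfolding coef_def by (simp only: sum.empty)
    with c' show False by simp
  qed
  then obtain q where q: "q \<in> pairs" "expo q = \<mu> \<circ> \<tau>" by auto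
  have "complex_of_int (sqnorm (\<mu> \<circ> \<tau>)) = of_int (sqnorm topw)"
    using coef_sphere c' coef_top by (metis zero_neq_one)
  then have nrm: "sqnorm (\<mu> \<circ> \<tau>) = sqnorm topw" by simp
  have eq: "(\<mu> \<circ> \<tau>) i = topw i" if "i < N" for i
  proof (rule eq_if_dominated_and_equal_norm[OF _ _ _ _ _ that])
    show "(\<Sum>i<k. (\<mu> \<circ> \<tau>) i) \<le> (\<Sum>i<k. topw i)" if "k \<le> N" for k
      using expo_dominated(1)[OF q(1) that] q(2) by simp
    show "(\<Sum>i<N. (\<mu> \<circ> \<tau>) i) = (\<Sum>i<N. topw i)"
      using expo_dominated(3)[OF q(1) order_refl] q(2) by simp
    show "(\<Sum>i<N. ((\<mu> \<circ> \<tau>) i)\<^sup>2) = (\<Sum>i<N. (topw i)\<^sup>2)"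
      using nrm by (simp add: sqnorm_def)
  qed (use \<tau>(2) topw_decreasing in auto)
  moreover have "(\<mu> \<circ> \<tau>) i = topw i" if "\<not> i < N" for i
    unfolding q(2)[symmetric] using that by (simp add: expo_def topw_def)
  ultimately have "\<mu> \<circ> \<tau> = topw" by (intro ext) blast
  then have "\<mu> = topw \<circ> inv_into UNIV \<tau>"
    using permutes_inv_o(1)[OF \<tau>(1)] by (metis comp_assoc comp_id)
  then show ?thesis using permutes_inv[OF \<tau>(1)] by blast
qed

text \<open>Only the permutations of the top exponent survive, with the signs as coefficients; this is the numerator.\<close>

theorem weyl_character_formula:
  assumes nz: "\<And>i. i < N \<Longrightarrow> z i \<noteq> 0"
  shows "leibniz N (\<lambda>i j. inverse (z i) ^ j) * (\<Sum>b<d. monom_at N z (w b)) =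
    leibniz N (\<lambda>i j. z i powi (n j - int j))"
proof -
  define P where "P = {\<tau>. \<tau> permutes {..<N}}"
  have fP: "finite P" by (simp add: P_def finite_permutations)
  have inj: "inj_on (\<lambda>\<tau>. topw \<circ> \<tau>) P"
  proof (rule inj_onI)
    fix \<tau> \<rho> assume t: "\<tau> \<in> P" "\<rho> \<in> P" and eq: "topw \<circ> \<tau> = topw \<circ> \<rho>"
    have "\<tau> i = \<rho> i" for i
    proof (cases "i < N")
      case True
      then have "\<tau> i < N" "\<rho> i < N"
        using t permutes_in_image[of \<tau> "{..<N}" i] permutes_in_image[of \<rho> "{..<N}" i] by (auto simp: P_def)
      moreover have "topw (\<tau> i) = topw (\<rho> i)" using fun_cong[OF eq, of i] by simp
      ultimately show ?thesis using topw_decreasing by (metis less_irrefl linorder_neqE_nat)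
    next
      case False
      then show ?thesis using t by (auto simp: P_def permutes_def)
    qed
    then show "\<tau> = \<rho>" by auto
  qed
  have "leibniz N (\<lambda>i j. inverse (z i) ^ j) * (\<Sum>b<d. monom_at N z (w b)) =
      (\<Sum>q\<in>pairs. of_int (sign (fst q)) * monom_at N z (expo q))"
    using denominator_mult_character[OF nz] by simp
  also have "\<dots> = (\<Sum>\<mu>\<in>expo ` pairs. \<Sum>q | q \<in> pairs \<and> expo q = \<mu>. of_int (sign (fst q)) * monom_at N z (expo q))"
    by (rule sum.group[symmetric]) (auto simp: finite_pairs)
  also have "\<dots> = (\<Sum>\<mu>\<in>expo ` pairs. coef \<mu> * monom_at N z \<mu>)"
    unfolding coef_def sum_distrib_right by (intro sum.cong refl) auto
  also have "\<dots> = (\<Sum>\<mu>\<in>(\<lambda>\<tau>. topw \<circ> \<tau>) ` P. coef \<mu> * monom_at N z \<mu>)"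
  proof (rule sum.mono_neutral_cong)
    fix \<mu> assume "\<mu> \<in> (\<lambda>\<tau>. topw \<circ> \<tau>) ` P - expo ` pairs"
    then have "\<mu> \<notin> expo ` pairs" by simp
    then have "{q. q \<in> pairs \<and> expo q = \<mu>} = {}" by blast
    then show "coef \<mu> * monom_at N z \<mu> = 0" unfolding coef_def by (simp only: sum.empty) simp
  next
    fix \<mu> assume "\<mu> \<in> expo ` pairs - (\<lambda>\<tau>. topw \<circ> \<tau>) ` P"
    then show "coef \<mu> * monom_at N z \<mu> = 0"
      using coef_nonzero_imp_permuted_top[of \<mu>] by (auto simp: P_def)
  qed (auto simp: finite_pairs fP)
  also have "\<dots> = (\<Sum>\<tau>\<in>P. coef (topw \<circ> \<tau>) * monom_at N z (topw \<circ> \<tau>))"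
    by (simp add: sum.reindex[OF inj])
  also have "\<dots> = leibniz N (\<lambda>i j. z i powi (n j - int j))"
    unfolding leibniz_def P_def
  proof (intro sum.cong refl arg_cong2[where f = "(*)"])
    fix \<tau> assume "\<tau> \<in> {\<tau>. \<tau> permutes {..<N}}"
    then have t: "\<tau> permutes {..<N}" by simp
    show "coef (topw \<circ> \<tau>) = of_int (sign \<tau>)"
      using coef_permute[OF t, of topw] coef_top by simp
    show "monom_at N z (topw \<circ> \<tau>) = (\<Prod>i<N. z i powi (n (\<tau> i) - int (\<tau> i)))"
      unfolding monom_at_def
      by (intro prod.cong refl) (use permutes_in_image[OF t] in \<open>auto simp: topw_def\<close>)
  qed
  finally show ?thesis .
qed

end

section \<open>Linear algebra and representations in coordinates\<close>

text \<open>Subspaces without the module structure, so that closure arguments do not carry the vector space locale around.\<close>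

definition lin_closed :: "nat \<Rightarrow> complex Matrix.vec set \<Rightarrow> bool" where
  "lin_closed d W \<longleftrightarrow> W \<subseteq> carrier_vec d \<and> 0\<^sub>v d \<in> W \<and>
     (\<forall>u\<in>W. \<forall>v\<in>W. u + v \<in> W) \<and> (\<forall>c. \<forall>u\<in>W. c \<cdot>\<^sub>v u \<in> W)"

lemma subspace_iff_lin_closed:
  "VectorSpace.subspace class_ring W (module_vec TYPE(complex) d) \<longleftrightarrow> lin_closed d W"
proof -
  have "VectorSpace.subspace class_ring W (module_vec TYPE(complex) d) \<longleftrightarrow>
      submodule class_ring W (module_vec TYPE(complex) d)"
    using vec_vs[where 'a = complex and n = d] by (simp add: VectorSpace.subspace_def)
  also have "\<dots> \<longleftrightarrow> lin_closed d W"
    using vec_module[where 'a = complex and n = d]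
    by (auto simp: submodule_def lin_closed_def module_vec_simps)
  finally show ?thesis .
qed

lemma maximal_independent_subset:
  assumes G: "G \<subseteq> carrier_vec d" and U0: "U0 \<subseteq> G"
    and li: "LinearCombinations.module.lin_indpt class_ring (module_vec TYPE(complex) d) U0"
  shows "\<exists>U. U0 \<subseteq> U \<and> U \<subseteq> G \<and> finite U \<and> card U \<le> d \<and>
    LinearCombinations.module.lin_indpt class_ring (module_vec TYPE(complex) d) U \<and>
    G \<subseteq> LinearCombinations.module.span class_ring (module_vec TYPE(complex) d) U"
proof -
  interpret vec_space "TYPE(complex)" d .
  define Q where "Q S \<longleftrightarrow> U0 \<subseteq> S \<and> S \<subseteq> G \<and> lin_indpt S" for S
  have bound: "finite S \<and> card S \<le> d" if "lin_indpt S" "S \<subseteq> carrier_vec d" for S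
    using li_le_dim[OF fin_dim _ that(1)] that(2) by (simp add: dim_is_n)
  have "\<exists>U. finite U \<and> maximal U Q"
    by (rule maximal_exists[where N = d and B = U0]) (use bound G U0 li in \<open>auto simp: Q_def\<close>)
  then obtain U where U: "finite U" "maximal U Q" by blast
  then have QU: "U0 \<subseteq> U" "U \<subseteq> G" "lin_indpt U" by (auto simp: maximal_def Q_def)
  have Uc: "U \<subseteq> carrier_vec d" using QU G by auto
  have "g \<in> span U" if g: "g \<in> G" for g
  proof (cases "g \<in> U")
    case True
    then show ?thesis using in_own_span[of U] Uc by auto
  next
    case False
    show ?thesis
    proof (rule ccontr)
      assume "g \<notin> span U"
      then have "lin_indpt (U \<union> {g})"
        using lin_dep_iff_in_span[of U g] Uc QU False g G by auto
      then have "Q (U \<union> {g})" using QU g by (auto simp: Q_def)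
      then have "U \<union> {g} = U" using U(2) unfolding maximal_def by blast
      with False show False by auto
    qed
  qed
  then show ?thesis using QU U bound[OF QU(3) Uc] by blast
qed

lemma span_subset_lin_closed:
  assumes "lin_closed d W" "U \<subseteq> W"
  shows "LinearCombinations.module.span class_ring (module_vec TYPE(complex) d) U \<subseteq> W"
proof -
  interpret vec_space "TYPE(complex)" d .
  show ?thesis
    using assms by (intro span_is_subset) (auto simp: subspace_iff_lin_closed[symmetric] VectorSpace.subspace_def)
qed

lemma lin_closed_span:
  assumes "U \<subseteq> carrier_vec d"
  shows "lin_closed d (LinearCombinations.module.span class_ring (module_vec TYPE(complex) d) U)"
proof -
  interpret vec_space "TYPE(complex)" d .
  show ?thesis
    using span_is_subspace[of U] assms by (simp add: subspace_iff_lin_closed)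
qed

lemma basis_matrix:
  assumes us: "distinct us" "set us \<subseteq> carrier_vec d"
    and li: "LinearCombinations.module.lin_indpt class_ring (module_vec TYPE(complex) d) (set us)"
    and len: "length us = d"
  shows "\<exists>Q. Q \<in> carrier_mat d d \<and> mat_of_cols d us * Q = 1\<^sub>m d \<and> Q * mat_of_cols d us = 1\<^sub>m d"
proof -
  interpret vec_space "TYPE(complex)" d .
  let ?P = "mat_of_cols d us"
  have P: "?P \<in> carrier_mat d d" using len by (simp add: carrier_matI)
  have cols: "cols ?P = us"
    using us(2) by (rule cols_mat_of_cols)
  have "rank ?P = d"
    by (rule lin_indpt_full_rank[OF P]) (use us li in \<open>simp_all add: cols\<close>)
  then have "Determinant.det ?P \<noteq> 0" using det_rank_iff[OF P] by simp
  from det_non_zero_imp_unit[OF P this, of "()"]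
  show ?thesis by (auto simp: Units_def ring_mat_def)
qed

text \<open>If \<open>G\<close> generates, any independent part of it extends inside \<open>G\<close> to a basis of the whole space.\<close>

lemma full_basis_list:
  assumes G: "G \<subseteq> carrier_vec d" and U0: "set us0 \<subseteq> G" "distinct us0"
    and li: "LinearCombinations.module.lin_indpt class_ring (module_vec TYPE(complex) d) (set us0)"
    and gen: "\<And>W. lin_closed d W \<Longrightarrow> G \<subseteq> W \<Longrightarrow> W = carrier_vec d"
  shows "\<exists>us1. distinct (us0 @ us1) \<and> set (us0 @ us1) \<subseteq> G \<and> length (us0 @ us1) = d \<and>
     LinearCombinations.module.lin_indpt class_ring (module_vec TYPE(complex) d) (set (us0 @ us1))"
proof -
  interpret vec_space "TYPE(complex)" d .
  obtain U where U: "set us0 \<subseteq> U" "U \<subseteq> G" "finite U" "lin_indpt U" "G \<subseteq> span U"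
    using maximal_independent_subset[OF G U0(1) li] by blast
  have Uc: "U \<subseteq> carrier_vec d" using U G by auto
  have "span U = carrier_vec d"
    using gen[OF lin_closed_span[OF Uc] U(5)] .
  then have "basis U" using U Uc by (simp add: basis_def)
  then have card: "card U = d" using dim_basis[of U] U by (simp add: dim_is_n)
  obtain us1 where us1: "set us1 = U - set us0" "distinct us1"
    using finite_distinct_list[of "U - set us0"] U by auto
  have "set (us0 @ us1) = U" using us1 U by auto
  moreover have "distinct (us0 @ us1)" using us1 U0 by auto
  moreover have "length (us0 @ us1) = d"
    using calculation card distinct_card by metis
  ultimately show ?thesis using U by (intro exI[of _ us1]) simp
qed

lemma singleton_independent:
  assumes "v \<in> carrier_vec d" "v \<noteq> 0\<^sub>v d"
  shows "LinearCombinations.module.lin_indpt class_ring (module_vec TYPE(complex) d) {v}"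
proof -
  interpret vec_space "TYPE(complex)" d .
  have "lin_indpt {}" by (auto simp: lin_dep_def)
  moreover have "v \<notin> span {}" using assms span_empty by simp
  ultimately show ?thesis
    using lin_dep_iff_in_span[of "{}" v] assms by auto
qed

text \<open>Matrix units with indices from \<open>0\<close>, the convention of the matrix entries.\<close>

definition emat :: "nat \<Rightarrow> nat \<Rightarrow> nat \<Rightarrow> complex Matrix.mat" where
  "emat N i j = gl_unit N (Suc i) (Suc j)"

lemma emat_carrier [simp]: "emat N i j \<in> carrier_mat N N" "dim_row (emat N i j) = N" "dim_col (emat N i j) = N"
  by (simp_all add: emat_def gl_unit_def)

lemma emat_index: "a < N \<Longrightarrow> b < N \<Longrightarrow> emat N i j $$ (a, b) = (if a = i \<and> b = j then 1 else 0)"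
  by (simp add: emat_def gl_unit_def)

lemma emat_mult:
  assumes "i < N" "j < N" "k < N" "l < N"
  shows "emat N i j * emat N k l = (if j = k then emat N i l else 0\<^sub>m N N)"
proof (rule eq_matI)
  fix a b assume "a < dim_row (if j = k then emat N i l else 0\<^sub>m N N)"
    "b < dim_col (if j = k then emat N i l else 0\<^sub>m N N)"
  then have ab: "a < N" "b < N" by (auto split: if_splits)
  have "(emat N i j * emat N k l) $$ (a, b) = (\<Sum>c<N. emat N i j $$ (a, c) * emat N k l $$ (c, b))"
    using ab by (simp add: scalar_prod_def lessThan_atLeast0)
  also have "\<dots> = (\<Sum>c<N. if c = j then (if a = i \<and> j = k \<and> b = l then 1 else 0) else 0)"
    by (intro sum.cong refl) (use ab in \<open>auto simp: emat_index\<close>)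
  also have "\<dots> = (if j = k then emat N i l else 0\<^sub>m N N) $$ (a, b)"
    using ab assms by (simp add: emat_index)
  finally show "(emat N i j * emat N k l) $$ (a, b) = (if j = k then emat N i l else 0\<^sub>m N N) $$ (a, b)" .
qed auto

text \<open>Induction over matrices along the matrix units; this reduces statements about a representation to the operators
\<open>\<rho> (emat N i j)\<close>.\<close>

lemma matrix_units_span:
  assumes X: "X \<in> carrier_mat N N"
    and zero: "Q (0\<^sub>m N N)"
    and add: "\<And>A B. A \<in> carrier_mat N N \<Longrightarrow> B \<in> carrier_mat N N \<Longrightarrow> Q A \<Longrightarrow> Q B \<Longrightarrow> Q (A + B)"
    and smult: "\<And>c A. A \<in> carrier_mat N N \<Longrightarrow> Q A \<Longrightarrow> Q (c \<cdot>\<^sub>m A)"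
    and unit: "\<And>i j. i < N \<Longrightarrow> j < N \<Longrightarrow> Q (emat N i j)"
  shows "Q X"
proof -
  define Y where "Y S = Matrix.mat N N (\<lambda>p. if p \<in> S then X $$ p else 0)" for S
  have "Q (Y S)" if "finite S" "S \<subseteq> {..<N} \<times> {..<N}" for S
    using that
  proof (induction S rule: finite_induct)
    case empty
    have "Y {} = 0\<^sub>m N N" by (rule eq_matI) (auto simp: Y_def)
    then show ?case using zero by simp
  next
    case (insert p S)
    obtain i j where p: "p = (i, j)" by (cases p)
    have "Y (insert p S) = Y S + X $$ p \<cdot>\<^sub>m emat N i j"
      by (rule eq_matI) (use insert p in \<open>auto simp: Y_def emat_index\<close>)
    moreover have "Q (X $$ p \<cdot>\<^sub>m emat N i j)"
      by (intro smult unit) (use insert p in auto)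
    ultimately show ?case using insert by (simp add: add Y_def)
  qed
  then have "Q (Y ({..<N} \<times> {..<N}))" by simp
  moreover have "Y ({..<N} \<times> {..<N}) = X"
    by (rule eq_matI) (use X in \<open>auto simp: Y_def\<close>)
  ultimately show ?thesis by simp
qed

context
  fixes N d :: nat and \<rho> :: "complex Matrix.mat \<Rightarrow> complex Matrix.mat"
  assumes rep: "gl_rep N d \<rho>"
begin

lemma rep_carrier [simp]: "X \<in> carrier_mat N N \<Longrightarrow> \<rho> X \<in> carrier_mat d d"
  using rep by (simp add: gl_rep_def)

lemma rep_add: "X \<in> carrier_mat N N \<Longrightarrow> Y \<in> carrier_mat N N \<Longrightarrow> \<rho> (X + Y) = \<rho> X + \<rho> Y"
  using rep by (simp add: gl_rep_def)

lemma rep_smult: "X \<in> carrier_mat N N \<Longrightarrow> \<rho> (c \<cdot>\<^sub>m X) = c \<cdot>\<^sub>m \<rho> X"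
  using rep by (simp add: gl_rep_def)

lemma rep_zero: "\<rho> (0\<^sub>m N N) = 0\<^sub>m d d"
proof -
  have "\<rho> (0 \<cdot>\<^sub>m 0\<^sub>m N N) = 0 \<cdot>\<^sub>m \<rho> (0\<^sub>m N N)" by (rule rep_smult) simp
  moreover have "(0::complex) \<cdot>\<^sub>m 0\<^sub>m N N = 0\<^sub>m N N" by (rule eq_matI) auto
  moreover have "0 \<cdot>\<^sub>m \<rho> (0\<^sub>m N N) = 0\<^sub>m d d" using carrier_matD[OF rep_carrier[OF zero_carrier_mat]] by (intro eq_matI) auto
  ultimately show ?thesis by simp
qed

lemma rep_diff:
  assumes "X \<in> carrier_mat N N" "Y \<in> carrier_mat N N"
  shows "\<rho> (X - Y) = \<rho> X - \<rho> Y"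
proof -
  have e: "X - Y = X + (-1) \<cdot>\<^sub>m Y"
    by (rule eq_matI) (use assms in auto)
  have "\<rho> (X - Y) = \<rho> X + (-1) \<cdot>\<^sub>m \<rho> Y"
    unfolding e using assms rep_smult[of Y "-1"] by (subst rep_add) auto
  also have "\<dots> = \<rho> X - \<rho> Y"
    by (rule eq_matI) (use rep_carrier assms in auto)
  finally show ?thesis .
qed

lemma rep_bracket:
  assumes "i < N" "j < N" "k < N" "l < N"
  shows "\<rho> (emat N i j) * \<rho> (emat N k l) - \<rho> (emat N k l) * \<rho> (emat N i j) =
    (if j = k then \<rho> (emat N i l) else 0\<^sub>m d d) - (if l = i then \<rho> (emat N k j) else 0\<^sub>m d d)"
proof -
  have "\<rho> (emat N i j) * \<rho> (emat N k l) - \<rho> (emat N k l) * \<rho> (emat N i j) =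
      \<rho> (emat N i j * emat N k l - emat N k l * emat N i j)"
    using rep by (simp add: gl_rep_def)
  also have "\<dots> = \<rho> (if j = k then emat N i l else 0\<^sub>m N N) - \<rho> (if l = i then emat N k j else 0\<^sub>m N N)"
    unfolding emat_mult[OF assms] emat_mult[OF assms(3,4,1,2)] by (subst rep_diff) auto
  finally show ?thesis by (auto simp: rep_zero)
qed

lemma rep_bracket_index:
  assumes "i < N" "j < N" "k < N" "l < N" "a < d" "b < d"
  shows "(\<Sum>c<d. \<rho> (emat N i j) $$ (a, c) * \<rho> (emat N k l) $$ (c, b)) =
    (\<Sum>c<d. \<rho> (emat N k l) $$ (a, c) * \<rho> (emat N i j) $$ (c, b)) +
    (if j = k then \<rho> (emat N i l) $$ (a, b) else 0) - (if l = i then \<rho> (emat N k j) $$ (a, b) else 0)"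
proof -
  have m: "(\<rho> X * \<rho> Y) $$ (a, b) = (\<Sum>c<d. \<rho> X $$ (a, c) * \<rho> Y $$ (c, b))"
    if "X \<in> carrier_mat N N" "Y \<in> carrier_mat N N" for X Y
    using rep_carrier[OF that(1)] rep_carrier[OF that(2)] assms(5,6)
    by (simp add: scalar_prod_def lessThan_atLeast0)
  have dims: "dim_row (\<rho> (emat N p q)) = d" "dim_col (\<rho> (emat N p q)) = d" for p q
    using carrier_matD[OF rep_carrier[OF emat_carrier(1)]] by simp_all
  have "(\<rho> (emat N i j) * \<rho> (emat N k l)) $$ (a, b) - (\<rho> (emat N k l) * \<rho> (emat N i j)) $$ (a, b)
     = (\<rho> (emat N i j) * \<rho> (emat N k l) - \<rho> (emat N k l) * \<rho> (emat N i j)) $$ (a, b)"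
    using assms(5,6) by (simp add: dims)
  also have "\<dots> = (if j = k then \<rho> (emat N i l) $$ (a, b) else 0) - (if l = i then \<rho> (emat N k j) $$ (a, b) else 0)"
    unfolding rep_bracket[OF assms(1-4)] using assms(5,6) by (simp add: dims)
  finally show ?thesis by (simp add: m algebra_simps)
qed

lemma rep_bracket_vec:
  assumes "i < N" "j < N" "k < N" "l < N" "u \<in> carrier_vec d"
  shows "\<rho> (emat N i j) *\<^sub>v (\<rho> (emat N k l) *\<^sub>v u) = \<rho> (emat N k l) *\<^sub>v (\<rho> (emat N i j) *\<^sub>v u) +
    ((if j = k then \<rho> (emat N i l) *\<^sub>v u else 0\<^sub>v d) + (-1) \<cdot>\<^sub>v (if l = i then \<rho> (emat N k j) *\<^sub>v u else 0\<^sub>v d))"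
proof (rule eq_vecI)
  have dims: "dim_row (\<rho> (emat N p q)) = d" "dim_col (\<rho> (emat N p q)) = d" for p q
    using carrier_matD[OF rep_carrier[OF emat_carrier(1)]] by simp_all
  have du: "dim_vec u = d" using assms by simp
  let ?A = "\<rho> (emat N i j)" and ?B = "\<rho> (emat N k l)"
  fix a assume "a < dim_vec (?B *\<^sub>v (?A *\<^sub>v u) +
    ((if j = k then \<rho> (emat N i l) *\<^sub>v u else 0\<^sub>v d) + (-1) \<cdot>\<^sub>v (if l = i then \<rho> (emat N k j) *\<^sub>v u else 0\<^sub>v d)))"
  then have a: "a < d" by (auto simp: dims split: if_splits)
  have app: "vec_index (\<rho> (emat N p q) *\<^sub>v x) a = (\<Sum>b<d. \<rho> (emat N p q) $$ (a, b) * vec_index x b)"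
    if "dim_vec x = d" for p q x
    using a that by (simp add: dims scalar_prod_def lessThan_atLeast0)
  have app2: "vec_index (\<rho> (emat N p q) *\<^sub>v (\<rho> (emat N r s) *\<^sub>v u)) a =
      (\<Sum>b<d. (\<Sum>c<d. \<rho> (emat N p q) $$ (a, c) * \<rho> (emat N r s) $$ (c, b)) * vec_index u b)" for p q r s
  proof -
    have "vec_index (\<rho> (emat N p q) *\<^sub>v (\<rho> (emat N r s) *\<^sub>v u)) a =
       (\<Sum>c<d. \<rho> (emat N p q) $$ (a, c) * (\<Sum>b<d. \<rho> (emat N r s) $$ (c, b) * vec_index u b))"
      by (subst app) (auto simp: dims du scalar_prod_def lessThan_atLeast0)
    then show ?thesis
      by (simp add: sum_distrib_left sum_distrib_right mult.assoc) (rule sum.swap)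
  qed
  have "vec_index (?A *\<^sub>v (?B *\<^sub>v u)) a = vec_index (?B *\<^sub>v (?A *\<^sub>v u)) a +
     (\<Sum>b<d. ((if j = k then \<rho> (emat N i l) $$ (a, b) else 0) - (if l = i then \<rho> (emat N k j) $$ (a, b) else 0)) * vec_index u b)"
    unfolding app2 sum.distrib[symmetric]
    by (intro sum.cong refl) (use a in \<open>simp add: rep_bracket_index[OF assms(1-4)] algebra_simps\<close>)
  also have "(\<Sum>b<d. ((if j = k then \<rho> (emat N i l) $$ (a, b) else 0) - (if l = i then \<rho> (emat N k j) $$ (a, b) else 0)) * vec_index u b)
     = (if j = k then vec_index (\<rho> (emat N i l) *\<^sub>v u) a else 0) - (if l = i then vec_index (\<rho> (emat N k j) *\<^sub>v u) a else 0)"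
    by (simp add: app du left_diff_distrib sum_subtractf)
  finally show "vec_index (?A *\<^sub>v (?B *\<^sub>v u)) a = vec_index (?B *\<^sub>v (?A *\<^sub>v u) +
    ((if j = k then \<rho> (emat N i l) *\<^sub>v u else 0\<^sub>v d) + (-1) \<cdot>\<^sub>v (if l = i then \<rho> (emat N k j) *\<^sub>v u else 0\<^sub>v d))) a"
    using a by (auto simp: dims simp del: index_mult_mat_vec)
qed (use rep_carrier in \<open>auto simp: carrier_matD(1)[OF rep_carrier[OF emat_carrier(1)]]\<close>)

end

context
  fixes N d :: nat and \<rho> :: "complex Matrix.mat \<Rightarrow> complex Matrix.mat"
  assumes rep: "gl_rep N d \<rho>"
begin

lemma rep_dims: "dim_row (\<rho> (emat N i j)) = d" "dim_col (\<rho> (emat N i j)) = d"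
  using carrier_matD[OF rep_carrier[OF rep emat_carrier(1)]] by simp_all

lemma rep_apply_carrier [simp]: "\<rho> (emat N i j) *\<^sub>v u \<in> carrier_vec d"
  by (rule carrier_vecI) (simp add: rep_dims)

lemma rep_apply_index:
  assumes "a < d" "dim_vec x = d"
  shows "vec_index (\<rho> (emat N p q) *\<^sub>v x) a = (\<Sum>b<d. \<rho> (emat N p q) $$ (a, b) * vec_index x b)"
  using assms by (simp add: rep_dims scalar_prod_def lessThan_atLeast0)

lemma rep_apply_add:
  assumes "u \<in> carrier_vec d" "v \<in> carrier_vec d"
  shows "\<rho> (emat N i j) *\<^sub>v (u + v) = \<rho> (emat N i j) *\<^sub>v u + \<rho> (emat N i j) *\<^sub>v v"
  by (rule mult_add_distrib_mat_vec[OF rep_carrier[OF rep emat_carrier(1)] assms])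

lemma rep_apply_smult:
  assumes "u \<in> carrier_vec d"
  shows "\<rho> (emat N i j) *\<^sub>v (c \<cdot>\<^sub>v u) = c \<cdot>\<^sub>v (\<rho> (emat N i j) *\<^sub>v u)"
  by (rule mult_mat_vec[OF rep_carrier[OF rep emat_carrier(1)] assms])

lemma rep_apply_zero: "\<rho> (emat N i j) *\<^sub>v 0\<^sub>v d = 0\<^sub>v d"
  by (rule eq_vecI) (auto simp: rep_dims scalar_prod_def)

lemma lin_closed_vimage:
  assumes "lin_closed d W"
  shows "lin_closed d {u \<in> carrier_vec d. \<rho> (emat N i j) *\<^sub>v u \<in> W}"
  using assms unfolding lin_closed_def
  by (auto simp: rep_apply_add rep_apply_smult rep_apply_zero)

lemma lin_closed_invariant:
  assumes W: "lin_closed d W"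
    and inv: "\<And>i j w. i < N \<Longrightarrow> j < N \<Longrightarrow> w \<in> W \<Longrightarrow> \<rho> (emat N i j) *\<^sub>v w \<in> W"
    and X: "X \<in> carrier_mat N N"
  shows "\<forall>w\<in>W. \<rho> X *\<^sub>v w \<in> W"
  using X
proof (rule matrix_units_span)
  have c: "w \<in> carrier_vec d" if "w \<in> W" for w using that W by (auto simp: lin_closed_def)
  show "\<forall>w\<in>W. \<rho> (0\<^sub>m N N) *\<^sub>v w \<in> W"
  proof
    fix w assume "w \<in> W"
    then have "0\<^sub>m d d *\<^sub>v w = 0\<^sub>v d" using c by (intro eq_vecI) auto
    then show "\<rho> (0\<^sub>m N N) *\<^sub>v w \<in> W" using W by (simp add: rep_zero[OF rep] lin_closed_def)
  qed
  show "\<forall>w\<in>W. \<rho> (A + B) *\<^sub>v w \<in> W"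
    if "A \<in> carrier_mat N N" "B \<in> carrier_mat N N" "\<forall>w\<in>W. \<rho> A *\<^sub>v w \<in> W" "\<forall>w\<in>W. \<rho> B *\<^sub>v w \<in> W" for A B
  proof
    fix w assume w: "w \<in> W"
    have "\<rho> (A + B) *\<^sub>v w = \<rho> A *\<^sub>v w + \<rho> B *\<^sub>v w"
      unfolding rep_add[OF rep that(1,2)]
      by (rule add_mult_distrib_mat_vec[OF rep_carrier[OF rep that(1)] rep_carrier[OF rep that(2)] c[OF w]])
    then show "\<rho> (A + B) *\<^sub>v w \<in> W" using that w W by (simp add: lin_closed_def)
  qed
  show "\<forall>w\<in>W. \<rho> (k \<cdot>\<^sub>m A) *\<^sub>v w \<in> W"
    if "A \<in> carrier_mat N N" "\<forall>w\<in>W. \<rho> A *\<^sub>v w \<in> W" for k A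
  proof
    fix w assume w: "w \<in> W"
    have "\<rho> (k \<cdot>\<^sub>m A) *\<^sub>v w = k \<cdot>\<^sub>v (\<rho> A *\<^sub>v w)"
      unfolding rep_smult[OF rep that(1)]
      using carrier_matD[OF rep_carrier[OF rep that(1)]] c[OF w] by (intro eq_vecI) auto
    then show "\<rho> (k \<cdot>\<^sub>m A) *\<^sub>v w \<in> W" using that w W by (simp add: lin_closed_def)
  qed
qed (use inv in auto)

text \<open>The quadratic Casimir operator \<open>\<Sum>\<^sub>i\<^sub>j E\<^sub>i\<^sub>j E\<^sub>j\<^sub>i\<close>.\<close>

definition casimir_mat :: "complex Matrix.mat" where
  "casimir_mat = Matrix.mat d d (\<lambda>(a, b). \<Sum>i<N. \<Sum>j<N. \<Sum>c<d.
     \<rho> (emat N i j) $$ (a, c) * \<rho> (emat N j i) $$ (c, b))"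

lemma casimir_carrier [simp]: "casimir_mat \<in> carrier_mat d d"
  by (simp add: casimir_mat_def)

lemma casimir_apply:
  assumes "u \<in> carrier_vec d" "a < d"
  shows "vec_index (casimir_mat *\<^sub>v u) a =
    (\<Sum>i<N. \<Sum>j<N. vec_index (\<rho> (emat N i j) *\<^sub>v (\<rho> (emat N j i) *\<^sub>v u)) a)"
proof -
  have du: "dim_vec u = d" using assms by simp
  have "vec_index (casimir_mat *\<^sub>v u) a = (\<Sum>b<d. casimir_mat $$ (a, b) * vec_index u b)"
    using assms by (simp add: casimir_mat_def scalar_prod_def lessThan_atLeast0)
  also have "\<dots> = (\<Sum>b<d. \<Sum>i<N. \<Sum>j<N. \<Sum>c<d. \<rho> (emat N i j) $$ (a, c) * \<rho> (emat N j i) $$ (c, b) * vec_index u b)"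
    by (intro sum.cong refl) (use assms in \<open>simp add: casimir_mat_def sum_distrib_right\<close>)
  also have "\<dots> = (\<Sum>i<N. \<Sum>b<d. \<Sum>j<N. \<Sum>c<d. \<rho> (emat N i j) $$ (a, c) * \<rho> (emat N j i) $$ (c, b) * vec_index u b)"
    by (rule sum.swap)
  also have "\<dots> = (\<Sum>i<N. \<Sum>j<N. \<Sum>b<d. \<Sum>c<d. \<rho> (emat N i j) $$ (a, c) * \<rho> (emat N j i) $$ (c, b) * vec_index u b)"
    by (intro sum.cong refl sum.swap)
  also have "\<dots> = (\<Sum>i<N. \<Sum>j<N. \<Sum>c<d. \<Sum>b<d. \<rho> (emat N i j) $$ (a, c) * \<rho> (emat N j i) $$ (c, b) * vec_index u b)"
    by (intro sum.cong refl sum.swap)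
  also have "\<dots> = (\<Sum>i<N. \<Sum>j<N. vec_index (\<rho> (emat N i j) *\<^sub>v (\<rho> (emat N j i) *\<^sub>v u)) a)"
  proof (intro sum.cong refl)
    fix i j
    have "(\<Sum>c<d. \<Sum>b<d. \<rho> (emat N i j) $$ (a, c) * \<rho> (emat N j i) $$ (c, b) * vec_index u b) =
        (\<Sum>c<d. \<rho> (emat N i j) $$ (a, c) * vec_index (\<rho> (emat N j i) *\<^sub>v u) c)"
      by (intro sum.cong refl) (use du in \<open>simp add: rep_apply_index sum_distrib_left mult.assoc del: index_mult_mat_vec\<close>)
    then show "(\<Sum>c<d. \<Sum>b<d. \<rho> (emat N i j) $$ (a, c) * \<rho> (emat N j i) $$ (c, b) * vec_index u b) =
        vec_index (\<rho> (emat N i j) *\<^sub>v (\<rho> (emat N j i) *\<^sub>v u)) a"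
      using assms by (simp add: rep_apply_index rep_dims del: index_mult_mat_vec)
  qed
  finally show ?thesis .
qed

text \<open>Commuting \<open>E\<^sub>k\<^sub>l\<close> through \<open>\<Sum>\<^sub>i\<^sub>j E\<^sub>i\<^sub>j E\<^sub>j\<^sub>i\<close> produces four families of terms which cancel in pairs after summation.\<close>

lemma casimir_commutes:
  assumes k: "k < N" and l: "l < N" and u: "u \<in> carrier_vec d"
  shows "casimir_mat *\<^sub>v (\<rho> (emat N k l) *\<^sub>v u) = \<rho> (emat N k l) *\<^sub>v (casimir_mat *\<^sub>v u)"
proof (rule eq_vecI)
  fix a assume "a < dim_vec (\<rho> (emat N k l) *\<^sub>v (casimir_mat *\<^sub>v u))"
  then have a: "a < d" by (simp add: rep_dims)
  define E where "E i j x = \<rho> (emat N i j) *\<^sub>v x" for i j x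
  define \<delta> where "\<delta> i j x = (if i = (j::nat) then vec_index x a else 0)" for i j and x :: "complex Matrix.vec"
  have Ec [simp]: "E i j x \<in> carrier_vec d" for i j x by (simp add: E_def)
  have dE: "dim_vec (E i j x) = d" for i j x by (simp add: E_def rep_dims)
  have br: "E i j (E k l x) = E k l (E i j x) +
    ((if j = k then E i l x else 0\<^sub>v d) + (-1) \<cdot>\<^sub>v (if l = i then E k j x else 0\<^sub>v d))"
    if "i < N" "j < N" "k < N" "l < N" "x \<in> carrier_vec d" for i j k l x
    unfolding E_def using rep_bracket_vec[OF rep that] .
  have Eadd: "E i j (x + y) = E i j x + E i j y" if "x \<in> carrier_vec d" "y \<in> carrier_vec d" for i j x y
    unfolding E_def using that by (rule rep_apply_add)
  have Esm: "E i j (c \<cdot>\<^sub>v x) = c \<cdot>\<^sub>v E i j x" if "x \<in> carrier_vec d" for i j c x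
    unfolding E_def using that by (rule rep_apply_smult)
  have E0: "E i j (0\<^sub>v d) = 0\<^sub>v d" for i j
    unfolding E_def by (rule rep_apply_zero)
  \<comment> \<open>\<open>[E\<^sub>i\<^sub>j E\<^sub>j\<^sub>i, E\<^sub>k\<^sub>l]\<close> by the Leibniz rule.\<close>
  have key: "vec_index (E i j (E j i (E k l u))) a = vec_index (E k l (E i j (E j i u))) a
     + \<delta> i k (E i j (E j l u)) - \<delta> l j (E i j (E k i u))
     + \<delta> j k (E i l (E j i u)) - \<delta> l i (E k j (E j i u))" if i: "i < N" and j: "j < N" for i j
  proof -
    have "E j i (E k l u) = E k l (E j i u) +
      ((if i = k then E j l u else 0\<^sub>v d) + (-1) \<cdot>\<^sub>v (if l = j then E k i u else 0\<^sub>v d))"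
      by (rule br) (use i j k l u in auto)
    then have "E i j (E j i (E k l u)) = E i j (E k l (E j i u)) +
      ((if i = k then E i j (E j l u) else 0\<^sub>v d) + (-1) \<cdot>\<^sub>v (if l = j then E i j (E k i u) else 0\<^sub>v d))"
      by (auto simp: Eadd Esm E0)
    moreover have "E i j (E k l (E j i u)) = E k l (E i j (E j i u)) +
      ((if j = k then E i l (E j i u) else 0\<^sub>v d) + (-1) \<cdot>\<^sub>v (if l = i then E k j (E j i u) else 0\<^sub>v d))"
      by (rule br) (use i j k l u in auto)
    ultimately show ?thesis
      using a by (auto simp: \<delta>_def dE)
  qed
  have "vec_index (casimir_mat *\<^sub>v (\<rho> (emat N k l) *\<^sub>v u)) a = (\<Sum>i<N. \<Sum>j<N. vec_index (E i j (E j i (E k l u))) a)"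
    by (subst casimir_apply) (use a in \<open>simp_all add: E_def del: index_mult_mat_vec\<close>)
  also have "\<dots> = (\<Sum>i<N. \<Sum>j<N. vec_index (E k l (E i j (E j i u))) a)
     + (\<Sum>i<N. \<Sum>j<N. \<delta> i k (E i j (E j l u))) - (\<Sum>i<N. \<Sum>j<N. \<delta> l j (E i j (E k i u)))
     + (\<Sum>i<N. \<Sum>j<N. \<delta> j k (E i l (E j i u))) - (\<Sum>i<N. \<Sum>j<N. \<delta> l i (E k j (E j i u)))"
    unfolding sum.distrib[symmetric] sum_subtractf[symmetric]
    by (intro sum.cong refl) (simp add: key)
  also have "(\<Sum>i<N. \<Sum>j<N. \<delta> i k (E i j (E j l u))) = (\<Sum>j<N. vec_index (E k j (E j l u)) a)"
    by (subst sum.swap) (use k in \<open>simp add: \<delta>_def\<close>)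
  also have "(\<Sum>i<N. \<Sum>j<N. \<delta> l i (E k j (E j i u))) = (\<Sum>j<N. vec_index (E k j (E j l u)) a)"
    by (subst sum.swap) (use l in \<open>simp add: \<delta>_def\<close>)
  also have "(\<Sum>i<N. \<Sum>j<N. \<delta> l j (E i j (E k i u))) = (\<Sum>i<N. vec_index (E i l (E k i u)) a)"
    using l by (simp add: \<delta>_def)
  also have "(\<Sum>i<N. \<Sum>j<N. \<delta> j k (E i l (E j i u))) = (\<Sum>i<N. vec_index (E i l (E k i u)) a)"
    using k by (simp add: \<delta>_def)
  also have "(\<Sum>i<N. \<Sum>j<N. vec_index (E k l (E i j (E j i u))) a) = vec_index (\<rho> (emat N k l) *\<^sub>v (casimir_mat *\<^sub>v u)) a"
  proof -
    have "vec_index (\<rho> (emat N k l) *\<^sub>v (casimir_mat *\<^sub>v u)) a =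
       (\<Sum>b<d. \<rho> (emat N k l) $$ (a, b) * vec_index (casimir_mat *\<^sub>v u) b)"
      using a by (intro rep_apply_index) (auto simp: casimir_mat_def)
    also have "\<dots> = (\<Sum>b<d. \<rho> (emat N k l) $$ (a, b) * (\<Sum>i<N. \<Sum>j<N. vec_index (E i j (E j i u)) b))"
      by (intro sum.cong refl) (use u in \<open>simp add: casimir_apply E_def del: index_mult_mat_vec\<close>)
    also have "\<dots> = (\<Sum>i<N. \<Sum>j<N. \<Sum>b<d. \<rho> (emat N k l) $$ (a, b) * vec_index (E i j (E j i u)) b)"
      unfolding sum_distrib_left by (subst sum.swap, intro sum.cong refl sum.swap)
    also have "\<dots> = (\<Sum>i<N. \<Sum>j<N. vec_index (E k l (E i j (E j i u))) a)"
      by (intro sum.cong refl, subst (2) E_def, rule rep_apply_index[symmetric]) (use a dE in auto)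
    finally show ?thesis by simp
  qed
  finally show "vec_index (casimir_mat *\<^sub>v (\<rho> (emat N k l) *\<^sub>v u)) a = vec_index (\<rho> (emat N k l) *\<^sub>v (casimir_mat *\<^sub>v u)) a"
    by simp
qed (simp add: rep_dims casimir_mat_def)

end

lemma rep_conjugate:
  assumes rep: "gl_rep N d \<rho>" and P: "P \<in> carrier_mat d d" and Q: "Q \<in> carrier_mat d d"
    and PQ: "P * Q = 1\<^sub>m d"
  shows "gl_rep N d (\<lambda>X. Q * \<rho> X * P)"
proof -
  have mult: "Q * (A * B) * P = (Q * A * P) * (Q * B * P)"
    if A: "A \<in> carrier_mat d d" and B: "B \<in> carrier_mat d d" for A B
  proof -
    have "(Q * A * P) * (Q * B * P) = Q * A * (P * Q) * B * P"
      using P Q A B by (simp add: assoc_mult_mat[of _ d d _ d _ d])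
    then show ?thesis using P Q A B unfolding PQ by (simp add: assoc_mult_mat[of _ d d _ d _ d])
  qed
  have c: "\<rho> X \<in> carrier_mat d d" if "X \<in> carrier_mat N N" for X using rep_carrier[OF rep that] .
  show ?thesis
    unfolding gl_rep_def
  proof (intro conjI ballI allI)
    fix X Y :: "complex Matrix.mat" assume X: "X \<in> carrier_mat N N" and Y: "Y \<in> carrier_mat N N"
    show "Q * \<rho> (X + Y) * P = Q * \<rho> X * P + Q * \<rho> Y * P"
      unfolding rep_add[OF rep X Y] using P Q c[OF X] c[OF Y]
      by (simp add: mult_add_distrib_mat[of _ d d] add_mult_distrib_mat[of _ d d])
    have "Q * (A - B) * P = Q * A * P - Q * B * P"
      if "A \<in> carrier_mat d d" "B \<in> carrier_mat d d" for A B
      using P Q that by (simp add: mult_minus_distrib_mat[of _ d d] minus_mult_distrib_mat[of _ d d])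
    moreover have "\<rho> (X * Y - Y * X) = \<rho> X * \<rho> Y - \<rho> Y * \<rho> X"
      using rep X Y by (simp add: gl_rep_def)
    ultimately show "Q * \<rho> (X * Y - Y * X) * P = Q * \<rho> X * P * (Q * \<rho> Y * P) - Q * \<rho> Y * P * (Q * \<rho> X * P)"
      using c[OF X] c[OF Y] by (simp add: mult[symmetric])
  next
    fix k and X :: "complex Matrix.mat" assume X: "X \<in> carrier_mat N N"
    show "Q * \<rho> (k \<cdot>\<^sub>m X) * P = k \<cdot>\<^sub>m (Q * \<rho> X * P)"
      unfolding rep_smult[OF rep X] using P Q c[OF X]
      by (simp add: mult_smult_distrib[of _ d d] mult_smult_assoc_mat[of _ d d])
  qed (use P Q c in auto)
qed

section \<open>Weight bases of irreducible representations\<close>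

text \<open>Words in the lowering operators \<open>E\<^sub>k\<^sub>l\<close>, \<open>l < k\<close>, applied to \<open>v\<close>, together with their weights. The weight is carried along
as data since it cannot be read off from a vector that happens to be zero.\<close>

inductive lowered :: "nat \<Rightarrow> (complex Matrix.mat \<Rightarrow> complex Matrix.mat) \<Rightarrow> complex Matrix.vec \<Rightarrow> (nat \<Rightarrow> int) \<Rightarrow>
    complex Matrix.vec \<Rightarrow> (nat \<Rightarrow> int) \<Rightarrow> bool"
  for N \<rho> v n where
  base: "lowered N \<rho> v n v (\<lambda>i. if i < N then n i else 0)"
| step: "lowered N \<rho> v n u \<mu> \<Longrightarrow> l < k \<Longrightarrow> k < N \<Longrightarrow>
    lowered N \<rho> v n (\<rho> (emat N k l) *\<^sub>v u) (\<lambda>i. \<mu> i + (if i = k then 1 else 0) - (if i = l then 1 else 0))"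

lemma lowered_support: "lowered N \<rho> v n u \<mu> \<Longrightarrow> i \<ge> N \<Longrightarrow> \<mu> i = 0"
  by (induction rule: lowered.induct) auto

lemma lowered_total: "lowered N \<rho> v n u \<mu> \<Longrightarrow> (\<Sum>i<N. \<mu> i) = (\<Sum>i<N. n i)"
  by (induction rule: lowered.induct) (auto simp: sum.distrib sum_subtractf)

lemma lowered_dominated:
  assumes "lowered N \<rho> v n u \<mu>" "m \<le> N"
  shows "(\<Sum>i<m. \<mu> i) \<le> (\<Sum>i<m. n i)"
  using assms
proof (induction rule: lowered.induct)
  case base
  have "(\<Sum>i<m. if i < N then n i else 0) = (\<Sum>i<m. n i)"
    by (intro sum.cong) (use base in auto)
  then show ?case by simp
next
  case (step u \<mu> l k)
  then show ?case by (auto simp: sum.distrib sum_subtractf)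
qed

text \<open>Each lowering moves a unit of weight to a larger index and increases \<open>\<Sum> i \<mu>\<^sub>i\<close>. Hence only the empty word has the
highest weight, which is therefore simple.\<close>

lemma lowered_height:
  assumes "lowered N \<rho> v n u \<mu>"
  shows "u = v \<and> \<mu> = (\<lambda>i. if i < N then n i else 0) \<or>
    (\<Sum>i<N. int i * \<mu> i) > (\<Sum>i<N. int i * (if i < N then n i else 0))"
  using assms
proof (induction rule: lowered.induct)
  case (step u \<mu> l k)
  have "(\<Sum>i<N. int i * (\<mu> i + (if i = k then 1 else 0) - (if i = l then 1 else 0))) =
      (\<Sum>i<N. int i * \<mu> i) + (\<Sum>i<N. if i = k then int i else 0) - (\<Sum>i<N. if i = l then int i else 0)"
    unfolding sum.distrib[symmetric] sum_subtractf[symmetric]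
    by (intro sum.cong refl) (auto simp: algebra_simps)
  also have "\<dots> = (\<Sum>i<N. int i * \<mu> i) + int k - int l"
    using step by simp
  finally show ?case using step by auto
qed simp

text \<open>Everything about an irreducible representation with highest weight \<open>n\<close> that its character depends on, in coordinates:
in the basis formed by the columns of \<open>P\<close> the Cartan operators are diagonal with the weights \<open>w\<close> as entries, the highest
weight occurs at index \<open>0\<close> only, and the Casimir operator is the scalar \<open>c\<close>.\<close>

theorem irreducible_weight_basis:
  assumes rep: "gl_rep N d \<rho>" and irr: "gl_irreducible N d \<rho>"
    and v: "v \<in> carrier_vec d" "v \<noteq> 0\<^sub>v d"
    and diag: "\<And>i. i < N \<Longrightarrow> \<rho> (emat N i i) *\<^sub>v v = of_int (n i) \<cdot>\<^sub>v v"
    and raise: "\<And>i j. i < j \<Longrightarrow> j < N \<Longrightarrow> \<rho> (emat N i j) *\<^sub>v v = 0\<^sub>v d"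
  shows "\<exists>w P Q c. d > 0 \<and> P \<in> carrier_mat d d \<and> Q \<in> carrier_mat d d \<and> P * Q = 1\<^sub>m d \<and> Q * P = 1\<^sub>m d \<and>
    (\<forall>i<N. Q * \<rho> (emat N i i) * P = Matrix.mat d d (\<lambda>(a, b). if a = b then of_int (w a i) else 0)) \<and>
    (\<forall>b<d. (\<forall>i\<ge>N. w b i = 0) \<and> (\<Sum>i<N. w b i) = (\<Sum>i<N. n i) \<and>
       (\<forall>m\<le>N. (\<Sum>i<m. w b i) \<le> (\<Sum>i<m. n i)) \<and> ((\<forall>i<N. w b i = n i) \<longleftrightarrow> b = 0)) \<and>
    (\<forall>a<d. \<forall>b<d. (\<Sum>i<N. \<Sum>j<N. \<Sum>e<d. (Q * \<rho> (emat N i j) * P) $$ (a, e) * (Q * \<rho> (emat N j i) * P) $$ (e, b))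
       = (if a = b then c else 0))"
proof -
  define low where "low u \<mu> \<longleftrightarrow> lowered N \<rho> v n u \<mu>" for u \<mu>
  define G where "G = {u. \<exists>\<mu>. low u \<mu>}"
  have lc: "u \<in> carrier_vec d" if "low u \<mu>" for u \<mu>
    using that unfolding low_def by induction (auto simp: v rep_apply_carrier[OF rep])
  have Gc: "G \<subseteq> carrier_vec d" using lc by (auto simp: G_def)
  have vG: "v \<in> G" by (auto simp: G_def low_def intro: lowered.base)
  have stepG: "\<rho> (emat N k l) *\<^sub>v u \<in> G" if "u \<in> G" "l < k" "k < N" for u k l
    using that by (auto simp: G_def low_def intro: lowered.step)
  have wt: "\<rho> (emat N i i) *\<^sub>v u = of_int (\<mu> i) \<cdot>\<^sub>v u" if "low u \<mu>" "i < N" for u \<mu> i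
    using that unfolding low_def
  proof (induction rule: lowered.induct)
    case base
    then show ?case using diag by simp
  next
    case (step u \<mu> l k)
    have uc: "u \<in> carrier_vec d" using step lc low_def by blast
    have "\<rho> (emat N i i) *\<^sub>v (\<rho> (emat N k l) *\<^sub>v u) = \<rho> (emat N k l) *\<^sub>v (\<rho> (emat N i i) *\<^sub>v u) +
      ((if i = k then \<rho> (emat N i l) *\<^sub>v u else 0\<^sub>v d) + (-1) \<cdot>\<^sub>v (if l = i then \<rho> (emat N k i) *\<^sub>v u else 0\<^sub>v d))"
      by (rule rep_bracket_vec[OF rep]) (use step uc in auto)
    also have "\<rho> (emat N k l) *\<^sub>v (\<rho> (emat N i i) *\<^sub>v u) = of_int (\<mu> i) \<cdot>\<^sub>v (\<rho> (emat N k l) *\<^sub>v u)"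
      using step uc by (simp add: rep_apply_smult[OF rep])
    finally show ?case
      using step by (intro eq_vecI) (auto simp: rep_dims[OF rep] algebra_simps simp del: index_mult_mat_vec)
  qed
  \<comment> \<open>The span \<open>H\<close> of the lowered vectors is stable under lowering by construction. Raising and Cartan operators
    are commuted past the last lowering operator, by induction on the word; so \<open>H\<close> is invariant, hence everything.\<close>
  define H where "H = \<Inter>{W. lin_closed d W \<and> G \<subseteq> W}"
  have full: "lin_closed d (carrier_vec d)" by (auto simp: lin_closed_def)
  have Hc: "lin_closed d H"
    using full Gc unfolding H_def lin_closed_def by (auto 4 3)
  have GH: "G \<subseteq> H" by (auto simp: H_def)
  have Hmin: "H \<subseteq> W" if "lin_closed d W" "G \<subseteq> W" for W using that by (auto simp: H_def)
  have Hcar: "H \<subseteq> carrier_vec d" using Hc by (simp add: lin_closed_def)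
  have lowerH: "\<rho> (emat N k l) *\<^sub>v w \<in> H" if "w \<in> H" "l < k" "k < N" for w k l
  proof -
    have "H \<subseteq> {u \<in> carrier_vec d. \<rho> (emat N k l) *\<^sub>v u \<in> H}"
      by (rule Hmin[OF lin_closed_vimage[OF rep Hc]]) (use stepG[OF _ that(2,3)] GH Gc in auto)
    with that show ?thesis by auto
  qed
  have smH: "c \<cdot>\<^sub>v x \<in> H" if "x \<in> H" for c x using that Hc by (simp add: lin_closed_def)
  have zH: "0\<^sub>v d \<in> H" using Hc by (simp add: lin_closed_def)
  have addH: "x + y \<in> H" if "x \<in> H" "y \<in> H" for x y using that Hc by (simp add: lin_closed_def)
  have EG: "\<forall>a<N. \<forall>b<N. \<rho> (emat N a b) *\<^sub>v u \<in> H" if "low u \<mu>" for u \<mu>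
    using that unfolding low_def
  proof (induction rule: lowered.induct)
    case base
    have vH: "v \<in> H" using vG GH by auto
    show ?case
    proof (intro allI impI)
      fix a b assume "a < N" "b < N"
      then show "\<rho> (emat N a b) *\<^sub>v v \<in> H"
        using diag[of a] raise[of a b] lowerH[OF vH, of b a] smH[OF vH] zH
        by (cases a b rule: linorder_cases) auto
    qed
  next
    case (step u \<mu> l k)
    have uc: "u \<in> carrier_vec d" using step lc low_def by blast
    show ?case
    proof (intro allI impI)
      fix a b assume ab: "a < N" "b < N"
      have "\<rho> (emat N a b) *\<^sub>v (\<rho> (emat N k l) *\<^sub>v u) = \<rho> (emat N k l) *\<^sub>v (\<rho> (emat N a b) *\<^sub>v u) +
        ((if b = k then \<rho> (emat N a l) *\<^sub>v u else 0\<^sub>v d) + (-1) \<cdot>\<^sub>v (if l = a then \<rho> (emat N k b) *\<^sub>v u else 0\<^sub>v d))"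
        by (rule rep_bracket_vec[OF rep]) (use step uc ab in auto)
      also have "\<dots> \<in> H"
      proof (intro addH smH)
        show "\<rho> (emat N k l) *\<^sub>v (\<rho> (emat N a b) *\<^sub>v u) \<in> H"
          by (rule lowerH) (use step ab in auto)
      qed (use step ab zH in auto)
      finally show "\<rho> (emat N a b) *\<^sub>v (\<rho> (emat N k l) *\<^sub>v u) \<in> H" .
    qed
  qed
  have EH: "\<rho> (emat N a b) *\<^sub>v w \<in> H" if "a < N" "b < N" "w \<in> H" for a b w
  proof -
    have "H \<subseteq> {u \<in> carrier_vec d. \<rho> (emat N a b) *\<^sub>v u \<in> H}"
      by (rule Hmin[OF lin_closed_vimage[OF rep Hc]]) (use EG that Gc in \<open>auto simp: G_def\<close>)
    with that show ?thesis by auto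
  qed
  have "\<forall>X\<in>carrier_mat N N. \<forall>w\<in>H. \<rho> X *\<^sub>v w \<in> H"
    using lin_closed_invariant[OF rep Hc EH] by blast
  then have "H = {0\<^sub>v d} \<or> H = carrier_vec d"
    using irr Hc by (auto simp: gl_irreducible_def subspace_iff_lin_closed)
  then have HV: "H = carrier_vec d" using vG GH v by auto
  have gen: "W = carrier_vec d" if "lin_closed d W" "G \<subseteq> W" for W
    using Hmin[OF that] HV that(1) by (auto simp: lin_closed_def)
  \<comment> \<open>A basis of weight vectors starting with the highest one.\<close>
  obtain us1 where us1: "distinct ([v] @ us1)" "set ([v] @ us1) \<subseteq> G" "length ([v] @ us1) = d"
     "LinearCombinations.module.lin_indpt class_ring (module_vec TYPE(complex) d) (set ([v] @ us1))"
    using full_basis_list[OF Gc, of "[v]"] vG singleton_independent[OF v] gen by auto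
  define us where "us = v # us1"
  have us: "distinct us" "set us \<subseteq> G" "length us = d"
     "LinearCombinations.module.lin_indpt class_ring (module_vec TYPE(complex) d) (set us)"
    using us1 by (simp_all add: us_def)
  have d0: "d > 0" using us(3) by (auto simp: us_def)
  have us0: "us ! 0 = v" by (simp add: us_def)
  define P where "P = mat_of_cols d us"
  have P: "P \<in> carrier_mat d d" using us(3) by (simp add: P_def carrier_matI)
  obtain Q where Q: "Q \<in> carrier_mat d d" and PQ: "P * Q = 1\<^sub>m d" and QP: "Q * P = 1\<^sub>m d"
    using basis_matrix[OF us(1) _ us(4,3)] us(2) Gc unfolding P_def by blast
  define w where "w b = (if b = 0 then (\<lambda>i. if i < N then n i else 0) else (SOME \<mu>. low (us ! b) \<mu>))" for b
  have lw: "low (us ! b) (w b)" if "b < d" for b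
  proof (cases "b = 0")
    case True
    then show ?thesis using us0 by (auto simp: w_def low_def intro: lowered.base)
  next
    case False
    have "us ! b \<in> G" using that us(2,3) nth_mem by blast
    then have "\<exists>\<mu>. low (us ! b) \<mu>" by (simp add: G_def)
    then have "low (us ! b) (SOME \<mu>. low (us ! b) \<mu>)" by (rule someI_ex)
    then show ?thesis using False by (simp add: w_def)
  qed
  have Pidx: "P $$ (a, b) = vec_index (us ! b) a" if "a < d" "b < d" for a b
    using that us(3) by (simp add: P_def mat_of_cols_index)
  have colP: "Matrix.col P b = us ! b" if "b < d" for b
    unfolding P_def using that us(3) lc[OF lw[OF that]] by (intro col_mat_of_cols) auto
  have dg: "Q * \<rho> (emat N i i) * P = Matrix.mat d d (\<lambda>(a, b). if a = b then of_int (w a i) else 0)"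
    if i: "i < N" for i
  proof -
    define D where "D = Matrix.mat d d (\<lambda>(a, b). if a = b then complex_of_int (w a i) else 0)"
    have Dc: "D \<in> carrier_mat d d" by (simp add: D_def)
    have Rc: "\<rho> (emat N i i) \<in> carrier_mat d d" by (simp add: rep_carrier[OF rep])
    have "\<rho> (emat N i i) * P = P * D"
    proof (rule eq_matI)
      fix a b assume "a < dim_row (P * D)" "b < dim_col (P * D)"
      then have ab: "a < d" "b < d" using P Dc by auto
      have "(\<rho> (emat N i i) * P) $$ (a, b) = vec_index (\<rho> (emat N i i) *\<^sub>v us ! b) a"
        using ab P by (simp add: colP rep_dims[OF rep])
      also have "\<dots> = vec_index (of_int (w b i) \<cdot>\<^sub>v us ! b) a"
        using wt[OF lw[OF ab(2)] i] by simp
      also have "\<dots> = P $$ (a, b) * of_int (w b i)"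
        using ab lc[OF lw[OF ab(2)]] by (simp add: Pidx)
      also have "\<dots> = (\<Sum>e<d. if e = b then P $$ (a, b) * of_int (w b i) else 0)"
        using ab by simp
      also have "\<dots> = (\<Sum>e<d. P $$ (a, e) * D $$ (e, b))"
        by (intro sum.cong refl) (use ab in \<open>auto simp: D_def\<close>)
      also have "\<dots> = (P * D) $$ (a, b)"
        using ab P Dc by (simp add: scalar_prod_def lessThan_atLeast0)
      finally show "(\<rho> (emat N i i) * P) $$ (a, b) = (P * D) $$ (a, b)" .
    qed (use P Dc rep_dims[OF rep] in auto)
    then have "Q * \<rho> (emat N i i) * P = Q * P * D"
      using P Q Dc Rc by (simp add: assoc_mult_mat[of _ d d _ d _ d])
    then show ?thesis using QP Dc by (simp add: D_def)
  qed
  have wprops: "(\<forall>i\<ge>N. w b i = 0) \<and> (\<Sum>i<N. w b i) = (\<Sum>i<N. n i) \<and>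
       (\<forall>m\<le>N. (\<Sum>i<m. w b i) \<le> (\<Sum>i<m. n i)) \<and> ((\<forall>i<N. w b i = n i) \<longleftrightarrow> b = 0)" if b: "b < d" for b
  proof -
    have l: "lowered N \<rho> v n (us ! b) (w b)" using lw[OF b] by (simp add: low_def)
    have "b = 0" if e: "\<forall>i<N. w b i = n i"
    proof -
      have "(\<Sum>i<N. int i * w b i) = (\<Sum>i<N. int i * (if i < N then n i else 0))"
        by (intro sum.cong refl) (use e in auto)
      then have "us ! b = us ! 0" using lowered_height[OF l] us0 by auto
      then show ?thesis using us(1,3) b d0 by (simp add: nth_eq_iff_index_eq)
    qed
    moreover have "\<forall>i<N. w 0 i = n i" by (simp add: w_def)
    ultimately show ?thesis
      using lowered_support[OF l] lowered_total[OF l] lowered_dominated[OF l] by blast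
  qed
  \<comment> \<open>The Casimir operator is a scalar on the highest weight vector: \<open>E\<^sub>i\<^sub>j E\<^sub>j\<^sub>i v\<close> vanishes for \<open>j < i\<close> and equals
    \<open>[E\<^sub>i\<^sub>j, E\<^sub>j\<^sub>i] v\<close> for \<open>i < j\<close>. As it commutes with the lowering operators, it is the same scalar everywhere.\<close>
  define C where "C = casimir_mat N d \<rho>"
  have Cc: "C \<in> carrier_mat d d" unfolding C_def by (rule casimir_carrier[OF rep])
  define q where "q i j = (if i < j then of_int (n i - n j) else if i = j then (of_int (n i))\<^sup>2 else (0::complex))" for i j
  have qv: "\<rho> (emat N i j) *\<^sub>v (\<rho> (emat N j i) *\<^sub>v v) = q i j \<cdot>\<^sub>v v" if ij: "i < N" "j < N" for i j
  proof (cases i j rule: linorder_cases)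
    case less
    have "\<rho> (emat N i j) *\<^sub>v (\<rho> (emat N j i) *\<^sub>v v) = \<rho> (emat N j i) *\<^sub>v (\<rho> (emat N i j) *\<^sub>v v) +
       ((if j = j then \<rho> (emat N i i) *\<^sub>v v else 0\<^sub>v d) + (-1) \<cdot>\<^sub>v (if i = i then \<rho> (emat N j j) *\<^sub>v v else 0\<^sub>v d))"
      by (rule rep_bracket_vec[OF rep]) (use ij v in auto)
    also have "\<rho> (emat N j i) *\<^sub>v (\<rho> (emat N i j) *\<^sub>v v) = 0\<^sub>v d"
      using raise[OF less ij(2)] by (simp add: rep_apply_zero[OF rep])
    finally show ?thesis
      using less v(1) by (simp add: diag ij q_def) (intro eq_vecI, auto simp: algebra_simps)
  next
    case equal
    then show ?thesis using ij v(1)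
      by (simp add: diag q_def rep_apply_smult[OF rep] power2_eq_square smult_smult_assoc)
  next
    case greater
    then show ?thesis using raise[OF greater ij(1)] v(1)
      by (simp add: q_def rep_apply_zero[OF rep]) (intro eq_vecI, auto)
  qed
  define c where "c = (\<Sum>i<N. \<Sum>j<N. q i j)"
  have Cv: "C *\<^sub>v v = c \<cdot>\<^sub>v v"
  proof (rule eq_vecI)
    fix a assume "a < dim_vec (c \<cdot>\<^sub>v v)"
    then have a: "a < d" using v by auto
    have "vec_index (C *\<^sub>v v) a = (\<Sum>i<N. \<Sum>j<N. vec_index (\<rho> (emat N i j) *\<^sub>v (\<rho> (emat N j i) *\<^sub>v v)) a)"
      unfolding C_def by (rule casimir_apply[OF rep v(1) a])
    also have "\<dots> = (\<Sum>i<N. \<Sum>j<N. q i j * vec_index v a)"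
      by (intro sum.cong refl) (use a v(1) in \<open>simp add: qv del: index_mult_mat_vec\<close>)
    finally show "vec_index (C *\<^sub>v v) a = vec_index (c \<cdot>\<^sub>v v) a"
      using a v(1) by (simp add: c_def sum_distrib_right)
  qed (use Cc v in auto)
  have Ccl: "lin_closed d {u \<in> carrier_vec d. C *\<^sub>v u = c \<cdot>\<^sub>v u}"
    unfolding lin_closed_def
  proof (intro conjI ballI allI)
    fix x y assume "x \<in> {u \<in> carrier_vec d. C *\<^sub>v u = c \<cdot>\<^sub>v u}" "y \<in> {u \<in> carrier_vec d. C *\<^sub>v u = c \<cdot>\<^sub>v u}"
    then show "x + y \<in> {u \<in> carrier_vec d. C *\<^sub>v u = c \<cdot>\<^sub>v u}"
      using Cc by (auto simp: mult_add_distrib_mat_vec[of _ d d] smult_add_distrib_vec[of _ d])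
  next
    fix k x assume "x \<in> {u \<in> carrier_vec d. C *\<^sub>v u = c \<cdot>\<^sub>v u}"
    then show "k \<cdot>\<^sub>v x \<in> {u \<in> carrier_vec d. C *\<^sub>v u = c \<cdot>\<^sub>v u}"
      using Cc by (auto simp: mult_mat_vec[of _ d d] smult_smult_assoc mult.commute)
  next
    show "0\<^sub>v d \<in> {u \<in> carrier_vec d. C *\<^sub>v u = c \<cdot>\<^sub>v u}"
      using Cc by (auto intro!: eq_vecI simp: scalar_prod_def)
  qed auto
  have "C *\<^sub>v u = c \<cdot>\<^sub>v u" if "low u \<mu>" for u \<mu>
    using that unfolding low_def
  proof (induction rule: lowered.induct)
    case (step u \<mu> l k)
    have uc: "u \<in> carrier_vec d" using step lc low_def by blast
    have "C *\<^sub>v (\<rho> (emat N k l) *\<^sub>v u) = \<rho> (emat N k l) *\<^sub>v (C *\<^sub>v u)"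
      unfolding C_def by (rule casimir_commutes[OF rep]) (use step uc in auto)
    then show ?case using step uc by (simp add: rep_apply_smult[OF rep])
  qed (rule Cv)
  then have "G \<subseteq> {u \<in> carrier_vec d. C *\<^sub>v u = c \<cdot>\<^sub>v u}" using Gc by (auto simp: G_def)
  then have Call: "C *\<^sub>v u = c \<cdot>\<^sub>v u" if "u \<in> carrier_vec d" for u
    using gen[OF Ccl] that by auto
  have Cidx: "(\<Sum>i<N. \<Sum>j<N. \<Sum>e<d. \<rho> (emat N i j) $$ (a, e) * \<rho> (emat N j i) $$ (e, b)) = (if a = b then c else 0)"
    if ab: "a < d" "b < d" for a b
  proof -
    have "(\<Sum>i<N. \<Sum>j<N. \<Sum>e<d. \<rho> (emat N i j) $$ (a, e) * \<rho> (emat N j i) $$ (e, b)) = C $$ (a, b)"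
      unfolding C_def casimir_mat_def[OF rep] using ab by simp
    also have "\<dots> = vec_index (C *\<^sub>v unit_vec d b) a"
      using ab Cc by simp
    also have "\<dots> = (if a = b then c else 0)"
      using ab by (subst Call) auto
    finally show ?thesis .
  qed
  have cas: "(\<Sum>i<N. \<Sum>j<N. \<Sum>e<d. (Q * \<rho> (emat N i j) * P) $$ (a, e) * (Q * \<rho> (emat N j i) * P) $$ (e, b))
       = (if a = b then c else 0)" if ab: "a < d" "b < d" for a b
  proof -
    have "(\<Sum>e<d. (Q * \<rho> (emat N i j) * P) $$ (a, e) * (Q * \<rho> (emat N j i) * P) $$ (e, b))
      = (\<Sum>f<d. \<Sum>g<d. Q $$ (a, f) * P $$ (g, b) * (\<Sum>e<d. \<rho> (emat N i j) $$ (f, e) * \<rho> (emat N j i) $$ (e, g)))" for i j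
    proof -
      have c1: "\<rho> (emat N i j) \<in> carrier_mat d d" "\<rho> (emat N j i) \<in> carrier_mat d d"
        by (simp_all add: rep_carrier[OF rep])
      have "(\<Sum>e<d. (Q * \<rho> (emat N i j) * P) $$ (a, e) * (Q * \<rho> (emat N j i) * P) $$ (e, b))
          = ((Q * \<rho> (emat N i j) * P) * (Q * \<rho> (emat N j i) * P)) $$ (a, b)"
        using ab c1 P Q by (simp add: times_mat_def scalar_prod_def lessThan_atLeast0)
      also have "(Q * \<rho> (emat N i j) * P) * (Q * \<rho> (emat N j i) * P) = Q * \<rho> (emat N i j) * (P * Q) * \<rho> (emat N j i) * P"
        using P Q c1 by (simp add: assoc_mult_mat[of _ d d _ d _ d])
      also have "\<dots> = Q * (\<rho> (emat N i j) * \<rho> (emat N j i)) * P"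
        using P Q c1 unfolding PQ by (simp add: assoc_mult_mat[of _ d d _ d _ d])
      also have "\<dots> $$ (a, b) = (\<Sum>g<d. (\<Sum>f<d. Q $$ (a, f) * (\<Sum>e<d. \<rho> (emat N i j) $$ (f, e) * \<rho> (emat N j i) $$ (e, g))) * P $$ (g, b))"
        using ab c1 P Q by (simp add: times_mat_def scalar_prod_def lessThan_atLeast0)
      also have "\<dots> = (\<Sum>g<d. \<Sum>f<d. Q $$ (a, f) * P $$ (g, b) * (\<Sum>e<d. \<rho> (emat N i j) $$ (f, e) * \<rho> (emat N j i) $$ (e, g)))"
        unfolding sum_distrib_right[of _ "{..<d}" "P $$ (_, b)"] by (intro sum.cong refl) (simp add: mult_ac)
      finally show ?thesis by (subst sum.swap)
    qed
    then have "(\<Sum>i<N. \<Sum>j<N. \<Sum>e<d. (Q * \<rho> (emat N i j) * P) $$ (a, e) * (Q * \<rho> (emat N j i) * P) $$ (e, b))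
      = (\<Sum>i<N. \<Sum>j<N. \<Sum>f<d. \<Sum>g<d. Q $$ (a, f) * P $$ (g, b) * (\<Sum>e<d. \<rho> (emat N i j) $$ (f, e) * \<rho> (emat N j i) $$ (e, g)))"
      by simp
    also have "\<dots> = (\<Sum>i<N. \<Sum>f<d. \<Sum>j<N. \<Sum>g<d. Q $$ (a, f) * P $$ (g, b) * (\<Sum>e<d. \<rho> (emat N i j) $$ (f, e) * \<rho> (emat N j i) $$ (e, g)))"
      by (intro sum.cong refl sum.swap)
    also have "\<dots> = (\<Sum>f<d. \<Sum>i<N. \<Sum>j<N. \<Sum>g<d. Q $$ (a, f) * P $$ (g, b) * (\<Sum>e<d. \<rho> (emat N i j) $$ (f, e) * \<rho> (emat N j i) $$ (e, g)))"
      by (rule sum.swap)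
    also have "\<dots> = (\<Sum>f<d. \<Sum>i<N. \<Sum>g<d. \<Sum>j<N. Q $$ (a, f) * P $$ (g, b) * (\<Sum>e<d. \<rho> (emat N i j) $$ (f, e) * \<rho> (emat N j i) $$ (e, g)))"
      by (intro sum.cong refl sum.swap)
    also have "\<dots> = (\<Sum>f<d. \<Sum>g<d. \<Sum>i<N. \<Sum>j<N. Q $$ (a, f) * P $$ (g, b) * (\<Sum>e<d. \<rho> (emat N i j) $$ (f, e) * \<rho> (emat N j i) $$ (e, g)))"
      by (intro sum.cong refl sum.swap)
    also have "\<dots> = (\<Sum>f<d. \<Sum>g<d. Q $$ (a, f) * P $$ (g, b) * (if f = g then c else 0))"
      by (intro sum.cong refl) (simp add: sum_distrib_left[symmetric] Cidx)
    also have "\<dots> = (\<Sum>f<d. c * (Q $$ (a, f) * P $$ (f, b)))"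
    proof (intro sum.cong refl)
      fix f assume "f \<in> {..<d}"
      have "(\<Sum>g<d. Q $$ (a, f) * P $$ (g, b) * (if f = g then c else 0)) = (\<Sum>g<d. if f = g then c * (Q $$ (a, f) * P $$ (f, b)) else 0)"
        by (intro sum.cong refl) auto
      then show "(\<Sum>g<d. Q $$ (a, f) * P $$ (g, b) * (if f = g then c else 0)) = c * (Q $$ (a, f) * P $$ (f, b))"
        using \<open>f \<in> _\<close> by simp
    qed
    also have "\<dots> = c * (Q * P) $$ (a, b)"
      using ab P Q by (simp add: scalar_prod_def lessThan_atLeast0 sum_distrib_left)
    finally show ?thesis using ab by (simp add: QP)
  qed
  show ?thesis
    by (intro exI[of _ w] exI[of _ P] exI[of _ Q] exI[of _ c] conjI d0 P Q PQ QP allI impI dg wprops cas)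
qed

section \<open>Characters of irreducible representations\<close>

definition diag_fun_mat :: "nat \<Rightarrow> (nat \<Rightarrow> complex) \<Rightarrow> complex Matrix.mat" where
  "diag_fun_mat d f = Matrix.mat d d (\<lambda>(a, b). if a = b then f a else 0)"

lemma diag_fun_mat_carrier [simp]: "diag_fun_mat d f \<in> carrier_mat d d"
  by (simp add: diag_fun_mat_def)

lemma diag_fun_mat_mult: "diag_fun_mat d f * diag_fun_mat d g = diag_fun_mat d (\<lambda>a. f a * g a)"
proof (rule eq_matI)
  fix a b assume "a < dim_row (diag_fun_mat d (\<lambda>a. f a * g a))" "b < dim_col (diag_fun_mat d (\<lambda>a. f a * g a))"
  then have ab: "a < d" "b < d" by (simp_all add: diag_fun_mat_def)
  have "(diag_fun_mat d f * diag_fun_mat d g) $$ (a, b) = (\<Sum>c<d. diag_fun_mat d f $$ (a, c) * diag_fun_mat d g $$ (c, b))"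
    using ab by (simp add: diag_fun_mat_def scalar_prod_def lessThan_atLeast0)
  also have "\<dots> = (\<Sum>c<d. if c = a then (if a = b then f a * g a else 0) else 0)"
    by (intro sum.cong refl) (use ab in \<open>auto simp: diag_fun_mat_def\<close>)
  finally show "(diag_fun_mat d f * diag_fun_mat d g) $$ (a, b) = diag_fun_mat d (\<lambda>a. f a * g a) $$ (a, b)"
    using ab by (simp add: diag_fun_mat_def)
qed (simp_all add: diag_fun_mat_def)

lemma conj_diag_fun_mat_index:
  assumes "P \<in> carrier_mat d d" "Q \<in> carrier_mat d d" "a < d" "b < d"
  shows "(P * diag_fun_mat d f * Q) $$ (a, b) = (\<Sum>e<d. P $$ (a, e) * f e * Q $$ (e, b))"
proof -
  have "(P * diag_fun_mat d f) $$ (a, e) = P $$ (a, e) * f e" if e: "e < d" for e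
  proof -
    have "(P * diag_fun_mat d f) $$ (a, e) = (\<Sum>c<d. P $$ (a, c) * diag_fun_mat d f $$ (c, e))"
      using assms e by (simp add: diag_fun_mat_def scalar_prod_def lessThan_atLeast0)
    also have "\<dots> = (\<Sum>c<d. if c = e then P $$ (a, e) * f e else 0)"
      by (intro sum.cong refl) (use e in \<open>auto simp: diag_fun_mat_def\<close>)
    finally show ?thesis using e by simp
  qed
  moreover have "(P * diag_fun_mat d f * Q) $$ (a, b) = (\<Sum>e<d. (P * diag_fun_mat d f) $$ (a, e) * Q $$ (e, b))"
    using assms by (simp add: times_mat_def diag_fun_mat_def scalar_prod_def lessThan_atLeast0)
  ultimately show ?thesis by simp
qed

lemma conj_mult:
  fixes P Q F G :: "complex Matrix.mat"
  assumes P: "P \<in> carrier_mat d d" and Q: "Q \<in> carrier_mat d d" and QP: "Q * P = 1\<^sub>m d"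
    and F: "F \<in> carrier_mat d d" and G: "G \<in> carrier_mat d d"
  shows "(P * F * Q) * (P * G * Q) = P * (F * G) * Q"
proof -
  have "(P * F * Q) * (P * G * Q) = P * F * (Q * P) * G * Q"
    using P Q F G by (simp add: assoc_mult_mat[of _ d d _ d _ d])
  then show ?thesis using P Q F G unfolding QP by (simp add: assoc_mult_mat[of _ d d _ d _ d])
qed

lemma conj_diag_fun_mat_mult:
  assumes P: "P \<in> carrier_mat d d" and Q: "Q \<in> carrier_mat d d" and QP: "Q * P = 1\<^sub>m d"
  shows "(P * diag_fun_mat d f * Q) * (P * diag_fun_mat d g * Q) = P * diag_fun_mat d (\<lambda>a. f a * g a) * Q"
  unfolding diag_fun_mat_mult[symmetric] by (rule conj_mult[OF assms diag_fun_mat_carrier diag_fun_mat_carrier])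

text \<open>Powers of a conjugated diagonal matrix are conjugated diagonal matrices, so the exponential series converges entrywise.\<close>

lemma mat_exp_conj:
  assumes P: "P \<in> carrier_mat d d" and Q: "Q \<in> carrier_mat d d" and QP: "Q * P = 1\<^sub>m d"
    and PQ: "P * Q = 1\<^sub>m d"
  shows "mat_exp (P * diag_fun_mat d f * Q) = P * diag_fun_mat d (\<lambda>a. exp (f a)) * Q"
proof (rule eq_matI)
  let ?A = "P * diag_fun_mat d f * Q"
  have A: "?A \<in> carrier_mat d d" using P Q by (simp add: mult_carrier_mat[of _ d d])
  have pow: "?A ^\<^sub>m k = P * diag_fun_mat d (\<lambda>a. f a ^ k) * Q" for k
  proof (induction k)
    case 0
    have "diag_fun_mat d (\<lambda>a. 1) = 1\<^sub>m d" by (rule eq_matI) (auto simp: diag_fun_mat_def)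
    then show ?case using A P Q PQ by (simp add: carrier_matD[OF P] carrier_matD[OF Q])
  next
    case (Suc k)
    then show ?case using conj_diag_fun_mat_mult[OF P Q QP, of "\<lambda>a. f a ^ k" f] by (simp add: mult.commute)
  qed
  fix a b assume "a < dim_row (P * diag_fun_mat d (\<lambda>a. exp (f a)) * Q)" "b < dim_col (P * diag_fun_mat d (\<lambda>a. exp (f a)) * Q)"
  then have ab: "a < d" "b < d" using P Q by auto
  have "(\<lambda>k. f e ^ k / fact k) sums exp (f e)" for e
    using exp_converges[of "f e"] by (simp add: scaleR_conv_of_real divide_inverse mult.commute)
  then have "(\<lambda>k. \<Sum>e<d. P $$ (a, e) * (f e ^ k / fact k) * Q $$ (e, b)) sums
      (\<Sum>e<d. P $$ (a, e) * exp (f e) * Q $$ (e, b))"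
    by (intro sums_sum sums_mult2 sums_mult)
  moreover have "(\<Sum>e<d. P $$ (a, e) * (f e ^ k / fact k) * Q $$ (e, b)) = (?A ^\<^sub>m k) $$ (a, b) / fact k" for k
    unfolding pow conj_diag_fun_mat_index[OF P Q ab] by (simp add: sum_divide_distrib)
  ultimately have "(\<lambda>k. (?A ^\<^sub>m k) $$ (a, b) / fact k) sums (P * diag_fun_mat d (\<lambda>a. exp (f a)) * Q) $$ (a, b)"
    unfolding conj_diag_fun_mat_index[OF P Q ab] by simp
  then show "mat_exp ?A $$ (a, b) = (P * diag_fun_mat d (\<lambda>a. exp (f a)) * Q) $$ (a, b)"
    using ab A by (simp add: mat_exp_def sums_iff carrier_matD[OF A] del: index_mult_mat)
qed (use P Q in \<open>auto simp: mat_exp_def\<close>)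

lemma trace_conj_diag_fun_mat:
  assumes P: "P \<in> carrier_mat d d" and Q: "Q \<in> carrier_mat d d" and QP: "Q * P = 1\<^sub>m d"
  shows "mat_trace (P * diag_fun_mat d f * Q) = (\<Sum>b<d. f b)"
proof -
  have "mat_trace (P * diag_fun_mat d f * Q) = (\<Sum>a<d. \<Sum>e<d. P $$ (a, e) * f e * Q $$ (e, a))"
    unfolding mat_trace_def by (intro sum.cong) (use P Q in \<open>auto simp: conj_diag_fun_mat_index simp del: index_mult_mat(1)\<close>)
  also have "\<dots> = (\<Sum>e<d. \<Sum>a<d. P $$ (a, e) * f e * Q $$ (e, a))"
    by (rule sum.swap)
  also have "\<dots> = (\<Sum>e<d. f e * (Q * P) $$ (e, e))"
    using P Q by (intro sum.cong refl) (simp add: scalar_prod_def lessThan_atLeast0 sum_distrib_left mult_ac)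
  finally show ?thesis by (simp add: QP)
qed

lemma exp_Ln_mult_int:
  assumes "z \<noteq> 0"
  shows "exp (Ln z * of_int m) = z powi m"
  using exp_power_int[of "Ln z" m] assms by (simp add: mult.commute)

lemma monom_at_shift:
  assumes i: "i < N" and j: "j < N" and nz: "\<And>k. k < N \<Longrightarrow> z k \<noteq> 0"
    and w: "\<And>k. k < N \<Longrightarrow> w' k = w k + (if k = i then 1 else 0) - (if k = j then 1 else 0)"
  shows "monom_at N z w' = z i / z j * monom_at N z w"
proof -
  have "monom_at N z w' = (\<Prod>k<N. z k powi w k * (if k = i then z k else 1) * (if k = j then inverse (z k) else 1))"
    unfolding monom_at_def
    by (intro prod.cong refl) (use w nz in \<open>auto simp: power_int_add power_int_diff divide_inverse\<close>)
  also have "\<dots> = monom_at N z w * z i * inverse (z j)"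
    using i j by (simp add: prod.distrib monom_at_def)
  finally show ?thesis by (simp add: divide_inverse)
qed

text \<open>The traces \<open>T\<^sub>i\<^sub>j\<close> of \<open>z\<^sup>H E\<^sub>i\<^sub>j E\<^sub>j\<^sub>i\<close> add up to \<open>c\<close> times the character. Moving \<open>E\<^sub>i\<^sub>j\<close> around the trace multiplies by
\<open>z\<^sub>i / z\<^sub>j\<close> and reverses the order of the two operators, and the commutator puts them back; the resulting linear equation for \<open>T\<^sub>i\<^sub>j\<close>
is solved by \<open>z\<^sub>i / (z\<^sub>i - z\<^sub>j) (D\<^sub>i - D\<^sub>j) \<chi>\<close>. This is the Casimir relation of the locale.\<close>

theorem irreducible_character:
  assumes rep: "gl_rep N d \<rho>" and irr: "gl_irreducible N d \<rho>" and hw: "gl_highest_weight N d \<rho> n"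
    and dom: "gl_dominant N n"
  shows "\<exists>w. highest_weight_character N d w (\<lambda>i. n (Suc i)) 0 \<and>
    (\<forall>z. (\<forall>i\<in>{1..N}. z i \<noteq> 0) \<longrightarrow>
      mat_trace (foldr (\<lambda>i M. mat_cpow (z i) (\<rho> (gl_unit N i i)) * M) [1..<N+1] (1\<^sub>m d)) =
      (\<Sum>b<d. monom_at N (\<lambda>i. z (Suc i)) (w b)))"
proof -
  obtain v where v: "v \<in> carrier_vec d" "v \<noteq> 0\<^sub>v d"
    and diag: "\<And>i. i \<in> {1..N} \<Longrightarrow> \<rho> (gl_unit N i i) *\<^sub>v v = of_int (n i) \<cdot>\<^sub>v v"
    and raise: "\<And>i j. i \<in> {1..N} \<Longrightarrow> j \<in> {1..N} \<Longrightarrow> i < j \<Longrightarrow> \<rho> (gl_unit N i j) *\<^sub>v v = 0\<^sub>v d"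
    using hw unfolding gl_highest_weight_def by blast
  have "\<exists>w P Q c. d > 0 \<and> P \<in> carrier_mat d d \<and> Q \<in> carrier_mat d d \<and> P * Q = 1\<^sub>m d \<and> Q * P = 1\<^sub>m d \<and>
    (\<forall>i<N. Q * \<rho> (emat N i i) * P = Matrix.mat d d (\<lambda>(a, b). if a = b then of_int (w a i) else 0)) \<and>
    (\<forall>b<d. (\<forall>i\<ge>N. w b i = 0) \<and> (\<Sum>i<N. w b i) = (\<Sum>i<N. n (Suc i)) \<and>
       (\<forall>m\<le>N. (\<Sum>i<m. w b i) \<le> (\<Sum>i<m. n (Suc i))) \<and> ((\<forall>i<N. w b i = n (Suc i)) \<longleftrightarrow> b = 0)) \<and>
    (\<forall>a<d. \<forall>b<d. (\<Sum>i<N. \<Sum>j<N. \<Sum>e<d. (Q * \<rho> (emat N i j) * P) $$ (a, e) * (Q * \<rho> (emat N j i) * P) $$ (e, b))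
       = (if a = b then c else 0))"
    by (rule irreducible_weight_basis[OF rep irr v]) (auto simp: emat_def diag raise)
  from this[folded diag_fun_mat_def] obtain w P Q c where A: "d > 0 \<and> P \<in> carrier_mat d d \<and> Q \<in> carrier_mat d d \<and> P * Q = 1\<^sub>m d \<and> Q * P = 1\<^sub>m d \<and>
    (\<forall>i<N. Q * \<rho> (emat N i i) * P = diag_fun_mat d (\<lambda>a. of_int (w a i))) \<and>
    (\<forall>b<d. (\<forall>i\<ge>N. w b i = 0) \<and> (\<Sum>i<N. w b i) = (\<Sum>i<N. n (Suc i)) \<and>
       (\<forall>m\<le>N. (\<Sum>i<m. w b i) \<le> (\<Sum>i<m. n (Suc i))) \<and> ((\<forall>i<N. w b i = n (Suc i)) \<longleftrightarrow> b = 0)) \<and>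
    (\<forall>a<d. \<forall>b<d. (\<Sum>i<N. \<Sum>j<N. \<Sum>e<d. (Q * \<rho> (emat N i j) * P) $$ (a, e) * (Q * \<rho> (emat N j i) * P) $$ (e, b))
       = (if a = b then c else 0))"
    by (elim exE)
  from A have d0: "d > 0" and P: "P \<in> carrier_mat d d" and Q: "Q \<in> carrier_mat d d"
    and PQ: "P * Q = 1\<^sub>m d" and QP: "Q * P = 1\<^sub>m d"
    and dg: "\<And>i. i < N \<Longrightarrow> Q * \<rho> (emat N i i) * P = diag_fun_mat d (\<lambda>a. of_int (w a i))"
    and wp: "\<And>b. b < d \<Longrightarrow> (\<forall>i\<ge>N. w b i = 0) \<and> (\<Sum>i<N. w b i) = (\<Sum>i<N. n (Suc i)) \<and>
       (\<forall>m\<le>N. (\<Sum>i<m. w b i) \<le> (\<Sum>i<m. n (Suc i))) \<and> ((\<forall>i<N. w b i = n (Suc i)) \<longleftrightarrow> b = 0)"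
    and cas: "\<And>a b. a < d \<Longrightarrow> b < d \<Longrightarrow>
      (\<Sum>i<N. \<Sum>j<N. \<Sum>e<d. (Q * \<rho> (emat N i j) * P) $$ (a, e) * (Q * \<rho> (emat N j i) * P) $$ (e, b))
       = (if a = b then c else 0)"
    by blast+
  define \<sigma> where "\<sigma> X = Q * \<rho> X * P" for X
  have srep: "gl_rep N d \<sigma>" unfolding \<sigma>_def by (rule rep_conjugate[OF rep P Q PQ])
  define \<alpha> where "\<alpha> i j a b = \<sigma> (emat N i j) $$ (a, b)" for i j a b
  have \<alpha>d: "\<alpha> i i a b = (if a = b then of_int (w a i) else 0)" if "i < N" "a < d" "b < d" for i a b
    using dg[OF that(1)] that by (simp add: \<alpha>_def \<sigma>_def diag_fun_mat_def)
  have br: "(\<Sum>c<d. \<alpha> i j a c * \<alpha> k l c b) = (\<Sum>c<d. \<alpha> k l a c * \<alpha> i j c b) +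
     (if j = k then \<alpha> i l a b else 0) - (if l = i then \<alpha> k j a b else 0)"
    if "i < N" "j < N" "k < N" "l < N" "a < d" "b < d" for i j k l a b
    using rep_bracket_index[OF srep that] by (simp add: \<alpha>_def)
  \<comment> \<open>Matrix entries of \<open>E\<^sub>i\<^sub>j\<close> connect only weights that differ by the root \<open>e\<^sub>i - e\<^sub>j\<close>.\<close>
  have wt: "w a k = w b k + (if k = i then 1 else 0) - (if k = j then 1 else 0)"
    if nz: "\<alpha> i j a b \<noteq> 0" and l: "i < N" "j < N" "k < N" "a < d" "b < d" for i j k a b
  proof -
    have "(\<Sum>c<d. \<alpha> k k a c * \<alpha> i j c b) = (\<Sum>c<d. if c = a then of_int (w a k) * \<alpha> i j a b else 0)"
      by (intro sum.cong refl) (use l in \<open>auto simp: \<alpha>d\<close>)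
    then have 1: "(\<Sum>c<d. \<alpha> k k a c * \<alpha> i j c b) = of_int (w a k) * \<alpha> i j a b" using l by simp
    have "(\<Sum>c<d. \<alpha> i j a c * \<alpha> k k c b) = (\<Sum>c<d. if c = b then of_int (w b k) * \<alpha> i j a b else 0)"
      by (intro sum.cong refl) (use l in \<open>auto simp: \<alpha>d\<close>)
    then have 2: "(\<Sum>c<d. \<alpha> i j a c * \<alpha> k k c b) = of_int (w b k) * \<alpha> i j a b" using l by simp
    have "of_int (w a k) * \<alpha> i j a b = of_int (w b k + (if k = i then 1 else 0) - (if k = j then 1 else 0)) * \<alpha> i j a b"
      using br[of k k i j a b] l unfolding 1 2 by (auto simp: algebra_simps)
    then have "complex_of_int (w a k) = of_int (w b k + (if k = i then 1 else 0) - (if k = j then 1 else 0))"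
      using nz by (simp only: mult_cancel_right) simp
    then show ?thesis by (simp only: of_int_eq_iff)
  qed
  have pde: "c * (\<Sum>b<d. monom_at N z (w b)) =
        (\<Sum>b<d. (\<Sum>i<N. (of_int (w b i))\<^sup>2) * monom_at N z (w b)) +
        (\<Sum>i<N. \<Sum>j<N. z i / (z i - z j) * (\<Sum>b<d. of_int (w b i - w b j) * monom_at N z (w b)))"
    if nz: "\<forall>i<N. z i \<noteq> 0" and inj: "inj_on z {..<N}" for z
  proof -
    define Y where "Y b = monom_at N z (w b)" for b
    define H where "H i j = (\<Sum>b<d. of_int (w b i - w b j) * Y b)" for i j
    define T where "T i j = (\<Sum>b<d. Y b * (\<Sum>e<d. \<alpha> i j b e * \<alpha> j i e b))" for i j
    have Tii: "T i i = (\<Sum>b<d. (of_int (w b i))\<^sup>2 * Y b)" if "i < N" for i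
    proof -
      have "(\<Sum>e<d. \<alpha> i i b e * \<alpha> i i e b) = (\<Sum>e<d. if e = b then (of_int (w b i))\<^sup>2 else 0)" if "b < d" for b
        by (intro sum.cong refl) (use \<open>i < N\<close> that in \<open>auto simp: \<alpha>d power2_eq_square\<close>)
      then show ?thesis by (simp add: T_def mult.commute)
    qed
    \<comment> \<open>Cyclicity of the trace, with the weights shifted by the root.\<close>
    have Tij: "T i j = z i / (z i - z j) * H i j" if ij: "i < N" "j < N" "i \<noteq> j" for i j
    proof -
      have "T i j = (\<Sum>b<d. \<Sum>e<d. Y b * \<alpha> i j b e * \<alpha> j i e b)"
        by (simp add: T_def sum_distrib_left mult.assoc)
      also have "\<dots> = (\<Sum>b<d. \<Sum>e<d. z i / z j * (Y e * \<alpha> j i e b * \<alpha> i j b e))"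
      proof (intro sum.cong refl)
        fix b e assume be: "b \<in> {..<d}" "e \<in> {..<d}"
        show "Y b * \<alpha> i j b e * \<alpha> j i e b = z i / z j * (Y e * \<alpha> j i e b * \<alpha> i j b e)"
        proof (cases "\<alpha> i j b e = 0")
          case False
          have "Y b = z i / z j * Y e"
            unfolding Y_def by (rule monom_at_shift) (use wt[OF False] ij be nz in auto)
          then show ?thesis by simp
        qed simp
      qed
      also have "\<dots> = (\<Sum>e<d. \<Sum>b<d. z i / z j * (Y e * \<alpha> j i e b * \<alpha> i j b e))"
        by (rule sum.swap)
      also have "\<dots> = z i / z j * (\<Sum>e<d. Y e * (\<Sum>b<d. \<alpha> j i e b * \<alpha> i j b e))"
        by (simp add: sum_distrib_left mult.assoc)
      also have "(\<Sum>e<d. Y e * (\<Sum>b<d. \<alpha> j i e b * \<alpha> i j b e)) = (\<Sum>e<d. Y e * (\<Sum>b<d. \<alpha> i j e b * \<alpha> j i b e) - of_int (w e i - w e j) * Y e)"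
      proof (intro sum.cong refl)
        fix e assume e: "e \<in> {..<d}"
        have "(\<Sum>b<d. \<alpha> i j e b * \<alpha> j i b e) = (\<Sum>b<d. \<alpha> j i e b * \<alpha> i j b e) + \<alpha> i i e e - \<alpha> j j e e"
          using br[of i j j i e e] ij e by simp
        then have eq: "(\<Sum>b<d. \<alpha> j i e b * \<alpha> i j b e) = (\<Sum>b<d. \<alpha> i j e b * \<alpha> j i b e) - (of_int (w e i) - of_int (w e j))"
          using ij e by (simp add: \<alpha>d)
        show "Y e * (\<Sum>b<d. \<alpha> j i e b * \<alpha> i j b e) = Y e * (\<Sum>b<d. \<alpha> i j e b * \<alpha> j i b e) - of_int (w e i - w e j) * Y e"
          unfolding eq by (simp add: algebra_simps)
      qed
      also have "\<dots> = T i j - H i j" by (simp add: sum_subtractf T_def H_def)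
      finally have "T i j = z i / z j * (T i j - H i j)" .
      moreover have "z j \<noteq> 0" using nz ij by simp
      ultimately have "z j * T i j = z i * T i j - z i * H i j" by (simp add: field_simps)
      then have "(z i - z j) * T i j = z i * H i j" by (simp add: algebra_simps)
      moreover have "z i - z j \<noteq> 0" using inj ij by (auto simp: inj_on_def)
      ultimately show ?thesis by (simp add: field_simps)
    qed
    have "c * (\<Sum>b<d. Y b) = (\<Sum>b<d. Y b * (\<Sum>i<N. \<Sum>j<N. \<Sum>e<d. \<alpha> i j b e * \<alpha> j i e b))"
      unfolding sum_distrib_left by (intro sum.cong refl) (use cas in \<open>simp add: \<alpha>_def \<sigma>_def sum_distrib_left[symmetric]\<close>)
    also have "\<dots> = (\<Sum>b<d. \<Sum>i<N. \<Sum>j<N. Y b * (\<Sum>e<d. \<alpha> i j b e * \<alpha> j i e b))"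
      by (simp add: sum_distrib_left)
    also have "\<dots> = (\<Sum>i<N. \<Sum>b<d. \<Sum>j<N. Y b * (\<Sum>e<d. \<alpha> i j b e * \<alpha> j i e b))"
      by (rule sum.swap)
    also have "\<dots> = (\<Sum>i<N. \<Sum>j<N. T i j)"
      unfolding T_def by (intro sum.cong refl sum.swap)
    also have "\<dots> = (\<Sum>i<N. T i i + (\<Sum>j<N. z i / (z i - z j) * H i j))"
    proof (intro sum.cong refl)
      fix i assume i: "i \<in> {..<N}"
      have "(\<Sum>j<N. T i j) = T i i + (\<Sum>j\<in>{..<N} - {i}. T i j)"
        using i by (simp add: sum.remove)
      also have "(\<Sum>j\<in>{..<N} - {i}. T i j) = (\<Sum>j<N. z i / (z i - z j) * H i j)"
        by (rule sum.mono_neutral_cong_left) (use i Tij in auto)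
      finally show "(\<Sum>j<N. T i j) = T i i + (\<Sum>j<N. z i / (z i - z j) * H i j)" .
    qed
    also have "\<dots> = (\<Sum>b<d. (\<Sum>i<N. (of_int (w b i))\<^sup>2) * Y b) + (\<Sum>i<N. \<Sum>j<N. z i / (z i - z j) * H i j)"
    proof -
      have "(\<Sum>i<N. T i i) = (\<Sum>i<N. \<Sum>b<d. (of_int (w b i))\<^sup>2 * Y b)" by (simp add: Tii)
      also have "\<dots> = (\<Sum>b<d. \<Sum>i<N. (of_int (w b i))\<^sup>2 * Y b)" by (rule sum.swap)
      finally show ?thesis by (simp add: sum.distrib sum_distrib_right)
    qed
    finally show ?thesis by (simp add: Y_def H_def)
  qed
  have hwc: "highest_weight_character N d w (\<lambda>i. n (Suc i)) 0"
  proof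
    show "\<exists>c. \<forall>z. (\<forall>i<N. z i \<noteq> 0) \<longrightarrow> inj_on z {..<N} \<longrightarrow>
      c * (\<Sum>b<d. monom_at N z (w b)) =
        (\<Sum>b<d. (\<Sum>i<N. (of_int (w b i))\<^sup>2) * monom_at N z (w b)) +
        (\<Sum>i<N. \<Sum>j<N. z i / (z i - z j) * (\<Sum>b<d. of_int (w b i - w b j) * monom_at N z (w b)))"
      using pde by (intro exI[of _ c] allI impI)
    show "n (Suc (Suc i)) \<le> n (Suc i)" if "Suc i < N" for i
      using dom that by (simp add: gl_dominant_def)
  qed (use wp d0 in auto)
  have trace: "mat_trace (foldr (\<lambda>i M. mat_cpow (z i) (\<rho> (gl_unit N i i)) * M) [1..<N+1] (1\<^sub>m d)) =
      (\<Sum>b<d. monom_at N (\<lambda>i. z (Suc i)) (w b))" if nz: "\<forall>i\<in>{1..N}. z i \<noteq> 0" for z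
  proof -
    have cp: "mat_cpow (z i) (\<rho> (gl_unit N i i)) = P * diag_fun_mat d (\<lambda>b. z i powi w b (i - 1)) * Q" if i: "i \<in> {1..N}" for i
    proof -
      define A where "A = \<rho> (gl_unit N i i)"
      have i1: "i - 1 < N" using i by auto
      have iA: "gl_unit N i i = emat N (i - 1) (i - 1)" using i by (simp add: emat_def)
      have A: "A \<in> carrier_mat d d" unfolding A_def iA by (simp add: rep_carrier[OF rep])
      have "P * diag_fun_mat d (\<lambda>a. of_int (w a (i - 1))) * Q = P * (Q * A * P) * Q"
        using dg[OF i1] by (simp add: A_def iA)
      also have "\<dots> = (P * Q) * A * (P * Q)"
        using P Q A by (simp add: assoc_mult_mat[of _ d d _ d _ d])
      also have "\<dots> = A" using A unfolding PQ by simp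
      finally have Aeq: "A = P * diag_fun_mat d (\<lambda>a. of_int (w a (i - 1))) * Q" by simp
      have "Ln (z i) \<cdot>\<^sub>m A = P * diag_fun_mat d (\<lambda>a. Ln (z i) * of_int (w a (i - 1))) * Q"
      proof (rule eq_matI)
        fix a b assume "a < dim_row (P * diag_fun_mat d (\<lambda>a. Ln (z i) * of_int (w a (i - 1))) * Q)"
          "b < dim_col (P * diag_fun_mat d (\<lambda>a. Ln (z i) * of_int (w a (i - 1))) * Q)"
        then have ab: "a < d" "b < d" using P Q by auto
        have "(Ln (z i) \<cdot>\<^sub>m A) $$ (a, b) = Ln (z i) * A $$ (a, b)" using ab A by simp
        then show "(Ln (z i) \<cdot>\<^sub>m A) $$ (a, b) = (P * diag_fun_mat d (\<lambda>a. Ln (z i) * of_int (w a (i - 1))) * Q) $$ (a, b)"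
          unfolding Aeq conj_diag_fun_mat_index[OF P Q ab] by (simp add: sum_distrib_left mult_ac)
      qed (use P Q A in auto)
      then show ?thesis
        unfolding mat_cpow_def A_def[symmetric]
        using nz i by (simp add: mat_exp_conj[OF P Q QP PQ] exp_Ln_mult_int)
    qed
    have fold: "foldr (\<lambda>i M. mat_cpow (z i) (\<rho> (gl_unit N i i)) * M) xs (1\<^sub>m d) =
        P * diag_fun_mat d (\<lambda>b. \<Prod>i\<leftarrow>xs. z i powi w b (i - 1)) * Q" if "set xs \<subseteq> {1..N}" for xs
      using that
    proof (induction xs)
      case Nil
      have "diag_fun_mat d (\<lambda>b. 1) = 1\<^sub>m d" by (rule eq_matI) (auto simp: diag_fun_mat_def)
      then show ?case using P Q PQ by simp
    next
      case (Cons i xs)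
      then show ?case by (simp add: cp conj_diag_fun_mat_mult[OF P Q QP])
    qed
    have "(\<Prod>i\<leftarrow>[1..<N+1]. z i powi w b (i - 1)) = monom_at N (\<lambda>i. z (Suc i)) (w b)" for b
    proof -
      have "(\<Prod>i\<leftarrow>[1..<N+1]. z i powi w b (i - 1)) = (\<Prod>i\<in>{1..<N+1}. z i powi w b (i - 1))"
        by (simp only: prod.distinct_set_conv_list[OF distinct_upt, symmetric] set_upt)
      also have "\<dots> = (\<Prod>i\<in>{..<N}. z (Suc i) powi w b i)"
        by (rule prod.reindex_bij_witness[of _ Suc "\<lambda>i. i - 1"]) auto
      finally show ?thesis by (simp add: monom_at_def)
    qed
    then show ?thesis
      by (subst fold) (auto simp: trace_conj_diag_fun_mat[OF P Q QP])
  qed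
  from hwc trace show ?thesis by blast
qed

section \<open>Existence of the irreducible representations\<close>

text \<open>States are functions on finite sets of occupied modes. The sign counts the occupied modes below \<open>x\<close>, which makes operators
at different modes anticommute.\<close>

definition fermion_sign :: "nat \<Rightarrow> nat set \<Rightarrow> complex" where
  "fermion_sign x S = (-1) ^ card {s \<in> S. s < x}"

definition annihilate :: "nat \<Rightarrow> (nat set \<Rightarrow> complex) \<Rightarrow> nat set \<Rightarrow> complex" where
  "annihilate x \<phi> S = (if x \<in> S then 0 else fermion_sign x S * \<phi> (insert x S))"

definition create :: "nat \<Rightarrow> (nat set \<Rightarrow> complex) \<Rightarrow> nat set \<Rightarrow> complex" where
  "create x \<phi> S = (if x \<in> S then fermion_sign x S * \<phi> (S - {x}) else 0)"

lemma fermion_sign_square [simp]: "fermion_sign x S * (fermion_sign x S * c) = c"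
  by (simp add: fermion_sign_def mult.assoc[symmetric] flip: power_add)

lemma fermion_sign_insert:
  assumes "finite S" "y \<notin> S"
  shows "fermion_sign x (insert y S) = (if y < x then - fermion_sign x S else fermion_sign x S)"
proof (cases "y < x")
  case True
  then have "{s \<in> insert y S. s < x} = insert y {s \<in> S. s < x}" by auto
  then show ?thesis using True assms by (simp add: fermion_sign_def)
next
  case False
  then have "{s \<in> insert y S. s < x} = {s \<in> S. s < x}" by auto
  then show ?thesis using False by (simp add: fermion_sign_def)
qed

lemma fermion_sign_delete:
  assumes "finite S" "y \<in> S"
  shows "fermion_sign x (S - {y}) = (if y < x then - fermion_sign x S else fermion_sign x S)"
  using fermion_sign_insert[of "S - {y}" y x] assms by (auto simp: insert_absorb)

lemma create_annihilate:
  assumes "finite S"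
  shows "create x (annihilate y \<phi>) S = (if x = y then \<phi> S else 0) - annihilate y (create x \<phi>) S"
proof (cases "x = y")
  case True
  then show ?thesis
    using assms by (auto simp: create_def annihilate_def fermion_sign_insert fermion_sign_delete insert_absorb)
next
  case False
  show ?thesis
  proof (cases "x \<in> S \<and> y \<notin> S")
    case True
    have "insert y (S - {x}) = insert y S - {x}" using False by auto
    then show ?thesis using False True assms
      by (cases "x < y") (auto simp: create_def annihilate_def fermion_sign_insert fermion_sign_delete)
  next
    case c: False
    then show ?thesis using False by (auto simp: create_def annihilate_def)
  qed
qed

lemma create_create:
  assumes "finite S"
  shows "create x (create y \<phi>) S = - create y (create x \<phi>) S"
proof (cases "x = y")
  case False
  have "S - {x} - {y} = S - {y} - {x}" by auto
  then show ?thesis using False assms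
    by (cases "x < y") (auto simp: create_def fermion_sign_delete)
qed (auto simp: create_def)

lemma annihilate_annihilate:
  assumes "finite S"
  shows "annihilate x (annihilate y \<phi>) S = - annihilate y (annihilate x \<phi>) S"
proof (cases "x = y")
  case False
  have "insert x (insert y S) = insert y (insert x S)" by auto
  then show ?thesis using False assms
    by (cases "x < y") (auto simp: annihilate_def fermion_sign_insert)
qed (auto simp: annihilate_def)

lemma create_cong: "finite S \<Longrightarrow> (\<And>T. finite T \<Longrightarrow> \<phi> T = \<psi> T) \<Longrightarrow> create x \<phi> S = create x \<psi> S"
  by (simp add: create_def)

lemma create_diff: "create x (\<lambda>T. \<phi> T - \<psi> T) S = create x \<phi> S - create x \<psi> S"
  by (simp add: create_def algebra_simps)

lemma create_uminus: "create x (\<lambda>T. - \<phi> T) S = - create x \<phi> S"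
  by (simp add: create_def)

lemma annihilate_sum: "annihilate x (\<lambda>T. \<Sum>i\<in>I. \<phi> i T) S = (\<Sum>i\<in>I. annihilate x (\<phi> i) S)"
  by (simp add: annihilate_def sum_distrib_left)

lemma create_sum: "create x (\<lambda>T. \<Sum>i\<in>I. \<phi> i T) S = (\<Sum>i\<in>I. create x (\<phi> i) S)"
  by (simp add: create_def sum_distrib_left)

text \<open>Quadratic expressions in creation and annihilation operators satisfy the commutation relations of the matrix units.\<close>

lemma create_annihilate_bracket:
  assumes S: "finite S"
  shows "create x (annihilate y (create k (annihilate l \<phi>))) S - create k (annihilate l (create x (annihilate y \<phi>))) S =
    (if y = k then create x (annihilate l \<phi>) S else 0) - (if l = x then create k (annihilate y \<phi>) S else 0)"
proof -
  have 1: "create x (annihilate y (create k (annihilate l \<phi>))) S =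
      (if y = k then create x (annihilate l \<phi>) S else 0) - create x (create k (annihilate y (annihilate l \<phi>))) S" for x y k l
  proof -
    have "create x (annihilate y (create k (annihilate l \<phi>))) S = create x (\<lambda>T. (if k = y then annihilate l \<phi> T else 0) - create k (annihilate y (annihilate l \<phi>)) T) S"
      by (rule create_cong[OF S]) (simp add: create_annihilate)
    also have "\<dots> = create x (\<lambda>T. if k = y then annihilate l \<phi> T else 0) S - create x (create k (annihilate y (annihilate l \<phi>))) S"
      by (rule create_diff)
    finally show ?thesis by (auto simp: create_def)
  qed
  have "create k (create x (annihilate l (annihilate y \<phi>))) S = - create x (create k (annihilate l (annihilate y \<phi>))) S"
    by (rule create_create[OF S])
  also have "create x (create k (annihilate l (annihilate y \<phi>))) S = create x (create k (\<lambda>T. - annihilate y (annihilate l \<phi>) T)) S"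
    by (intro create_cong S annihilate_annihilate) 
  also have "\<dots> = - create x (create k (annihilate y (annihilate l \<phi>))) S"
    by (simp add: create_uminus[abs_def])
  finally show ?thesis
    unfolding 1[of x y k l] 1[of k l x y] by simp
qed

text \<open>The action on the exterior algebra of \<open>\<complex>\<^sup>N \<otimes> \<complex>\<^sup>M\<close>: the modes are pairs of a row \<open>i < N\<close> and a column \<open>c < M\<close>.
  The twist by \<open>\<kappa>\<close> times the trace is there to reach highest weights with negative entries.\<close>

definition fermion_mode :: "nat \<Rightarrow> nat \<Rightarrow> nat" where
  "fermion_mode i c = prod_encode (i, c)"

lemma fermion_mode_eq [simp]: "fermion_mode i c = fermion_mode j c' \<longleftrightarrow> i = j \<and> c = c'"
  by (simp add: fermion_mode_def)

definition fock :: "nat \<Rightarrow> complex \<Rightarrow> nat \<Rightarrow> nat \<Rightarrow> (nat set \<Rightarrow> complex) \<Rightarrow> nat set \<Rightarrow> complex" where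
  "fock M \<kappa> i j \<phi> S = (\<Sum>c<M. create (fermion_mode i c) (annihilate (fermion_mode j c) \<phi>) S) + (if i = j then \<kappa> * \<phi> S else 0)"

lemma create_linear: "create x (\<lambda>T. \<phi> T + a * \<psi> T) S = create x \<phi> S + a * create x \<psi> S"
  by (simp add: create_def algebra_simps)

lemma annihilate_linear: "annihilate x (\<lambda>T. \<phi> T + a * \<psi> T) S = annihilate x \<phi> S + a * annihilate x \<psi> S"
  by (simp add: annihilate_def algebra_simps)

lemma fock_sum: "fock M \<kappa> i j (\<lambda>T. \<Sum>b\<in>I. a b * \<phi> b T) S = (\<Sum>b\<in>I. a b * fock M \<kappa> i j (\<phi> b) S)"
proof -
  have "create x (annihilate y (\<lambda>T. \<Sum>b\<in>I. a b * \<phi> b T)) S = (\<Sum>b\<in>I. a b * create x (annihilate y (\<phi> b)) S)" for x y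
    by (auto simp: create_def annihilate_def sum_distrib_left mult_ac)
  then have "fock M \<kappa> i j (\<lambda>T. \<Sum>b\<in>I. a b * \<phi> b T) S =
      (\<Sum>b\<in>I. \<Sum>c<M. a b * create (fermion_mode i c) (annihilate (fermion_mode j c) (\<phi> b)) S) + (if i = j then \<kappa> * (\<Sum>b\<in>I. a b * \<phi> b S) else 0)"
    unfolding fock_def by (simp only: sum.swap[of _ "{..<M}" I])
  then show ?thesis
    by (simp add: fock_def sum.distrib sum_distrib_left algebra_simps)
qed

lemma fock_bracket:
  assumes S: "finite S"
  shows "fock M \<kappa> i j (fock M \<kappa> k l \<phi>) S - fock M \<kappa> k l (fock M \<kappa> i j \<phi>) S =
    (if j = k then fock M \<kappa> i l \<phi> S else 0) - (if l = i then fock M \<kappa> k j \<phi> S else 0)"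
proof -
  define h where "h i j c \<phi> = create (fermion_mode i c) (annihilate (fermion_mode j c) \<phi>)" for i j c \<phi>
  have h_lin: "h i j c (\<lambda>T. (\<Sum>c'<M. \<phi> c' T) + a * \<psi> T) S = (\<Sum>c'<M. h i j c (\<phi> c') S) + a * h i j c \<psi> S" for i j c \<phi> a \<psi>
    unfolding h_def annihilate_linear[abs_def] create_linear annihilate_sum[abs_def] create_sum ..
  have f: "fock M \<kappa> i j \<phi> = (\<lambda>T. (\<Sum>c<M. h i j c \<phi> T) + (if i = j then \<kappa> else 0) * \<phi> T)" for i j \<phi>
    by (rule ext) (simp add: fock_def h_def)
  define K where "K i j = (if i = j then \<kappa> else 0)" for i j :: nat
  have ff: "fock M \<kappa> i j (fock M \<kappa> k l \<phi>) S = (\<Sum>c<M. \<Sum>c'<M. h i j c (h k l c' \<phi>) S)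
      + K k l * (\<Sum>c<M. h i j c \<phi> S) + K i j * (\<Sum>c<M. h k l c \<phi> S) + K i j * K k l * \<phi> S" for i j k l
    unfolding f[of i j "fock M \<kappa> k l \<phi>"] unfolding f[of k l] h_lin K_def[symmetric]
    by (simp add: sum.distrib sum_distrib_left algebra_simps)
  have "(\<Sum>c<M. \<Sum>c'<M. h i j c (h k l c' \<phi>) S) - (\<Sum>c<M. \<Sum>c'<M. h k l c (h i j c' \<phi>) S)
      = (\<Sum>c<M. \<Sum>c'<M. h i j c (h k l c' \<phi>) S) - (\<Sum>c<M. \<Sum>c'<M. h k l c' (h i j c \<phi>) S)"
    by (subst (2) sum.swap) simp
  also have "\<dots> = (\<Sum>c<M. \<Sum>c'<M. if c = c' then (if j = k then h i l c \<phi> S else 0) - (if l = i then h k j c \<phi> S else 0) else 0)"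
    unfolding sum_subtractf[symmetric]
    by (intro sum.cong refl) (auto simp: h_def create_annihilate_bracket[OF S])
  also have "\<dots> = (if j = k then (\<Sum>c<M. h i l c \<phi> S) else 0) - (if l = i then (\<Sum>c<M. h k j c \<phi> S) else 0)"
    by (simp add: sum_subtractf)
  finally have "fock M \<kappa> i j (fock M \<kappa> k l \<phi>) S - fock M \<kappa> k l (fock M \<kappa> i j \<phi>) S =
     (if j = k then (\<Sum>c<M. h i l c \<phi> S) else 0) - (if l = i then (\<Sum>c<M. h k j c \<phi> S) else 0)"
    unfolding ff by (simp add: algebra_simps)
  also have "\<dots> = (if j = k then fock M \<kappa> i l \<phi> S else 0) - (if l = i then fock M \<kappa> k j \<phi> S else 0)"
    unfolding f by auto
  finally show ?thesis .
qed


definition fock_op :: "nat \<Rightarrow> nat \<Rightarrow> complex \<Rightarrow> complex Matrix.mat \<Rightarrow> (nat set \<Rightarrow> complex) \<Rightarrow> nat set \<Rightarrow> complex" where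
  "fock_op N M \<kappa> X \<phi> S = (\<Sum>p\<in>{..<N} \<times> {..<N}. X $$ p * fock M \<kappa> (fst p) (snd p) \<phi> S)"

lemma fock_op_sum: "fock_op N M \<kappa> X (\<lambda>T. \<Sum>b\<in>I. a b * \<phi> b T) S = (\<Sum>b\<in>I. a b * fock_op N M \<kappa> X (\<phi> b) S)"
  unfolding fock_op_def fock_sum sum_distrib_left
  by (subst sum.swap) (simp add: mult_ac)

lemma fock_op_bracket:
  assumes S: "finite S" and X: "X \<in> carrier_mat N N" and Y: "Y \<in> carrier_mat N N"
  shows "fock_op N M \<kappa> (X * Y - Y * X) \<phi> S =
    fock_op N M \<kappa> X (fock_op N M \<kappa> Y \<phi>) S - fock_op N M \<kappa> Y (fock_op N M \<kappa> X \<phi>) S"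
proof -
  define F where "F i j = fock M \<kappa> i j \<phi> S" for i j
  have FF: "fock_op N M \<kappa> X (fock_op N M \<kappa> Y \<phi>) S =
      (\<Sum>p\<in>{..<N} \<times> {..<N}. \<Sum>q\<in>{..<N} \<times> {..<N}. X $$ p * Y $$ q * fock M \<kappa> (fst p) (snd p) (fock M \<kappa> (fst q) (snd q) \<phi>) S)" for X Y
    unfolding fock_op_def[of N M \<kappa> X] fock_op_def[of N M \<kappa> Y, abs_def] fock_sum
    by (simp add: sum_distrib_left mult.assoc)
  have YX: "fock_op N M \<kappa> Y (fock_op N M \<kappa> X \<phi>) S =
      (\<Sum>p\<in>{..<N} \<times> {..<N}. \<Sum>q\<in>{..<N} \<times> {..<N}. X $$ p * Y $$ q * fock M \<kappa> (fst q) (snd q) (fock M \<kappa> (fst p) (snd p) \<phi>) S)"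
    unfolding FF[of Y X] by (subst sum.swap) (simp only: mult.commute)
  have "fock_op N M \<kappa> X (fock_op N M \<kappa> Y \<phi>) S - fock_op N M \<kappa> Y (fock_op N M \<kappa> X \<phi>) S =
    (\<Sum>p\<in>{..<N} \<times> {..<N}. \<Sum>q\<in>{..<N} \<times> {..<N}. X $$ p * Y $$ q *
      (fock M \<kappa> (fst p) (snd p) (fock M \<kappa> (fst q) (snd q) \<phi>) S - fock M \<kappa> (fst q) (snd q) (fock M \<kappa> (fst p) (snd p) \<phi>) S))"
    unfolding FF[of X Y] YX by (simp add: sum_subtractf[symmetric] right_diff_distrib)
  also have "\<dots> = (\<Sum>i<N. \<Sum>j<N. \<Sum>k<N. \<Sum>l<N. X $$ (i, j) * Y $$ (k, l) *
      ((if j = k then F i l else 0) - (if l = i then F k j else 0)))"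
    unfolding fock_bracket[OF S] F_def by (simp only: sum.cartesian_product' fst_conv snd_conv)
  also have "\<dots> = (\<Sum>i<N. \<Sum>j<N. \<Sum>k<N. \<Sum>l<N. if k = j then X $$ (i, j) * Y $$ (j, l) * F i l else 0)
      - (\<Sum>i<N. \<Sum>j<N. \<Sum>k<N. \<Sum>l<N. if l = i then X $$ (i, j) * Y $$ (k, i) * F k j else 0)"
    unfolding sum_subtractf[symmetric] by (intro sum.cong refl) (auto simp: right_diff_distrib)
  also have "(\<Sum>i<N. \<Sum>j<N. \<Sum>k<N. \<Sum>l<N. if k = j then X $$ (i, j) * Y $$ (j, l) * F i l else 0) =
      (\<Sum>i<N. \<Sum>j<N. \<Sum>l<N. X $$ (i, j) * Y $$ (j, l) * F i l)"
    by (rule sum.cong[OF refl], rule sum.cong[OF refl], subst sum.swap) simp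
  also have "\<dots> = (\<Sum>i<N. \<Sum>l<N. (X * Y) $$ (i, l) * F i l)"
    by (rule sum.cong[OF refl], subst sum.swap, rule sum.cong[OF refl])
       (use X Y in \<open>auto simp: scalar_prod_def lessThan_atLeast0 sum_distrib_right intro!: sum.cong\<close>)
  also have "(\<Sum>i<N. \<Sum>j<N. \<Sum>k<N. \<Sum>l<N. if l = i then X $$ (i, j) * Y $$ (k, i) * F k j else 0) =
      (\<Sum>i<N. \<Sum>j<N. \<Sum>k<N. X $$ (i, j) * Y $$ (k, i) * F k j)"
    by (intro sum.cong refl) simp
  also have "\<dots> = (\<Sum>k<N. \<Sum>j<N. \<Sum>i<N. X $$ (i, j) * Y $$ (k, i) * F k j)"
    by (subst sum.swap, subst (2) sum.swap, subst sum.swap) (rule refl)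
  also have "\<dots> = (\<Sum>i<N. \<Sum>l<N. (Y * X) $$ (i, l) * F i l)"
    by (intro sum.cong refl)
       (use X Y in \<open>auto simp: scalar_prod_def lessThan_atLeast0 sum_distrib_left mult_ac intro!: sum.cong\<close>)
  also have "(\<Sum>i<N. \<Sum>l<N. (X * Y) $$ (i, l) * F i l) - (\<Sum>i<N. \<Sum>l<N. (Y * X) $$ (i, l) * F i l) =
      (\<Sum>i<N. \<Sum>l<N. (X * Y - Y * X) $$ (i, l) * F i l)"
    unfolding sum_subtractf[symmetric]
    by (intro sum.cong refl) (use X Y in \<open>simp add: left_diff_distrib\<close>)
  also have "\<dots> = fock_op N M \<kappa> (X * Y - Y * X) \<phi> S"
    by (simp add: fock_op_def F_def sum.cartesian_product case_prod_unfold)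
  finally show ?thesis by simp
qed

definition fermion_modes :: "nat \<Rightarrow> nat \<Rightarrow> nat set" where
  "fermion_modes N M = (\<lambda>(i, c). fermion_mode i c) ` ({..<N} \<times> {..<M})"

lemma finite_fermion_modes [simp]: "finite (fermion_modes N M)"
  by (simp add: fermion_modes_def)

lemma fermion_mode_in_fermion_modes: "i < N \<Longrightarrow> c < M \<Longrightarrow> fermion_mode i c \<in> fermion_modes N M"
  by (auto simp: fermion_modes_def)

text \<open>States supported on the \<open>N M\<close> modes form an invariant subspace of dimension \<open>2 ^ (N * M)\<close>; this allows the
passage to matrices.\<close>

lemma fock_op_local:
  assumes "S \<subseteq> fermion_modes N M" and eq: "\<And>T. T \<subseteq> fermion_modes N M \<Longrightarrow> \<phi> T = \<psi> T"
  shows "fock_op N M \<kappa> X \<phi> S = fock_op N M \<kappa> X \<psi> S"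
proof -
  have "fock M \<kappa> i j \<phi> S = fock M \<kappa> i j \<psi> S" if ij: "i < N" "j < N" for i j
  proof -
    have "create (fermion_mode i c) (annihilate (fermion_mode j c) \<phi>) S = create (fermion_mode i c) (annihilate (fermion_mode j c) \<psi>) S" if c: "c < M" for c
    proof -
      have "insert (fermion_mode j c) (S - {fermion_mode i c}) \<subseteq> fermion_modes N M"
        using assms(1) fermion_mode_in_fermion_modes[OF ij(2) c] by auto
      then show ?thesis using eq by (simp add: create_def annihilate_def)
    qed
    then show ?thesis using eq[OF assms(1)] by (simp add: fock_def)
  qed
  then show ?thesis unfolding fock_op_def by (intro sum.cong refl) auto
qed

text \<open>After subtracting the last entry \<open>n N\<close> from the highest weight, by the twist, it is a partition with at most \<open>n 1 - n N\<close>
columns. The state in which exactly the boxes of its Young diagram are occupied is a highest weight vector: \<open>E\<^sub>i\<^sub>i\<close> counts the boxes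
in row \<open>i\<close>, and moving a box up from row \<open>j\<close> to row \<open>i < j\<close> in the same column hits an occupied place.\<close>

theorem exists_highest_weight_rep:
  assumes dom: "gl_dominant N n"
  shows "\<exists>d \<rho>. gl_rep N d \<rho> \<and> gl_highest_weight N d \<rho> n"
proof -
  define h where "h i = nat (n (Suc i) - n N)" for i
  define M where "M = h 0"
  define \<kappa> :: complex where "\<kappa> = of_int (n N)"
  define A where "A = fermion_modes N M"
  define D where "D = card (Pow A)"
  have "finite (Pow A)" by (simp add: A_def)
  then obtain e where e: "bij_betw e {..<D} (Pow A)"
    unfolding D_def lessThan_atLeast0 using ex_bij_betw_nat_finite by blast
  have eA: "e a \<subseteq> A" if "a < D" for a
    using bij_betwE[OF e] that by auto
  have fin: "finite (e a)" if "a < D" for a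
    using eA[OF that] by (rule finite_subset) (simp add: A_def)
  define \<delta> where "\<delta> T S = (if S = T then 1 else (0::complex))" for T S :: "nat set"
  define \<rho> where "\<rho> X = Matrix.mat D D (\<lambda>(a, b). fock_op N M \<kappa> X (\<delta> (e b)) (e a))" for X
  have expand: "fock_op N M \<kappa> X \<phi> (e a) = (\<Sum>b<D. \<phi> (e b) * fock_op N M \<kappa> X (\<delta> (e b)) (e a))" if a: "a < D" for X \<phi> a
  proof -
    have "fock_op N M \<kappa> X \<phi> (e a) = fock_op N M \<kappa> X (\<lambda>S. \<Sum>b<D. \<phi> (e b) * \<delta> (e b) S) (e a)"
    proof (rule fock_op_local)
      fix T assume "T \<subseteq> fermion_modes N M"
      then obtain c where c: "c < D" "T = e c"
        using e unfolding bij_betw_def A_def[symmetric] by blast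
      have "(\<Sum>b<D. \<phi> (e b) * \<delta> (e b) T) = (\<Sum>b<D. if b = c then \<phi> T else 0)"
      proof (intro sum.cong refl)
        fix b assume b: "b \<in> {..<D}"
        have "e c = e b \<longleftrightarrow> b = c"
          using e b c unfolding bij_betw_def by (auto dest: inj_onD)
        then show "\<phi> (e b) * \<delta> (e b) T = (if b = c then \<phi> T else 0)"
          using c by (auto simp: \<delta>_def)
      qed
      then show "\<phi> T = (\<Sum>b<D. \<phi> (e b) * \<delta> (e b) T)" using c by simp
    qed (use eA[OF a] in \<open>simp add: A_def\<close>)
    then show ?thesis by (simp add: fock_op_sum)
  qed
  have rep: "gl_rep N D \<rho>"
    unfolding gl_rep_def
  proof (intro conjI ballI allI)
    fix X Y :: "complex Matrix.mat" assume X: "X \<in> carrier_mat N N" and Y: "Y \<in> carrier_mat N N"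
    show "\<rho> X \<in> carrier_mat D D" by (simp add: \<rho>_def)
    have "fock_op N M \<kappa> (X + Y) \<phi> S = fock_op N M \<kappa> X \<phi> S + fock_op N M \<kappa> Y \<phi> S" for \<phi> S
      unfolding fock_op_def sum.distrib[symmetric]
      by (intro sum.cong refl) (use X Y in \<open>auto simp: algebra_simps\<close>)
    then show "\<rho> (X + Y) = \<rho> X + \<rho> Y"
      by (intro eq_matI) (auto simp: \<rho>_def)
    have prod: "(\<rho> X * \<rho> Y) $$ (a, b) = fock_op N M \<kappa> X (fock_op N M \<kappa> Y (\<delta> (e b))) (e a)"
      if "a < D" "b < D" for X Y a b
      unfolding expand[OF that(1), of X "fock_op N M \<kappa> Y (\<delta> (e b))"]
      using that by (simp add: \<rho>_def scalar_prod_def lessThan_atLeast0 mult.commute)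
    show "\<rho> (X * Y - Y * X) = \<rho> X * \<rho> Y - \<rho> Y * \<rho> X"
    proof (rule eq_matI)
      fix a b assume "a < dim_row (\<rho> X * \<rho> Y - \<rho> Y * \<rho> X)" "b < dim_col (\<rho> X * \<rho> Y - \<rho> Y * \<rho> X)"
      then have ab: "a < D" "b < D" by (simp_all add: \<rho>_def)
      have "(\<rho> X * \<rho> Y - \<rho> Y * \<rho> X) $$ (a, b) = (\<rho> X * \<rho> Y) $$ (a, b) - (\<rho> Y * \<rho> X) $$ (a, b)"
        using ab by (simp add: \<rho>_def)
      also have "\<dots> = \<rho> (X * Y - Y * X) $$ (a, b)"
        unfolding prod[OF ab] using ab fin by (simp add: \<rho>_def fock_op_bracket[OF _ X Y])
      finally show "\<rho> (X * Y - Y * X) $$ (a, b) = (\<rho> X * \<rho> Y - \<rho> Y * \<rho> X) $$ (a, b)" by simp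
    qed (simp_all add: \<rho>_def)
  next
    fix k and X :: "complex Matrix.mat" assume X: "X \<in> carrier_mat N N"
    have "fock_op N M \<kappa> (k \<cdot>\<^sub>m X) \<phi> S = k * fock_op N M \<kappa> X \<phi> S" for \<phi> S
      unfolding fock_op_def sum_distrib_left
      by (intro sum.cong refl) (use X in auto)
    then show "\<rho> (k \<cdot>\<^sub>m X) = k \<cdot>\<^sub>m \<rho> X"
      by (intro eq_matI) (auto simp: \<rho>_def)
  qed
  \<comment> \<open>The state occupying the boxes of the Young diagram of \<open>n - n N\<close>.\<close>
  define T where "T = (\<lambda>(i, c). fermion_mode i c) ` {(i, c). i < N \<and> c < h i}"
  have Tmem: "fermion_mode i c \<in> T \<longleftrightarrow> i < N \<and> c < h i" for i c
    by (auto simp: T_def)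
  have hmono: "h j \<le> h i" if "i \<le> j" "j < N" for i j
    using dom that by (auto simp: h_def gl_dominant_def intro!: nat_mono)
  have TA: "T \<subseteq> A"
    using hmono[of 0] by (auto simp: T_def A_def M_def intro!: fermion_mode_in_fermion_modes intro: less_le_trans)
  then obtain t where t: "t < D" "e t = T"
    using e unfolding bij_betw_def by (metis PowI imageE lessThan_iff)
  define v where "v = Matrix.vec D (\<lambda>a. \<delta> T (e a))"
  have v: "v \<in> carrier_vec D" by (simp add: v_def)
  have "vec_index v t = 1" using t by (simp add: v_def \<delta>_def)
  then have v0: "v \<noteq> 0\<^sub>v D" using t by auto
  have fT: "fock M \<kappa> i j (\<delta> T) S = (if i = j then of_int (n (Suc i)) * \<delta> T S else 0)"
    if ij: "i \<le> j" "j < N" and S: "finite S" for i j S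
  proof (cases "i = j")
    case False
    have "create (fermion_mode i c) (annihilate (fermion_mode j c) (\<delta> T)) S = 0" for c
    proof (rule ccontr)
      assume a: "create (fermion_mode i c) (annihilate (fermion_mode j c) (\<delta> T)) S \<noteq> 0"
      then have "fermion_mode i c \<in> S" "insert (fermion_mode j c) (S - {fermion_mode i c}) = T"
        by (auto simp: create_def annihilate_def \<delta>_def split: if_splits)
      then have "fermion_mode j c \<in> T" "fermion_mode i c \<notin> T" using False by auto
      then show False using Tmem hmono[OF ij] ij by auto
    qed
    then show ?thesis using False by (simp add: fock_def)
  next
    case True
    have "create (fermion_mode i c) (annihilate (fermion_mode i c) (\<delta> T)) S = (if c < h i then \<delta> T S else 0)" if "c < M" for c
    proof -
      have "create (fermion_mode i c) (annihilate (fermion_mode i c) (\<delta> T)) S = (if fermion_mode i c \<in> S then \<delta> T S else 0)"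
        using S by (auto simp: create_def annihilate_def fermion_sign_delete insert_absorb)
      also have "\<dots> = (if c < h i then \<delta> T S else 0)"
        using Tmem[of i c] ij by (auto simp: \<delta>_def)
      finally show ?thesis .
    qed
    then have "fock M \<kappa> i i (\<delta> T) S = (\<Sum>c<M. if c < h i then \<delta> T S else 0) + \<kappa> * \<delta> T S"
      by (simp add: fock_def)
    also have "(\<Sum>c<M. if c < h i then \<delta> T S else 0) = (\<Sum>c<h i. \<delta> T S)"
      using hmono[of 0 i] ij True by (intro sum.mono_neutral_cong_right) (auto simp: M_def)
    also have "\<dots> + \<kappa> * \<delta> T S = (of_nat (h i) + \<kappa>) * \<delta> T S" by (simp add: algebra_simps)
    also have "of_nat (h i) + \<kappa> = of_int (n (Suc i))"
    proof -
      have "n N \<le> n (Suc i)" using dom ij True by (auto simp: gl_dominant_def)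
      then have "int (h i) + n N = n (Suc i)" by (simp add: h_def)
      then show ?thesis unfolding \<kappa>_def by (metis of_int_add of_int_of_nat_eq)
    qed
    finally show ?thesis using True by simp
  qed
  have opv: "vec_index (\<rho> (gl_unit N (Suc i) (Suc j)) *\<^sub>v v) a = fock M \<kappa> i j (\<delta> T) (e a)"
    if ij: "i < N" "j < N" and a: "a < D" for i j a
  proof -
    have "vec_index (\<rho> (gl_unit N (Suc i) (Suc j)) *\<^sub>v v) a = fock_op N M \<kappa> (emat N i j) (\<delta> T) (e a)"
      unfolding expand[OF a, of _ "\<delta> T"] using a
      by (simp add: \<rho>_def v_def scalar_prod_def lessThan_atLeast0 emat_def mult.commute)
    also have "\<dots> = (\<Sum>p\<in>{..<N} \<times> {..<N}. if p = (i, j) then fock M \<kappa> i j (\<delta> T) (e a) else 0)"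
      unfolding fock_op_def by (intro sum.cong refl) (auto simp: emat_index split: if_splits)
    also have "\<dots> = fock M \<kappa> i j (\<delta> T) (e a)"
      using ij by (subst sum.delta) auto
    finally show ?thesis .
  qed
  have "gl_highest_weight N D \<rho> n"
    unfolding gl_highest_weight_def
  proof (intro bexI[OF _ v] conjI v0 ballI impI)
    fix i assume i: "i \<in> {1..N}"
    then obtain i' where i': "i = Suc i'" "i' < N" by (cases i) auto
    show "\<rho> (gl_unit N i i) *\<^sub>v v = of_int (n i) \<cdot>\<^sub>v v"
    proof (rule eq_vecI)
      fix a assume "a < dim_vec (of_int (n i) \<cdot>\<^sub>v v)"
      then have a: "a < D" by (simp add: v_def)
      show "vec_index (\<rho> (gl_unit N i i) *\<^sub>v v) a = vec_index (of_int (n i) \<cdot>\<^sub>v v) a"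
        using opv[OF i'(2) i'(2) a] fT[OF order_refl i'(2) fin[OF a]] a by (simp add: i' v_def)
    qed (simp add: \<rho>_def v_def)
  next
    fix i j assume ij: "i \<in> {1..N}" "j \<in> {1..N}" "i < j"
    then obtain i' j' where ij': "i = Suc i'" "j = Suc j'" "i' < j'" "j' < N" "i' < N"
      by (cases i; cases j) auto
    show "\<rho> (gl_unit N i j) *\<^sub>v v = 0\<^sub>v D"
    proof (rule eq_vecI)
      fix a assume "a < dim_vec (0\<^sub>v D :: complex Matrix.vec)"
      then have a: "a < D" by simp
      show "vec_index (\<rho> (gl_unit N i j) *\<^sub>v v) a = vec_index (0\<^sub>v D) a"
        using opv[OF ij'(5,4) a] fT[OF less_imp_le[OF ij'(3)] ij'(4) fin[OF a]] ij'(3) a by (simp add: ij')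
    qed (simp add: \<rho>_def)
  qed
  with rep show ?thesis by blast
qed

text \<open>The columns of \<open>P\<close> are a basis of the invariant subspace, completed to a basis of the whole space.\<close>

lemma rep_block_triangular:
  assumes rep: "gl_rep N d \<rho>" and W: "lin_closed d W" "W \<noteq> {0\<^sub>v d}" "W \<noteq> carrier_vec d"
    and inv: "\<And>X w. X \<in> carrier_mat N N \<Longrightarrow> w \<in> W \<Longrightarrow> \<rho> X *\<^sub>v w \<in> W"
  shows "\<exists>k P Q. 0 < k \<and> k < d \<and> P \<in> carrier_mat d d \<and> Q \<in> carrier_mat d d \<and> P * Q = 1\<^sub>m d \<and> Q * P = 1\<^sub>m d \<and>
    (\<forall>X\<in>carrier_mat N N. \<forall>a b. k \<le> a \<longrightarrow> a < d \<longrightarrow> b < k \<longrightarrow> (Q * \<rho> X * P) $$ (a, b) = 0)"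
proof -
  interpret vec_space "TYPE(complex)" d .
  have Wc: "W \<subseteq> carrier_vec d" using W by (simp add: lin_closed_def)
  have "lin_indpt {}" by (auto simp: lin_dep_def)
  from maximal_independent_subset[OF Wc _ this]
  obtain U where U: "U \<subseteq> W" "finite U" "lin_indpt U" "W \<subseteq> span U" by auto
  obtain us0 where us0: "set us0 = U" "distinct us0" using finite_distinct_list[OF U(2)] by blast
  have spanW: "span U = W"
    using U span_subset_lin_closed[OF W(1) U(1)] by auto
  have "\<exists>us1. distinct (us0 @ us1) \<and> set (us0 @ us1) \<subseteq> carrier_vec d \<and> length (us0 @ us1) = d \<and>
     lin_indpt (set (us0 @ us1))"
    by (rule full_basis_list) (use U us0 Wc in \<open>auto simp: lin_closed_def\<close>)
  then obtain us1 where us: "distinct (us0 @ us1)" "set (us0 @ us1) \<subseteq> carrier_vec d" "length (us0 @ us1) = d"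
     "lin_indpt (set (us0 @ us1))" by blast
  define us where "us = us0 @ us1"
  define k where "k = length us0"
  define P where "P = mat_of_cols d us"
  have P: "P \<in> carrier_mat d d" using us(3) by (simp add: P_def us_def carrier_matI)
  obtain Q where Q: "Q \<in> carrier_mat d d" and PQ: "P * Q = 1\<^sub>m d" and QP: "Q * P = 1\<^sub>m d"
    using basis_matrix[OF us(1,2,4,3)] unfolding P_def us_def by blast
  have kd: "k \<le> d" using us(3) by (simp add: k_def)
  have "k \<noteq> d"
  proof
    assume "k = d"
    then have "us1 = []" using us(3) by (simp add: k_def)
    then have "card U = d" using us us0 distinct_card[OF us0(2)] by simp
    then have "basis U" using U Wc by (intro dim_li_is_basis) (auto simp: dim_is_n)
    then have "span U = carrier_vec d" by (simp add: basis_def)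
    then show False using spanW W by simp
  qed
  moreover have "k \<noteq> 0"
  proof
    assume "k = 0"
    then have "U = {}" using us0 by (simp add: k_def)
    then show False using spanW W span_empty by simp
  qed
  ultimately have k: "0 < k" "k < d" using kd by auto
  have colP: "Matrix.col P b = us ! b" if "b < d" for b
  proof -
    have "us ! b \<in> set us" using that us(3) by (intro nth_mem) (simp add: us_def)
    then have "us ! b \<in> carrier_vec d" using us(2) by (auto simp: us_def)
    then show ?thesis
      unfolding P_def using that us(3) by (intro col_mat_of_cols) (simp_all add: us_def)
  qed
  have Qus: "Q *\<^sub>v (us ! b) = unit_vec d b" if b: "b < d" for b
  proof -
    have "Q *\<^sub>v (us ! b) = Matrix.col (Q * P) b"
      using b P Q by (subst col_mult2[of _ d d _ d]) (auto simp: colP)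
    then show ?thesis using b by (simp add: QP)
  qed
  define Z where "Z = {u \<in> carrier_vec d. \<forall>a. k \<le> a \<longrightarrow> a < d \<longrightarrow> vec_index (Q *\<^sub>v u) a = 0}"
  have "lin_closed d Z"
    unfolding lin_closed_def
  proof (intro conjI ballI allI)
    fix x y assume "x \<in> Z" "y \<in> Z"
    then show "x + y \<in> Z"
      using Q by (auto simp: Z_def mult_add_distrib_mat_vec[of _ d d] simp del: index_mult_mat_vec)
  next
    fix c x assume "x \<in> Z"
    then show "c \<cdot>\<^sub>v x \<in> Z"
      using Q by (auto simp: Z_def mult_mat_vec[of _ d d] simp del: index_mult_mat_vec)
  qed (use Q in \<open>auto simp: Z_def scalar_prod_def\<close>)
  moreover have "U \<subseteq> Z"
  proof
    fix u assume u: "u \<in> U"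
    then obtain b where b: "b < k" "u = us0 ! b"
      using us0 by (metis in_set_conv_nth k_def)
    then have "u = us ! b" by (simp add: us_def nth_append k_def)
    then show "u \<in> Z" using b k u U Wc by (auto simp: Z_def Qus simp del: index_mult_mat_vec)
  qed
  ultimately have WZ: "W \<subseteq> Z" using span_subset_lin_closed spanW by blast
  have "(Q * \<rho> X * P) $$ (a, b) = 0" if X: "X \<in> carrier_mat N N" and ab: "k \<le> a" "a < d" "b < k" for X a b
  proof -
    have R: "\<rho> X \<in> carrier_mat d d" using rep_carrier[OF rep X] .
    have bd: "b < d" using ab k by simp
    have "us ! b \<in> W" using ab U us0 by (auto simp: us_def nth_append k_def)
    then have "\<rho> X *\<^sub>v (us ! b) \<in> Z" using inv[OF X] WZ by auto
    then have 0: "vec_index (Q *\<^sub>v (\<rho> X *\<^sub>v (us ! b))) a = 0" using ab by (simp add: Z_def)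
    have ub: "us ! b \<in> carrier_vec d" using us bd nth_mem[of b us] by (auto simp: us_def)
    have "(Q * \<rho> X * P) $$ (a, b) = vec_index (Matrix.col (Q * \<rho> X * P) b) a"
      using ab bd P Q R by simp
    also have "Matrix.col (Q * \<rho> X * P) b = Q * \<rho> X *\<^sub>v (us ! b)"
      using bd P Q R by (subst col_mult2[of _ d d _ d]) (auto simp: colP)
    also have "\<dots> = Q *\<^sub>v (\<rho> X *\<^sub>v (us ! b))"
      using Q R ub by (rule assoc_mult_mat_vec)
    finally show ?thesis using 0 by simp
  qed
  then show ?thesis
    using k P Q PQ QP by (intro exI[of _ k] exI[of _ P] exI[of _ Q]) auto
qed

text \<open>The subrepresentation and the quotient, in coordinates.\<close>

lemma diagonal_block_rep:
  assumes rep: "gl_rep N d \<sigma>" and k: "k \<le> d"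
    and tri: "\<And>X a b. X \<in> carrier_mat N N \<Longrightarrow> k \<le> a \<Longrightarrow> a < d \<Longrightarrow> b < k \<Longrightarrow> \<sigma> X $$ (a, b) = 0"
  shows "gl_rep N k (\<lambda>X. Matrix.mat k k (\<lambda>(a, b). \<sigma> X $$ (a, b)))" (is "gl_rep N k ?A")
    and "gl_rep N (d - k) (\<lambda>X. Matrix.mat (d - k) (d - k) (\<lambda>(a, b). \<sigma> X $$ (a + k, b + k)))" (is "gl_rep N (d - k) ?B")
proof -
  have split: "(\<Sum>c<d. f c) = (\<Sum>c<k. f c) + (\<Sum>c<d - k. f (c + k))" for f :: "nat \<Rightarrow> complex"
  proof -
    have "(\<Sum>c<d. f c) = (\<Sum>c<k. f c) + (\<Sum>c=k..<d. f c)"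
      using k by (simp add: lessThan_atLeast0 sum.atLeastLessThan_concat)
    also have "(\<Sum>c=k..<d. f c) = (\<Sum>c<d - k. f (c + k))"
      using sum.shift_bounds_nat_ivl[of f 0 k "d - k"] k by (simp add: lessThan_atLeast0)
    finally show ?thesis .
  qed
  have sc: "\<sigma> X \<in> carrier_mat d d" if "X \<in> carrier_mat N N" for X using rep_carrier[OF rep that] .
  have mult: "(\<sigma> X * \<sigma> Y) $$ (a, b) = (\<Sum>c<k. \<sigma> X $$ (a, c) * \<sigma> Y $$ (c, b)) + (\<Sum>c<d - k. \<sigma> X $$ (a, c + k) * \<sigma> Y $$ (c + k, b))"
    if "X \<in> carrier_mat N N" "Y \<in> carrier_mat N N" "a < d" "b < d" for X Y a b
    unfolding split[symmetric, of "\<lambda>c. \<sigma> X $$ (a, c) * \<sigma> Y $$ (c, b)"]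
    using that sc[OF that(1)] sc[OF that(2)] by (simp add: scalar_prod_def lessThan_atLeast0)
  have br: "\<sigma> (X * Y - Y * X) $$ (a, b) = (\<sigma> X * \<sigma> Y) $$ (a, b) - (\<sigma> Y * \<sigma> X) $$ (a, b)"
    if "X \<in> carrier_mat N N" "Y \<in> carrier_mat N N" "a < d" "b < d" for X Y a b
  proof -
    have "\<sigma> (X * Y - Y * X) = \<sigma> X * \<sigma> Y - \<sigma> Y * \<sigma> X" using rep that by (simp add: gl_rep_def)
    then show ?thesis using that sc[OF that(1)] sc[OF that(2)] by simp
  qed
  show "gl_rep N k ?A"
    unfolding gl_rep_def
  proof (intro conjI ballI allI)
    fix X Y :: "complex Matrix.mat" assume X: "X \<in> carrier_mat N N" and Y: "Y \<in> carrier_mat N N"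
    show "?A (X + Y) = ?A X + ?A Y"
      using k sc[OF X] sc[OF Y] by (intro eq_matI) (auto simp: rep_add[OF rep X Y])
    show "?A (X * Y - Y * X) = ?A X * ?A Y - ?A Y * ?A X"
      by (rule eq_matI)
         (use k X Y tri in \<open>simp_all add: br mult scalar_prod_def lessThan_atLeast0[symmetric]\<close>)
  next
    fix c and X :: "complex Matrix.mat" assume X: "X \<in> carrier_mat N N"
    show "?A (c \<cdot>\<^sub>m X) = c \<cdot>\<^sub>m ?A X"
      using k sc[OF X] by (intro eq_matI) (auto simp: rep_smult[OF rep X])
  qed simp
  show "gl_rep N (d - k) ?B"
    unfolding gl_rep_def
  proof (intro conjI ballI allI)
    fix X Y :: "complex Matrix.mat" assume X: "X \<in> carrier_mat N N" and Y: "Y \<in> carrier_mat N N"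
    show "?B (X + Y) = ?B X + ?B Y"
      using k sc[OF X] sc[OF Y] by (intro eq_matI) (auto simp: rep_add[OF rep X Y])
    show "?B (X * Y - Y * X) = ?B X * ?B Y - ?B Y * ?B X"
      by (rule eq_matI)
         (use k X Y tri in \<open>simp_all add: br mult scalar_prod_def lessThan_atLeast0[symmetric]\<close>)
  next
    fix c and X :: "complex Matrix.mat" assume X: "X \<in> carrier_mat N N"
    show "?B (c \<cdot>\<^sub>m X) = c \<cdot>\<^sub>m ?B X"
      using k sc[OF X] by (intro eq_matI) (auto simp: rep_smult[OF rep X])
  qed simp
qed

text \<open>Take a representation of minimal dimension among those with a highest weight vector of weight \<open>n\<close>. If it had an invariant
subspace, the image of the vector in the quotient, or the vector itself if it lies in the subspace, would be a highest weight
vector in a smaller representation.\<close>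

theorem exists_irreducible:
  assumes dom: "gl_dominant N n"
  shows "\<exists>d \<rho>. gl_rep N d \<rho> \<and> gl_irreducible N d \<rho> \<and> gl_highest_weight N d \<rho> n"
proof -
  define G where "G d \<longleftrightarrow> (\<exists>\<rho>. gl_rep N d \<rho> \<and> gl_highest_weight N d \<rho> n)" for d
  have "\<exists>d. G d" using exists_highest_weight_rep[OF dom] by (auto simp: G_def)
  then obtain d where d: "G d" and least: "\<And>d'. d' < d \<Longrightarrow> \<not> G d'"
    using exists_least_iff[of G] by auto
  obtain \<rho> where rep: "gl_rep N d \<rho>" and hw: "gl_highest_weight N d \<rho> n" using d by (auto simp: G_def)
  obtain v where v: "v \<in> carrier_vec d" "v \<noteq> 0\<^sub>v d"
    and diag: "\<And>i. i \<in> {1..N} \<Longrightarrow> \<rho> (gl_unit N i i) *\<^sub>v v = of_int (n i) \<cdot>\<^sub>v v"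
    and raise: "\<And>i j. i \<in> {1..N} \<Longrightarrow> j \<in> {1..N} \<Longrightarrow> i < j \<Longrightarrow> \<rho> (gl_unit N i j) *\<^sub>v v = 0\<^sub>v d"
    using hw unfolding gl_highest_weight_def by blast
  have "d > 0"
  proof (rule ccontr)
    assume "\<not> d > 0"
    then have "v = 0\<^sub>v d" using v(1) by (intro eq_vecI) auto
    with v show False by simp
  qed
  moreover have "W = {0\<^sub>v d} \<or> W = carrier_vec d"
    if W: "lin_closed d W" and inv: "\<forall>X\<in>carrier_mat N N. \<forall>w\<in>W. \<rho> X *\<^sub>v w \<in> W" for W
  proof (rule ccontr)
    assume "\<not> (W = {0\<^sub>v d} \<or> W = carrier_vec d)"
    then have ne: "W \<noteq> {0\<^sub>v d}" "W \<noteq> carrier_vec d" by auto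
    have "\<exists>k P Q. 0 < k \<and> k < d \<and> P \<in> carrier_mat d d \<and> Q \<in> carrier_mat d d \<and> P * Q = 1\<^sub>m d \<and> Q * P = 1\<^sub>m d \<and>
      (\<forall>X\<in>carrier_mat N N. \<forall>a b. k \<le> a \<longrightarrow> a < d \<longrightarrow> b < k \<longrightarrow> (Q * \<rho> X * P) $$ (a, b) = 0)"
      by (rule rep_block_triangular[OF rep W ne]) (use inv in auto)
    then obtain k P Q where k: "0 < k" "k < d" and P: "P \<in> carrier_mat d d" and Q: "Q \<in> carrier_mat d d"
      and PQ: "P * Q = 1\<^sub>m d" and QP: "Q * P = 1\<^sub>m d"
      and tri0: "\<And>X a b. X \<in> carrier_mat N N \<Longrightarrow> k \<le> a \<Longrightarrow> a < d \<Longrightarrow> b < k \<Longrightarrow> (Q * \<rho> X * P) $$ (a, b) = 0"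
      by auto
    define \<sigma> where "\<sigma> X = Q * \<rho> X * P" for X
    have srep: "gl_rep N d \<sigma>" unfolding \<sigma>_def by (rule rep_conjugate[OF rep P Q PQ])
    have tri: "\<sigma> X $$ (a, b) = 0" if "X \<in> carrier_mat N N" "k \<le> a" "a < d" "b < k" for X a b
      unfolding \<sigma>_def using tri0[OF that] .
    define u where "u = Q *\<^sub>v v"
    have uc: "u \<in> carrier_vec d" using Q v by (simp add: u_def)
    have Pu: "P *\<^sub>v u = v"
      unfolding u_def using assoc_mult_mat_vec[OF P Q v(1)] v(1) by (simp add: PQ)
    have un: "u \<noteq> 0\<^sub>v d"
    proof
      assume "u = 0\<^sub>v d"
      then have "P *\<^sub>v u = 0\<^sub>v d" using P by (intro eq_vecI) (auto simp: scalar_prod_def)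
      with Pu v show False by simp
    qed
    have su: "\<sigma> X *\<^sub>v u = Q *\<^sub>v (\<rho> X *\<^sub>v v)" if X: "X \<in> carrier_mat N N" for X
    proof -
      have R: "\<rho> X \<in> carrier_mat d d" using rep_carrier[OF rep X] .
      have "\<sigma> X *\<^sub>v u = Q * \<rho> X *\<^sub>v (P *\<^sub>v u)"
        unfolding \<sigma>_def by (rule assoc_mult_mat_vec) (use P Q R uc in auto)
      also have "\<dots> = Q *\<^sub>v (\<rho> X *\<^sub>v v)"
        unfolding Pu using Q R v(1) by (rule assoc_mult_mat_vec)
      finally show ?thesis .
    qed
    have uX: "gl_unit N i j \<in> carrier_mat N N" for i j by (simp add: gl_unit_def)
    have sdiag: "\<sigma> (gl_unit N i i) *\<^sub>v u = of_int (n i) \<cdot>\<^sub>v u" if "i \<in> {1..N}" for i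
      unfolding su[OF uX] diag[OF that] unfolding u_def using Q v(1) by (rule mult_mat_vec)
    have sraise: "\<sigma> (gl_unit N i j) *\<^sub>v u = 0\<^sub>v d" if "i \<in> {1..N}" "j \<in> {1..N}" "i < j" for i j
      unfolding su[OF uX] raise[OF that] using Q by (intro eq_vecI) (auto simp: scalar_prod_def)
    have split: "(\<Sum>c<d. f c) = (\<Sum>c<k. f c) + (\<Sum>c<d - k. f (c + k))" for f :: "nat \<Rightarrow> complex"
    proof -
      have "(\<Sum>c<d. f c) = (\<Sum>c<k. f c) + (\<Sum>c=k..<d. f c)"
        using k by (simp add: lessThan_atLeast0 sum.atLeastLessThan_concat)
      also have "(\<Sum>c=k..<d. f c) = (\<Sum>c<d - k. f (c + k))"
        using sum.shift_bounds_nat_ivl[of f 0 k "d - k"] k by (simp add: lessThan_atLeast0)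
      finally show ?thesis .
    qed
    have sidx: "vec_index (\<sigma> X *\<^sub>v u) a = (\<Sum>c<k. \<sigma> X $$ (a, c) * vec_index u c) + (\<Sum>c<d - k. \<sigma> X $$ (a, c + k) * vec_index u (c + k))"
      if "X \<in> carrier_mat N N" "a < d" for X a
      unfolding split[symmetric, of "\<lambda>c. \<sigma> X $$ (a, c) * vec_index u c"]
      using that rep_carrier[OF srep that(1)] uc by (simp add: scalar_prod_def lessThan_atLeast0)
    \<comment> \<open>If a lower coordinate of \<open>u\<close> is nonzero, the quotient block is used; otherwise \<open>u\<close> lies in the first block.\<close>
    show False
    proof (cases "\<exists>a. k \<le> a \<and> a < d \<and> vec_index u a \<noteq> 0")
      case True
      then obtain a where a: "k \<le> a" "a < d" "vec_index u a \<noteq> 0" by blast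
      define \<tau> where "\<tau> X = Matrix.mat (d - k) (d - k) (\<lambda>(a, b). \<sigma> X $$ (a + k, b + k))" for X
      define u' where "u' = Matrix.vec (d - k) (\<lambda>a. vec_index u (a + k))"
      have trep: "gl_rep N (d - k) \<tau>"
        unfolding \<tau>_def using k by (intro diagonal_block_rep(2)[OF srep _ tri]) auto
      have tu: "vec_index (\<tau> X *\<^sub>v u') a = vec_index (\<sigma> X *\<^sub>v u) (a + k)" if "X \<in> carrier_mat N N" "a < d - k" for X a
        using that tri[OF that(1)] by (subst sidx) (auto simp: \<tau>_def u'_def scalar_prod_def lessThan_atLeast0)
      have dims: "u' \<in> carrier_vec (d - k)" "dim_vec u' = d - k" "dim_row (\<tau> X) = d - k"
        "i < d - k \<Longrightarrow> vec_index u' i = vec_index u (i + k)" for X i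
        by (simp_all add: u'_def \<tau>_def)
      have "vec_index u' (a - k) = vec_index u (a - k + k)" unfolding u'_def using a by (intro index_vec) linarith
      also have "a - k + k = a" using a(1) by (rule le_add_diff_inverse2)
      finally have "vec_index u' (a - k) \<noteq> 0" using a by simp
      then have "u' \<noteq> 0\<^sub>v (d - k)" using a by auto
      then have "gl_highest_weight N (d - k) \<tau> n"
        unfolding gl_highest_weight_def
        by (intro bexI[of _ u'] conjI ballI impI eq_vecI)
           (use uc k in \<open>auto simp: tu[OF uX] sdiag sraise dims simp del: index_mult_mat_vec\<close>)
      with trep have "G (d - k)" by (auto simp: G_def)
      then show False using least[of "d - k"] k by simp
    next
      case False
      define \<tau> where "\<tau> X = Matrix.mat k k (\<lambda>(a, b). \<sigma> X $$ (a, b))" for X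
      define u' where "u' = Matrix.vec k (\<lambda>a. vec_index u a)"
      have trep: "gl_rep N k \<tau>"
        unfolding \<tau>_def using k by (intro diagonal_block_rep(1)[OF srep _ tri]) auto
      have tu: "vec_index (\<tau> X *\<^sub>v u') a = vec_index (\<sigma> X *\<^sub>v u) a" if "X \<in> carrier_mat N N" "a < k" for X a
        using that False k by (subst sidx) (auto simp: \<tau>_def u'_def scalar_prod_def lessThan_atLeast0)
      have dims: "u' \<in> carrier_vec k" "dim_vec u' = k" "dim_row (\<tau> X) = k"
        "i < k \<Longrightarrow> vec_index u' i = vec_index u i" for X i
        by (simp_all add: u'_def \<tau>_def)
      have "u' \<noteq> 0\<^sub>v k"
      proof
        assume z: "u' = 0\<^sub>v k"
        have "vec_index u a = 0" if "a < d" for a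
        proof (cases "a < k")
          case True
          then have "vec_index u a = vec_index u' a" by (simp add: u'_def)
          then show ?thesis using z True by simp
        next
          case c: False
          then show ?thesis using False that by auto
        qed
        then have "u = 0\<^sub>v d" using uc by (intro eq_vecI) auto
        with un show False by simp
      qed
      then have "gl_highest_weight N k \<tau> n"
        unfolding gl_highest_weight_def
        by (intro bexI[of _ u'] conjI ballI impI eq_vecI)
           (use uc k in \<open>auto simp: tu[OF uX] sdiag sraise dims simp del: index_mult_mat_vec\<close>)
      with trep have "G k" by (auto simp: G_def)
      then show False using least[of k] k by simp
    qed
  qed
  ultimately have "gl_irreducible N d \<rho>"
    by (auto simp: gl_irreducible_def subspace_iff_lin_closed)
  with rep hw show ?thesis by blast
qed

corollary whittaker_q0_character:
  assumes dom: "gl_dominant N n"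
  shows "\<exists>d w. highest_weight_character N d w (\<lambda>i. n (Suc i)) 0 \<and>
    (\<forall>z. (\<forall>i\<in>{1..N}. z i \<noteq> 0) \<longrightarrow> whittaker_q0 N z n = (\<Sum>b<d. monom_at N (\<lambda>i. z (Suc i)) (w b)))"
proof -
  obtain d \<rho> where dr: "gl_irrep N n = (d, \<rho>)" by (cases "gl_irrep N n")
  have "case gl_irrep N n of (d, \<rho>) \<Rightarrow> gl_rep N d \<rho> \<and> gl_irreducible N d \<rho> \<and> gl_highest_weight N d \<rho> n"
    unfolding gl_irrep_def
    by (rule someI_ex) (use exists_irreducible[OF dom] in auto)
  then have r: "gl_rep N d \<rho>" "gl_irreducible N d \<rho>" "gl_highest_weight N d \<rho> n"
    by (simp_all add: dr)
  have "whittaker_q0 N z n = mat_trace (foldr (\<lambda>i M. mat_cpow (z i) (\<rho> (gl_unit N i i)) * M) [1..<N+1] (1\<^sub>m d))" for z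
    by (simp only: whittaker_q0_def dr dom if_True prod.case)
  then show ?thesis
    using irreducible_character[OF r dom] by metis
qed

section \<open>The limit of the characters\<close>

text \<open>The continuous analogue of the ratio of determinants in the Weyl formula. At coinciding parameters it is \<open>0\<close> by the
convention on division, and not the limit; it is evaluated at distinct parameters.\<close>

definition char_limit :: "nat \<Rightarrow> (nat \<Rightarrow> complex) \<Rightarrow> (nat \<Rightarrow> real) \<Rightarrow> complex" where
  "char_limit N lam x = leibniz N (\<lambda>i j. exp (\<i> * lam i * of_real (x j))) /
     (\<Prod>j<N. \<Prod>i<j. \<i> * (lam i - lam j))"

definition dominant_pt :: "nat \<Rightarrow> (nat \<Rightarrow> real) \<Rightarrow> bool" where
  "dominant_pt N x \<longleftrightarrow> (\<forall>i j. i \<le> j \<longrightarrow> j < N \<longrightarrow> x j \<le> x i)"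

definition floor_weight :: "(nat \<Rightarrow> real) \<Rightarrow> real \<Rightarrow> nat \<Rightarrow> int" where
  "floor_weight x h j = \<lfloor>x (j - 1) / h\<rfloor>"

text \<open>The character at \<open>z\<^sub>i = exp (\<i> \<lambda>\<^sub>i h)\<close> for parameters and a point indexed from \<open>0\<close>, with \<open>h\<close> in the role of \<open>ln t\<close>.\<close>

definition q0_at :: "nat \<Rightarrow> (nat \<Rightarrow> complex) \<Rightarrow> (nat \<Rightarrow> real) \<Rightarrow> real \<Rightarrow> complex" where
  "q0_at N lam x h = whittaker_q0 N (\<lambda>i. exp (\<i> * lam (i - 1) * of_real h)) (floor_weight x h)"

lemma floor_weight_dominant:
  assumes "dominant_pt N x" "h > 0"
  shows "gl_dominant N (floor_weight x h)"
  using assms by (auto simp: gl_dominant_def floor_weight_def dominant_pt_def intro!: floor_mono divide_right_mono)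

lemma floor_scaled_tendsto:
  "((\<lambda>h. h * of_int (\<lfloor>y / h\<rfloor> - int j)) \<longlongrightarrow> (y::real)) (at_right 0)"
proof (rule tendsto_sandwich)
  show "eventually (\<lambda>h. y - h - h * real j \<le> h * of_int (\<lfloor>y / h\<rfloor> - int j)) (at_right 0)"
    using eventually_at_right_less[of "0::real"]
  proof eventually_elim
    case (elim h)
    have "y / h - 1 \<le> of_int \<lfloor>y / h\<rfloor>" by linarith
    then have "h * (y / h - 1) \<le> h * of_int \<lfloor>y / h\<rfloor>" using elim by (intro mult_left_mono) auto
    then show ?case using elim by (simp add: right_diff_distrib)
  qed
  show "eventually (\<lambda>h. h * of_int (\<lfloor>y / h\<rfloor> - int j) \<le> y) (at_right 0)"
    using eventually_at_right_less[of "0::real"]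
  proof eventually_elim
    case (elim h)
    have "of_int \<lfloor>y / h\<rfloor> \<le> y / h" by linarith
    then have "h * of_int \<lfloor>y / h\<rfloor> \<le> h * (y / h)" using elim by (intro mult_left_mono) auto
    moreover have "0 \<le> h * real j" "h * (y / h) = y" using elim by simp_all
    moreover have "h * of_int (\<lfloor>y / h\<rfloor> - int j) = h * of_int \<lfloor>y / h\<rfloor> - h * real j"
      by (simp add: right_diff_distrib)
    ultimately show ?case by linarith
  qed
  have "((\<lambda>h. y - h - h * real j) \<longlongrightarrow> y - 0 - 0 * real j) (at_right 0)"
    by (intro tendsto_intros)
  then show "((\<lambda>h. y - h - h * real j) \<longlongrightarrow> y) (at_right 0)" by simp
qed simp

lemma exp_difference_quotient:
  "((\<lambda>h::real. (exp (- (\<i> * b * of_real h)) - exp (- (\<i> * a * of_real h))) / of_real h) \<longlongrightarrow> \<i> * (a - b)) (at_right 0)"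
proof -
  have d: "((\<lambda>z. exp (- (\<i> * b * z)) - exp (- (\<i> * a * z))) has_field_derivative \<i> * (a - b)) (at 0)"
    by (auto intro!: derivative_eq_intros simp: algebra_simps)
  have "((\<lambda>z. (exp (- (\<i> * b * z)) - exp (- (\<i> * a * z))) / z) \<longlongrightarrow> \<i> * (a - b)) (at 0)"
    using d by (simp add: has_field_derivative_iff)
  moreover have "filterlim (\<lambda>h::real. complex_of_real h) (at 0) (at_right 0)"
    unfolding filterlim_at
  proof
    show "eventually (\<lambda>h. complex_of_real h \<in> UNIV \<and> complex_of_real h \<noteq> 0) (at_right 0)"
      using eventually_at_right_less[of "0::real"] by eventually_elim auto
    have "((\<lambda>h. complex_of_real h) \<longlongrightarrow> of_real 0) (at_right 0)" by (intro tendsto_intros)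
    then show "((\<lambda>h. complex_of_real h) \<longlongrightarrow> 0) (at_right 0)" by simp
  qed
  ultimately show ?thesis by (rule filterlim_compose)
qed

text \<open>The Weyl formula writes the rescaled character as \<open>num h / den h\<close>, where the power of \<open>h\<close> provides one factor \<open>1 / h\<close> for each
factor of the denominator; both converge.\<close>

lemma q0_at_distinct_limit:
  assumes dom: "dominant_pt N x" and inj: "inj_on lam {..<N}"
  shows "((\<lambda>h. of_real h ^ (\<Sum>j<N. j) * q0_at N lam x h) \<longlongrightarrow> char_limit N lam x) (at_right 0)"
proof -
  define num where "num h = leibniz N (\<lambda>i j. exp (\<i> * lam i * of_real (h * of_int (floor_weight x h (Suc j) - int j))))" for h
  define den where "den h = (\<Prod>j<N. \<Prod>i<j. (exp (- (\<i> * lam j * of_real h)) - exp (- (\<i> * lam i * of_real h))) / of_real h)" for h :: real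
  have den: "(den \<longlongrightarrow> (\<Prod>j<N. \<Prod>i<j. \<i> * (lam i - lam j))) (at_right 0)"
    unfolding den_def by (intro tendsto_prod exp_difference_quotient)
  have num: "(num \<longlongrightarrow> leibniz N (\<lambda>i j. exp (\<i> * lam i * of_real (x j)))) (at_right 0)"
  proof -
    have "((\<lambda>h. h * of_int (floor_weight x h (Suc j) - int j)) \<longlongrightarrow> x j) (at_right 0)" for j
      unfolding floor_weight_def using floor_scaled_tendsto[of "x j" j] by (simp only: diff_Suc_1)
    then show ?thesis
      unfolding num_def leibniz_def by (intro tendsto_intros)
  qed
  have nz: "(\<Prod>j<N. \<Prod>i<j. \<i> * (lam i - lam j)) \<noteq> 0"
    using inj by (auto simp: inj_on_def)
  have lim: "((\<lambda>h. num h / den h) \<longlongrightarrow> char_limit N lam x) (at_right 0)"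
    unfolding char_limit_def by (intro tendsto_divide num den nz)
  have ev: "eventually (\<lambda>h. den h \<noteq> 0) (at_right 0)"
    using den nz by (rule tendsto_imp_eventually_ne)
  have "eventually (\<lambda>h. num h / den h = of_real h ^ (\<Sum>j<N. j) * q0_at N lam x h) (at_right 0)"
    using ev eventually_at_right_less[of "0::real"]
  proof eventually_elim
    case (elim h)
    define z where "z i = exp (\<i> * lam i * of_real h)" for i
    have znz: "z i \<noteq> 0" for i by (simp add: z_def)
    obtain d w where hw: "highest_weight_character N d w (\<lambda>i. floor_weight x h (Suc i)) 0"
      and q: "\<And>z. (\<forall>i\<in>{1..N}. z i \<noteq> 0) \<Longrightarrow> whittaker_q0 N z (floor_weight x h) = (\<Sum>b<d. monom_at N (\<lambda>i. z (Suc i)) (w b))"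
      using whittaker_q0_character[OF floor_weight_dominant[OF dom elim(2)]] by blast
    have "q0_at N lam x h = (\<Sum>b<d. monom_at N z (w b))"
      unfolding q0_at_def by (subst q) (auto simp: z_def[abs_def])
    moreover have "leibniz N (\<lambda>i j. inverse (z i) ^ j) * (\<Sum>b<d. monom_at N z (w b)) =
        leibniz N (\<lambda>i j. z i powi (floor_weight x h (Suc j) - int j))"
      by (rule highest_weight_character.weyl_character_formula[OF hw]) (rule znz)
    moreover have "leibniz N (\<lambda>i j. z i powi (floor_weight x h (Suc j) - int j)) = num h"
      unfolding num_def by (rule leibniz_cong) (simp add: z_def exp_power_int mult_ac)
    moreover have "leibniz N (\<lambda>i j. inverse (z i) ^ j) = of_real h ^ (\<Sum>j<N. j) * den h"
    proof -
      have "leibniz N (\<lambda>i j. inverse (z i) ^ j) = (\<Prod>j<N. \<Prod>i<j. inverse (z j) - inverse (z i))"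
        by (rule vandermonde_det)
      also have "\<dots> = (\<Prod>j<N. \<Prod>i<j. of_real h * ((exp (- (\<i> * lam j * of_real h)) - exp (- (\<i> * lam i * of_real h))) / of_real h))"
        by (intro prod.cong refl) (use elim in \<open>simp add: z_def exp_minus\<close>)
      also have "\<dots> = (\<Prod>j<N. of_real h ^ j) * den h"
        by (simp only: prod.distrib den_def prod_constant card_lessThan)
      also have "(\<Prod>j<N. of_real h ^ j :: complex) = of_real h ^ (\<Sum>j<N. j)"
        by (simp add: power_sum)
      finally show ?thesis .
    qed
    ultimately have "of_real h ^ (\<Sum>j<N. j) * den h * q0_at N lam x h = num h" by simp
    then show ?case using elim by (simp add: field_simps)
  qed
  then show ?thesis using lim by (rule Lim_transform_eventually[rotated])
qed

text \<open>If \<open>x i < x j\<close> with \<open>i < j\<close>, the integer parts violate dominance as soon as \<open>h < x j - x i\<close>.\<close>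

lemma q0_at_nondominant:
  assumes "\<not> dominant_pt N x"
  shows "((\<lambda>h. of_real h ^ m * q0_at N lam x h) \<longlongrightarrow> 0) (at_right 0)"
proof -
  obtain i j where ij: "i \<le> j" "j < N" "x i < x j" using assms by (auto simp: dominant_pt_def not_le)
  have "eventually (\<lambda>h::real. h < x j - x i) (at_right 0)"
    using ij by (intro eventually_at_right_real[THEN eventually_mono]) auto
  then have "eventually (\<lambda>h. of_real h ^ m * q0_at N lam x h = 0) (at_right 0)"
    using eventually_at_right_less[of "0::real"]
  proof eventually_elim
    case (elim h)
    have "(x i + h) / h \<le> x j / h" using elim by (intro divide_right_mono) auto
    then have "x i / h + 1 \<le> x j / h" using elim by (simp add: add_divide_distrib)
    then have "\<lfloor>x i / h\<rfloor> < \<lfloor>x j / h\<rfloor>" by linarith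
    moreover have "floor_weight x h (Suc j) \<le> floor_weight x h (Suc i)" if "gl_dominant N (floor_weight x h)"
      using that ij by (auto simp: gl_dominant_def)
    ultimately have "\<not> gl_dominant N (floor_weight x h)"
      by (auto simp: floor_weight_def)
    then show ?case by (simp add: q0_at_def whittaker_q0_def)
  qed
  then show ?thesis by (rule tendsto_eventually)
qed

text \<open>A choice of the weights, with multiplicity, valid for all \<open>z\<close> at once; bounds below evaluate the same list at
  different arguments.\<close>

definition weight_list :: "nat \<Rightarrow> (nat \<Rightarrow> int) \<Rightarrow> nat \<times> (nat \<Rightarrow> nat \<Rightarrow> int)" where
  "weight_list N n = (SOME (d, w). \<forall>z. (\<forall>i\<in>{1..N}. z i \<noteq> 0) \<longrightarrow>
     whittaker_q0 N z n = (\<Sum>b<d. monom_at N (\<lambda>i. z (Suc i)) (w b)))"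

definition weight_pairing :: "nat \<Rightarrow> (nat \<Rightarrow> 'a) \<Rightarrow> (nat \<Rightarrow> int) \<Rightarrow> 'a :: ring_1" where
  "weight_pairing N s \<mu> = (\<Sum>i<N. s i * of_int (\<mu> i))"

lemma q0_at_weight_sum:
  assumes "dominant_pt N x" "h > 0" and dw: "weight_list N (floor_weight x h) = (d, w)"
  shows "q0_at N lam x h = (\<Sum>b<d. exp (\<i> * of_real h * weight_pairing N lam (w b)))"
proof -
  have "case weight_list N (floor_weight x h) of (d, w) \<Rightarrow> \<forall>z. (\<forall>i\<in>{1..N}. z i \<noteq> 0) \<longrightarrow>
     whittaker_q0 N z (floor_weight x h) = (\<Sum>b<d. monom_at N (\<lambda>i. z (Suc i)) (w b))"
    unfolding weight_list_def
    by (rule someI_ex) (use whittaker_q0_character[OF floor_weight_dominant[OF assms(1,2)]] in auto)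
  then have "q0_at N lam x h = (\<Sum>b<d. monom_at N (\<lambda>i. exp (\<i> * lam i * of_real h)) (w b))"
    unfolding q0_at_def by (simp add: dw)
  also have "\<dots> = (\<Sum>b<d. exp (\<i> * of_real h * weight_pairing N lam (w b)))"
  proof (intro sum.cong refl)
    fix b
    have "monom_at N (\<lambda>i. exp (\<i> * lam i * of_real h)) (w b) = (\<Prod>i<N. exp (\<i> * of_real h * (lam i * of_int (w b i))))"
      unfolding monom_at_def by (intro prod.cong refl) (simp add: exp_power_int mult_ac)
    then show "monom_at N (\<lambda>i. exp (\<i> * lam i * of_real h)) (w b) = exp (\<i> * of_real h * weight_pairing N lam (w b))"
      by (simp add: weight_pairing_def exp_sum sum_distrib_left)
  qed
  finally show ?thesis .
qed

text \<open>Bounds the derivative of the rescaled character in the spectral parameters, uniformly in \<open>h\<close>. The summand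
\<open>exp (h s\<cdot>w) h |w|\<close> is at most \<open>exp (h (s\<cdot>w + |w|))\<close>, which is at most the sum of \<open>exp (h r\<cdot>w)\<close> over the corners \<open>r\<close> of a
large box. At each corner the sum over \<open>w\<close> is a character at distinct parameters, whose rescaling converges.\<close>

lemma weighted_dimension_bound:
  assumes dom: "dominant_pt N x"
  shows "\<exists>C. eventually (\<lambda>h. \<forall>d w. weight_list N (floor_weight x h) = (d, w) \<longrightarrow>
    h ^ (\<Sum>j<N. j) * (\<Sum>b<d. exp (h * weight_pairing N s (w b)) * (h * (\<Sum>i<N. \<bar>of_int (w b i)\<bar>))) \<le> C) (at_right 0)"
proof -
  define K where "K = (\<Sum>i<N. \<bar>s i\<bar>) + 1"
  have K: "\<bar>s i\<bar> + 1 \<le> K" if "i < N" for i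
    unfolding K_def using that by (intro add_right_mono member_le_sum) auto
  \<comment> \<open>Corners of a box around \<open>s\<close>, with pairwise distinct coordinates.\<close>
  define r where "r X i = (if i \<in> X then K + real i else - K - real i)" for X and i :: nat
  have rinj: "inj_on (\<lambda>i. - \<i> * of_real (r X i)) {..<N}" for X
  proof (rule inj_onI)
    fix i j assume ij: "i \<in> {..<N}" "j \<in> {..<N}" and eq: "- \<i> * of_real (r X i) = - \<i> * of_real (r X j)"
    have "K > 0" by (simp add: K_def sum_nonneg add_nonneg_pos)
    moreover have "r X i = r X j" using eq by simp
    ultimately show "i = j" by (auto simp: r_def split: if_splits)
  qed
  define L where "L X = char_limit N (\<lambda>i. - \<i> * of_real (r X i)) x" for X
  define F where "F X h = of_real h ^ (\<Sum>j<N. j) * q0_at N (\<lambda>i. - \<i> * of_real (r X i)) x h" for X h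
  have "eventually (\<lambda>h. \<forall>X\<in>Pow {..<N}. norm (F X h) < norm (L X) + 1) (at_right 0)"
  proof (rule eventually_ball_finite, simp, rule ballI)
    fix X
    have "((\<lambda>h. norm (F X h)) \<longlongrightarrow> norm (L X)) (at_right 0)"
      unfolding F_def L_def by (intro tendsto_norm q0_at_distinct_limit dom rinj)
    then show "eventually (\<lambda>h. norm (F X h) < norm (L X) + 1) (at_right 0)"
      by (rule order_tendstoD) simp
  qed
  then have "eventually (\<lambda>h. \<forall>d w. weight_list N (floor_weight x h) = (d, w) \<longrightarrow>
    h ^ (\<Sum>j<N. j) * (\<Sum>b<d. exp (h * weight_pairing N s (w b)) * (h * (\<Sum>i<N. \<bar>of_int (w b i)\<bar>))) \<le> (\<Sum>X\<in>Pow {..<N}. norm (L X) + 1)) (at_right 0)"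
    using eventually_at_right_less[of "0::real"]
  proof eventually_elim
    case (elim h)
    show ?case
    proof (intro allI impI)
      fix d w assume dw: "weight_list N (floor_weight x h) = (d, w)"
      have FX: "h ^ (\<Sum>j<N. j) * (\<Sum>b<d. exp (h * weight_pairing N (r X) (w b))) \<le> norm (L X) + 1" if "X \<in> Pow {..<N}" for X
      proof -
        have wp: "\<i> * of_real h * weight_pairing N (\<lambda>i. - \<i> * of_real (r X i)) \<mu> = of_real (h * weight_pairing N (r X) \<mu>)" for \<mu>
        proof -
          have "weight_pairing N (\<lambda>i. - \<i> * of_real (r X i)) \<mu> = - \<i> * of_real (weight_pairing N (r X) \<mu>)"
            by (simp add: weight_pairing_def sum_distrib_left mult.assoc)
          then show ?thesis by (simp add: complex_eq_iff)
        qed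
        have "F X h = of_real (h ^ (\<Sum>j<N. j) * (\<Sum>b<d. exp (h * weight_pairing N (r X) (w b))))"
          unfolding F_def q0_at_weight_sum[OF dom elim(2) dw] wp
          by (simp only: exp_of_real of_real_sum[symmetric] of_real_power[symmetric] of_real_mult[symmetric])
        then have "norm (F X h) = \<bar>h ^ (\<Sum>j<N. j) * (\<Sum>b<d. exp (h * weight_pairing N (r X) (w b)))\<bar>"
          by (simp only: norm_of_real)
        moreover have "norm (F X h) < norm (L X) + 1" using elim(1) that by blast
        ultimately show ?thesis
          using abs_ge_self[of "h ^ (\<Sum>j<N. j) * (\<Sum>b<d. exp (h * weight_pairing N (r X) (w b)))"] by linarith
      qed
      have corner: "exp (h * weight_pairing N s \<mu>) * (h * (\<Sum>i<N. \<bar>of_int (\<mu> i)\<bar>)) \<le> (\<Sum>X\<in>Pow {..<N}. exp (h * weight_pairing N (r X) \<mu>))" for \<mu>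
      proof -
        define B where "B = h * (\<Sum>i<N. \<bar>real_of_int (\<mu> i)\<bar>)"
        have "B \<le> exp B" using exp_ge_add_one_self[of B] by linarith
        then have "exp (h * weight_pairing N s \<mu>) * B \<le> exp (h * weight_pairing N s \<mu>) * exp B" by (intro mult_left_mono) auto
        also have "\<dots> = (\<Prod>i<N. exp (h * (s i * of_int (\<mu> i) + \<bar>of_int (\<mu> i)\<bar>)))"
          by (simp add: exp_sum[symmetric] exp_add[symmetric] B_def weight_pairing_def sum_distrib_left sum.distrib distrib_left)
        also have "\<dots> \<le> (\<Prod>i<N. exp (h * ((K + real i) * of_int (\<mu> i))) + exp (h * ((- K - real i) * of_int (\<mu> i))))"
        proof (intro prod_mono conjI)
          fix i assume "i \<in> {..<N}"
          then have Ki: "\<bar>s i\<bar> + 1 \<le> K" using K by simp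
          show "exp (h * (s i * of_int (\<mu> i) + \<bar>of_int (\<mu> i)\<bar>)) \<le> exp (h * ((K + real i) * of_int (\<mu> i))) + exp (h * ((- K - real i) * of_int (\<mu> i)))"
          proof (cases "\<mu> i \<ge> 0")
            case True
            have "(s i + 1) * of_int (\<mu> i) \<le> (K + real i) * of_int (\<mu> i)"
              using Ki True by (intro mult_right_mono) auto
            then have "h * (s i * of_int (\<mu> i) + \<bar>of_int (\<mu> i)\<bar>) \<le> h * ((K + real i) * of_int (\<mu> i))"
              using True elim by (intro mult_left_mono) (auto simp: algebra_simps)
            then show ?thesis by (meson add_increasing2 exp_ge_zero exp_le_cancel_iff order_trans)
          next
            case False
            have "(s i - 1) * of_int (\<mu> i) \<le> (- K - real i) * of_int (\<mu> i)"
              using Ki False by (intro mult_right_mono_neg) auto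
            then have "h * (s i * of_int (\<mu> i) + \<bar>of_int (\<mu> i)\<bar>) \<le> h * ((- K - real i) * of_int (\<mu> i))"
              using False elim by (intro mult_left_mono) (auto simp: algebra_simps)
            then show ?thesis by (meson add_increasing exp_ge_zero exp_le_cancel_iff order_trans)
          qed
        qed auto
        also have "\<dots> = (\<Sum>X\<in>Pow {..<N}. (\<Prod>i\<in>X. exp (h * ((K + real i) * of_int (\<mu> i)))) * (\<Prod>i\<in>{..<N} - X. exp (h * ((- K - real i) * of_int (\<mu> i)))))"
          by (rule prod_add) simp
        also have "\<dots> = (\<Sum>X\<in>Pow {..<N}. exp (h * weight_pairing N (r X) \<mu>))"
        proof (intro sum.cong refl)
          fix X assume X: "X \<in> Pow {..<N}"
          have "exp (h * weight_pairing N (r X) \<mu>) = (\<Prod>i<N. exp (h * (r X i * of_int (\<mu> i))))"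
            by (simp add: weight_pairing_def exp_sum sum_distrib_left)
          also have "\<dots> = (\<Prod>i\<in>X. exp (h * (r X i * of_int (\<mu> i)))) * (\<Prod>i\<in>{..<N} - X. exp (h * (r X i * of_int (\<mu> i))))"
            using X by (subst prod.subset_diff[of X "{..<N}"]) (auto simp: mult.commute)
          also have "\<dots> = (\<Prod>i\<in>X. exp (h * ((K + real i) * of_int (\<mu> i)))) * (\<Prod>i\<in>{..<N} - X. exp (h * ((- K - real i) * of_int (\<mu> i))))"
            by (intro arg_cong2[where f = "(*)"] prod.cong refl) (auto simp: r_def)
          finally show "(\<Prod>i\<in>X. exp (h * ((K + real i) * of_int (\<mu> i)))) * (\<Prod>i\<in>{..<N} - X. exp (h * ((- K - real i) * of_int (\<mu> i)))) = exp (h * weight_pairing N (r X) \<mu>)" by simp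
        qed
        finally show ?thesis by (simp add: B_def)
      qed
      have "h ^ (\<Sum>j<N. j) * (\<Sum>b<d. exp (h * weight_pairing N s (w b)) * (h * (\<Sum>i<N. \<bar>of_int (w b i)\<bar>)))
          \<le> h ^ (\<Sum>j<N. j) * (\<Sum>b<d. \<Sum>X\<in>Pow {..<N}. exp (h * weight_pairing N (r X) (w b)))"
        using elim by (intro mult_left_mono sum_mono corner) auto
      also have "\<dots> = (\<Sum>X\<in>Pow {..<N}. h ^ (\<Sum>j<N. j) * (\<Sum>b<d. exp (h * weight_pairing N (r X) (w b))))"
        by (subst sum.swap) (simp add: sum_distrib_left)
      also have "\<dots> \<le> (\<Sum>X\<in>Pow {..<N}. norm (L X) + 1)"
        by (intro sum_mono FX)
      finally show "h ^ (\<Sum>j<N. j) * (\<Sum>b<d. exp (h * weight_pairing N s (w b)) * (h * (\<Sum>i<N. \<bar>of_int (w b i)\<bar>))) \<le> (\<Sum>X\<in>Pow {..<N}. norm (L X) + 1)" .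
    qed
  qed
  then show ?thesis by blast
qed

text \<open>The factor \<open>i + 1\<close> makes the parameters distinct for small \<open>\<delta> > 0\<close>, and real shifts keep the imaginary parts on which
the contour depends.\<close>

definition shifted :: "(nat \<Rightarrow> complex) \<Rightarrow> real \<Rightarrow> nat \<Rightarrow> complex" where
  "shifted lam \<delta> i = lam i + of_real (\<delta> * (real i + 1))"

lemma eventually_shifted_inj: "eventually (\<lambda>\<delta>. inj_on (shifted lam \<delta>) {..<N}) (at_right 0)"
proof -
  have "eventually (\<lambda>\<delta>. \<forall>i\<in>{..<N}. \<forall>j\<in>{..<N}. i \<noteq> j \<longrightarrow> shifted lam \<delta> i \<noteq> shifted lam \<delta> j) (at_right 0)"
  proof (intro eventually_ball_finite finite_lessThan ballI)
    fix i j
    show "eventually (\<lambda>\<delta>. i \<noteq> j \<longrightarrow> shifted lam \<delta> i \<noteq> shifted lam \<delta> j) (at_right 0)"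
    proof (cases "lam i = lam j")
      case True
      show ?thesis
        using eventually_at_right_less[of "0::real"]
        by eventually_elim (auto simp: shifted_def True)
    next
      case False
      have "((\<lambda>\<delta>. shifted lam \<delta> i - shifted lam \<delta> j) \<longlongrightarrow> (lam i + of_real (0 * (real i + 1))) - (lam j + of_real (0 * (real j + 1)))) (at_right 0)"
        unfolding shifted_def by (intro tendsto_intros)
      then have "eventually (\<lambda>\<delta>. shifted lam \<delta> i - shifted lam \<delta> j \<noteq> 0) (at_right 0)"
        by (rule tendsto_imp_eventually_ne) (use False in simp)
      then show ?thesis by eventually_elim auto
    qed
  qed
  then show ?thesis by eventually_elim (auto simp: inj_on_def)
qed

text \<open>The estimate \<open>|exp (\<i> y) - 1| \<le> |y|\<close> for each weight, summed by \<open>weighted_dimension_bound\<close>.\<close>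

lemma q0_at_shift_lipschitz:
  assumes dom: "dominant_pt N x"
  shows "\<exists>C. eventually (\<lambda>h. \<forall>\<delta>\<ge>0. norm (of_real h ^ (\<Sum>j<N. j) * q0_at N (shifted lam \<delta>) x h - of_real h ^ (\<Sum>j<N. j) * q0_at N lam x h) \<le> \<delta> * C) (at_right 0)"
proof -
  define s where "s i = - Im (lam i)" for i
  obtain C where "eventually (\<lambda>h. \<forall>d w. weight_list N (floor_weight x h) = (d, w) \<longrightarrow>
    h ^ (\<Sum>j<N. j) * (\<Sum>b<d. exp (h * weight_pairing N s (w b)) * (h * (\<Sum>i<N. \<bar>of_int (w b i)\<bar>))) \<le> C) (at_right 0)"
    using weighted_dimension_bound[OF dom] by blast
  then have "eventually (\<lambda>h. \<forall>\<delta>\<ge>0. norm (of_real h ^ (\<Sum>j<N. j) * q0_at N (shifted lam \<delta>) x h - of_real h ^ (\<Sum>j<N. j) * q0_at N lam x h) \<le> \<delta> * (real N * C)) (at_right 0)"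
    using eventually_at_right_less[of "0::real"]
  proof eventually_elim
    case (elim h)
    obtain d w where dw: "weight_list N (floor_weight x h) = (d, w)" by (cases "weight_list N (floor_weight x h)")
    have C: "h ^ (\<Sum>j<N. j) * (\<Sum>b<d. exp (h * weight_pairing N s (w b)) * (h * (\<Sum>i<N. \<bar>of_int (w b i)\<bar>))) \<le> C"
      using elim(1) dw by blast
    show ?case
    proof (intro allI impI)
      fix \<delta> :: real assume \<delta>: "\<delta> \<ge> 0"
      have diff: "norm (exp (\<i> * of_real h * weight_pairing N (shifted lam \<delta>) \<mu>) - exp (\<i> * of_real h * weight_pairing N lam \<mu>))
          \<le> \<delta> * real N * (exp (h * weight_pairing N s \<mu>) * (h * (\<Sum>i<N. \<bar>of_int (\<mu> i)\<bar>)))" for \<mu>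
      proof -
        define y where "y = h * \<delta> * (\<Sum>i<N. (real i + 1) * of_int (\<mu> i))"
        have "weight_pairing N (shifted lam \<delta>) \<mu> = weight_pairing N lam \<mu> + of_real (\<delta> * (\<Sum>i<N. (real i + 1) * of_int (\<mu> i)))"
        proof -
          have "weight_pairing N (shifted lam \<delta>) \<mu> = (\<Sum>i<N. lam i * of_int (\<mu> i) + of_real (\<delta> * ((real i + 1) * of_int (\<mu> i))))"
            unfolding weight_pairing_def by (intro sum.cong refl) (simp add: shifted_def algebra_simps)
          also have "\<dots> = weight_pairing N lam \<mu> + of_real (\<delta> * (\<Sum>i<N. (real i + 1) * of_int (\<mu> i)))"
            by (simp only: weight_pairing_def sum.distrib of_real_sum[symmetric] sum_distrib_left[symmetric])
          finally show ?thesis .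
        qed
        then have "\<i> * of_real h * weight_pairing N (shifted lam \<delta>) \<mu> = \<i> * of_real h * weight_pairing N lam \<mu> + \<i> * of_real y"
          by (simp add: y_def algebra_simps)
        then have "exp (\<i> * of_real h * weight_pairing N (shifted lam \<delta>) \<mu>) - exp (\<i> * of_real h * weight_pairing N lam \<mu>)
            = exp (\<i> * of_real h * weight_pairing N lam \<mu>) * (exp (\<i> * of_real y) - 1)"
          by (simp add: exp_add algebra_simps)
        then have "norm (exp (\<i> * of_real h * weight_pairing N (shifted lam \<delta>) \<mu>) - exp (\<i> * of_real h * weight_pairing N lam \<mu>))
            = norm (exp (\<i> * of_real h * weight_pairing N lam \<mu>)) * norm (exp (\<i> * of_real y) - 1)"
          by (simp only: norm_mult)
        also have "norm (exp (\<i> * of_real h * weight_pairing N lam \<mu>)) = exp (h * weight_pairing N s \<mu>)"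
        proof -
          have "Re (\<i> * of_real h * weight_pairing N lam \<mu>) = h * weight_pairing N s \<mu>"
            by (simp add: weight_pairing_def s_def sum_negf sum_distrib_left algebra_simps)
          then show ?thesis by (simp only: norm_exp_eq_Re)
        qed
        also have "exp (h * weight_pairing N s \<mu>) * norm (exp (\<i> * of_real y) - 1) \<le> exp (h * weight_pairing N s \<mu>) * \<bar>y\<bar>"
        proof (intro mult_left_mono)
          have "norm (exp (\<i> * of_real y) - 1) = 2 * \<bar>sin (y / 2)\<bar>"
            using dist_exp_i_1[of y] by (simp add: dist_norm)
          also have "\<dots> \<le> \<bar>y\<bar>" using abs_sin_x_le_abs_x[of "y / 2"] by simp
          finally show "norm (exp (\<i> * of_real y) - 1) \<le> \<bar>y\<bar>" .
        qed simp
        also have "\<bar>y\<bar> \<le> \<delta> * real N * (h * (\<Sum>i<N. \<bar>of_int (\<mu> i)\<bar>))"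
        proof -
          have "\<bar>\<Sum>i<N. (real i + 1) * of_int (\<mu> i)\<bar> \<le> (\<Sum>i<N. \<bar>(real i + 1) * of_int (\<mu> i)\<bar>)"
            by (rule sum_abs)
          also have "\<dots> \<le> (\<Sum>i<N. real N * \<bar>of_int (\<mu> i)\<bar>)"
            by (intro sum_mono) (auto simp: abs_mult intro!: mult_right_mono)
          finally have "\<bar>\<Sum>i<N. (real i + 1) * of_int (\<mu> i)\<bar> \<le> real N * (\<Sum>i<N. \<bar>of_int (\<mu> i)\<bar>)"
            by (simp add: sum_distrib_left)
          then have "h * \<delta> * \<bar>\<Sum>i<N. (real i + 1) * of_int (\<mu> i)\<bar> \<le> h * \<delta> * (real N * (\<Sum>i<N. \<bar>of_int (\<mu> i)\<bar>))"
            using elim \<delta> by (intro mult_left_mono) auto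
          then show ?thesis using elim \<delta> by (simp add: y_def abs_mult mult_ac)
        qed
        finally show ?thesis by (simp add: mult_ac mult_left_mono)
      qed
      have "norm (of_real h ^ (\<Sum>j<N. j) * q0_at N (shifted lam \<delta>) x h - of_real h ^ (\<Sum>j<N. j) * q0_at N lam x h)
         = h ^ (\<Sum>j<N. j) * norm (\<Sum>b<d. exp (\<i> * of_real h * weight_pairing N (shifted lam \<delta>) (w b)) - exp (\<i> * of_real h * weight_pairing N lam (w b)))"
        unfolding q0_at_weight_sum[OF dom elim(2) dw] right_diff_distrib[symmetric] sum_subtractf[symmetric]
        using elim by (simp add: norm_mult norm_power)
      also have "\<dots> \<le> h ^ (\<Sum>j<N. j) * (\<Sum>b<d. \<delta> * real N * (exp (h * weight_pairing N s (w b)) * (h * (\<Sum>i<N. \<bar>of_int (w b i)\<bar>))))"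
        using elim by (intro mult_left_mono sum_norm_le diff) auto
      also have "\<dots> = \<delta> * real N * (h ^ (\<Sum>j<N. j) * (\<Sum>b<d. exp (h * weight_pairing N s (w b)) * (h * (\<Sum>i<N. \<bar>of_int (w b i)\<bar>))))"
        by (simp add: sum_distrib_left mult_ac)
      also have "\<dots> \<le> \<delta> * real N * C" using \<delta> C by (intro mult_left_mono) auto
      finally show "norm (of_real h ^ (\<Sum>j<N. j) * q0_at N (shifted lam \<delta>) x h - of_real h ^ (\<Sum>j<N. j) * q0_at N lam x h) \<le> \<delta> * (real N * C)"
        by (simp add: mult_ac)
    qed
  qed
  then show ?thesis by blast
qed

text \<open>The limits in \<open>\<delta>\<close> and in \<open>h\<close> may be exchanged by the uniform Lipschitz bound. The hypothesis that the limit \<open>\<Phi>\<close> in \<open>\<delta>\<close> exists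
will be provided by the integral.\<close>

theorem q0_at_limit:
  assumes dom: "dominant_pt N x"
    and lim: "((\<lambda>\<delta>. char_limit N (shifted lam \<delta>) x) \<longlongrightarrow> \<Phi>) (at_right 0)"
  shows "((\<lambda>h. of_real h ^ (\<Sum>j<N. j) * q0_at N lam x h) \<longlongrightarrow> \<Phi>) (at_right 0)"
proof (rule tendstoI)
  fix e :: real assume e: "e > 0"
  define F where "F lam h = of_real h ^ (\<Sum>j<N. j) * q0_at N lam x h" for lam h
  obtain C where C: "eventually (\<lambda>h. \<forall>\<delta>\<ge>0. norm (F (shifted lam \<delta>) h - F lam h) \<le> \<delta> * C) (at_right 0)"
    using q0_at_shift_lipschitz[OF dom, of lam] unfolding F_def by blast
  have "((\<lambda>\<delta>. \<delta> * C) \<longlongrightarrow> 0 * C) (at_right 0)" by (intro tendsto_intros)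
  then have "eventually (\<lambda>\<delta>. \<delta> * C < e / 3) (at_right 0)"
    by (rule order_tendstoD) (use e in simp)
  moreover have "eventually (\<lambda>\<delta>. dist (char_limit N (shifted lam \<delta>) x) \<Phi> < e / 3) (at_right 0)"
    using lim e by (intro tendstoD) auto
  ultimately have "eventually (\<lambda>\<delta>. \<delta> * C < e / 3 \<and> dist (char_limit N (shifted lam \<delta>) x) \<Phi> < e / 3 \<and>
     inj_on (shifted lam \<delta>) {..<N} \<and> \<delta> > 0) (at_right 0)"
    using eventually_shifted_inj[of lam N] eventually_at_right_less[of "0::real"] by eventually_elim auto
  then obtain \<delta> where \<delta>: "\<delta> * C < e / 3" "dist (char_limit N (shifted lam \<delta>) x) \<Phi> < e / 3"
     "inj_on (shifted lam \<delta>) {..<N}" "\<delta> > 0"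
    using eventually_happens'[OF trivial_limit_at_right_real] by blast
  have "eventually (\<lambda>h. dist (F (shifted lam \<delta>) h) (char_limit N (shifted lam \<delta>) x) < e / 3) (at_right 0)"
    unfolding F_def using q0_at_distinct_limit[OF dom \<delta>(3)] e by (intro tendstoD) auto
  then show "eventually (\<lambda>h. dist (of_real h ^ (\<Sum>j<N. j) * q0_at N lam x h) \<Phi> < e) (at_right 0)"
    unfolding F_def[symmetric] using C
  proof eventually_elim
    case (elim h)
    have "dist (F lam h) (F (shifted lam \<delta>) h) < e / 3"
    proof -
      have "norm (F (shifted lam \<delta>) h - F lam h) \<le> \<delta> * C" using elim(2) \<delta>(4) by auto
      then show ?thesis using \<delta>(1) by (simp add: dist_norm norm_minus_commute)
    qed
    then show ?case using elim(1) \<delta>(2)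
      dist_triangle[of "F lam h" \<Phi> "F (shifted lam \<delta>) h"]
      dist_triangle[of "F (shifted lam \<delta>) h" \<Phi> "char_limit N (shifted lam \<delta>) x"] by linarith
  qed
qed

section \<open>Fourier integrals of rational functions of one variable\<close>

lemma nn_integral_powr_finite:
  fixes \<delta> :: real
  assumes "\<delta> > 0"
  shows "(\<integral>\<^sup>+u. ennreal ((1 + \<bar>u\<bar>) powr (- \<delta> - 1)) \<partial>lborel) \<le> ennreal (2 / \<delta>)"
proof -
  define f where "f u = (1 + \<bar>u\<bar>) powr (- \<delta> - 1)" for u :: real
  have [measurable]: "f \<in> borel_measurable borel" unfolding f_def by measurable
  have "(\<integral>\<^sup>+u. ennreal (f u) * indicator {0..} u \<partial>lborel) = ennreal (0 - (- ((1 + 0) powr (- \<delta>)) / \<delta>))"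
  proof (rule nn_integral_FTC_atLeast)
    show "((\<lambda>u. - ((1 + u) powr (- \<delta>)) / \<delta>) has_real_derivative f u) (at u)" if "0 \<le> u" for u
      using that assms unfolding f_def
      by (auto intro!: derivative_eq_intros simp: algebra_simps)
    have "filterlim (\<lambda>u::real. 1 + u) at_top at_top"
      by (rule filterlim_tendsto_add_at_top[OF tendsto_const filterlim_ident])
    then have "((\<lambda>u::real. (1 + u) powr (- \<delta>)) \<longlongrightarrow> 0) at_top"
      using assms by (intro tendsto_neg_powr) auto
    then have "((\<lambda>u::real. - ((1 + u) powr (- \<delta>)) / \<delta>) \<longlongrightarrow> - 0 / \<delta>) at_top"
      using assms by (intro tendsto_intros) auto
    then show "((\<lambda>u::real. - ((1 + u) powr (- \<delta>)) / \<delta>) \<longlongrightarrow> 0) at_top" by simp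
  qed (auto simp: f_def)
  then have half: "(\<integral>\<^sup>+u. ennreal (f u) * indicator {0..} u \<partial>lborel) = ennreal (1 / \<delta>)" by simp
  have "(\<integral>\<^sup>+u. ennreal (f u) * indicator {0..} u \<partial>lborel) = (\<integral>\<^sup>+u. ennreal (f (- u)) * indicator {0..} (- u) \<partial>lborel)"
    by (subst nn_integral_real_affine[of _ "-1" 0]) auto
  then have half': "(\<integral>\<^sup>+u. ennreal (f u) * indicator {0..} (- u) \<partial>lborel) = ennreal (1 / \<delta>)"
    using half by (simp add: f_def)
  have "(\<integral>\<^sup>+u. ennreal (f u) \<partial>lborel) \<le> (\<integral>\<^sup>+u. ennreal (f u) * indicator {0..} u + ennreal (f u) * indicator {0..} (- u) \<partial>lborel)"
    by (intro nn_integral_mono) (auto simp: indicator_def)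
  also have "\<dots> = ennreal (1 / \<delta>) + ennreal (1 / \<delta>)"
    by (subst nn_integral_add) (simp_all add: half half')
  also have "\<dots> = ennreal (2 / \<delta>)" using assms by (simp flip: ennreal_plus)
  finally show ?thesis by (simp add: f_def)
qed

lemma integrable_powr_decay:
  fixes \<delta> :: real
  assumes "\<delta> > 0"
  shows "integrable lborel (\<lambda>u. (1 + \<bar>u\<bar>) powr (- \<delta> - 1))"
  unfolding integrable_iff_bounded
  using nn_integral_powr_finite[OF assms] by (auto simp: less_top[symmetric] top_unique)

lemma integrable_inverse_square: "integrable lborel (\<lambda>u::real. 1 / (1 + \<bar>u\<bar>)\<^sup>2)"
proof -
  have "(1 + \<bar>u\<bar>) powr (- 1 - 1) = 1 / (1 + \<bar>u\<bar>)\<^sup>2" for u :: real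
    by (simp add: powr_minus divide_inverse powr_numeral)
  then show ?thesis using integrable_powr_decay[of 1] by simp
qed

lemma resolvent_lower_bound:
  fixes a :: complex
  assumes "\<bar>Im a\<bar> \<ge> \<eta>" "\<eta> > 0"
  shows "1 + \<bar>u\<bar> \<le> ((1 + norm a) / \<eta> + 1) * norm (of_real u - a)"
proof -
  have "\<eta> \<le> norm (of_real u - a)"
    using abs_Im_le_cmod[of "of_real u - a"] assms by simp
  then have "(1 + norm a) * 1 \<le> (1 + norm a) * (norm (of_real u - a) / \<eta>)"
    using assms by (intro mult_left_mono) auto
  moreover have "\<bar>u\<bar> \<le> norm (of_real u - a) + norm a"
    using norm_triangle_ineq[of "of_real u - a" a] by simp
  ultimately show ?thesis by (simp add: algebra_simps)
qed

text \<open>The difference of two resolvents decays quadratically, which makes the integral absolutely convergent. It is evaluated by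
residues in a large rectangle resting on the real line; for \<open>y \<ge> 0\<close> the exponential is bounded in the upper half plane.\<close>

lemma fourier_resolvent_difference:
  fixes a b :: complex
  assumes a: "Im a \<noteq> 0" and b: "Im b \<noteq> 0" and y: "y \<ge> 0"
  shows "integrable lborel (\<lambda>u. exp (\<i> * of_real u * of_real y) * (1 / (of_real u - a) - 1 / (of_real u - b)))" (is "integrable _ ?F")
    and "(LINT u|lborel. exp (\<i> * of_real u * of_real y) * (1 / (of_real u - a) - 1 / (of_real u - b))) =
      2 * pi * \<i> * ((if Im a > 0 then exp (\<i> * a * of_real y) else 0) - (if Im b > 0 then exp (\<i> * b * of_real y) else 0))"
proof -
  define f where "f w = exp (\<i> * w * of_real y) * (1 / (w - a) - 1 / (w - b))" for w
  define Ca where "Ca = (1 + norm a) / \<bar>Im a\<bar> + 1"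
  define Cb where "Cb = (1 + norm b) / \<bar>Im b\<bar> + 1"
  have na: "of_real u \<noteq> a" "of_real u \<noteq> b" for u using a b by auto
  have bound: "norm (?F u) \<le> norm (a - b) * Ca * Cb * (1 / (1 + \<bar>u\<bar>)\<^sup>2)" for u
  proof -
    have ra: "1 + \<bar>u\<bar> \<le> Ca * norm (of_real u - a)" unfolding Ca_def by (rule resolvent_lower_bound) (use a in auto)
    have rb: "1 + \<bar>u\<bar> \<le> Cb * norm (of_real u - b)" unfolding Cb_def by (rule resolvent_lower_bound) (use b in auto)
    have p: "norm (of_real u - a) > 0" "norm (of_real u - b) > 0" using na by auto
    have "norm (?F u) = norm (a - b) / (norm (of_real u - a) * norm (of_real u - b))"
    proof -
      have "1 / (of_real u - a) - 1 / (of_real u - b) = (a - b) / ((of_real u - a) * (of_real u - b))"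
        using na[of u] by (simp add: field_simps)
      moreover have "norm (exp (\<i> * of_real u * of_real y)) = 1" by (simp add: norm_exp_eq_Re)
      ultimately show ?thesis by (simp add: norm_mult norm_divide)
    qed
    moreover have "(1 + \<bar>u\<bar>)\<^sup>2 \<le> (Ca * norm (of_real u - a)) * (Cb * norm (of_real u - b))"
      unfolding power2_eq_square using ra rb by (intro mult_mono) auto
    then have "1 / (norm (of_real u - a) * norm (of_real u - b)) \<le> Ca * Cb * (1 / (1 + \<bar>u\<bar>)\<^sup>2)"
      using p by (simp add: field_simps)
    then have "norm (a - b) * (1 / (norm (of_real u - a) * norm (of_real u - b))) \<le> norm (a - b) * (Ca * Cb * (1 / (1 + \<bar>u\<bar>)\<^sup>2))"
      by (rule mult_left_mono) simp
    ultimately show ?thesis by (simp add: mult_ac)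
  qed
  show int: "integrable lborel ?F"
  proof (rule Bochner_Integration.integrable_bound[OF integrable_mult_right[OF integrable_inverse_square, of "norm (a - b) * Ca * Cb"]])
    show "AE u in lborel. norm (?F u) \<le> norm (norm (a - b) * Ca * Cb * (1 / (1 + \<bar>u\<bar>)\<^sup>2))"
      by (intro AE_I2 order.trans[OF bound]) (simp only: real_norm_def abs_ge_self)
  qed simp
  define V where "V = 2 * pi * \<i> * ((if Im a > 0 then exp (\<i> * a * of_real y) else 0) - (if Im b > 0 then exp (\<i> * b * of_real y) else 0))"
  define J where "J n = (LINT u|lborel. indicator {- real n..real n} u *\<^sub>R ?F u)" for n
  have J1: "J \<longlonglongrightarrow> (LINT u|lborel. ?F u)"
    unfolding J_def
  proof (rule integral_dominated_convergence[where w = "\<lambda>u. norm (?F u)"])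
    show "AE u in lborel. (\<lambda>n. indicator {- real n..real n} u *\<^sub>R ?F u) \<longlonglongrightarrow> ?F u"
    proof (rule AE_I2)
      fix u
      have "eventually (\<lambda>n. indicator {- real n..real n} u *\<^sub>R ?F u = ?F u) sequentially"
        using eventually_ge_at_top[of "nat \<lceil>\<bar>u\<bar>\<rceil>"]
      proof eventually_elim
        case (elim n)
        then have "\<bar>u\<bar> \<le> real n" by linarith
        then show ?case by (auto simp: indicator_def)
      qed
      then show "(\<lambda>n. indicator {- real n..real n} u *\<^sub>R ?F u) \<longlonglongrightarrow> ?F u" by (rule tendsto_eventually)
    qed
  qed (use int in \<open>auto simp: indicator_def\<close>)
  define M where "M = norm a + norm b + 1"
  have J2: "norm (J n - V) \<le> norm (a - b) / ((real n - norm a) * (real n - norm b)) * (4 * real n)" if n: "real n > M" for n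
  proof -
    define R where "R = real n"
    have R: "R > norm a" "R > norm b" "R > 0"
      using n norm_ge_zero[of a] norm_ge_zero[of b] unfolding M_def R_def by linarith+
    \<comment> \<open>The rectangle \<open>[- R, R] \<times> [0, R]\<close>. Its three upper sides have total length \<open>4 R\<close> and carry values of size \<open>O(1 / R\<^sup>2)\<close>.\<close>
    define c1 c2 c3 c4 where "c1 = complex_of_real (- R)" and "c2 = Complex R 0" and "c3 = Complex R R" and "c4 = Complex (- R) R"
    have c: "Re c1 = - R" "Im c1 = 0" "Re c2 = R" "Im c2 = 0" "Re c3 = R" "Im c3 = R" "Re c4 = - R" "Im c4 = R"
      by (simp_all add: c1_def c2_def c3_def c4_def)
    have rp: "rectpath c1 c3 = linepath c1 c2 +++ linepath c2 c3 +++ linepath c3 c4 +++ linepath c4 c1"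
      by (simp add: rectpath_def Let_def c c2_def c4_def)
    have reim: "\<bar>Re z\<bar> < R" "\<bar>Im z\<bar> < R" if "z \<in> {a, b}" for z
      using R abs_Re_le_cmod[of z] abs_Im_le_cmod[of z] that by auto
    have pimg: "path_image (rectpath c1 c3) \<subseteq> UNIV - {z}" if "z \<in> {a, b}" for z
      using reim[OF that] a b that R(3) by (subst path_image_rectpath) (auto simp: c)
    have wn: "winding_number (rectpath c1 c3) z = (if Im z > 0 then 1 else 0)" if z: "z \<in> {a, b}" for z
    proof (cases "Im z > 0")
      case True
      have "z \<in> box c1 c3" using reim[OF z] True by (auto simp: in_box_complex_iff c)
      then show ?thesis using True by (simp add: winding_number_rectpath)
    next
      case False
      have "z \<notin> cbox c1 c3" using False a b z by (auto simp: in_cbox_complex_iff c)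
      then show ?thesis using False R by (simp add: winding_number_rectpath_outside c)
    qed
    have cf: "((\<lambda>w. exp (\<i> * w * of_real y) / (w - z)) has_contour_integral
        (2 * pi * \<i> * winding_number (rectpath c1 c3) z * exp (\<i> * z * of_real y))) (rectpath c1 c3)" if "z \<in> {a, b}" for z
      by (rule Cauchy_integral_formula_convex_simple[where S = UNIV and f = "\<lambda>w. exp (\<i> * w * of_real y)"])
         (use pimg[OF that] in \<open>auto intro!: holomorphic_intros\<close>)
    have "(f has_contour_integral V) (rectpath c1 c3)"
    proof -
      have "((\<lambda>w. exp (\<i> * w * of_real y) / (w - a) - exp (\<i> * w * of_real y) / (w - b)) has_contour_integral
        (2 * pi * \<i> * winding_number (rectpath c1 c3) a * exp (\<i> * a * of_real y)
          - 2 * pi * \<i> * winding_number (rectpath c1 c3) b * exp (\<i> * b * of_real y))) (rectpath c1 c3)"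
        by (rule has_contour_integral_diff[OF cf cf]) auto
      moreover have "(\<lambda>w. exp (\<i> * w * of_real y) / (w - a) - exp (\<i> * w * of_real y) / (w - b)) = f"
        by (rule ext) (simp add: f_def right_diff_distrib)
      ultimately show ?thesis
        by (cases "Im a > 0"; cases "Im b > 0") (simp_all add: wn V_def right_diff_distrib)
    qed
    then have CV: "contour_integral (rectpath c1 c3) f = V" by (rule contour_integral_unique)
    have nab: "a \<notin> closed_segment p q" "b \<notin> closed_segment p q" if "(p, q) \<in> {(c1, c2), (c2, c3), (c3, c4), (c4, c1)}" for p q
      using pimg[of a] pimg[of b] that unfolding rp by (auto simp: path_image_join)
    have ci: "f contour_integrable_on linepath p q" if "(p, q) \<in> {(c1, c2), (c2, c3), (c3, c4), (c4, c1)}" for p q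
      using nab[OF that] unfolding f_def
      by (intro contour_integrable_continuous_linepath continuous_intros) auto
    have sum: "V = contour_integral (linepath c1 c2) f + (contour_integral (linepath c2 c3) f +
       (contour_integral (linepath c3 c4) f + contour_integral (linepath c4 c1) f))"
      unfolding CV[symmetric] rp by (simp add: ci)
    define B where "B = norm (a - b) / ((R - norm a) * (R - norm b))"
    have B0: "B \<ge> 0" using R by (simp add: B_def)
    have fB: "norm (f w) \<le> B" if w: "norm w \<ge> R" "Im w \<ge> 0" for w
    proof -
      have 1: "R - norm a \<le> norm (w - a)" "R - norm b \<le> norm (w - b)"
        using w(1) norm_triangle_ineq2[of w a] norm_triangle_ineq2[of w b] by linarith+
      have ne: "w \<noteq> a" "w \<noteq> b" using w R by auto
      have "f w = exp (\<i> * w * of_real y) * ((a - b) / ((w - a) * (w - b)))"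
        using ne by (simp add: f_def field_simps)
      then have "norm (f w) = norm (exp (\<i> * w * of_real y)) * (norm (a - b) / (norm (w - a) * norm (w - b)))"
        by (simp add: norm_mult norm_divide)
      also have "\<dots> \<le> 1 * (norm (a - b) / ((R - norm a) * (R - norm b)))"
      proof (rule mult_mono)
        show "norm (exp (\<i> * w * of_real y)) \<le> 1" using w y by (simp add: norm_exp_eq_Re)
        show "norm (a - b) / (norm (w - a) * norm (w - b)) \<le> norm (a - b) / ((R - norm a) * (R - norm b))"
          using 1 R by (intro divide_left_mono mult_mono mult_pos_pos) auto
      qed auto
      finally show ?thesis by (simp add: B_def)
    qed
    have seg: "norm (contour_integral (linepath p q) f) \<le> B * norm (q - p)" if "(p, q) \<in> {(c2, c3), (c3, c4), (c4, c1)}" for p q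
    proof (rule contour_integral_bound_linepath)
      show "f contour_integrable_on linepath p q" using that by (intro ci) auto
      fix w assume "w \<in> closed_segment p q"
      then have "(Re w = R \<or> Re w = - R \<or> Im w = R) \<and> Im w \<ge> 0"
        using that R by (auto simp: closed_segment_same_Re closed_segment_same_Im c closed_segment_eq_real_ivl split: if_splits)
      then show "norm (f w) \<le> B"
        using R abs_Re_le_cmod[of w] abs_Im_le_cmod[of w] by (intro fB) auto
    qed (rule B0)
    have len: "norm (c3 - c2) = R" "norm (c4 - c3) = 2 * R" "norm (c1 - c4) = R"
      using R(3) by (simp_all add: c1_def c2_def c3_def c4_def cmod_def real_sqrt_mult)
    have I1: "contour_integral (linepath c1 c2) f = J n"
    proof -
      have c2: "c2 = of_real R" by (simp add: c2_def complex_of_real_def)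
      have "contour_integral (linepath c1 c2) f = integral {- R..R} (\<lambda>x. f (of_real x))"
        using R by (subst contour_integral_linepath_Reals_eq) (auto simp: c1_def c2)
      also have "\<dots> = (LINT u:{- R..R}|lborel. ?F u)"
      proof -
        have "set_integrable lborel {- R..R} ?F"
          unfolding set_integrable_def using int by (intro integrable_mult_indicator) auto
        from set_borel_integral_eq_integral(2)[OF this] show ?thesis by (simp add: f_def)
      qed
      finally show ?thesis by (simp add: J_def set_lebesgue_integral_def R_def)
    qed
    have "J n - V = - (contour_integral (linepath c2 c3) f + (contour_integral (linepath c3 c4) f + contour_integral (linepath c4 c1) f))"
      using sum I1 by simp
    then have "norm (J n - V) = norm (contour_integral (linepath c2 c3) f + (contour_integral (linepath c3 c4) f + contour_integral (linepath c4 c1) f))"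
      by (simp only: norm_minus_cancel)
    also have "\<dots> \<le> B * norm (c3 - c2) + (B * norm (c4 - c3) + B * norm (c1 - c4))"
      by (intro norm_triangle_le add_mono seg) auto
    also have "\<dots> = B * (4 * R)" by (simp add: len)
    finally show ?thesis by (simp add: B_def R_def)
  qed
  have "(\<lambda>n. norm (a - b) / ((real n - norm a) * (real n - norm b)) * (4 * real n)) \<longlonglongrightarrow> 0"
    by real_asymp
  then have "(\<lambda>n. J n - V) \<longlonglongrightarrow> 0"
  proof (rule Lim_null_comparison[rotated])
    show "eventually (\<lambda>n. norm (J n - V) \<le> norm (a - b) / ((real n - norm a) * (real n - norm b)) * (4 * real n)) sequentially"
      using eventually_gt_at_top[of "nat \<lceil>M\<rceil>"]
    proof eventually_elim
      case (elim n)
      then have "real n > M" by linarith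
      then show ?case by (rule J2)
    qed
  qed
  then have "J \<longlonglongrightarrow> V" by (simp add: LIM_zero_iff)
  with J1 show "(LINT u|lborel. ?F u) = 2 * pi * \<i> * ((if Im a > 0 then exp (\<i> * a * of_real y) else 0) - (if Im b > 0 then exp (\<i> * b * of_real y) else 0))"
    unfolding V_def by (rule LIMSEQ_unique)
qed

text \<open>For \<open>y < 0\<close> the substitution \<open>u \<mapsto> - u\<close> moves both poles to the lower half plane.\<close>

lemma fourier_resolvent_difference_upper:
  fixes a b :: complex and y :: real
  assumes a: "Im a > 0" and b: "Im b > 0"
  shows "integrable lborel (\<lambda>u. exp (\<i> * of_real u * of_real y) * (1 / (of_real u - a) - 1 / (of_real u - b)))"
    and "(LINT u|lborel. exp (\<i> * of_real u * of_real y) * (1 / (of_real u - a) - 1 / (of_real u - b))) =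
      (if y \<ge> 0 then 2 * pi * \<i> * (exp (\<i> * a * of_real y) - exp (\<i> * b * of_real y)) else 0)"
proof -
  define F where "F u = exp (\<i> * of_real u * of_real y) * (1 / (of_real u - a) - 1 / (of_real u - b))" for u :: real
  define G where "G u = exp (\<i> * of_real u * of_real (- y)) * (1 / (of_real u - (- a)) - 1 / (of_real u - (- b)))" for u :: real
  have FG: "F (0 + (- 1) * u) = - G u" for u
  proof -
    have "1 / (- of_real u - a) = - (1 / (of_real u + a))" "1 / (- of_real u - b) = - (1 / (of_real u + b))"
      by (metis add.commute minus_add_distrib minus_divide_right uminus_add_conv_diff diff_conv_add_uminus)+
    then show ?thesis by (simp add: F_def G_def algebra_simps)
  qed
  have "integrable lborel F \<and> (LINT u|lborel. F u) =
      (if y \<ge> 0 then 2 * pi * \<i> * (exp (\<i> * a * of_real y) - exp (\<i> * b * of_real y)) else 0)"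
  proof (cases "y \<ge> 0")
    case True
    then show ?thesis
      using fourier_resolvent_difference[of a b y] a b unfolding F_def by simp
  next
    case False
    then have "integrable lborel G" "(LINT u|lborel. G u) = 0"
      using fourier_resolvent_difference[of "- a" "- b" "- y"] a b unfolding G_def by simp_all
    then have "integrable lborel (\<lambda>u. F (0 + (- 1) * u))" "(LINT u|lborel. F (0 + (- 1) * u)) = 0"
      unfolding FG by simp_all
    then show ?thesis
      using lborel_integrable_real_affine_iff[of "-1" F 0] lborel_integral_real_affine[of "-1" F 0] False by simp
  qed
  then show "integrable lborel (\<lambda>u. exp (\<i> * of_real u * of_real y) * (1 / (of_real u - a) - 1 / (of_real u - b)))"
    "(LINT u|lborel. exp (\<i> * of_real u * of_real y) * (1 / (of_real u - a) - 1 / (of_real u - b))) =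
      (if y \<ge> 0 then 2 * pi * \<i> * (exp (\<i> * a * of_real y) - exp (\<i> * b * of_real y)) else 0)"
    unfolding F_def by blast+
qed

text \<open>Partial fractions with coefficients \<open>c m\<close>, whose sum vanishes because \<open>k < n\<close>. This allows subtracting the
  same resolvent from every term, so that each term is integrable.\<close>

lemma rational_fourier_integral:
  fixes lam :: "nat \<Rightarrow> complex" and \<epsilon> y :: real
  assumes inj: "inj_on lam {..n}" and up: "\<And>m. m \<le> n \<Longrightarrow> - \<epsilon> < Im (lam m)" and k: "k < n"
  defines "\<gamma> \<equiv> \<lambda>u. complex_of_real u - \<i> * complex_of_real \<epsilon>"
  shows "integrable lborel (\<lambda>u. \<gamma> u ^ k * exp (\<i> * \<gamma> u * of_real y) / (\<Prod>m\<le>n. \<gamma> u - lam m))" (is ?int)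
    and "(LINT u|lborel. \<gamma> u ^ k * exp (\<i> * \<gamma> u * of_real y) / (\<Prod>m\<le>n. \<gamma> u - lam m)) =
      (if y \<ge> 0 then 2 * pi * \<i> * (\<Sum>m\<le>n. lam m ^ k / (\<Prod>j\<in>{..n} - {m}. lam m - lam j) * exp (\<i> * lam m * of_real y)) else 0)" (is ?val)
proof -
  define c where "c m = lam m ^ k / (\<Prod>j\<in>{..n} - {m}. lam m - lam j)" for m
  define a where "a m = lam m + \<i> * of_real \<epsilon>" for m
  have ap: "Im (a m) > 0" if "m \<le> n" for m using up[OF that] by (simp add: a_def)
  have dg: "degree (Polynomial.monom (1::complex) k) < card {..n}"
    using k by (simp add: degree_monom_eq)
  have c0: "(\<Sum>m\<le>n. c m) = 0"
    using lagrange_interpolation(2)[OF finite_atMost inj dg] k by (simp add: c_def poly_monom)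
  define T where "T m u = exp (\<i> * of_real u * of_real y) * (1 / (of_real u - a m) - 1 / (of_real u - a 0))" for m and u :: real
  have decomp: "\<gamma> u ^ k * exp (\<i> * \<gamma> u * of_real y) / (\<Prod>m\<le>n. \<gamma> u - lam m) =
      (\<Sum>m\<le>n. exp (of_real (\<epsilon> * y)) * c m * T m u)" for u
  proof -
    have ne: "\<gamma> u - lam m \<noteq> 0" if "m \<le> n" for m
      using up[OF that] by (auto simp: \<gamma>_def complex_eq_iff)
    have gm: "\<gamma> u - lam m = of_real u - a m" for m by (simp add: \<gamma>_def a_def)
    have "\<gamma> u ^ k = (\<Sum>m\<le>n. c m * (\<Prod>j\<in>{..n} - {m}. \<gamma> u - lam j))"
      using lagrange_interpolation(1)[OF finite_atMost inj dg, of "\<gamma> u"] by (simp add: poly_monom c_def)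
    then have "\<gamma> u ^ k / (\<Prod>m\<le>n. \<gamma> u - lam m) = (\<Sum>m\<le>n. c m * (\<Prod>j\<in>{..n} - {m}. \<gamma> u - lam j) / (\<Prod>m\<le>n. \<gamma> u - lam m))"
      by (simp only: sum_divide_distrib)
    also have "\<dots> = (\<Sum>m\<le>n. c m * (1 / (\<gamma> u - lam m)))"
    proof (intro sum.cong refl)
      fix m assume m: "m \<in> {..n}"
      have "(\<Prod>j\<le>n. \<gamma> u - lam j) = (\<gamma> u - lam m) * (\<Prod>j\<in>{..n} - {m}. \<gamma> u - lam j)"
        using m by (simp add: prod.remove)
      moreover have "(\<Prod>j\<in>{..n} - {m}. \<gamma> u - lam j) \<noteq> 0" using ne by auto
      ultimately show "c m * (\<Prod>j\<in>{..n} - {m}. \<gamma> u - lam j) / (\<Prod>m\<le>n. \<gamma> u - lam m) = c m * (1 / (\<gamma> u - lam m))"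
        by simp
    qed
    also have "\<dots> = (\<Sum>m\<le>n. c m * (1 / (\<gamma> u - lam m))) - (\<Sum>m\<le>n. c m) * (1 / (\<gamma> u - lam 0))"
      by (simp add: c0)
    also have "\<dots> = (\<Sum>m\<le>n. c m * (1 / (of_real u - a m) - 1 / (of_real u - a 0)))"
      by (simp add: gm sum_distrib_right sum_subtractf right_diff_distrib sum_divide_distrib)
    finally have 1: "\<gamma> u ^ k / (\<Prod>m\<le>n. \<gamma> u - lam m) = (\<Sum>m\<le>n. c m * (1 / (of_real u - a m) - 1 / (of_real u - a 0)))" .
    have "\<i> * \<gamma> u * of_real y = of_real (\<epsilon> * y) + \<i> * of_real u * of_real y"
      by (simp add: \<gamma>_def complex_eq_iff algebra_simps)
    then have "exp (\<i> * \<gamma> u * of_real y) = exp (of_real (\<epsilon> * y)) * exp (\<i> * of_real u * of_real y)"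
      by (simp only: exp_add)
    then have "\<gamma> u ^ k * exp (\<i> * \<gamma> u * of_real y) / (\<Prod>m\<le>n. \<gamma> u - lam m) =
        exp (of_real (\<epsilon> * y)) * exp (\<i> * of_real u * of_real y) * (\<gamma> u ^ k / (\<Prod>m\<le>n. \<gamma> u - lam m))"
      by simp
    also have "\<dots> = (\<Sum>m\<le>n. exp (of_real (\<epsilon> * y)) * c m * T m u)"
      unfolding 1 sum_distrib_left by (intro sum.cong refl) (simp only: T_def mult_ac)
    finally show ?thesis .
  qed
  have Ti: "integrable lborel (T m)" and Tv: "(LINT u|lborel. T m u) =
      (if y \<ge> 0 then 2 * pi * \<i> * (exp (\<i> * a m * of_real y) - exp (\<i> * a 0 * of_real y)) else 0)" if "m \<le> n" for m
    using fourier_resolvent_difference_upper[OF ap[OF that] ap[of 0], of y] unfolding T_def by auto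
  show ?int
    unfolding decomp using Ti by (intro Bochner_Integration.integrable_sum integrable_mult_right) auto
  have "(LINT u|lborel. \<gamma> u ^ k * exp (\<i> * \<gamma> u * of_real y) / (\<Prod>m\<le>n. \<gamma> u - lam m)) =
      (\<Sum>m\<le>n. exp (of_real (\<epsilon> * y)) * c m * (LINT u|lborel. T m u))"
    unfolding decomp using Ti by (subst Bochner_Integration.integral_sum) auto
  also have "\<dots> = (if y \<ge> 0 then 2 * pi * \<i> * (\<Sum>m\<le>n. c m * exp (\<i> * lam m * of_real y)) else 0)"
  proof (cases "y \<ge> 0")
    case True
    have ex: "exp (of_real (\<epsilon> * y)) * exp (\<i> * a m * of_real y) = exp (\<i> * lam m * of_real y)" for m
    proof -
      have "of_real (\<epsilon> * y) + \<i> * a m * of_real y = \<i> * lam m * of_real y"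
        by (simp add: a_def complex_eq_iff algebra_simps)
      then show ?thesis by (simp only: exp_add[symmetric])
    qed
    have "(\<Sum>m\<le>n. exp (of_real (\<epsilon> * y)) * c m * (LINT u|lborel. T m u)) =
        (\<Sum>m\<le>n. 2 * pi * \<i> * c m * (exp (of_real (\<epsilon> * y)) * exp (\<i> * a m * of_real y) - exp (of_real (\<epsilon> * y)) * exp (\<i> * a 0 * of_real y)))"
      by (intro sum.cong refl) (use True in \<open>simp add: Tv algebra_simps\<close>)
    also have "\<dots> = 2 * pi * \<i> * ((\<Sum>m\<le>n. c m * exp (\<i> * lam m * of_real y)) - (\<Sum>m\<le>n. c m) * exp (\<i> * lam 0 * of_real y))"
      unfolding ex by (simp add: right_diff_distrib sum_subtractf sum_distrib_left sum_distrib_right mult_ac)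
    finally show ?thesis using True by (simp add: c0)
  qed (simp add: Tv)
  finally show ?val by (simp add: c_def)
qed

section \<open>The integral over one row of variables\<close>

lemma prod_offdiagonal:
  fixes f :: "nat \<Rightarrow> nat \<Rightarrow> 'a :: comm_monoid_mult"
  shows "(\<Prod>i<n. \<Prod>j\<in>{..<n} - {i}. f i j) = (\<Prod>j<n. \<Prod>i<j. f i j * f j i)"
proof (induction n)
  case (Suc n)
  have "(\<Prod>j\<in>{..<Suc n} - {i}. f i j) = (\<Prod>j\<in>{..<n} - {i}. f i j) * f i n" if "i < n" for i
  proof -
    have "{..<Suc n} - {i} = insert n ({..<n} - {i})" using that by auto
    then show ?thesis by (simp add: mult.commute)
  qed
  then have "(\<Prod>i<n. \<Prod>j\<in>{..<Suc n} - {i}. f i j) = (\<Prod>i<n. (\<Prod>j\<in>{..<n} - {i}. f i j) * f i n)"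
    by (intro prod.cong refl) auto
  moreover have "{..<Suc n} - {n} = {..<n}" by auto
  ultimately show ?case
    using Suc by (simp add: prod.distrib mult_ac)
qed simp

text \<open>The variables \<open>u (n, j)\<close>, \<open>1 \<le> j \<le> n\<close>, of one row; \<open>row_point\<close> is the corresponding point of the contour, indexed from \<open>0\<close>.\<close>

definition row_index :: "nat \<Rightarrow> (nat \<times> nat) set" where
  "row_index n = (\<lambda>a. (n, Suc a)) ` {..<n}"

lemma row_index_inj: "inj_on (\<lambda>a. (n, Suc a)) {..<n}"
  by (auto simp: inj_on_def)

lemma finite_row_index [simp]: "finite (row_index n)"
  by (simp add: row_index_def)

lemma prod_row_index: "(\<Prod>i\<in>row_index n. F i) = (\<Prod>a<n. F (n, Suc a))"
  by (simp add: row_index_def prod.reindex[OF row_index_inj])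

definition row_point :: "nat \<Rightarrow> (nat \<Rightarrow> real) \<Rightarrow> (nat \<times> nat \<Rightarrow> real) \<Rightarrow> nat \<Rightarrow> complex" where
  "row_point n \<epsilon> u a = complex_of_real (u (n, Suc a)) - \<i> * complex_of_real (\<epsilon> a)"

interpretation lborel_product: product_sigma_finite "\<lambda>_ :: nat \<times> nat. lborel :: real measure"
  by unfold_locales

text \<open>The Leibniz expansions turn the integral into a double sum of products of one-dimensional integrals. By symmetry it equals
\<open>n!\<close> times the determinant of the integrals \<open>G k b\<close>. By residues these are sums over the \<open>n + 1\<close> parameters; extended
to \<open>k = n\<close> and \<open>b = n\<close> the sums have a unit vector as last column by Lagrange interpolation, and the enlarged matrix is the product
of a rescaled Vandermonde matrix and the matrix of exponentials.\<close>

theorem row_integral: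
  fixes lam :: "nat \<Rightarrow> complex" and x :: "nat \<Rightarrow> real" and \<epsilon> :: "nat \<Rightarrow> real"
  assumes inj: "inj_on lam {..n}" and up: "\<And>a m. a < n \<Longrightarrow> m \<le> n \<Longrightarrow> - \<epsilon> a < Im (lam m)"
  shows "(LINT u|PiM (row_index n) (\<lambda>_. lborel).
      leibniz n (\<lambda>a b. row_point n \<epsilon> u a ^ b) / (\<Prod>a<n. \<Prod>m\<le>n. row_point n \<epsilon> u a - lam m) *
      leibniz n (\<lambda>a b. exp (\<i> * row_point n \<epsilon> u a * of_real (x b))) *
      exp (\<i> * ((\<Sum>m\<le>n. lam m) - (\<Sum>a<n. row_point n \<epsilon> u a)) * of_real (x n))) =
    (if \<forall>b<n. x n \<le> x b
     then fact n * (2 * pi * \<i>) ^ n * leibniz (Suc n) (\<lambda>m b. exp (\<i> * lam m * of_real (x b))) /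
       (\<Prod>j<Suc n. \<Prod>i<j. lam i - lam j)
     else 0)"
proof -
  define S where "S = {p. p permutes {..<n}}"
  have fS: "finite S" by (simp add: S_def finite_permutations)
  define \<gamma> where "\<gamma> a t = complex_of_real t - \<i> * complex_of_real (\<epsilon> a)" for a t
  have rp: "row_point n \<epsilon> u a = \<gamma> a (u (n, Suc a))" for u a
    by (simp add: row_point_def \<gamma>_def)
  define \<phi> where "\<phi> a k b t = \<gamma> a t ^ k * exp (\<i> * \<gamma> a t * of_real (x b - x n)) / (\<Prod>m\<le>n. \<gamma> a t - lam m)" for a k b t
  define c where "c m = 1 / (\<Prod>j\<in>{..n} - {m}. lam m - lam j)" for m
  \<comment> \<open>The factor \<open>exp (- \<i> \<gamma>\<^sub>a x\<^sub>n)\<close> shifts all exponents by \<open>x n\<close>; the rest \<open>E\<close> of the last exponential is constant.\<close>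
  define G where "G k b = (if x b - x n \<ge> 0 then 2 * pi * \<i> * (\<Sum>m\<le>n. lam m ^ k * c m * exp (\<i> * lam m * of_real (x b - x n))) else 0)" for k b
  define E where "E = exp (\<i> * (\<Sum>m\<le>n. lam m) * of_real (x n))"
  have \<phi>: "integrable lborel (\<phi> a k b)" "(LINT t|lborel. \<phi> a k b t) = G k b" if "a < n" "k < n" for a k b
    using rational_fourier_integral[OF inj up[OF that(1)] that(2), of "x b - x n"]
    unfolding \<phi>_def \<gamma>_def G_def c_def by (simp_all add: divide_inverse)
  have integrand: "leibniz n (\<lambda>a b. row_point n \<epsilon> u a ^ b) / (\<Prod>a<n. \<Prod>m\<le>n. row_point n \<epsilon> u a - lam m) *
      leibniz n (\<lambda>a b. exp (\<i> * row_point n \<epsilon> u a * of_real (x b))) *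
      exp (\<i> * ((\<Sum>m\<le>n. lam m) - (\<Sum>a<n. row_point n \<epsilon> u a)) * of_real (x n)) =
     (\<Sum>p\<in>S. \<Sum>q\<in>S. E * of_int (sign p) * of_int (sign q) * (\<Prod>i\<in>row_index n. \<phi> (snd i - 1) (p (snd i - 1)) (q (snd i - 1)) (u i)))" for u
  proof -
    have e1: "exp (\<i> * ((\<Sum>m\<le>n. lam m) - (\<Sum>a<n. row_point n \<epsilon> u a)) * of_real (x n)) =
        E * (\<Prod>a<n. exp (- (\<i> * row_point n \<epsilon> u a * of_real (x n))))"
    proof -
      have "\<i> * ((\<Sum>m\<le>n. lam m) - (\<Sum>a<n. row_point n \<epsilon> u a)) * of_real (x n) =
         \<i> * (\<Sum>m\<le>n. lam m) * of_real (x n) + (\<Sum>a<n. - (\<i> * row_point n \<epsilon> u a * of_real (x n)))"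
        by (simp add: right_diff_distrib left_diff_distrib sum_negf sum_distrib_left sum_distrib_right)
      then show ?thesis by (simp only: exp_add E_def exp_sum finite_lessThan)
    qed
    have trm: "(\<Prod>a<n. row_point n \<epsilon> u a ^ p a) / (\<Prod>a<n. \<Prod>m\<le>n. row_point n \<epsilon> u a - lam m) *
        (\<Prod>a<n. exp (\<i> * row_point n \<epsilon> u a * of_real (x (q a)))) * (\<Prod>a<n. exp (- (\<i> * row_point n \<epsilon> u a * of_real (x n)))) =
        (\<Prod>i\<in>row_index n. \<phi> (snd i - 1) (p (snd i - 1)) (q (snd i - 1)) (u i))" for p q
      unfolding prod_row_index prod_dividef[symmetric] prod.distrib[symmetric]
    proof (intro prod.cong refl)
      fix a assume "a \<in> {..<n}"
      have "exp (\<i> * row_point n \<epsilon> u a * of_real (x (q a))) * exp (- (\<i> * row_point n \<epsilon> u a * of_real (x n))) =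
          exp (\<i> * row_point n \<epsilon> u a * of_real (x (q a) - x n))"
        by (simp add: exp_add[symmetric] right_diff_distrib)
      then show "row_point n \<epsilon> u a ^ p a / (\<Prod>m\<le>n. row_point n \<epsilon> u a - lam m) *
          exp (\<i> * row_point n \<epsilon> u a * of_real (x (q a))) * exp (- (\<i> * row_point n \<epsilon> u a * of_real (x n))) =
          \<phi> (snd (n, Suc a) - 1) (p (snd (n, Suc a) - 1)) (q (snd (n, Suc a) - 1)) (u (n, Suc a))"
        by (simp add: \<phi>_def rp mult.assoc)
    qed
    have "leibniz n (\<lambda>a b. row_point n \<epsilon> u a ^ b) / (\<Prod>a<n. \<Prod>m\<le>n. row_point n \<epsilon> u a - lam m) *
      leibniz n (\<lambda>a b. exp (\<i> * row_point n \<epsilon> u a * of_real (x b))) * (\<Prod>a<n. exp (- (\<i> * row_point n \<epsilon> u a * of_real (x n)))) =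
      (\<Sum>p\<in>S. \<Sum>q\<in>S. of_int (sign p) * of_int (sign q) * ((\<Prod>a<n. row_point n \<epsilon> u a ^ p a) / (\<Prod>a<n. \<Prod>m\<le>n. row_point n \<epsilon> u a - lam m) *
        (\<Prod>a<n. exp (\<i> * row_point n \<epsilon> u a * of_real (x (q a)))) * (\<Prod>a<n. exp (- (\<i> * row_point n \<epsilon> u a * of_real (x n))))))"
      unfolding leibniz_def S_def[symmetric] sum_divide_distrib sum_product sum_distrib_right
      by (intro sum.cong refl) (simp add: sum_distrib_left sum_divide_distrib mult_ac)
    also have "\<dots> = (\<Sum>p\<in>S. \<Sum>q\<in>S. of_int (sign p) * of_int (sign q) * (\<Prod>i\<in>row_index n. \<phi> (snd i - 1) (p (snd i - 1)) (q (snd i - 1)) (u i)))"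
      unfolding trm ..
    finally have fin: "leibniz n (\<lambda>a b. row_point n \<epsilon> u a ^ b) / (\<Prod>a<n. \<Prod>m\<le>n. row_point n \<epsilon> u a - lam m) *
      leibniz n (\<lambda>a b. exp (\<i> * row_point n \<epsilon> u a * of_real (x b))) * (\<Prod>a<n. exp (- (\<i> * row_point n \<epsilon> u a * of_real (x n)))) =
      (\<Sum>p\<in>S. \<Sum>q\<in>S. of_int (sign p) * of_int (sign q) * (\<Prod>i\<in>row_index n. \<phi> (snd i - 1) (p (snd i - 1)) (q (snd i - 1)) (u i)))" .
    show ?thesis
      unfolding e1 mult.left_commute[of _ E] fin by (simp only: sum_distrib_left mult.assoc)
  qed
  have pin: "p a < n" if "p \<in> S" "a < n" for p a
    using that permutes_in_image[of p "{..<n}" a] by (simp add: S_def)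
  have pint: "integrable (PiM (row_index n) (\<lambda>_. lborel)) (\<lambda>u. \<Prod>i\<in>row_index n. \<phi> (snd i - 1) (p (snd i - 1)) (q (snd i - 1)) (u i))"
    and pval: "(LINT u|PiM (row_index n) (\<lambda>_. lborel). (\<Prod>i\<in>row_index n. \<phi> (snd i - 1) (p (snd i - 1)) (q (snd i - 1)) (u i))) = (\<Prod>a<n. G (p a) (q a))"
    if pq: "p \<in> S" "q \<in> S" for p q
  proof -
    have i: "integrable lborel (\<phi> (snd i - 1) (p (snd i - 1)) (q (snd i - 1)))" if "i \<in> row_index n" for i
      using that pin[OF pq(1)] by (intro \<phi>) (auto simp: row_index_def)
    show "integrable (PiM (row_index n) (\<lambda>_. lborel)) (\<lambda>u. \<Prod>i\<in>row_index n. \<phi> (snd i - 1) (p (snd i - 1)) (q (snd i - 1)) (u i))"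
      by (rule lborel_product.product_integrable_prod) (use i in auto)
    have "(LINT u|PiM (row_index n) (\<lambda>_. lborel). (\<Prod>i\<in>row_index n. \<phi> (snd i - 1) (p (snd i - 1)) (q (snd i - 1)) (u i))) =
        (\<Prod>i\<in>row_index n. (LINT t|lborel. \<phi> (snd i - 1) (p (snd i - 1)) (q (snd i - 1)) t))"
      by (rule lborel_product.product_integral_prod) (use i in auto)
    also have "\<dots> = (\<Prod>a<n. G (p a) (q a))"
      unfolding prod_row_index by (intro prod.cong refl) (use pin[OF pq(1)] in \<open>simp add: \<phi>\<close>)
    finally show "(LINT u|PiM (row_index n) (\<lambda>_. lborel). (\<Prod>i\<in>row_index n. \<phi> (snd i - 1) (p (snd i - 1)) (q (snd i - 1)) (u i))) = (\<Prod>a<n. G (p a) (q a))" .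
  qed
  have "(LINT u|PiM (row_index n) (\<lambda>_. lborel).
      leibniz n (\<lambda>a b. row_point n \<epsilon> u a ^ b) / (\<Prod>a<n. \<Prod>m\<le>n. row_point n \<epsilon> u a - lam m) *
      leibniz n (\<lambda>a b. exp (\<i> * row_point n \<epsilon> u a * of_real (x b))) *
      exp (\<i> * ((\<Sum>m\<le>n. lam m) - (\<Sum>a<n. row_point n \<epsilon> u a)) * of_real (x n))) =
     (\<Sum>p\<in>S. \<Sum>q\<in>S. E * of_int (sign p) * of_int (sign q) * (\<Prod>a<n. G (p a) (q a)))"
    unfolding integrand
  proof -
    define F where "F p q u = E * of_int (sign p) * of_int (sign q) * (\<Prod>i\<in>row_index n. \<phi> (snd i - 1) (p (snd i - 1)) (q (snd i - 1)) (u i))" for p q and u :: "nat \<times> nat \<Rightarrow> real"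
    have Fi: "integrable (PiM (row_index n) (\<lambda>_. lborel)) (F p q)" if "p \<in> S" "q \<in> S" for p q
      unfolding F_def using pint[OF that] by (rule integrable_mult_right)
    have Fv: "(LINT u|PiM (row_index n) (\<lambda>_. lborel). F p q u) = E * of_int (sign p) * of_int (sign q) * (\<Prod>a<n. G (p a) (q a))"
      if "p \<in> S" "q \<in> S" for p q
      unfolding F_def pval[OF that, symmetric] by (rule integral_mult_right_zero)
    have "(LINT u|PiM (row_index n) (\<lambda>_. lborel). (\<Sum>p\<in>S. \<Sum>q\<in>S. F p q u)) = (\<Sum>p\<in>S. LINT u|PiM (row_index n) (\<lambda>_. lborel). (\<Sum>q\<in>S. F p q u))"
      by (rule Bochner_Integration.integral_sum) (intro Bochner_Integration.integrable_sum Fi)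
    also have "\<dots> = (\<Sum>p\<in>S. \<Sum>q\<in>S. LINT u|PiM (row_index n) (\<lambda>_. lborel). F p q u)"
      by (rule sum.cong[OF refl], rule Bochner_Integration.integral_sum) (rule Fi)
    also have "\<dots> = (\<Sum>p\<in>S. \<Sum>q\<in>S. E * of_int (sign p) * of_int (sign q) * (\<Prod>a<n. G (p a) (q a)))"
      by (intro sum.cong refl Fv)
    finally show "(LINT u|PiM (row_index n) (\<lambda>_. lborel). (\<Sum>p\<in>S. \<Sum>q\<in>S. E * of_int (sign p) * of_int (sign q) * (\<Prod>i\<in>row_index n. \<phi> (snd i - 1) (p (snd i - 1)) (q (snd i - 1)) (u i)))) =
       (\<Sum>p\<in>S. \<Sum>q\<in>S. E * of_int (sign p) * of_int (sign q) * (\<Prod>a<n. G (p a) (q a)))"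
      unfolding F_def .
  qed
  also have "\<dots> = (\<Sum>p\<in>S. E * of_int (sign p) * leibniz n (\<lambda>a b. G (p a) b))"
    by (simp add: leibniz_def S_def sum_distrib_left mult.assoc)
  also have "\<dots> = (\<Sum>p\<in>S. E * leibniz n G)"
  proof (intro sum.cong refl)
    fix p assume "p \<in> S"
    then have "p permutes {..<n}" by (simp add: S_def)
    then have "leibniz n (\<lambda>a b. G (p a) b) = of_int (sign p) * leibniz n G" by (rule leibniz_permute_rows)
    moreover have "(of_int (sign p) :: complex) * of_int (sign p) = 1"
      by (metis of_int_1 of_int_mult sign_idempotent)
    ultimately show "E * of_int (sign p) * leibniz n (\<lambda>a b. G (p a) b) = E * leibniz n G"
      by (metis (no_types, lifting) mult.assoc mult_1)
  qed
  also have "\<dots> = fact n * E * leibniz n G"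
    by (simp add: S_def card_permutations[OF refl])
  finally have I: "(LINT u|PiM (row_index n) (\<lambda>_. lborel).
      leibniz n (\<lambda>a b. row_point n \<epsilon> u a ^ b) / (\<Prod>a<n. \<Prod>m\<le>n. row_point n \<epsilon> u a - lam m) *
      leibniz n (\<lambda>a b. exp (\<i> * row_point n \<epsilon> u a * of_real (x b))) *
      exp (\<i> * ((\<Sum>m\<le>n. lam m) - (\<Sum>a<n. row_point n \<epsilon> u a)) * of_real (x n))) = fact n * E * leibniz n G" .
  show ?thesis
  proof (cases "\<forall>b<n. x n \<le> x b")
    case False
    then obtain b where b: "b < n" "x b < x n" by (auto simp: not_le)
    have "leibniz n G = 0"
      unfolding leibniz_def
    proof (intro sum.neutral ballI)
      fix p assume "p \<in> {p. p permutes {..<n}}"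
      then have p: "p permutes {..<n}" by simp
      then obtain a where a: "a < n" "p a = b"
        using b permutes_image[OF p] by (metis imageE lessThan_iff)
      then have "G a (p a) = 0" using b by (simp add: G_def)
      then have "(\<Prod>i<n. G i (p i)) = 0" using a by (intro prod_zero) auto
      then show "of_int (sign p) * (\<Prod>i<n. G i (p i)) = 0" by simp
    qed
    then show ?thesis unfolding I if_not_P[OF False] by (simp only: mult_zero_right)
  next
    case True
    define e where "e m b = exp (\<i> * lam m * of_real (x b - x n))" for m b
    have "leibniz n G = leibniz n (\<lambda>k b. (2 * pi * \<i>) * (\<Sum>m<Suc n. (c m * lam m ^ k) * e m b))"
      by (rule leibniz_cong) (use True in \<open>simp add: G_def e_def lessThan_Suc_atMost mult_ac\<close>)
    also have "\<dots> = (2 * pi * \<i>) ^ n * leibniz n (\<lambda>k b. \<Sum>m<Suc n. (c m * lam m ^ k) * e m b)"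
      by (subst leibniz_scale_rows) simp
    also have "leibniz n (\<lambda>k b. \<Sum>m<Suc n. (c m * lam m ^ k) * e m b) = leibniz (Suc n) (\<lambda>k b. \<Sum>m<Suc n. (c m * lam m ^ k) * e m b)"
    proof (rule leibniz_border[symmetric])
      have lag: "(\<Sum>m<Suc n. (c m * lam m ^ k) * e m n) = (if k = n then 1 else 0)" if "k \<le> n" for k
      proof -
        have "degree (Polynomial.monom (1::complex) k) < card {..n}"
          using that by (simp add: degree_monom_eq)
        from lagrange_interpolation(2)[OF finite_atMost inj this] show ?thesis
          by (simp add: c_def e_def poly_monom lessThan_Suc_atMost split: if_splits)
      qed
      show "(\<Sum>m<Suc n. (c m * lam m ^ k) * e m n) = 0" if "k < n" for k using lag[of k] that by simp
      show "(\<Sum>m<Suc n. (c m * lam m ^ n) * e m n) = 1" using lag[of n] by simp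
    qed
    also have "\<dots> = leibniz (Suc n) (\<lambda>k m. c m * lam m ^ k) * leibniz (Suc n) e"
      by (rule leibniz_mult)
    also have "leibniz (Suc n) (\<lambda>k m. c m * lam m ^ k) = (\<Prod>m<Suc n. c m) * (\<Prod>j<Suc n. \<Prod>i<j. lam j - lam i)"
      unfolding leibniz_scale_cols using leibniz_transpose[of "Suc n" "\<lambda>m k. lam m ^ k"] vandermonde_det[of "Suc n" lam] by simp
    also have "leibniz (Suc n) e = (\<Prod>m<Suc n. exp (- (\<i> * lam m * of_real (x n)))) * leibniz (Suc n) (\<lambda>m b. exp (\<i> * lam m * of_real (x b)))"
    proof -
      have "leibniz (Suc n) e = leibniz (Suc n) (\<lambda>m b. exp (- (\<i> * lam m * of_real (x n))) * exp (\<i> * lam m * of_real (x b)))"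
        by (rule leibniz_cong) (simp add: e_def exp_add[symmetric] right_diff_distrib)
      then show ?thesis by (simp only: leibniz_scale_rows)
    qed
    also have "(\<Prod>m<Suc n. exp (- (\<i> * lam m * of_real (x n)))) = inverse E"
      unfolding E_def exp_minus[symmetric]
      by (simp only: exp_sum[symmetric] finite_atMost lessThan_Suc_atMost sum_negf sum_distrib_left sum_distrib_right mult.assoc)
    finally have LG: "leibniz n G = (2 * pi * \<i>) ^ n * ((\<Prod>m<Suc n. c m) * (\<Prod>j<Suc n. \<Prod>i<j. lam j - lam i) *
        (inverse E * leibniz (Suc n) (\<lambda>m b. exp (\<i> * lam m * of_real (x b)))))" .
    have inj': "lam i - lam j \<noteq> 0" if "i < j" "j < Suc n" for i j
      using inj_onD[OF inj, of i j] that by auto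
    have cprod: "(\<Prod>m<Suc n. c m) * (\<Prod>j<Suc n. \<Prod>i<j. lam j - lam i) = 1 / (\<Prod>j<Suc n. \<Prod>i<j. lam i - lam j)"
    proof -
      have "(\<Prod>m<Suc n. c m) = 1 / (\<Prod>m<Suc n. \<Prod>j\<in>{..<Suc n} - {m}. lam m - lam j)"
        by (simp only: c_def prod_dividef lessThan_Suc_atMost prod.neutral_const)
      also have "\<dots> = 1 / ((\<Prod>j<Suc n. \<Prod>i<j. lam i - lam j) * (\<Prod>j<Suc n. \<Prod>i<j. lam j - lam i))"
        unfolding prod_offdiagonal by (simp only: prod.distrib)
      finally have "(\<Prod>m<Suc n. c m) = 1 / ((\<Prod>j<Suc n. \<Prod>i<j. lam i - lam j) * (\<Prod>j<Suc n. \<Prod>i<j. lam j - lam i))" .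
      moreover have "(\<Prod>j<Suc n. \<Prod>i<j. lam j - lam i) \<noteq> 0"
        unfolding prod_zero_iff[OF finite_lessThan] using inj' by fastforce
      ultimately show ?thesis by simp
    qed
    have "E \<noteq> 0" by (simp add: E_def)
    then show ?thesis
      using True unfolding I LG cprod by simp
  qed
qed

section \<open>Absolute bounds for Cauchy-type products\<close>

text \<open>The absolute value of the Vandermonde determinant, for families indexed by an unordered set: every pair occurs twice in the product.\<close>

definition abs_vandermonde :: "'i set \<Rightarrow> ('i \<Rightarrow> complex) \<Rightarrow> real" where
  "abs_vandermonde A g = sqrt (\<Prod>i\<in>A. \<Prod>j\<in>A - {i}. norm (g i - g j))"

lemma abs_vandermonde_nonneg [simp]: "abs_vandermonde A g \<ge> 0"
  by (simp add: abs_vandermonde_def prod_nonneg)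

lemma abs_vandermonde_insert:
  assumes "finite A" "k \<notin> A"
  shows "abs_vandermonde (insert k A) g = abs_vandermonde A g * (\<Prod>j\<in>A. norm (g j - g k))"
proof -
  have "(\<Prod>i\<in>insert k A. \<Prod>j\<in>insert k A - {i}. norm (g i - g j)) =
      (\<Prod>j\<in>A. norm (g k - g j)) * (\<Prod>i\<in>A. \<Prod>j\<in>insert k A - {i}. norm (g i - g j))"
    using assms by simp
  also have "(\<Prod>i\<in>A. \<Prod>j\<in>insert k A - {i}. norm (g i - g j)) = (\<Prod>i\<in>A. norm (g i - g k) * (\<Prod>j\<in>A - {i}. norm (g i - g j)))"
  proof (intro prod.cong refl)
    fix i assume "i \<in> A"
    then have "insert k A - {i} = insert k (A - {i})" using assms by auto
    then show "(\<Prod>j\<in>insert k A - {i}. norm (g i - g j)) = norm (g i - g k) * (\<Prod>j\<in>A - {i}. norm (g i - g j))"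
      using assms by simp
  qed
  finally have "(\<Prod>i\<in>insert k A. \<Prod>j\<in>insert k A - {i}. norm (g i - g j)) =
      (\<Prod>i\<in>A. \<Prod>j\<in>A - {i}. norm (g i - g j)) * (\<Prod>j\<in>A. norm (g j - g k))\<^sup>2"
    by (simp add: prod.distrib power2_eq_square norm_minus_commute)
  then show ?thesis
    by (simp add: abs_vandermonde_def real_sqrt_mult prod_nonneg)
qed

lemma abs_vandermonde_reindex:
  assumes "inj_on f A"
  shows "abs_vandermonde (f ` A) g = abs_vandermonde A (\<lambda>a. g (f a))"
proof -
  have "(\<Prod>j\<in>f ` A - {f i}. norm (g (f i) - g j)) = (\<Prod>j\<in>A - {i}. norm (g (f i) - g (f j)))" if "i \<in> A" for i
  proof -
    have "f ` A - {f i} = f ` (A - {i})" using assms that by (auto simp: inj_on_def)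
    then show ?thesis using assms by (simp add: prod.reindex inj_on_diff)
  qed
  then show ?thesis by (simp add: abs_vandermonde_def prod.reindex[OF assms])
qed

text \<open>For \<open>card B = card A + 1\<close> this is, up to sign, the absolute value of the Cauchy determinant of the \<open>1 / (g\<^sub>i - \<lambda>\<^sub>m)\<close> bordered by a row of ones.\<close>

definition cauchy_ratio :: "'i set \<Rightarrow> 'j set \<Rightarrow> ('i \<Rightarrow> complex) \<Rightarrow> ('j \<Rightarrow> complex) \<Rightarrow> real" where
  "cauchy_ratio A B g lam = abs_vandermonde A g * abs_vandermonde B lam / (\<Prod>i\<in>A. \<Prod>m\<in>B. norm (g i - lam m))"

lemma cauchy_ratio_nonneg [simp]: "cauchy_ratio A B g lam \<ge> 0"
  by (simp add: cauchy_ratio_def prod_nonneg)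

definition resolvent_diff :: "complex \<Rightarrow> complex \<Rightarrow> complex \<Rightarrow> real" where
  "resolvent_diff c a b = norm (a - b) / (norm (c - a) * norm (c - b))"

lemma resolvent_diff_nonneg [simp]: "resolvent_diff c a b \<ge> 0"
  by (simp add: resolvent_diff_def)

text \<open>As a function of \<open>g\<^sub>k\<close>, the ratio is the absolute value of \<open>P (g\<^sub>k) / \<Prod> (g\<^sub>k - \<lambda>\<^sub>m)\<close> with \<open>deg P = card B - 2\<close>. Its partial fraction
coefficients have sum zero, which allows differences of resolvents; and each coefficient is a ratio with \<open>k\<close> and one
\<open>\<lambda>\<^sub>m\<close> removed.\<close>

lemma cauchy_ratio_step:
  fixes lam :: "nat \<Rightarrow> complex"
  assumes A: "finite A" "k \<notin> A" and B: "finite B" "inj_on lam B" "card B = card A + 2" "m0 \<in> B"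
    and ne: "\<And>i m. i \<in> insert k A \<Longrightarrow> m \<in> B \<Longrightarrow> g i \<noteq> lam m"
  shows "cauchy_ratio (insert k A) B g lam \<le>
    (\<Sum>m\<in>B - {m0}. resolvent_diff (g k) (lam m) (lam m0) * cauchy_ratio A (B - {m}) g lam)"
proof -
  define P where "P = (\<Prod>i\<in>A. [:- g i, 1:])"
  have pP: "poly P z = (\<Prod>i\<in>A. z - g i)" for z by (simp add: P_def poly_prod)
  have dP: "degree P = card A" unfolding P_def by (subst degree_prod_sum_eq) auto
  define c where "c m = poly P (lam m) / (\<Prod>j\<in>B - {m}. lam m - lam j)" for m
  have dlt: "degree P < card B" using dP B(3) by simp
  have c0: "(\<Sum>m\<in>B. c m) = 0"
    using lagrange_interpolation(2)[OF B(1,2) dlt] dP B(3) by (simp add: c_def coeff_eq_0)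
  let ?z = "g k"
  have zne: "?z - lam m \<noteq> 0" if "m \<in> B" for m using ne[of k m] that by simp
  have "poly P ?z / (\<Prod>m\<in>B. ?z - lam m) = (\<Sum>m\<in>B. c m * (\<Prod>j\<in>B - {m}. ?z - lam j) / (\<Prod>m\<in>B. ?z - lam m))"
    unfolding lagrange_interpolation(1)[OF B(1,2) dlt, of ?z] c_def[symmetric] by (rule sum_divide_distrib)
  also have "\<dots> = (\<Sum>m\<in>B. c m * (1 / (?z - lam m)))"
  proof (intro sum.cong refl)
    fix m assume m: "m \<in> B"
    have "(\<Prod>j\<in>B. ?z - lam j) = (?z - lam m) * (\<Prod>j\<in>B - {m}. ?z - lam j)"
      using m B(1) by (simp add: prod.remove)
    moreover have "(\<Prod>j\<in>B - {m}. ?z - lam j) \<noteq> 0" using zne B(1) by auto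
    ultimately show "c m * (\<Prod>j\<in>B - {m}. ?z - lam j) / (\<Prod>m\<in>B. ?z - lam m) = c m * (1 / (?z - lam m))" by simp
  qed
  also have "\<dots> = (\<Sum>m\<in>B. c m * (1 / (?z - lam m))) - (\<Sum>m\<in>B. c m) * (1 / (?z - lam m0))" by (simp add: c0)
  also have "\<dots> = (\<Sum>m\<in>B. c m * (1 / (?z - lam m) - 1 / (?z - lam m0)))"
    by (simp add: sum_distrib_right sum_subtractf right_diff_distrib sum_divide_distrib)
  also have "\<dots> = (\<Sum>m\<in>B - {m0}. c m * (1 / (?z - lam m) - 1 / (?z - lam m0)))"
    by (rule sum.mono_neutral_right) (use B in auto)
  finally have eq: "poly P ?z / (\<Prod>m\<in>B. ?z - lam m) = (\<Sum>m\<in>B - {m0}. c m * (1 / (?z - lam m) - 1 / (?z - lam m0)))" .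
  have bound: "norm (poly P ?z) / (\<Prod>m\<in>B. norm (?z - lam m)) \<le> (\<Sum>m\<in>B - {m0}. norm (c m) * resolvent_diff ?z (lam m) (lam m0))"
  proof -
    have "norm (poly P ?z) / (\<Prod>m\<in>B. norm (?z - lam m)) = norm (poly P ?z / (\<Prod>m\<in>B. ?z - lam m))"
      by (simp add: norm_divide prod_norm)
    also have "\<dots> \<le> (\<Sum>m\<in>B - {m0}. norm (c m * (1 / (?z - lam m) - 1 / (?z - lam m0))))"
      unfolding eq by (rule norm_sum)
    also have "\<dots> = (\<Sum>m\<in>B - {m0}. norm (c m) * resolvent_diff ?z (lam m) (lam m0))"
    proof (intro sum.cong refl)
      fix m assume "m \<in> B - {m0}"
      then have "?z - lam m \<noteq> 0" "?z - lam m0 \<noteq> 0" using zne B by auto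
      then have "1 / (?z - lam m) - 1 / (?z - lam m0) = (lam m - lam m0) / ((?z - lam m) * (?z - lam m0))"
        by (simp add: diff_frac_eq)
      then show "norm (c m * (1 / (?z - lam m) - 1 / (?z - lam m0))) = norm (c m) * resolvent_diff ?z (lam m) (lam m0)"
        by (simp add: norm_mult norm_divide resolvent_diff_def)
    qed
    finally show ?thesis .
  qed
  define W where "W = abs_vandermonde A g * abs_vandermonde B lam / (\<Prod>i\<in>A. \<Prod>m\<in>B. norm (g i - lam m))"
  have W0: "W \<ge> 0" by (simp add: W_def prod_nonneg)
  have "cauchy_ratio (insert k A) B g lam = W * (norm (poly P ?z) / (\<Prod>m\<in>B. norm (?z - lam m)))"
  proof -
    have "(\<Prod>j\<in>A. norm (g j - g k)) = norm (poly P ?z)"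
      unfolding pP by (simp add: prod_norm[symmetric] norm_minus_commute)
    then show ?thesis using A by (simp add: cauchy_ratio_def abs_vandermonde_insert W_def mult_ac)
  qed
  also have "\<dots> \<le> W * (\<Sum>m\<in>B - {m0}. norm (c m) * resolvent_diff ?z (lam m) (lam m0))"
    by (rule mult_left_mono[OF bound W0])
  also have "\<dots> = (\<Sum>m\<in>B - {m0}. resolvent_diff ?z (lam m) (lam m0) * (W * norm (c m)))"
    by (simp add: sum_distrib_left mult_ac)
  also have "\<dots> = (\<Sum>m\<in>B - {m0}. resolvent_diff ?z (lam m) (lam m0) * cauchy_ratio A (B - {m}) g lam)"
  proof (intro sum.cong refl arg_cong2[where f = "(*)"])
    fix m assume "m \<in> B - {m0}"
    then have m: "m \<in> B" by simp
    have 1: "abs_vandermonde B lam = abs_vandermonde (B - {m}) lam * (\<Prod>j\<in>B - {m}. norm (lam j - lam m))"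
      using abs_vandermonde_insert[of "B - {m}" m lam] B m by (simp add: insert_absorb)
    have 2: "norm (c m) = (\<Prod>i\<in>A. norm (g i - lam m)) / (\<Prod>j\<in>B - {m}. norm (lam j - lam m))"
      by (simp add: c_def pP norm_divide prod_norm[symmetric] norm_minus_commute)
    have 3: "(\<Prod>i\<in>A. \<Prod>m\<in>B. norm (g i - lam m)) = (\<Prod>i\<in>A. norm (g i - lam m)) * (\<Prod>i\<in>A. \<Prod>m\<in>B - {m}. norm (g i - lam m))"
      unfolding prod.distrib[symmetric] using m B by (simp add: prod.remove)
    have n1: "(\<Prod>j\<in>B - {m}. norm (lam j - lam m)) \<noteq> 0"
      using B m by (auto simp: inj_on_def)
    have n2: "(\<Prod>i\<in>A. norm (g i - lam m)) \<noteq> 0"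
      using A ne m by auto
    show "W * norm (c m) = cauchy_ratio A (B - {m}) g lam"
      unfolding W_def 1 2 3 cauchy_ratio_def using n1 n2 by simp
  qed
  finally show ?thesis .
qed

text \<open>Decay in \<open>u\<close> better than \<open>1 / |u|\<close> costs a small power of the parameters. With \<open>P\<close> and \<open>R\<close> the distances from the
point \<open>c\<close> to \<open>a\<close> and \<open>b\<close>, the numerator \<open>N = |a - b|\<close> is at most \<open>2 R\<close> and at most \<open>T = (1 + |a|) (1 + |b|)\<close>. Using the
first bound for the power \<open>1 - 2 \<delta>\<close> of \<open>N\<close> and the second for the rest leaves \<open>P\<close> to the power \<open>- 1 - 2 \<delta>\<close>, of
which \<open>\<delta>\<close> is spent on the weight \<open>(1 + |c|) powr \<delta>\<close>.\<close>

lemma resolvent_diff_decay: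
  fixes a b :: complex and \<delta> \<eta> e :: real
  assumes \<delta>: "0 < \<delta>" "\<delta> \<le> 1/2" and \<eta>: "\<eta> > 0"
    and p: "Im a + e \<ge> \<eta>" and q: "Im b + e \<ge> \<eta>"
    and le: "norm (of_real u - \<i> * of_real e - a) \<le> norm (of_real u - \<i> * of_real e - b)"
  shows "resolvent_diff (of_real u - \<i> * of_real e) a b * (1 + norm (of_real u - \<i> * of_real e)) powr \<delta> \<le>
    2 * (1 + 1 / \<eta>) powr (1 + 2 * \<delta>) * ((1 + norm a) * (1 + norm b)) powr (3 * \<delta>) * (1 + \<bar>u - Re a\<bar>) powr (- \<delta> - 1)"
proof -
  define c where "c = complex_of_real u - \<i> * of_real e"
  define P where "P = norm (c - a)"
  define R where "R = norm (c - b)"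
  define T where "T = (1 + norm a) * (1 + norm b)"
  define N where "N = norm (a - b)"
  have PR: "P \<le> R" using le by (simp add: P_def R_def c_def)
  have P\<eta>: "P \<ge> \<eta>"
    using abs_Im_le_cmod[of "c - a"] p \<eta> by (simp add: P_def c_def)
  have Ppos: "P > 0" "R > 0" using P\<eta> \<eta> PR by auto
  have N0: "N \<ge> 0" by (simp add: N_def)
  have NR: "N \<le> 2 * R"
  proof -
    have "norm (a - b) \<le> norm (c - a) + norm (c - b)"
      using norm_triangle_ineq4[of "c - b" "c - a"] by (simp add: add.commute)
    then show ?thesis using PR by (simp add: N_def P_def R_def)
  qed
  have NT: "N \<le> T"
  proof -
    have "N \<le> norm a + norm b" unfolding N_def by (rule norm_triangle_ineq4)
    then show ?thesis by (simp add: T_def algebra_simps) (smt (verit) mult_nonneg_nonneg norm_ge_zero)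
  qed
  have T1: "T \<ge> 1" "1 + norm a \<le> T" unfolding T_def
    by (simp_all add: algebra_simps add_nonneg_nonneg)
  have X: "resolvent_diff c a b \<le> 2 * N powr (2 * \<delta>) * P powr (- 1 - 2 * \<delta>)"
  proof -
    have "N = N powr (2 * \<delta>) * N powr (1 - 2 * \<delta>)"
      using N0 by (cases "N = 0") (simp_all add: powr_add[symmetric])
    also have "\<dots> \<le> N powr (2 * \<delta>) * (2 * R powr (1 - 2 * \<delta>))"
    proof (rule mult_left_mono)
      have "N powr (1 - 2 * \<delta>) \<le> (2 * R) powr (1 - 2 * \<delta>)"
        using NR N0 \<delta> by (intro powr_mono2) auto
      also have "\<dots> = 2 powr (1 - 2 * \<delta>) * R powr (1 - 2 * \<delta>)"
        using Ppos by (simp add: powr_mult)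
      also have "\<dots> \<le> 2 powr 1 * R powr (1 - 2 * \<delta>)"
        using \<delta> by (intro mult_right_mono powr_mono) auto
      finally show "N powr (1 - 2 * \<delta>) \<le> 2 * R powr (1 - 2 * \<delta>)" by simp
    qed simp
    finally have "resolvent_diff c a b \<le> N powr (2 * \<delta>) * (2 * R powr (1 - 2 * \<delta>)) / (P * R)"
      unfolding resolvent_diff_def N_def[symmetric] P_def[symmetric] R_def[symmetric]
      using Ppos by (intro divide_right_mono) auto
    also have "\<dots> = 2 * N powr (2 * \<delta>) * (R powr (- 2 * \<delta>) * P powr (- 1))"
      using Ppos by (simp add: powr_diff powr_minus field_simps)
    also have "\<dots> \<le> 2 * N powr (2 * \<delta>) * (P powr (- 2 * \<delta>) * P powr (- 1))"
      using Ppos PR \<delta> by (intro mult_left_mono mult_right_mono powr_mono2') auto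
    also have "P powr (- 2 * \<delta>) * P powr (- 1) = P powr (- 1 - 2 * \<delta>)"
    proof -
      have "- 2 * \<delta> + - 1 = - 1 - 2 * \<delta>" by simp
      then show ?thesis using powr_add[of P "- 2 * \<delta>" "- 1"] by (simp only:)
    qed
    finally show ?thesis .
  qed
  have Y: "(1 + norm c) powr \<delta> \<le> (1 + norm a) powr \<delta> * (1 + P) powr \<delta>"
  proof -
    have "norm c \<le> norm a + P" using norm_triangle_ineq[of "c - a" a] by (simp add: P_def)
    moreover have "0 \<le> norm a * P" by (simp add: P_def)
    ultimately have "1 + norm c \<le> (1 + norm a) * (1 + P)" by (simp add: algebra_simps)
    then have "(1 + norm c) powr \<delta> \<le> ((1 + norm a) * (1 + P)) powr \<delta>"
      using \<delta> by (intro powr_mono2) auto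
    also have "\<dots> = (1 + norm a) powr \<delta> * (1 + P) powr \<delta>" using Ppos by (simp add: powr_mult)
    finally show ?thesis .
  qed
  have Z: "P powr (- 1 - 2 * \<delta>) \<le> (1 + 1 / \<eta>) powr (1 + 2 * \<delta>) * (1 + P) powr (- 1 - 2 * \<delta>)"
  proof -
    have "1 \<le> P / \<eta>" using P\<eta> \<eta> by simp
    then have "1 + P \<le> (1 + 1 / \<eta>) * P" by (simp add: algebra_simps)
    then have "((1 + 1 / \<eta>) * P) powr (- 1 - 2 * \<delta>) \<le> (1 + P) powr (- 1 - 2 * \<delta>)"
      using Ppos \<delta> by (intro powr_mono2') auto
    moreover have "((1 + 1 / \<eta>) * P) powr (- 1 - 2 * \<delta>) = P powr (- 1 - 2 * \<delta>) / (1 + 1 / \<eta>) powr (1 + 2 * \<delta>)"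
    proof -
      have "- 1 - 2 * \<delta> = - (1 + 2 * \<delta>)" by simp
      then have "(1 + 1 / \<eta>) powr (- 1 - 2 * \<delta>) = 1 / (1 + 1 / \<eta>) powr (1 + 2 * \<delta>)"
        by (simp only: powr_minus_divide)
      then show ?thesis using Ppos \<eta> by (simp add: powr_mult)
    qed
    moreover have "(1 + 1 / \<eta>) powr (1 + 2 * \<delta>) > 0" using add_pos_pos[of 1 "1 / \<eta>"] \<eta> by auto
    ultimately show ?thesis by (simp add: divide_le_eq mult.commute)
  qed
  have "resolvent_diff c a b * (1 + norm c) powr \<delta> \<le>
      (2 * N powr (2 * \<delta>) * ((1 + 1 / \<eta>) powr (1 + 2 * \<delta>) * (1 + P) powr (- 1 - 2 * \<delta>))) * ((1 + norm a) powr \<delta> * (1 + P) powr \<delta>)"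
    by (intro mult_mono order.trans[OF X] mult_left_mono Z Y) auto
  also have "\<dots> = 2 * (1 + 1 / \<eta>) powr (1 + 2 * \<delta>) * (N powr (2 * \<delta>) * (1 + norm a) powr \<delta>) * ((1 + P) powr (- 1 - 2 * \<delta>) * (1 + P) powr \<delta>)"
    by (simp add: mult_ac)
  also have "(1 + P) powr (- 1 - 2 * \<delta>) * (1 + P) powr \<delta> = (1 + P) powr (- \<delta> - 1)"
    by (simp add: powr_add[symmetric])
  also have "2 * (1 + 1 / \<eta>) powr (1 + 2 * \<delta>) * (N powr (2 * \<delta>) * (1 + norm a) powr \<delta>) * (1 + P) powr (- \<delta> - 1) \<le>
     2 * (1 + 1 / \<eta>) powr (1 + 2 * \<delta>) * (T powr (2 * \<delta>) * T powr \<delta>) * (1 + \<bar>u - Re a\<bar>) powr (- \<delta> - 1)"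
  proof (intro mult_mono mult_left_mono)
    show "N powr (2 * \<delta>) \<le> T powr (2 * \<delta>)" using NT N0 \<delta> by (intro powr_mono2) auto
    show "(1 + norm a) powr \<delta> \<le> T powr \<delta>" using T1 \<delta> by (intro powr_mono2) auto
    have "\<bar>u - Re a\<bar> \<le> P" using abs_Re_le_cmod[of "c - a"] by (simp add: P_def c_def)
    then show "(1 + P) powr (- \<delta> - 1) \<le> (1 + \<bar>u - Re a\<bar>) powr (- \<delta> - 1)"
      using \<delta> by (intro powr_mono2') auto
  qed auto
  also have "T powr (2 * \<delta>) * T powr \<delta> = T powr (3 * \<delta>)" by (simp add: powr_add[symmetric])
  finally show ?thesis by (simp add: c_def T_def mult.assoc)
qed

lemma nn_integral_powr_translate:
  assumes "\<delta> > 0"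
  shows "(\<integral>\<^sup>+u. ennreal ((1 + \<bar>u - r\<bar>) powr (- \<delta> - 1)) \<partial>lborel) \<le> ennreal (2 / \<delta>)"
proof -
  have "(\<integral>\<^sup>+u. ennreal ((1 + \<bar>u\<bar>) powr (- \<delta> - 1)) \<partial>lborel) =
      (\<integral>\<^sup>+u. ennreal ((1 + \<bar>- r + 1 * u\<bar>) powr (- \<delta> - 1)) \<partial>lborel)"
    by (subst nn_integral_real_affine[of _ 1 "- r"]) auto
  then show ?thesis using nn_integral_powr_finite[OF assms] by (simp add: add.commute)
qed

text \<open>The pointwise bound applies with \<open>a\<close> or with \<open>b\<close> as the nearer point; the sum of both covers all \<open>u\<close>.\<close>

lemma resolvent_diff_integral:
  fixes \<delta> \<eta> :: real
  assumes \<delta>: "0 < \<delta>" "\<delta> \<le> 1/2" and \<eta>: "\<eta> > 0"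
  shows "\<exists>C\<ge>0. \<forall>a b e. Im a + e \<ge> \<eta> \<longrightarrow> Im b + e \<ge> \<eta> \<longrightarrow>
    (\<integral>\<^sup>+u. ennreal (resolvent_diff (of_real u - \<i> * of_real e) a b * (1 + norm (of_real u - \<i> * of_real e)) powr \<delta>) \<partial>lborel)
      \<le> ennreal (C * ((1 + norm a) powr (3 * \<delta>) * (1 + norm b) powr (3 * \<delta>)))"
proof -
  define K where "K = 2 * (1 + 1 / \<eta>) powr (1 + 2 * \<delta>)"
  have K0: "K \<ge> 0" by (simp add: K_def)
  show ?thesis
  proof (intro exI[of _ "K * (4 / \<delta>)"] conjI allI impI)
    show "0 \<le> K * (4 / \<delta>)" using K0 \<delta> by simp
    fix a b e assume p: "Im a + e \<ge> \<eta>" and q: "Im b + e \<ge> \<eta>"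
    define T where "T = (1 + norm a) powr (3 * \<delta>) * (1 + norm b) powr (3 * \<delta>)"
    have T0: "T \<ge> 0" by (simp add: T_def)
    have T: "T = ((1 + norm a) * (1 + norm b)) powr (3 * \<delta>)" "T = ((1 + norm b) * (1 + norm a)) powr (3 * \<delta>)"
      by (simp_all add: T_def powr_mult mult.commute)
    have sym: "resolvent_diff c b a = resolvent_diff c a b" for c
      by (simp add: resolvent_diff_def norm_minus_commute mult.commute)
    have pw: "resolvent_diff (of_real u - \<i> * of_real e) a b * (1 + norm (of_real u - \<i> * of_real e)) powr \<delta> \<le>
        K * T * ((1 + \<bar>u - Re a\<bar>) powr (- \<delta> - 1) + (1 + \<bar>u - Re b\<bar>) powr (- \<delta> - 1))" for u
    proof (cases "norm (of_real u - \<i> * of_real e - a) \<le> norm (of_real u - \<i> * of_real e - b)")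
      case True
      have "resolvent_diff (of_real u - \<i> * of_real e) a b * (1 + norm (of_real u - \<i> * of_real e)) powr \<delta> \<le> K * T * (1 + \<bar>u - Re a\<bar>) powr (- \<delta> - 1)"
        using resolvent_diff_decay[OF \<delta> \<eta> p q True] by (simp add: K_def T(1))
      also have "\<dots> \<le> K * T * ((1 + \<bar>u - Re a\<bar>) powr (- \<delta> - 1) + (1 + \<bar>u - Re b\<bar>) powr (- \<delta> - 1))"
        using K0 T0 by (intro mult_left_mono) auto
      finally show ?thesis .
    next
      case False
      have "resolvent_diff (of_real u - \<i> * of_real e) b a * (1 + norm (of_real u - \<i> * of_real e)) powr \<delta> \<le> K * T * (1 + \<bar>u - Re b\<bar>) powr (- \<delta> - 1)"
        using resolvent_diff_decay[OF \<delta> \<eta> q p, of u] False by (simp add: K_def T(2))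
      also have "\<dots> \<le> K * T * ((1 + \<bar>u - Re a\<bar>) powr (- \<delta> - 1) + (1 + \<bar>u - Re b\<bar>) powr (- \<delta> - 1))"
        using K0 T0 by (intro mult_left_mono) auto
      finally show ?thesis by (simp add: sym)
    qed
    have "(\<integral>\<^sup>+u. ennreal (resolvent_diff (of_real u - \<i> * of_real e) a b * (1 + norm (of_real u - \<i> * of_real e)) powr \<delta>) \<partial>lborel)
      \<le> (\<integral>\<^sup>+u. ennreal (K * T) * (ennreal ((1 + \<bar>u - Re a\<bar>) powr (- \<delta> - 1)) + ennreal ((1 + \<bar>u - Re b\<bar>) powr (- \<delta> - 1))) \<partial>lborel)"
      using K0 T0 pw by (intro nn_integral_mono) (simp add: ennreal_mult[symmetric] ennreal_plus[symmetric] ennreal_leI del: ennreal_plus)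
    also have "\<dots> = ennreal (K * T) * ((\<integral>\<^sup>+u. ennreal ((1 + \<bar>u - Re a\<bar>) powr (- \<delta> - 1)) \<partial>lborel) + (\<integral>\<^sup>+u. ennreal ((1 + \<bar>u - Re b\<bar>) powr (- \<delta> - 1)) \<partial>lborel))"
      by (subst nn_integral_cmult) (auto simp: nn_integral_add)
    also have "\<dots> \<le> ennreal (K * T) * (ennreal (2 / \<delta>) + ennreal (2 / \<delta>))"
      by (intro mult_left_mono add_mono nn_integral_powr_translate \<delta>) auto
    also have "\<dots> = ennreal (K * (4 / \<delta>) * T)"
      using K0 T0 \<delta> by (simp add: ennreal_plus[symmetric] ennreal_mult[symmetric] mult_ac del: ennreal_plus)
    finally show "(\<integral>\<^sup>+u. ennreal (resolvent_diff (of_real u - \<i> * of_real e) a b * (1 + norm (of_real u - \<i> * of_real e)) powr \<delta>) \<partial>lborel)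
      \<le> ennreal (K * (4 / \<delta>) * ((1 + norm a) powr (3 * \<delta>) * (1 + norm b) powr (3 * \<delta>)))"
      by (simp add: T_def)
  qed
qed


lemma cauchy_ratio_measurable:
  assumes "finite A" "finite B" "\<And>i. i \<in> A \<Longrightarrow> (\<lambda>w. g w i) \<in> borel_measurable M"
  shows "(\<lambda>w. cauchy_ratio A B (g w) lam) \<in> borel_measurable M"
  unfolding cauchy_ratio_def abs_vandermonde_def using assms(3)
  by (intro borel_measurable_divide borel_measurable_times borel_measurable_prod borel_measurable_norm
      borel_measurable_diff borel_measurable_const measurable_compose[OF _ borel_measurable_sqrt]) auto

lemma finite_positive_gap:
  fixes f :: "'i \<Rightarrow> real"
  assumes "finite A" "\<And>i. i \<in> A \<Longrightarrow> f i > 0"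
  shows "\<exists>\<eta>>0. \<forall>i\<in>A. \<eta> \<le> f i"
proof (intro exI[of _ "Min (insert 1 (f ` A))"] conjI ballI)
  show "Min (insert 1 (f ` A)) > 0" using assms by simp
  show "Min (insert 1 (f ` A)) \<le> f i" if "i \<in> A" for i using assms that by simp
qed

text \<open>The weight in the integrand is what the induction on rows produces, and the right side is again such a weight, with the exponent
multiplied by \<open>3 card A\<close>. As \<open>\<delta>\<close> may be chosen arbitrarily small, a fixed number of rows can be handled. The proof integrates out one
variable at a time.\<close>

lemma cauchy_ratio_integral:
  fixes e :: "nat \<times> nat \<Rightarrow> real"
  assumes \<delta>: "0 < \<delta>" "\<delta> \<le> 1/2" and \<eta>: "\<eta> > 0" and "finite A"
  shows "\<exists>K\<ge>0. \<forall>B (lam :: nat \<Rightarrow> complex). finite B \<longrightarrow> card B = Suc (card A) \<longrightarrow> inj_on lam B \<longrightarrow>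
      (\<forall>i\<in>A. \<forall>m\<in>B. Im (lam m) + e i \<ge> \<eta>) \<longrightarrow>
      (\<integral>\<^sup>+u. ennreal (cauchy_ratio A B (\<lambda>i. of_real (u i) - \<i> * of_real (e i)) lam *
          (\<Prod>i\<in>A. (1 + norm (of_real (u i) - \<i> * of_real (e i))) powr \<delta>)) \<partial>PiM A (\<lambda>_. lborel))
      \<le> ennreal (K * (\<Prod>m\<in>B. (1 + norm (lam m)) powr (3 * \<delta> * card A)))"
  using \<open>finite A\<close>
proof (induction A)
  case empty
  have "abs_vandermonde B lam = 1" if "card B = Suc 0" for B and lam :: "nat \<Rightarrow> complex"
    using that by (auto simp: card_Suc_eq abs_vandermonde_def)
  then show ?case
    by (intro exI[of _ 1])
      (auto simp: cauchy_ratio_def lborel_product.nn_integral_empty abs_vandermonde_def space_PiM_empty add_nonneg_eq_0_iff)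
next
  case (insert k A)
  then obtain K where K: "K \<ge> 0" and KB: "\<And>B (lam :: nat \<Rightarrow> complex). finite B \<Longrightarrow> card B = Suc (card A) \<Longrightarrow> inj_on lam B \<Longrightarrow>
      (\<And>i m. i \<in> A \<Longrightarrow> m \<in> B \<Longrightarrow> Im (lam m) + e i \<ge> \<eta>) \<Longrightarrow>
      (\<integral>\<^sup>+u. ennreal (cauchy_ratio A B (\<lambda>i. of_real (u i) - \<i> * of_real (e i)) lam *
          (\<Prod>i\<in>A. (1 + norm (of_real (u i) - \<i> * of_real (e i))) powr \<delta>)) \<partial>PiM A (\<lambda>_. lborel))
      \<le> ennreal (K * (\<Prod>m\<in>B. (1 + norm (lam m)) powr (3 * \<delta> * card A)))"
    by (auto simp: Ball_def)
  obtain C where C: "C \<ge> 0" and CX: "\<And>a b e. Im a + e \<ge> \<eta> \<Longrightarrow> Im b + e \<ge> \<eta> \<Longrightarrow>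
    (\<integral>\<^sup>+u. ennreal (resolvent_diff (of_real u - \<i> * of_real e) a b * (1 + norm (of_real u - \<i> * of_real e)) powr \<delta>) \<partial>lborel)
      \<le> ennreal (C * ((1 + norm a) powr (3 * \<delta>) * (1 + norm b) powr (3 * \<delta>)))"
    using resolvent_diff_integral[OF \<delta> \<eta>] by blast
  show ?case
  proof (intro exI[of _ "(card A + 1) * (C * K)"] conjI allI impI)
    show "0 \<le> (card A + 1) * (C * K)" using C K by simp
    fix B and lam :: "nat \<Rightarrow> complex"
    assume B: "finite B" and cB: "card B = Suc (card (insert k A))" and inj: "inj_on lam B"
      and gap: "\<forall>i\<in>insert k A. \<forall>m\<in>B. Im (lam m) + e i \<ge> \<eta>"
    have cB': "card B = card A + 2" using cB insert.hyps by simp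
    then obtain m0 where m0: "m0 \<in> B" by fastforce
    define g where "g u i = complex_of_real (u i) - \<i> * complex_of_real (e i)" for u :: "nat \<times> nat \<Rightarrow> real" and i
    define R where "R u = (\<Prod>i\<in>A. (1 + norm (g u i)) powr \<delta>)" for u
    have R0: "R u \<ge> 0" for u by (simp add: R_def prod_nonneg)
    have gA: "cauchy_ratio A B' (g (u(k := y))) lam = cauchy_ratio A B' (g u) lam" "R (u(k := y)) = R u" for u y B'
    proof -
      have *: "i \<in> A \<Longrightarrow> g (u(k := y)) i = g u i" for i using insert.hyps by (auto simp: g_def)
      show "R (u(k := y)) = R u" by (simp add: R_def *)
      have "abs_vandermonde A (g (u(k := y))) = abs_vandermonde A (g u)" by (simp add: abs_vandermonde_def *)
      then show "cauchy_ratio A B' (g (u(k := y))) lam = cauchy_ratio A B' (g u) lam"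
        by (simp add: cauchy_ratio_def *)
    qed
    define X where "X m y = resolvent_diff (of_real y - \<i> * of_real (e k)) (lam m) (lam m0) * (1 + norm (of_real y - \<i> * of_real (e k))) powr \<delta>" for m y
    have X0: "X m y \<ge> 0" for m y by (simp add: X_def)
    have Xm: "X m \<in> borel_measurable borel" for m unfolding X_def resolvent_diff_def by measurable
    have gm: "(\<lambda>u. g u i) \<in> borel_measurable (PiM I (\<lambda>_. lborel))" if "i \<in> I" for i I
      unfolding g_def using that by measurable
    have Rm: "R \<in> borel_measurable (PiM I (\<lambda>_. lborel))" if "A \<subseteq> I" for I
      unfolding R_def
    proof (rule borel_measurable_prod)
      fix i assume "i \<in> A"
      then have [measurable]: "(\<lambda>u. g u i) \<in> borel_measurable (PiM I (\<lambda>_. lborel))" using that by (intro gm) auto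
      show "(\<lambda>u. (1 + norm (g u i)) powr \<delta>) \<in> borel_measurable (PiM I (\<lambda>_. lborel))" by measurable
    qed
    have Cm: "(\<lambda>u. cauchy_ratio A B' (g u) lam) \<in> borel_measurable (PiM I (\<lambda>_. lborel))" if "finite B'" "A \<subseteq> I" for B' I
      using that insert.hyps gm by (intro cauchy_ratio_measurable) auto
    have pw: "cauchy_ratio (insert k A) B (g u) lam * (\<Prod>i\<in>insert k A. (1 + norm (g u i)) powr \<delta>) \<le>
       (\<Sum>m\<in>B - {m0}. X m (u k) * (cauchy_ratio A (B - {m}) (g u) lam * R u))" for u
    proof -
      have ne: "g u i \<noteq> lam m" if "i \<in> insert k A" "m \<in> B" for i m
      proof
        assume "g u i = lam m"
        then have "Im (lam m) + e i = 0" by (metis (no_types, lifting) g_def Im_complex_of_real add.commute add.right_inverse add_cancel_left_left complex_i_mult_minus diff_0 minus_complex.simps(2) mult_minus_right Im_i_times Re_complex_of_real uminus_complex.simps(2))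
        then show False using gap that \<eta> by fastforce
      qed
      have "cauchy_ratio (insert k A) B (g u) lam * ((1 + norm (g u k)) powr \<delta> * R u) \<le>
        (\<Sum>m\<in>B - {m0}. resolvent_diff (g u k) (lam m) (lam m0) * cauchy_ratio A (B - {m}) (g u) lam) * ((1 + norm (g u k)) powr \<delta> * R u)"
        by (rule mult_right_mono[OF cauchy_ratio_step[OF insert.hyps B inj cB' m0 ne]]) (use R0 in auto)
      also have "\<dots> = (\<Sum>m\<in>B - {m0}. X m (u k) * (cauchy_ratio A (B - {m}) (g u) lam * R u))"
        unfolding sum_distrib_right X_def g_def by (intro sum.cong refl) (simp only: mult_ac)
      finally show ?thesis using insert.hyps by (simp add: R_def)
    qed
    have "(\<integral>\<^sup>+u. ennreal (cauchy_ratio (insert k A) B (g u) lam * (\<Prod>i\<in>insert k A. (1 + norm (g u i)) powr \<delta>)) \<partial>PiM (insert k A) (\<lambda>_. lborel))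
      \<le> (\<integral>\<^sup>+u. (\<Sum>m\<in>B - {m0}. ennreal (X m (u k)) * ennreal (cauchy_ratio A (B - {m}) (g u) lam * R u)) \<partial>PiM (insert k A) (\<lambda>_. lborel))"
      by (intro nn_integral_mono) (use pw X0 R0 in \<open>simp add: ennreal_mult[symmetric] sum_ennreal ennreal_leI\<close>)
    also have "\<dots> = (\<Sum>m\<in>B - {m0}. \<integral>\<^sup>+u. ennreal (X m (u k)) * ennreal (cauchy_ratio A (B - {m}) (g u) lam * R u) \<partial>PiM (insert k A) (\<lambda>_. lborel))"
    proof (rule nn_integral_sum)
      fix m
      have [measurable]: "(\<lambda>u. X m (u k)) \<in> borel_measurable (PiM (insert k A) (\<lambda>_. lborel))"
        by (rule measurable_compose[OF measurable_component_singleton]) (use Xm in auto)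
      have [measurable]: "R \<in> borel_measurable (PiM (insert k A) (\<lambda>_. lborel))" by (rule Rm) auto
      have [measurable]: "(\<lambda>u. cauchy_ratio A (B - {m}) (g u) lam) \<in> borel_measurable (PiM (insert k A) (\<lambda>_. lborel))"
        by (rule Cm) (use B in auto)
      show "(\<lambda>u. ennreal (X m (u k)) * ennreal (cauchy_ratio A (B - {m}) (g u) lam * R u)) \<in> borel_measurable (PiM (insert k A) (\<lambda>_. lborel))"
        by measurable
    qed
    also have "\<dots> \<le> (\<Sum>m\<in>B - {m0}. ennreal (C * K * (\<Prod>j\<in>B. (1 + norm (lam j)) powr (3 * \<delta> * card (insert k A)))))"
    proof (rule sum_mono)
      fix m assume m: "m \<in> B - {m0}"
      have [measurable]: "(\<lambda>u. X m (u k)) \<in> borel_measurable (PiM (insert k A) (\<lambda>_. lborel))"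
        by (rule measurable_compose[OF measurable_component_singleton]) (use Xm in auto)
      have Rm1[measurable]: "R \<in> borel_measurable (PiM (insert k A) (\<lambda>_. lborel))" "R \<in> borel_measurable (PiM A (\<lambda>_. lborel))"
        by (rule Rm; auto)+
      have [measurable]: "(\<lambda>u. cauchy_ratio A (B - {m}) (g u) lam) \<in> borel_measurable (PiM (insert k A) (\<lambda>_. lborel))"
         "(\<lambda>u. cauchy_ratio A (B - {m}) (g u) lam) \<in> borel_measurable (PiM A (\<lambda>_. lborel))"
        by (rule Cm; use B in auto)+
      have [measurable]: "X m \<in> borel_measurable lborel" using Xm by simp
      have "(\<integral>\<^sup>+u. ennreal (X m (u k)) * ennreal (cauchy_ratio A (B - {m}) (g u) lam * R u) \<partial>PiM (insert k A) (\<lambda>_. lborel))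
        = (\<integral>\<^sup>+u. (\<integral>\<^sup>+y. ennreal (X m y) * ennreal (cauchy_ratio A (B - {m}) (g u) lam * R u) \<partial>lborel) \<partial>PiM A (\<lambda>_. lborel))"
        by (subst lborel_product.product_nn_integral_insert) (use insert.hyps in \<open>auto simp: gA\<close>)
      also have "\<dots> = (\<integral>\<^sup>+u. (\<integral>\<^sup>+y. ennreal (X m y) \<partial>lborel) * ennreal (cauchy_ratio A (B - {m}) (g u) lam * R u) \<partial>PiM A (\<lambda>_. lborel))"
        by (simp add: nn_integral_multc)
      also have "\<dots> = (\<integral>\<^sup>+y. ennreal (X m y) \<partial>lborel) * (\<integral>\<^sup>+u. ennreal (cauchy_ratio A (B - {m}) (g u) lam * R u) \<partial>PiM A (\<lambda>_. lborel))"
        by (subst nn_integral_cmult) auto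
      also have "\<dots> \<le> ennreal (C * ((1 + norm (lam m)) powr (3 * \<delta>) * (1 + norm (lam m0)) powr (3 * \<delta>))) *
          ennreal (K * (\<Prod>j\<in>B - {m}. (1 + norm (lam j)) powr (3 * \<delta> * card A)))"
      proof (rule mult_mono)
        show "(\<integral>\<^sup>+y. ennreal (X m y) \<partial>lborel) \<le> ennreal (C * ((1 + norm (lam m)) powr (3 * \<delta>) * (1 + norm (lam m0)) powr (3 * \<delta>)))"
          unfolding X_def by (rule CX) (use gap m m0 in auto)
        show "(\<integral>\<^sup>+u. ennreal (cauchy_ratio A (B - {m}) (g u) lam * R u) \<partial>PiM A (\<lambda>_. lborel)) \<le>
            ennreal (K * (\<Prod>j\<in>B - {m}. (1 + norm (lam j)) powr (3 * \<delta> * card A)))"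
          unfolding R_def g_def by (rule KB) (use B cB' m inj gap in \<open>auto intro: inj_on_subset\<close>)
      qed auto
      also have "\<dots> = ennreal (C * K * ((1 + norm (lam m)) powr (3 * \<delta>) * ((1 + norm (lam m0)) powr (3 * \<delta>) *
          (\<Prod>j\<in>B - {m}. (1 + norm (lam j)) powr (3 * \<delta> * card A)))))"
        using C K by (subst ennreal_mult[symmetric]) (auto intro!: mult_nonneg_nonneg prod_nonneg simp: mult_ac)
      also have "\<dots> \<le> ennreal (C * K * (\<Prod>j\<in>B. (1 + norm (lam j)) powr (3 * \<delta> * card (insert k A))))"
      proof (intro ennreal_leI mult_left_mono)
        define w where "w j = 1 + norm (lam j)" for j
        have w1: "w j \<ge> 1" for j by (simp add: w_def)
        have ge1: "w j powr (3 * \<delta>) \<ge> 1" for j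
          using w1[of j] \<delta> by (intro ge_one_powr_ge_zero) auto
        have sp: "w j powr (3 * \<delta> * card (insert k A)) = w j powr (3 * \<delta>) * w j powr (3 * \<delta> * card A)" for j
          using insert.hyps by (simp add: powr_add[symmetric] algebra_simps)
        have "w m0 powr (3 * \<delta>) \<le> (\<Prod>j\<in>B - {m}. w j powr (3 * \<delta>))"
        proof -
          have "(\<Prod>j\<in>B - {m}. w j powr (3 * \<delta>)) = w m0 powr (3 * \<delta>) * (\<Prod>j\<in>B - {m} - {m0}. w j powr (3 * \<delta>))"
            using m m0 B by (intro prod.remove) auto
          moreover have "(\<Prod>j\<in>B - {m} - {m0}. w j powr (3 * \<delta>)) \<ge> 1" using ge1 by (intro prod_ge_1) auto
          ultimately show ?thesis by (simp add: mult_le_cancel_left1)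
        qed
        then have "w m0 powr (3 * \<delta>) * (\<Prod>j\<in>B - {m}. w j powr (3 * \<delta> * card A)) \<le> (\<Prod>j\<in>B - {m}. w j powr (3 * \<delta> * card (insert k A)))"
          unfolding sp prod.distrib by (intro mult_right_mono prod_nonneg) auto
        moreover have "w m powr (3 * \<delta>) \<le> w m powr (3 * \<delta> * card (insert k A))"
          using w1[of m] \<delta> insert.hyps by (intro powr_mono) auto
        ultimately have "w m powr (3 * \<delta>) * (w m0 powr (3 * \<delta>) * (\<Prod>j\<in>B - {m}. w j powr (3 * \<delta> * card A))) \<le>
            w m powr (3 * \<delta> * card (insert k A)) * (\<Prod>j\<in>B - {m}. w j powr (3 * \<delta> * card (insert k A)))"
          by (intro mult_mono mult_nonneg_nonneg prod_nonneg) auto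
        also have "\<dots> = (\<Prod>j\<in>B. w j powr (3 * \<delta> * card (insert k A)))"
          using m B by (intro prod.remove[symmetric]) auto
        finally show "(1 + norm (lam m)) powr (3 * \<delta>) * ((1 + norm (lam m0)) powr (3 * \<delta>) *
          (\<Prod>j\<in>B - {m}. (1 + norm (lam j)) powr (3 * \<delta> * card A))) \<le> (\<Prod>j\<in>B. (1 + norm (lam j)) powr (3 * \<delta> * card (insert k A)))"
          by (simp only: w_def)
      qed (use C K in auto)
      finally show "(\<integral>\<^sup>+u. ennreal (X m (u k)) * ennreal (cauchy_ratio A (B - {m}) (g u) lam * R u) \<partial>PiM (insert k A) (\<lambda>_. lborel))
         \<le> ennreal (C * K * (\<Prod>j\<in>B. (1 + norm (lam j)) powr (3 * \<delta> * card (insert k A))))" .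
    qed
    also have "\<dots> = ennreal ((card A + 1) * (C * K) * (\<Prod>j\<in>B. (1 + norm (lam j)) powr (3 * \<delta> * card (insert k A))))"
    proof -
      have "card (B - {m0}) = card A + 1" using cB' m0 B by simp
      moreover have "0 \<le> C * K * (\<Prod>j\<in>B. (1 + norm (lam j)) powr (3 * \<delta> * card (insert k A)))"
        using C K by (intro mult_nonneg_nonneg prod_nonneg) auto
      ultimately show ?thesis by (subst sum_ennreal) (auto simp: mult.assoc)
    qed
    finally show "(\<integral>\<^sup>+u. ennreal (cauchy_ratio (insert k A) B (\<lambda>i. of_real (u i) - \<i> * of_real (e i)) lam *
          (\<Prod>i\<in>insert k A. (1 + norm (of_real (u i) - \<i> * of_real (e i))) powr \<delta>)) \<partial>PiM (insert k A) (\<lambda>_. lborel))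
      \<le> ennreal ((card A + 1) * (C * K) * (\<Prod>m\<in>B. (1 + norm (lam m)) powr (3 * \<delta> * card (insert k A))))"
      unfolding g_def .
  qed
qed

section \<open>The integrand as a nested product\<close>

text \<open>The part of the integrand that depends on row \<open>n\<close> and on the row above it, whose entries are denoted by \<open>lam\<close>.\<close>

definition row_factor :: "(nat \<Rightarrow> real) \<Rightarrow> nat \<Rightarrow> (nat \<Rightarrow> complex) \<Rightarrow> (nat \<Rightarrow> complex) \<Rightarrow> complex" where
  "row_factor x n lam g =
     (\<Prod>j<n. \<Prod>i<j. (g i - g j) * (g j - g i)) / (fact n * (\<Prod>a<n. \<Prod>m\<le>n. g a - lam m)) *
     exp (\<i> * ((\<Sum>m\<le>n. lam m) - (\<Sum>a<n. g a)) * of_real (x n))"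

text \<open>The integrand is a product along the rows, in which each row takes the role of the spectral parameters for the next one. This form
admits induction on the number of rows, with arbitrary \<open>lam\<close>.\<close>

primrec nested_integrand ::
    "(nat \<Rightarrow> real) \<Rightarrow> (nat \<Rightarrow> nat \<Rightarrow> real) \<Rightarrow> nat \<Rightarrow> (nat \<Rightarrow> complex) \<Rightarrow> (nat \<times> nat \<Rightarrow> real) \<Rightarrow> complex" where
  "nested_integrand x \<epsilon> 0 lam u = exp (\<i> * lam 0 * of_real (x 0))"
| "nested_integrand x \<epsilon> (Suc l) lam u = row_factor x (Suc l) lam (row_point (Suc l) (\<epsilon> (Suc l)) u) *
     nested_integrand x \<epsilon> l (row_point (Suc l) (\<epsilon> (Suc l)) u) u"

text \<open>The condition on the imaginary parts: \<open>h m\<close> is the height of the entry \<open>m\<close> of the top row, and the heights increase strictly from row to row.\<close>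

primrec nested_heights :: "(nat \<Rightarrow> nat \<Rightarrow> real) \<Rightarrow> nat \<Rightarrow> (nat \<Rightarrow> real) \<Rightarrow> bool" where
  "nested_heights \<epsilon> 0 h \<longleftrightarrow> True"
| "nested_heights \<epsilon> (Suc l) h \<longleftrightarrow>
     (\<forall>a<Suc l. \<forall>m\<le>Suc l. - \<epsilon> (Suc l) a < h m) \<and> nested_heights \<epsilon> l (\<lambda>a. - \<epsilon> (Suc l) a)"

lemma Im_row_point [simp]: "Im (row_point n \<epsilon> u a) = - \<epsilon> a"
  by (simp add: row_point_def)

lemma whittaker_index_0: "whittaker_index 0 = {}"
  by (auto simp: whittaker_index_def)

lemma whittaker_index_Suc: "whittaker_index (Suc l) = row_index (Suc l) \<union> whittaker_index l"
proof (rule Set.set_eqI)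
  fix i :: "nat \<times> nat"
  obtain n j where i: "i = (n, j)" by (cases i)
  have "(n, j) \<in> row_index (Suc l) \<longleftrightarrow> n = Suc l \<and> 1 \<le> j \<and> j \<le> n"
    by (cases j) (auto simp: row_index_def)
  then show "i \<in> whittaker_index (Suc l) \<longleftrightarrow> i \<in> row_index (Suc l) \<union> whittaker_index l"
    unfolding i by (auto simp: whittaker_index_def)
qed

lemma row_index_disjoint: "row_index (Suc l) \<inter> whittaker_index l = {}"
  by (auto simp: row_index_def whittaker_index_def)

lemma finite_whittaker_index [simp]: "finite (whittaker_index l)"
  by (induction l) (simp_all add: whittaker_index_0 whittaker_index_Suc)

lemma card_whittaker_index: "card (whittaker_index l) = (\<Sum>n\<le>l. n)"
proof (induction l)
  case (Suc l)
  have "card (row_index (Suc l)) = Suc l"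
    unfolding row_index_def by (simp add: card_image[OF row_index_inj])
  then show ?case
    unfolding whittaker_index_Suc using Suc
    by (subst card_Un_disjoint) (auto simp: row_index_disjoint)
qed (simp add: whittaker_index_0)

lemma row_point_cong:
  assumes "\<And>i. i \<in> row_index n \<Longrightarrow> u i = v i" "a < n"
  shows "row_point n \<epsilon> u a = row_point n \<epsilon> v a"
  using assms by (auto simp: row_point_def row_index_def)

lemma row_factor_cong:
  assumes "\<And>a. a < n \<Longrightarrow> g a = g' a" "\<And>m. m \<le> n \<Longrightarrow> lam m = lam' m"
  shows "row_factor x n lam g = row_factor x n lam' g'"
proof -
  have "(\<Prod>j<n. \<Prod>i<j. (g i - g j) * (g j - g i)) = (\<Prod>j<n. \<Prod>i<j. (g' i - g' j) * (g' j - g' i))"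
    using assms(1) by (intro prod.cong refl) auto
  moreover have "(\<Prod>a<n. \<Prod>m\<le>n. g a - lam m) = (\<Prod>a<n. \<Prod>m\<le>n. g' a - lam' m)"
    using assms by (intro prod.cong refl) auto
  moreover have "(\<Sum>m\<le>n. lam m) = (\<Sum>m\<le>n. lam' m)" "(\<Sum>a<n. g a) = (\<Sum>a<n. g' a)"
    using assms by (auto intro: sum.cong)
  ultimately show ?thesis by (simp only: row_factor_def)
qed

lemma nested_integrand_cong:
  assumes "\<And>m. m \<le> l \<Longrightarrow> lam m = lam' m" "\<And>i. i \<in> whittaker_index l \<Longrightarrow> u i = v i"
  shows "nested_integrand x \<epsilon> l lam u = nested_integrand x \<epsilon> l lam' v"
  using assms
proof (induction l arbitrary: lam lam')
  case (Suc l)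
  have rp: "row_point (Suc l) (\<epsilon> (Suc l)) u a = row_point (Suc l) (\<epsilon> (Suc l)) v a" if "a < Suc l" for a
    by (rule row_point_cong) (use Suc.prems that in \<open>auto simp: whittaker_index_Suc\<close>)
  have "row_factor x (Suc l) lam (row_point (Suc l) (\<epsilon> (Suc l)) u) = row_factor x (Suc l) lam' (row_point (Suc l) (\<epsilon> (Suc l)) v)"
    by (rule row_factor_cong) (use Suc.prems rp in auto)
  moreover have "nested_integrand x \<epsilon> l (row_point (Suc l) (\<epsilon> (Suc l)) u) u = nested_integrand x \<epsilon> l (row_point (Suc l) (\<epsilon> (Suc l)) v) v"
    by (rule Suc.IH) (use Suc.prems rp in \<open>auto simp: whittaker_index_Suc\<close>)
  ultimately show ?case by simp
qed simp

lemma row_factor_measurable: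
  assumes "\<And>a. a < n \<Longrightarrow> (\<lambda>w. G w a) \<in> borel_measurable M" "\<And>m. m \<le> n \<Longrightarrow> (\<lambda>w. L w m) \<in> borel_measurable M"
  shows "(\<lambda>w. row_factor x n (L w) (G w)) \<in> borel_measurable M"
proof -
  have 1: "(\<lambda>w. \<Prod>j<n. \<Prod>i<j. (G w i - G w j) * (G w j - G w i)) \<in> borel_measurable M"
    using assms by (intro borel_measurable_prod borel_measurable_times borel_measurable_diff) auto
  have 2: "(\<lambda>w. \<Prod>a<n. \<Prod>m\<le>n. G w a - L w m) \<in> borel_measurable M"
    using assms by (intro borel_measurable_prod borel_measurable_diff) auto
  have 3: "(\<lambda>w. (\<Sum>m\<le>n. L w m) - (\<Sum>a<n. G w a)) \<in> borel_measurable M"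
    using assms by (intro borel_measurable_diff borel_measurable_sum) auto
  note [measurable] = 1 2 3
  show ?thesis unfolding row_factor_def by measurable
qed

lemma row_point_measurable:
  assumes "\<And>i. i \<in> row_index n \<Longrightarrow> (\<lambda>w. U w i) \<in> borel_measurable M" "a < n"
  shows "(\<lambda>w. row_point n \<epsilon> (U w) a) \<in> borel_measurable M"
proof -
  have [measurable]: "(\<lambda>w. U w (n, Suc a)) \<in> borel_measurable M"
    using assms by (auto simp: row_index_def)
  show ?thesis unfolding row_point_def by measurable
qed

lemma nested_integrand_measurable:
  assumes "\<And>m. m \<le> l \<Longrightarrow> (\<lambda>w. L w m) \<in> borel_measurable M"
    and "\<And>i. i \<in> whittaker_index l \<Longrightarrow> (\<lambda>w. U w i) \<in> borel_measurable M"
  shows "(\<lambda>w. nested_integrand x \<epsilon> l (L w) (U w)) \<in> borel_measurable M"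
  using assms
proof (induction l arbitrary: L)
  case 0
  then have [measurable]: "(\<lambda>w. L w 0) \<in> borel_measurable M" by simp
  show ?case by simp
next
  case (Suc l)
  have rp: "(\<lambda>w. row_point (Suc l) (\<epsilon> (Suc l)) (U w) a) \<in> borel_measurable M" if "a < Suc l" for a
    by (rule row_point_measurable) (use Suc.prems that in \<open>auto simp: whittaker_index_Suc\<close>)
  show ?case unfolding nested_integrand.simps
    by (intro borel_measurable_times row_factor_measurable Suc.IH) (use Suc.prems rp in \<open>auto simp: whittaker_index_Suc\<close>)
qed

text \<open>Multiplying by the absolute Vandermonde product of the upper row turns the row factor into a \<open>cauchy_ratio\<close> times the same
product for the lower row, which is what the induction hypothesis on the lower rows asks for.\<close>

lemma row_factor_norm:
  assumes "\<And>m. m \<le> n \<Longrightarrow> Im (lam m) = h m" "\<And>a. a < n \<Longrightarrow> Im (g a) = k a"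
  shows "abs_vandermonde {..n} lam * norm (row_factor x n lam g) =
    exp (- (((\<Sum>m\<le>n. h m) - (\<Sum>a<n. k a)) * x n)) / fact n * cauchy_ratio {..<n} {..n} g lam * abs_vandermonde {..<n} g"
proof -
  have "norm (\<Prod>j<n. \<Prod>i<j. (g i - g j) * (g j - g i)) = (abs_vandermonde {..<n} g)\<^sup>2"
    unfolding abs_vandermonde_def by (simp add: prod_nonneg prod_offdiagonal prod_norm[symmetric] norm_mult)
  moreover have "norm (exp (\<i> * ((\<Sum>m\<le>n. lam m) - (\<Sum>a<n. g a)) * of_real (x n))) = exp (- (((\<Sum>m\<le>n. h m) - (\<Sum>a<n. k a)) * x n))"
    using assms by (simp add: norm_exp_eq_Re left_diff_distrib)
  ultimately show ?thesis
    by (simp add: row_factor_def norm_mult norm_divide prod_norm[symmetric] cauchy_ratio_def power2_eq_square)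
qed

lemma nested_integrand_merge:
  "nested_integrand x \<epsilon> (Suc l) lam (merge (row_index (Suc l)) (whittaker_index l) (u, v)) =
     row_factor x (Suc l) lam (row_point (Suc l) (\<epsilon> (Suc l)) u) *
     nested_integrand x \<epsilon> l (row_point (Suc l) (\<epsilon> (Suc l)) u) v"
proof -
  let ?w = "merge (row_index (Suc l)) (whittaker_index l) (u, v)"
  have w1: "?w i = u i" if "i \<in> row_index (Suc l)" for i using that by (simp add: merge_def)
  have w2: "?w i = v i" if "i \<in> whittaker_index l" for i
    using that row_index_disjoint[of l] by (auto simp: merge_def)
  have rp: "row_point (Suc l) (\<epsilon> (Suc l)) ?w a = row_point (Suc l) (\<epsilon> (Suc l)) u a" if "a < Suc l" for a
    by (rule row_point_cong) (use w1 that in auto)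
  have "row_factor x (Suc l) lam (row_point (Suc l) (\<epsilon> (Suc l)) ?w) = row_factor x (Suc l) lam (row_point (Suc l) (\<epsilon> (Suc l)) u)"
    by (rule row_factor_cong) (use rp in auto)
  moreover have "nested_integrand x \<epsilon> l (row_point (Suc l) (\<epsilon> (Suc l)) ?w) ?w = nested_integrand x \<epsilon> l (row_point (Suc l) (\<epsilon> (Suc l)) u) v"
    by (rule nested_integrand_cong) (use rp w2 in auto)
  ultimately show ?thesis by simp
qed

text \<open>The integral of the absolute value, multiplied by the Vandermonde product of \<open>lam\<close>, grows at most like an arbitrarily small power of
\<open>lam\<close>. The factor \<open>abs_vandermonde\<close> makes the recursion close, and the growth on the right is absorbed by the next row
through \<open>cauchy_ratio_integral\<close>.\<close>

theorem nested_integrand_bound: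
  assumes "nested_heights \<epsilon> l h" and \<delta>: "0 < \<delta>" "\<delta> \<le> 1/2"
  shows "\<exists>K\<ge>0. \<forall>lam. (\<forall>m\<le>l. Im (lam m) = h m) \<longrightarrow>
    (\<integral>\<^sup>+u. ennreal (abs_vandermonde {..l} lam * norm (nested_integrand x \<epsilon> l lam u)) \<partial>PiM (whittaker_index l) (\<lambda>_. lborel))
      \<le> ennreal (K * (\<Prod>m\<le>l. (1 + norm (lam m)) powr \<delta>))"
  using assms
proof (induction l arbitrary: h \<delta>)
  case 0
  have "abs_vandermonde {..0} lam = 1" for lam :: "nat \<Rightarrow> complex" by (simp add: abs_vandermonde_def)
  moreover have "1 \<le> (1 + norm (lam 0)) powr \<delta>" for lam :: "nat \<Rightarrow> complex"
    using 0 by (intro ge_one_powr_ge_zero) auto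
  ultimately show ?case
    by (intro exI[of _ "exp (- (h 0 * x 0))"])
      (auto simp: whittaker_index_0 lborel_product.nn_integral_empty norm_exp_eq_Re space_PiM_empty mult_le_cancel_left1)
next
  case (Suc l)
  define n where "n = Suc l"
  define k where "k = (\<lambda>a. - \<epsilon> n a)"
  \<comment> \<open>The exponent for the lower rows, so small that the integration over row \<open>n\<close> returns \<open>\<delta>\<close>.\<close>
  define \<delta>' where "\<delta>' = \<delta> / (3 * n)"
  have \<delta>': "0 < \<delta>'" "\<delta>' \<le> 1/2" "3 * \<delta>' * n = \<delta>"
  proof -
    have "3 * real n \<ge> 1" by (simp add: n_def)
    then show "0 < \<delta>'" "\<delta>' \<le> 1/2" "3 * \<delta>' * n = \<delta>"
      using Suc.prems(2,3) by (auto simp: \<delta>'_def field_simps)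
  qed
  have hts: "\<And>a m. a < n \<Longrightarrow> m \<le> n \<Longrightarrow> k a < h m" and "nested_heights \<epsilon> l k"
    using Suc.prems(1) by (auto simp: n_def k_def)
  from Suc.IH[OF this(2) \<delta>'(1,2)] obtain K where K: "K \<ge> 0" and KB: "\<And>lam. (\<And>m. m \<le> l \<Longrightarrow> Im (lam m) = k m) \<Longrightarrow>
    (\<integral>\<^sup>+u. ennreal (abs_vandermonde {..l} lam * norm (nested_integrand x \<epsilon> l lam u)) \<partial>PiM (whittaker_index l) (\<lambda>_. lborel))
      \<le> ennreal (K * (\<Prod>m\<le>l. (1 + norm (lam m)) powr \<delta>'))" by metis
  obtain \<eta> where \<eta>: "\<eta> > 0" and gap: "\<And>a m. a < n \<Longrightarrow> m \<le> n \<Longrightarrow> \<eta> \<le> h m - k a"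
    using finite_positive_gap[of "{..<n} \<times> {..n}" "\<lambda>(a, m). h m - k a"] hts by fastforce
  define e where "e i = - k (snd i - 1)" for i :: "nat \<times> nat"
  have cn: "card (row_index n) = n"
    unfolding row_index_def by (simp add: card_image[OF row_index_inj])
  obtain C where C: "C \<ge> 0" and CB: "\<forall>B (lam :: nat \<Rightarrow> complex). finite B \<longrightarrow> card B = Suc n \<longrightarrow> inj_on lam B \<longrightarrow>
      (\<forall>i\<in>row_index n. \<forall>m\<in>B. Im (lam m) + e i \<ge> \<eta>) \<longrightarrow>
      (\<integral>\<^sup>+u. ennreal (cauchy_ratio (row_index n) B (\<lambda>i. of_real (u i) - \<i> * of_real (e i)) lam *
          (\<Prod>i\<in>row_index n. (1 + norm (of_real (u i) - \<i> * of_real (e i))) powr \<delta>')) \<partial>PiM (row_index n) (\<lambda>_. lborel))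
      \<le> ennreal (C * (\<Prod>m\<in>B. (1 + norm (lam m)) powr (3 * \<delta>' * n)))"
    using cauchy_ratio_integral[OF \<delta>'(1,2) \<eta> finite_row_index, of n e, unfolded cn] by (elim exE conjE) (rule that)
  define E where "E = exp (- (((\<Sum>m\<le>n. h m) - (\<Sum>a<n. k a)) * x n)) / fact n"
  have E0: "E \<ge> 0" by (simp add: E_def)
  show ?case unfolding n_def[symmetric]
  proof (intro exI[of _ "E * K * C"] conjI allI impI)
    show "0 \<le> E * K * C" using E0 K C by simp
    fix lam :: "nat \<Rightarrow> complex" assume L: "\<forall>m\<le>n. Im (lam m) = h m"
    show "(\<integral>\<^sup>+u. ennreal (abs_vandermonde {..n} lam * norm (nested_integrand x \<epsilon> n lam u)) \<partial>PiM (whittaker_index n) (\<lambda>_. lborel))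
      \<le> ennreal (E * K * C * (\<Prod>m\<le>n. (1 + norm (lam m)) powr \<delta>))"
    proof (cases "inj_on lam {..n}")
      case False
      then obtain i j where "i \<le> n" "j \<le> n" "i \<noteq> j" "lam i = lam j" by (auto simp: inj_on_def)
      \<comment> \<open>For coinciding parameters the left side is \<open>0\<close>; integrability in this case comes from \<open>nested_integrand_comparison\<close>.\<close>
      then have "abs_vandermonde {..n} lam = 0"
        unfolding abs_vandermonde_def real_sqrt_eq_zero_cancel_iff prod_zero_iff[OF finite_atMost] by fastforce
      then show ?thesis by simp
    next
      case True
      let ?g = "row_point n (\<epsilon> n)"
      have cr: "cauchy_ratio (row_index n) {..n} (\<lambda>i. of_real (u i) - \<i> * of_real (e i)) lam = cauchy_ratio {..<n} {..n} (?g u) lam" for u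
        unfolding cauchy_ratio_def prod_row_index
        unfolding row_index_def abs_vandermonde_reindex[OF row_index_inj]
        by (simp add: e_def k_def row_point_def[abs_def])
      have wt: "(\<Prod>i\<in>row_index n. (1 + norm (of_real (u i) - \<i> * of_real (e i))) powr \<delta>') = (\<Prod>a\<le>l. (1 + norm (?g u a)) powr \<delta>')" for u
        unfolding prod_row_index by (simp add: e_def k_def row_point_def n_def lessThan_Suc_atMost)
      have gm: "(\<lambda>u. ?g u a) \<in> borel_measurable (PiM (row_index n) (\<lambda>_. lborel))" if "a < n" for a
        by (rule row_point_measurable) (use that in auto)
      have crm[measurable]: "(\<lambda>u. cauchy_ratio {..<n} {..n} (?g u) lam) \<in> borel_measurable (PiM (row_index n) (\<lambda>_. lborel))"
        by (rule cauchy_ratio_measurable) (use gm in auto)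
      have wtm[measurable]: "(\<lambda>u. \<Prod>a\<le>l. (1 + norm (?g u a)) powr \<delta>') \<in> borel_measurable (PiM (row_index n) (\<lambda>_. lborel))"
      proof (rule borel_measurable_prod)
        fix a assume "a \<in> {..l}"
        then have [measurable]: "(\<lambda>u. ?g u a) \<in> borel_measurable (PiM (row_index n) (\<lambda>_. lborel))" by (intro gm) (auto simp: n_def)
        show "(\<lambda>u. (1 + norm (?g u a)) powr \<delta>') \<in> borel_measurable (PiM (row_index n) (\<lambda>_. lborel))" by measurable
      qed
      have nim: "(\<lambda>u. nested_integrand x \<epsilon> l lm u) \<in> borel_measurable (PiM (whittaker_index l) (\<lambda>_. lborel))" for l lm
        by (rule nested_integrand_measurable) auto
      have "(\<integral>\<^sup>+u. ennreal (abs_vandermonde {..n} lam * norm (nested_integrand x \<epsilon> n lam u)) \<partial>PiM (whittaker_index n) (\<lambda>_. lborel)) =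
        (\<integral>\<^sup>+u. \<integral>\<^sup>+v. ennreal (abs_vandermonde {..n} lam * norm (nested_integrand x \<epsilon> n lam (merge (row_index n) (whittaker_index l) (u, v))))
          \<partial>PiM (whittaker_index l) (\<lambda>_. lborel) \<partial>PiM (row_index n) (\<lambda>_. lborel))"
      proof -
        have "(\<lambda>u. ennreal (abs_vandermonde {..n} lam * norm (nested_integrand x \<epsilon> n lam u))) \<in> borel_measurable (PiM (whittaker_index n) (\<lambda>_. lborel))"
          using nim[of n lam] by measurable
        then show ?thesis
          unfolding n_def whittaker_index_Suc
          by (intro lborel_product.product_nn_integral_fold row_index_disjoint) auto
      qed
      also have "\<dots> = (\<integral>\<^sup>+u. ennreal (E * cauchy_ratio {..<n} {..n} (?g u) lam) *
          (\<integral>\<^sup>+v. ennreal (abs_vandermonde {..l} (?g u) * norm (nested_integrand x \<epsilon> l (?g u) v)) \<partial>PiM (whittaker_index l) (\<lambda>_. lborel)) \<partial>PiM (row_index n) (\<lambda>_. lborel))"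
      proof (rule nn_integral_cong)
        fix u
        have "abs_vandermonde {..n} lam * norm (nested_integrand x \<epsilon> n lam (merge (row_index n) (whittaker_index l) (u, v))) =
           E * cauchy_ratio {..<n} {..n} (?g u) lam * (abs_vandermonde {..l} (?g u) * norm (nested_integrand x \<epsilon> l (?g u) v))" for v
        proof -
          have "abs_vandermonde {..n} lam * norm (row_factor x n lam (?g u)) = E * cauchy_ratio {..<n} {..n} (?g u) lam * abs_vandermonde {..<n} (?g u)"
            unfolding E_def by (rule row_factor_norm) (use L in \<open>auto simp: k_def\<close>)
          then show ?thesis
            unfolding n_def nested_integrand_merge by (simp add: norm_mult lessThan_Suc_atMost mult.assoc[symmetric])
        qed
        moreover have "(\<lambda>v. ennreal (abs_vandermonde {..l} (?g u) * norm (nested_integrand x \<epsilon> l (?g u) v))) \<in> borel_measurable (PiM (whittaker_index l) (\<lambda>_. lborel))"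
          using nim[of l "?g u"] by measurable
        ultimately show "(\<integral>\<^sup>+v. ennreal (abs_vandermonde {..n} lam * norm (nested_integrand x \<epsilon> n lam (merge (row_index n) (whittaker_index l) (u, v))))
          \<partial>PiM (whittaker_index l) (\<lambda>_. lborel)) = ennreal (E * cauchy_ratio {..<n} {..n} (?g u) lam) *
          (\<integral>\<^sup>+v. ennreal (abs_vandermonde {..l} (?g u) * norm (nested_integrand x \<epsilon> l (?g u) v)) \<partial>PiM (whittaker_index l) (\<lambda>_. lborel))"
          using E0 by (subst nn_integral_cmult[symmetric]) (auto simp: ennreal_mult')
      qed
      also have "\<dots> \<le> (\<integral>\<^sup>+u. ennreal (E * K) * ennreal (cauchy_ratio {..<n} {..n} (?g u) lam * (\<Prod>a\<le>l. (1 + norm (?g u a)) powr \<delta>')) \<partial>PiM (row_index n) (\<lambda>_. lborel))"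
      proof (rule nn_integral_mono)
        fix u
        have "ennreal (E * cauchy_ratio {..<n} {..n} (?g u) lam) *
          (\<integral>\<^sup>+v. ennreal (abs_vandermonde {..l} (?g u) * norm (nested_integrand x \<epsilon> l (?g u) v)) \<partial>PiM (whittaker_index l) (\<lambda>_. lborel)) \<le>
          ennreal (E * cauchy_ratio {..<n} {..n} (?g u) lam) * ennreal (K * (\<Prod>a\<le>l. (1 + norm (?g u a)) powr \<delta>'))"
          by (intro mult_left_mono KB) (auto simp: k_def)
        also have "\<dots> = ennreal (E * K) * ennreal (cauchy_ratio {..<n} {..n} (?g u) lam * (\<Prod>a\<le>l. (1 + norm (?g u a)) powr \<delta>'))"
          using E0 K by (simp add: ennreal_mult[symmetric] prod_nonneg mult_ac)
        finally show "ennreal (E * cauchy_ratio {..<n} {..n} (?g u) lam) *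
          (\<integral>\<^sup>+v. ennreal (abs_vandermonde {..l} (?g u) * norm (nested_integrand x \<epsilon> l (?g u) v)) \<partial>PiM (whittaker_index l) (\<lambda>_. lborel)) \<le>
          ennreal (E * K) * ennreal (cauchy_ratio {..<n} {..n} (?g u) lam * (\<Prod>a\<le>l. (1 + norm (?g u a)) powr \<delta>'))" .
      qed
      also have "\<dots> = ennreal (E * K) * (\<integral>\<^sup>+u. ennreal (cauchy_ratio {..<n} {..n} (?g u) lam * (\<Prod>a\<le>l. (1 + norm (?g u a)) powr \<delta>')) \<partial>PiM (row_index n) (\<lambda>_. lborel))"
        by (rule nn_integral_cmult) measurable
      also have "\<dots> \<le> ennreal (E * K) * ennreal (C * (\<Prod>m\<le>n. (1 + norm (lam m)) powr (3 * \<delta>' * n)))"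
      proof (rule mult_left_mono)
        have "Im (lam m) + e i \<ge> \<eta>" if "i \<in> row_index n" "m \<le> n" for i m
          using that gap L by (fastforce simp: e_def row_index_def)
        then show "(\<integral>\<^sup>+u. ennreal (cauchy_ratio {..<n} {..n} (?g u) lam * (\<Prod>a\<le>l. (1 + norm (?g u a)) powr \<delta>')) \<partial>PiM (row_index n) (\<lambda>_. lborel))
          \<le> ennreal (C * (\<Prod>m\<le>n. (1 + norm (lam m)) powr (3 * \<delta>' * n)))"
          using CB[rule_format, of "{..n}" lam] True unfolding cr wt by simp
      qed simp
      also have "\<dots> = ennreal (E * K * C * (\<Prod>m\<le>n. (1 + norm (lam m)) powr \<delta>))"
        unfolding \<delta>'(3) using E0 K C by (simp add: ennreal_mult[symmetric] prod_nonneg mult.assoc)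
      finally show ?thesis .
    qed
  qed
qed

section \<open>Value and continuity of the nested integral\<close>

lemma nested_integrand_integrable_distinct:
  assumes hts: "nested_heights \<epsilon> l (\<lambda>m. Im (lam m))" and inj: "inj_on lam {..l}"
  shows "integrable (PiM (whittaker_index l) (\<lambda>_. lborel)) (nested_integrand x \<epsilon> l lam)"
proof -
  obtain K where "\<forall>lm. (\<forall>m\<le>l. Im (lm m) = Im (lam m)) \<longrightarrow>
    (\<integral>\<^sup>+u. ennreal (abs_vandermonde {..l} lm * norm (nested_integrand x \<epsilon> l lm u)) \<partial>PiM (whittaker_index l) (\<lambda>_. lborel))
      \<le> ennreal (K * (\<Prod>m\<le>l. (1 + norm (lm m)) powr (1/2)))"
    using nested_integrand_bound[OF hts, of "1/2" x] by auto
  then have K: "(\<integral>\<^sup>+u. ennreal (abs_vandermonde {..l} lam * norm (nested_integrand x \<epsilon> l lam u)) \<partial>PiM (whittaker_index l) (\<lambda>_. lborel))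
      \<le> ennreal (K * (\<Prod>m\<le>l. (1 + norm (lam m)) powr (1/2)))" by blast
  have V: "abs_vandermonde {..l} lam \<noteq> 0"
    unfolding abs_vandermonde_def real_sqrt_eq_zero_cancel_iff using inj by (auto simp: inj_on_def)
  have m: "nested_integrand x \<epsilon> l lam \<in> borel_measurable (PiM (whittaker_index l) (\<lambda>_. lborel))"
    using nested_integrand_measurable[of l "\<lambda>_. lam" _ "\<lambda>u. u" x \<epsilon>] by simp
  have "integrable (PiM (whittaker_index l) (\<lambda>_. lborel)) (\<lambda>u. of_real (abs_vandermonde {..l} lam) * nested_integrand x \<epsilon> l lam u)"
  proof (rule integrableI_bounded)
    show "(\<lambda>u. of_real (abs_vandermonde {..l} lam) * nested_integrand x \<epsilon> l lam u) \<in> borel_measurable (PiM (whittaker_index l) (\<lambda>_. lborel))"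
      using m by measurable
    show "(\<integral>\<^sup>+u. ennreal (norm (of_real (abs_vandermonde {..l} lam) * nested_integrand x \<epsilon> l lam u)) \<partial>PiM (whittaker_index l) (\<lambda>_. lborel)) < \<infinity>"
      using K by (simp add: norm_mult order_le_less_trans[OF _ ennreal_less_top])
  qed
  then have "integrable (PiM (whittaker_index l) (\<lambda>_. lborel)) (\<lambda>u. of_real (1 / abs_vandermonde {..l} lam) * (of_real (abs_vandermonde {..l} lam) * nested_integrand x \<epsilon> l lam u))"
    by (rule integrable_mult_right)
  then show ?thesis using V by (simp add: mult.assoc[symmetric])
qed

text \<open>Only the denominators of the top row factor and a phase depend on \<open>lam\<close>. The points of the contour keep a distance \<open>\<eta>\<close> from the
parameters, so moving these horizontally by at most \<open>D\<close> changes each denominator at most by the factor \<open>1 + D / \<eta>\<close>.\<close>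

lemma nested_integrand_comparison:
  assumes hts: "nested_heights \<epsilon> l h" and D: "D \<ge> 0"
  shows "\<exists>C\<ge>0. \<forall>lam lam' u. (\<forall>m\<le>l. Im (lam m) = h m \<and> Im (lam' m) = h m \<and> norm (lam m - lam' m) \<le> D) \<longrightarrow>
    norm (nested_integrand x \<epsilon> l lam u) \<le> C * norm (nested_integrand x \<epsilon> l lam' u)"
proof (cases l)
  case 0
  then show ?thesis by (intro exI[of _ 1]) (auto simp: norm_exp_eq_Re)
next
  case (Suc l')
  define n where "n = Suc l'"
  define k where "k = (\<lambda>a. - \<epsilon> n a)"
  have hts': "\<And>a m. a < n \<Longrightarrow> m \<le> n \<Longrightarrow> k a < h m"
    using hts by (auto simp: n_def k_def Suc)
  obtain \<eta> where \<eta>: "\<eta> > 0" and gap: "\<And>a m. a < n \<Longrightarrow> m \<le> n \<Longrightarrow> \<eta> \<le> h m - k a"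
    using finite_positive_gap[of "{..<n} \<times> {..n}" "\<lambda>(a, m). h m - k a"] hts' by fastforce
  define q where "q = 1 + D / \<eta>"
  have q: "q \<ge> 1" using D \<eta> by (simp add: q_def)
  show ?thesis unfolding Suc n_def[symmetric]
  proof (intro exI[of _ "\<Prod>a<n. \<Prod>m\<le>n. q"] conjI allI impI)
    show "0 \<le> (\<Prod>a<n. \<Prod>m\<le>n. q)" using q by (intro prod_nonneg) auto
    fix lam lam' :: "nat \<Rightarrow> complex" and u
    assume L: "\<forall>m\<le>n. Im (lam m) = h m \<and> Im (lam' m) = h m \<and> norm (lam m - lam' m) \<le> D"
    define g where "g = row_point n (\<epsilon> n) u"
    have g: "Im (g a) = k a" for a by (simp add: g_def k_def)
    have ge: "norm (g a - lm m) \<ge> \<eta>" if "a < n" "m \<le> n" "Im (lm m) = h m" for a m lm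
      using abs_Im_le_cmod[of "g a - lm m"] gap[OF that(1,2)] that(3) by (simp add: g)
    have pr: "(\<Prod>a<n. \<Prod>m\<le>n. norm (g a - lam' m)) \<le> (\<Prod>a<n. \<Prod>m\<le>n. q) * (\<Prod>a<n. \<Prod>m\<le>n. norm (g a - lam m))"
      unfolding prod.distrib[symmetric]
    proof (intro prod_mono conjI prod_nonneg)
      fix a m assume am: "a \<in> {..<n}" "m \<in> {..n}"
      have "norm (g a - lam' m) \<le> norm (g a - lam m) + norm (lam m - lam' m)"
        using norm_triangle_ineq[of "g a - lam m" "lam m - lam' m"] by simp
      also have "\<dots> \<le> norm (g a - lam m) + D" using L am by auto
      also have "D \<le> D / \<eta> * norm (g a - lam m)"
        using mult_left_mono[OF ge[of a m lam], of "D / \<eta>"] am L D \<eta> by simp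
      finally show "norm (g a - lam' m) \<le> q * norm (g a - lam m)" by (simp add: q_def algebra_simps)
    qed auto
    have pos: "(\<Prod>a<n. \<Prod>m\<le>n. norm (g a - lm m)) > 0" if "\<forall>m\<le>n. Im (lm m) = h m" for lm
      using ge \<eta> that by (intro prod_pos) (fastforce simp: less_le_trans)+
    have ex: "norm (exp (\<i> * ((\<Sum>m\<le>n. lm m) - (\<Sum>a<n. g a)) * of_real (x n))) = exp (- (((\<Sum>m\<le>n. h m) - (\<Sum>a<n. k a)) * x n))"
      if "\<forall>m\<le>n. Im (lm m) = h m" for lm
      using that g by (simp add: norm_exp_eq_Re left_diff_distrib)
    define T where "T = norm (\<Prod>j<n. \<Prod>i<j. (g i - g j) * (g j - g i)) / fact n * exp (- (((\<Sum>m\<le>n. h m) - (\<Sum>a<n. k a)) * x n))"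
    have T: "T \<ge> 0" by (simp add: T_def)
    have rf: "norm (row_factor x n lm g) = T / (\<Prod>a<n. \<Prod>m\<le>n. norm (g a - lm m))" if "\<forall>m\<le>n. Im (lm m) = h m" for lm
    proof -
      have "norm (row_factor x n lm g) = norm ((\<Prod>j<n. \<Prod>i<j. (g i - g j) * (g j - g i)) / (fact n * (\<Prod>a<n. \<Prod>m\<le>n. g a - lm m))) *
          norm (exp (\<i> * ((\<Sum>m\<le>n. lm m) - (\<Sum>a<n. g a)) * of_real (x n)))"
        unfolding row_factor_def by (rule norm_mult)
      then show ?thesis unfolding ex[OF that] by (simp add: T_def norm_divide norm_mult prod_norm[symmetric])
    qed
    have "norm (row_factor x n lam g) \<le> (\<Prod>a<n. \<Prod>m\<le>n. q) * norm (row_factor x n lam' g)"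
    proof -
      have p: "(\<Prod>a<n. \<Prod>m\<le>n. norm (g a - lam m)) > 0" "(\<Prod>a<n. \<Prod>m\<le>n. norm (g a - lam' m)) > 0"
        using pos[of lam] pos[of lam'] L by auto
      have "T * (\<Prod>a<n. \<Prod>m\<le>n. norm (g a - lam' m)) \<le> T * ((\<Prod>a<n. \<Prod>m\<le>n. q) * (\<Prod>a<n. \<Prod>m\<le>n. norm (g a - lam m)))"
        by (rule mult_left_mono[OF pr T])
      then have "T / (\<Prod>a<n. \<Prod>m\<le>n. norm (g a - lam m)) \<le> (\<Prod>a<n. \<Prod>m\<le>n. q) * (T / (\<Prod>a<n. \<Prod>m\<le>n. norm (g a - lam' m)))"
        using p by (simp only: pos_divide_le_eq times_divide_eq_right times_divide_eq_left pos_le_divide_eq mult_ac)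
      then show ?thesis using L rf by simp
    qed
    then have "norm (row_factor x n lam g) * norm (nested_integrand x \<epsilon> l' g u) \<le>
        (\<Prod>a<n. \<Prod>m\<le>n. q) * norm (row_factor x n lam' g) * norm (nested_integrand x \<epsilon> l' g u)"
      by (rule mult_right_mono) simp
    then show "norm (nested_integrand x \<epsilon> n lam u) \<le> (\<Prod>a<n. \<Prod>m\<le>n. q) * norm (nested_integrand x \<epsilon> n lam' u)"
      unfolding n_def by (simp only: nested_integrand.simps norm_mult mult.assoc g_def[unfolded n_def])
  qed
qed

lemma Im_shifted [simp]: "Im (shifted lam s i) = Im (lam i)"
  by (simp add: shifted_def)

text \<open>One small shift \<open>s0\<close> with distinct parameters has an integrable integrand, and it dominates all the others.\<close>

lemma nested_integrand_shift_bound: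
  assumes hts: "nested_heights \<epsilon> l (\<lambda>m. Im (lam m))"
  shows "\<exists>w. integrable (PiM (whittaker_index l) (\<lambda>_. lborel)) w \<and>
    (\<forall>s u. 0 \<le> s \<longrightarrow> s < 1 \<longrightarrow> norm (nested_integrand x \<epsilon> l (shifted lam s) u) \<le> w u)"
proof -
  have "eventually (\<lambda>s. inj_on (shifted lam s) {..<Suc l} \<and> s < 1) (at_right 0)"
    by (intro eventually_conj eventually_shifted_inj) (auto simp: eventually_at_right_field intro!: exI[of _ 1])
  then have "eventually (\<lambda>s. inj_on (shifted lam s) {..<Suc l} \<and> s < 1 \<and> s > 0) (at_right 0)"
    using eventually_at_right_less[of "0::real"] by eventually_elim auto
  then obtain s0 where s0: "inj_on (shifted lam s0) {..l}" "0 < s0" "s0 < 1"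
    using eventually_happens'[OF trivial_limit_at_right_real] by (auto simp: lessThan_Suc_atMost)
  obtain C where C: "\<And>lm lm' u. (\<And>m. m \<le> l \<Longrightarrow> Im (lm m) = Im (lam m) \<and> Im (lm' m) = Im (lam m) \<and> norm (lm m - lm' m) \<le> real l + 1) \<Longrightarrow>
    norm (nested_integrand x \<epsilon> l lm u) \<le> C * norm (nested_integrand x \<epsilon> l lm' u)"
    using nested_integrand_comparison[OF hts, of "real l + 1" x] by auto metis
  show ?thesis
  proof (intro exI[of _ "\<lambda>u. C * norm (nested_integrand x \<epsilon> l (shifted lam s0) u)"] conjI allI impI)
    have "nested_heights \<epsilon> l (\<lambda>m. Im (shifted lam s0 m))" using hts by simp
    from nested_integrand_integrable_distinct[OF this s0(1)]
    show "integrable (PiM (whittaker_index l) (\<lambda>_. lborel)) (\<lambda>u. C * norm (nested_integrand x \<epsilon> l (shifted lam s0) u))"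
      by (intro integrable_mult_right integrable_norm)
    fix s :: real and u assume s: "0 \<le> s" "s < 1"
    show "norm (nested_integrand x \<epsilon> l (shifted lam s) u) \<le> C * norm (nested_integrand x \<epsilon> l (shifted lam s0) u)"
    proof (rule C)
      fix m assume m: "m \<le> l"
      have "shifted lam s m - shifted lam s0 m = of_real ((s - s0) * (real m + 1))"
        by (simp add: shifted_def algebra_simps)
      then have "norm (shifted lam s m - shifted lam s0 m) = \<bar>s - s0\<bar> * (real m + 1)"
        by (simp only: norm_of_real abs_mult)
      also have "\<dots> \<le> 1 * (real l + 1)" using s s0 m by (intro mult_mono) auto
      finally show "Im (shifted lam s m) = Im (lam m) \<and> Im (shifted lam s0 m) = Im (lam m) \<and> norm (shifted lam s m - shifted lam s0 m) \<le> real l + 1"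
        by simp
    qed
  qed
qed

text \<open>Induction on the rows. The lower rows contribute the closed formula for the parameters \<open>\<gamma>\<close>, whose denominator
\<open>\<Prod> (\<gamma>\<^sub>i - \<gamma>\<^sub>j)\<close> cancels against the row factor and leaves a Vandermonde determinant. If two entries of \<open>\<gamma>\<close> coincide, the
row factor vanishes and so does that determinant. The condition \<open>x n \<le> x b\<close> in \<open>row_integral\<close> adds
the last inequality of dominance.\<close>

lemma nested_integral_distinct:
  assumes "nested_heights \<epsilon> l (\<lambda>m. Im (lam m))" and "inj_on lam {..l}"
  shows "(LINT u|PiM (whittaker_index l) (\<lambda>_. lborel). nested_integrand x \<epsilon> l lam u) =
    (if dominant_pt (Suc l) x then (2 * pi * \<i>) ^ (\<Sum>n\<le>l. n) * leibniz (Suc l) (\<lambda>m b. exp (\<i> * lam m * of_real (x b))) /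
       (\<Prod>j<Suc l. \<Prod>i<j. lam i - lam j)
     else 0)"
  using assms
proof (induction l arbitrary: lam)
  case 0
  have "dominant_pt (Suc 0) x" by (simp add: dominant_pt_def)
  moreover have "leibniz (Suc 0) (\<lambda>m b. exp (\<i> * lam m * of_real (x b))) = exp (\<i> * lam 0 * of_real (x 0))"
    by (simp add: leibniz_def lessThan_Suc)
  ultimately show ?case
    by (simp add: whittaker_index_0 PiM_empty lebesgue_integral_count_space_finite)
next
  case (Suc l)
  define n where "n = Suc l"
  let ?g = "row_point n (\<epsilon> n)"
  define I where "I u = leibniz n (\<lambda>a b. ?g u a ^ b) / (\<Prod>a<n. \<Prod>m\<le>n. ?g u a - lam m) *
      leibniz n (\<lambda>a b. exp (\<i> * ?g u a * of_real (x b))) *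
      exp (\<i> * ((\<Sum>m\<le>n. lam m) - (\<Sum>a<n. ?g u a)) * of_real (x n))" for u
  have hts: "nested_heights \<epsilon> l (\<lambda>m. - \<epsilon> n m)" "\<And>a m. a < n \<Longrightarrow> m \<le> n \<Longrightarrow> - \<epsilon> n a < Im (lam m)"
    using Suc.prems(1) by (auto simp: n_def)
  define c where "c = (if dominant_pt n x then (2 * pi * \<i>) ^ (\<Sum>n\<le>l. n) / fact n else 0)"
  have inner: "(LINT v|PiM (whittaker_index l) (\<lambda>_. lborel). nested_integrand x \<epsilon> n lam (merge (row_index n) (whittaker_index l) (u, v))) = c * I u" for u
  proof -
    have vd: "leibniz n (\<lambda>a b. ?g u a ^ b) = (\<Prod>j<n. \<Prod>i<j. ?g u j - ?g u i)" by (rule vandermonde_det)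
    have "(LINT v|PiM (whittaker_index l) (\<lambda>_. lborel). nested_integrand x \<epsilon> n lam (merge (row_index n) (whittaker_index l) (u, v))) =
        row_factor x n lam (?g u) * (LINT v|PiM (whittaker_index l) (\<lambda>_. lborel). nested_integrand x \<epsilon> l (?g u) v)"
      unfolding n_def nested_integrand_merge by (rule integral_mult_right_zero)
    also have "\<dots> = c * I u"
    proof (cases "inj_on (?g u) {..l}")
      case True
      have ne: "(\<Prod>j<n. \<Prod>i<j. ?g u i - ?g u j) \<noteq> 0"
        unfolding prod_zero_iff[OF finite_lessThan] using inj_onD[OF True] by (fastforce simp: n_def)
      have "nested_heights \<epsilon> l (\<lambda>m. Im (?g u m))" using hts(1) by simp
      from Suc.IH[OF this True] show ?thesis
        using ne by (simp add: c_def I_def row_factor_def vd prod.distrib n_def[symmetric] del: prod.lessThan_Suc)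
    next
      case False
      then obtain i j where ij: "i < j" "j < n" "?g u i = ?g u j"
        unfolding inj_on_def n_def by (metis atMost_iff le_imp_less_Suc linorder_neqE_nat)
      have "(\<Prod>i<j. ?g u j - ?g u i) = 0" "(\<Prod>i<j. (?g u i - ?g u j) * (?g u j - ?g u i)) = 0"
        by (rule prod_zero, simp, rule bexI[of _ i], simp add: ij(3), simp add: ij(1))+
      then have "(\<Prod>j<n. \<Prod>i<j. ?g u j - ?g u i) = 0" "(\<Prod>j<n. \<Prod>i<j. (?g u i - ?g u j) * (?g u j - ?g u i)) = 0"
        using ij(2) unfolding prod_zero_iff[OF finite_lessThan, of _ n] by blast+
      then show ?thesis
        unfolding I_def vd row_factor_def by (simp only: mult_zero_left mult_zero_right div_0)
    qed
    finally show ?thesis .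
  qed
  have "(LINT u|PiM (whittaker_index n) (\<lambda>_. lborel). nested_integrand x \<epsilon> n lam u) =
     (LINT u|PiM (row_index n) (\<lambda>_. lborel). LINT v|PiM (whittaker_index l) (\<lambda>_. lborel). nested_integrand x \<epsilon> n lam (merge (row_index n) (whittaker_index l) (u, v)))"
  proof -
    have "integrable (PiM (row_index n \<union> whittaker_index l) (\<lambda>_. lborel)) (nested_integrand x \<epsilon> n lam)"
      using nested_integrand_integrable_distinct[OF Suc.prems, of x] unfolding n_def whittaker_index_Suc .
    then show ?thesis
      unfolding n_def whittaker_index_Suc by (rule lborel_product.product_integral_fold[OF row_index_disjoint finite_row_index finite_whittaker_index])
  qed
  also have "\<dots> = c * (LINT u|PiM (row_index n) (\<lambda>_. lborel). I u)"
    unfolding inner by (rule integral_mult_right_zero)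
  also have "(LINT u|PiM (row_index n) (\<lambda>_. lborel). I u) = (if \<forall>b<n. x n \<le> x b
     then fact n * (2 * pi * \<i>) ^ n * leibniz (Suc n) (\<lambda>m b. exp (\<i> * lam m * of_real (x b))) /
       (\<Prod>j<Suc n. \<Prod>i<j. lam i - lam j) else 0)"
    unfolding I_def by (rule row_integral) (use Suc.prems(2) hts(2) in \<open>auto simp: n_def\<close>)
  finally have R: "(LINT u|PiM (whittaker_index n) (\<lambda>_. lborel). nested_integrand x \<epsilon> n lam u) =
     c * (if \<forall>b<n. x n \<le> x b
     then fact n * (2 * pi * \<i>) ^ n * leibniz (Suc n) (\<lambda>m b. exp (\<i> * lam m * of_real (x b))) /
       (\<Prod>j<Suc n. \<Prod>i<j. lam i - lam j) else 0)" .
  have dom: "dominant_pt (Suc n) x \<longleftrightarrow> dominant_pt n x \<and> (\<forall>b<n. x n \<le> x b)"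
  proof
    assume "dominant_pt (Suc n) x"
    then show "dominant_pt n x \<and> (\<forall>b<n. x n \<le> x b)" by (simp add: dominant_pt_def)
  next
    assume R: "dominant_pt n x \<and> (\<forall>b<n. x n \<le> x b)"
    show "dominant_pt (Suc n) x"
      unfolding dominant_pt_def
    proof (intro allI impI)
      fix i j assume ij: "i \<le> j" "j < Suc n"
      show "x j \<le> x i"
      proof (cases "j < n")
        case True
        then show ?thesis using R ij by (simp add: dominant_pt_def)
      next
        case False
        then have "j = n" using ij(2) by simp
        then show ?thesis using R ij(1) by (cases "i = n") auto
      qed
    qed
  qed
  have M: "(\<Sum>n\<le>Suc l. n) = (\<Sum>n\<le>l. n) + n" by (simp add: n_def)
  show ?case
    unfolding n_def[symmetric] R dom
    by (cases "dominant_pt n x"; cases "\<forall>b<n. x n \<le> x b")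
      (auto simp: c_def M[unfolded n_def[symmetric]] power_add simp del: prod.lessThan_Suc)
qed

lemma nested_integrand_shift_tendsto:
  assumes hts: "nested_heights \<epsilon> l (\<lambda>m. Im (lam m))" and S: "S \<longlonglongrightarrow> 0"
  shows "(\<lambda>k. nested_integrand x \<epsilon> l (shifted lam (S k)) u) \<longlonglongrightarrow> nested_integrand x \<epsilon> l lam u"
proof -
  have sh: "(\<lambda>k. shifted lam (S k) m) \<longlonglongrightarrow> lam m" for m
  proof -
    have "(\<lambda>k. shifted lam (S k) m) \<longlonglongrightarrow> lam m + of_real (0 * (real m + 1))"
      unfolding shifted_def by (intro tendsto_intros S)
    then show ?thesis by simp
  qed
  show ?thesis
  proof (cases l)
    case 0
    then show ?thesis by (auto intro!: tendsto_intros sh)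
  next
    case (Suc l')
    have ne: "row_point (Suc l') (\<epsilon> (Suc l')) u a - lam m \<noteq> 0" if "a < Suc l'" "m \<le> Suc l'" for a m
    proof
      assume "row_point (Suc l') (\<epsilon> (Suc l')) u a - lam m = 0"
      then have "Im (row_point (Suc l') (\<epsilon> (Suc l')) u a) = Im (lam m)" by simp
      then show False using hts that by (fastforce simp: Suc)
    qed
    have "(\<lambda>k. row_factor x (Suc l') (shifted lam (S k)) (row_point (Suc l') (\<epsilon> (Suc l')) u)) \<longlonglongrightarrow> row_factor x (Suc l') lam (row_point (Suc l') (\<epsilon> (Suc l')) u)"
      unfolding row_factor_def by (intro tendsto_intros sh) (use ne in \<open>auto simp del: prod.lessThan_Suc prod.atMost_Suc fact_Suc\<close>)
    then show ?thesis unfolding Suc nested_integrand.simps by (rule tendsto_mult[OF _ tendsto_const])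
  qed
qed

text \<open>The shifted closed formula converges, to the normalized integral; in particular the limit of the quotient of determinants at
coinciding parameters exists, without being computed.\<close>

theorem nested_integral_limit:
  assumes hts: "nested_heights \<epsilon> l (\<lambda>m. Im (lam m))"
  shows "((\<lambda>s. if dominant_pt (Suc l) x then char_limit (Suc l) (shifted lam s) x else 0) \<longlongrightarrow>
     (LINT u|PiM (whittaker_index l) (\<lambda>_. lborel). nested_integrand x \<epsilon> l lam u) / ((2 * pi * \<i>) ^ (\<Sum>n\<le>l. n) * \<i> ^ (\<Sum>n\<le>l. n))) (at_right 0)"
proof -
  let ?J = "\<lambda>lm. LINT u|PiM (whittaker_index l) (\<lambda>_. lborel). nested_integrand x \<epsilon> l lm u"
  let ?c = "(2 * pi * \<i>) ^ (\<Sum>n\<le>l. n) * \<i> ^ (\<Sum>n\<le>l. n)"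
  have m: "nested_integrand x \<epsilon> l lm \<in> borel_measurable (PiM (whittaker_index l) (\<lambda>_. lborel))" for lm
    using nested_integrand_measurable[of l "\<lambda>_. lm" _ "\<lambda>u. u" x \<epsilon>] by simp
  obtain w where w: "integrable (PiM (whittaker_index l) (\<lambda>_. lborel)) w"
    "\<And>s u. 0 \<le> s \<Longrightarrow> s < 1 \<Longrightarrow> norm (nested_integrand x \<epsilon> l (shifted lam s) u) \<le> w u"
    using nested_integrand_shift_bound[OF hts, of x] by blast
  have lim: "((\<lambda>s. ?J (shifted lam s)) \<longlongrightarrow> ?J lam) (at_right 0)"
  proof (rule tendsto_at_right_sequentially[of 0 1])
    fix S :: "nat \<Rightarrow> real" assume S: "\<And>n. 0 < S n" "\<And>n. S n < 1" "S \<longlonglongrightarrow> 0"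
    show "(\<lambda>n. ?J (shifted lam (S n))) \<longlonglongrightarrow> ?J lam"
    proof (rule integral_dominated_convergence[OF m m w(1)])
      show "AE u in PiM (whittaker_index l) (\<lambda>_. lborel). (\<lambda>k. nested_integrand x \<epsilon> l (shifted lam (S k)) u) \<longlonglongrightarrow> nested_integrand x \<epsilon> l lam u"
        by (intro AE_I2 nested_integrand_shift_tendsto hts S)
      show "AE u in PiM (whittaker_index l) (\<lambda>_. lborel). norm (nested_integrand x \<epsilon> l (shifted lam (S k)) u) \<le> w u" for k
        by (intro AE_I2 w(2)) (use S less_imp_le in auto)
    qed
  qed simp
  have "eventually (\<lambda>s. ?J (shifted lam s) / ?c = (if dominant_pt (Suc l) x then char_limit (Suc l) (shifted lam s) x else 0)) (at_right 0)"
    using eventually_shifted_inj[of lam "Suc l"]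
  proof eventually_elim
    case (elim s)
    have "(\<Prod>j<Suc l. \<Prod>i<j. \<i> * (shifted lam s i - shifted lam s j)) = \<i> ^ (\<Sum>n\<le>l. n) * (\<Prod>j<Suc l. \<Prod>i<j. shifted lam s i - shifted lam s j)"
      by (simp only: prod.distrib prod_constant card_lessThan power_sum[symmetric] lessThan_Suc_atMost)
    moreover have "?J (shifted lam s) = (if dominant_pt (Suc l) x then (2 * pi * \<i>) ^ (\<Sum>n\<le>l. n) * leibniz (Suc l) (\<lambda>m b. exp (\<i> * shifted lam s m * of_real (x b))) /
       (\<Prod>j<Suc l. \<Prod>i<j. shifted lam s i - shifted lam s j) else 0)"
      by (rule nested_integral_distinct) (use hts elim in \<open>simp_all add: lessThan_Suc_atMost\<close>)
    ultimately show ?case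
      by (simp only: char_limit_def) (simp del: prod.lessThan_Suc)
  qed
  from tendsto_cong[OF this] show ?thesis
    using tendsto_divide[OF lim tendsto_const, of ?c] by simp
qed

section \<open>The Whittaker functions\<close>

lemma whittaker_integrand_cong:
  assumes "\<And>n j. n \<le> l + 1 \<Longrightarrow> \<gamma> n j = \<gamma>' n j"
  shows "whittaker_integrand l x \<gamma> = whittaker_integrand l x \<gamma>'"
proof -
  have "(\<Prod>(s, p)\<in>{(s, p). s \<in> {1..n} \<and> p \<in> {1..n} \<and> s \<noteq> p}. \<gamma> n s - \<gamma> n p) / (fact n * (\<Prod>k = 1..n. \<Prod>m = 1..n + 1. \<gamma> n k - \<gamma> (n + 1) m)) =
     (\<Prod>(s, p)\<in>{(s, p). s \<in> {1..n} \<and> p \<in> {1..n} \<and> s \<noteq> p}. \<gamma>' n s - \<gamma>' n p) / (fact n * (\<Prod>k = 1..n. \<Prod>m = 1..n + 1. \<gamma>' n k - \<gamma>' (n + 1) m))"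
    if "n \<in> {1..l}" for n
    using that assms by simp
  moreover have "(\<Sum>n = 1..l + 1. \<Sum>j = 1..n. (\<gamma> n j - \<gamma> (n - 1) j) * complex_of_real (x n)) =
      (\<Sum>n = 1..l + 1. \<Sum>j = 1..n. (\<gamma>' n j - \<gamma>' (n - 1) j) * complex_of_real (x n))"
    by (intro sum.cong refl) (use assms in auto)
  ultimately show ?thesis
    by (simp add: whittaker_integrand_def cong: prod.cong_simp)
qed

text \<open>The entry \<open>\<gamma> n (n + 1)\<close> is \<open>0\<close> by convention, so the last exponent is the difference of the sums of the two rows.\<close>

lemma whittaker_row_factor:
  assumes z: "\<gamma> n (n + 1) = 0"
  shows "(\<Prod>(s, p)\<in>{(s, p). s \<in> {1..n} \<and> p \<in> {1..n} \<and> s \<noteq> p}. \<gamma> n s - \<gamma> n p) / (fact n * (\<Prod>k = 1..n. \<Prod>m = 1..n + 1. \<gamma> n k - \<gamma> (n + 1) m)) *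
      exp (\<i> * (\<Sum>j = 1..n + 1. (\<gamma> (n + 1) j - \<gamma> n j) * complex_of_real (x (n + 1)))) =
    row_factor (\<lambda>j. x (Suc j)) n (\<lambda>m. \<gamma> (n + 1) (Suc m)) (\<lambda>a. \<gamma> n (Suc a))"
proof -
  have set: "{(s, p). s \<in> {1..n} \<and> p \<in> {1..n} \<and> s \<noteq> p} = Sigma {1..n} (\<lambda>s. {1..n} - {s})" by auto
  have img: "{1..n} - {Suc a} = Suc ` ({..<n} - {a})" for a
    by (simp add: image_set_diff[OF inj_Suc] image_Suc_lessThan)
  have "(\<Prod>(s, p)\<in>{(s, p). s \<in> {1..n} \<and> p \<in> {1..n} \<and> s \<noteq> p}. \<gamma> n s - \<gamma> n p) = (\<Prod>s = 1..n. \<Prod>p\<in>{1..n} - {s}. \<gamma> n s - \<gamma> n p)"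
    unfolding set by (rule prod.Sigma[symmetric]) auto
  also have "\<dots> = (\<Prod>a<n. \<Prod>p\<in>{..<n} - {a}. \<gamma> n (Suc a) - \<gamma> n (Suc p))"
    unfolding One_nat_def prod.atLeast1_atMost_eq img[unfolded One_nat_def] by (simp add: prod.reindex)
  also have "\<dots> = (\<Prod>j<n. \<Prod>i<j. (\<gamma> n (Suc i) - \<gamma> n (Suc j)) * (\<gamma> n (Suc j) - \<gamma> n (Suc i)))"
    by (rule prod_offdiagonal)
  finally have 1: "(\<Prod>(s, p)\<in>{(s, p). s \<in> {1..n} \<and> p \<in> {1..n} \<and> s \<noteq> p}. \<gamma> n s - \<gamma> n p) =
    (\<Prod>j<n. \<Prod>i<j. (\<gamma> n (Suc i) - \<gamma> n (Suc j)) * (\<gamma> n (Suc j) - \<gamma> n (Suc i)))" .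
  have 2: "(\<Prod>k = 1..n. \<Prod>m = 1..n + 1. \<gamma> n k - \<gamma> (n + 1) m) = (\<Prod>a<n. \<Prod>m\<le>n. \<gamma> n (Suc a) - \<gamma> (n + 1) (Suc m))"
    unfolding One_nat_def prod.atLeast1_atMost_eq by (simp only: add_Suc_right add_0_right lessThan_Suc_atMost)
  have 3: "(\<Sum>j = 1..n + 1. (\<gamma> (n + 1) j - \<gamma> n j) * complex_of_real (x (n + 1))) =
      ((\<Sum>m\<le>n. \<gamma> (n + 1) (Suc m)) - (\<Sum>a<n. \<gamma> n (Suc a))) * complex_of_real (x (Suc n))"
    unfolding One_nat_def sum.atLeast1_atMost_eq using z
    by (simp add: sum_distrib_right[symmetric] sum_subtractf lessThan_Suc_atMost[symmetric])
  show ?thesis unfolding 1 2 3 row_factor_def by (simp only: mult.assoc)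
qed

text \<open>The top row of variables becomes the row \<open>n = l + 1\<close> of parameters of the smaller integrand.\<close>

lemma whittaker_integrand_nested:
  "whittaker_integrand l x (whittaker_gamma l lam \<epsilon> u) =
     nested_integrand (\<lambda>j. x (Suc j)) (\<lambda>n a. \<epsilon> n (Suc a)) l (\<lambda>m. lam (Suc m)) u"
proof (induction l arbitrary: lam)
  case 0
  show ?case by (simp add: whittaker_integrand_def whittaker_gamma_def mult.assoc)
next
  case (Suc l)
  define lam' where "lam' j = complex_of_real (u (Suc l, j)) - \<i> * complex_of_real (\<epsilon> (Suc l) j)" for j
  let ?\<gamma> = "whittaker_gamma (Suc l) lam \<epsilon> u"
  have rp: "row_point (Suc l) (\<lambda>a. \<epsilon> (Suc l) (Suc a)) u = (\<lambda>m. lam' (Suc m))"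
    by (auto simp: row_point_def lam'_def)
  have "whittaker_gamma l lam' \<epsilon> u n j = ?\<gamma> n j" if "n \<le> l + 1" for n j
    using that by (auto simp: whittaker_gamma_def lam'_def)
  then have low: "whittaker_integrand l x ?\<gamma> = whittaker_integrand l x (whittaker_gamma l lam' \<epsilon> u)"
    by (intro whittaker_integrand_cong) simp
  have "whittaker_integrand (Suc l) x ?\<gamma> = whittaker_integrand l x ?\<gamma> *
    ((\<Prod>(s, p)\<in>{(s, p). s \<in> {1..Suc l} \<and> p \<in> {1..Suc l} \<and> s \<noteq> p}. ?\<gamma> (Suc l) s - ?\<gamma> (Suc l) p) / (fact (Suc l) * (\<Prod>k = 1..Suc l. \<Prod>m = 1..Suc l + 1. ?\<gamma> (Suc l) k - ?\<gamma> (Suc l + 1) m)) *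
      exp (\<i> * (\<Sum>j = 1..Suc l + 1. (?\<gamma> (Suc l + 1) j - ?\<gamma> (Suc l) j) * complex_of_real (x (Suc l + 1)))))"
  proof -
    have s: "(\<Sum>n = 1..Suc l + 1. \<Sum>j = 1..n. (?\<gamma> n j - ?\<gamma> (n - 1) j) * complex_of_real (x n)) =
       (\<Sum>n = 1..l + 1. \<Sum>j = 1..n. (?\<gamma> n j - ?\<gamma> (n - 1) j) * complex_of_real (x n)) +
       (\<Sum>j = 1..Suc l + 1. (?\<gamma> (Suc l + 1) j - ?\<gamma> (Suc l) j) * complex_of_real (x (Suc l + 1)))"
      by (simp only: add_Suc sum.cl_ivl_Suc diff_Suc_1 Suc_eq_plus1[symmetric]) simp
    have p: "(\<Prod>n = 1..Suc l. F n) = (\<Prod>n = 1..l. F n) * F (Suc l)" for F :: "nat \<Rightarrow> complex"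
      by simp
    show ?thesis
      unfolding whittaker_integrand_def s p distrib_left exp_add by (simp only: mult_ac)
  qed
  also have "\<dots> = whittaker_integrand l x ?\<gamma> * row_factor (\<lambda>j. x (Suc j)) (Suc l) (\<lambda>m. ?\<gamma> (Suc l + 1) (Suc m)) (\<lambda>a. ?\<gamma> (Suc l) (Suc a))"
    by (subst whittaker_row_factor) (simp_all add: whittaker_gamma_def)
  also have "row_factor (\<lambda>j. x (Suc j)) (Suc l) (\<lambda>m. ?\<gamma> (Suc l + 1) (Suc m)) (\<lambda>a. ?\<gamma> (Suc l) (Suc a)) =
      row_factor (\<lambda>j. x (Suc j)) (Suc l) (\<lambda>m. lam (Suc m)) (\<lambda>m. lam' (Suc m))"
    by (rule row_factor_cong) (auto simp: whittaker_gamma_def lam'_def)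
  finally show ?case
    by (simp only: low Suc.IH nested_integrand.simps rp mult.commute)
qed

text \<open>The imaginary parts of the contour do not depend on the real variables, so one choice of these suffices.\<close>

lemma whittaker_contour_nested:
  assumes "whittaker_contour l lam \<epsilon>"
  shows "nested_heights (\<lambda>n a. \<epsilon> n (Suc a)) l (\<lambda>m. Im (lam (Suc m)))"
proof -
  let ?\<gamma> = "\<lambda>l lam. whittaker_gamma l lam \<epsilon> (\<lambda>_. 0)"
  have "Im (?\<gamma> l lam k j) < Im (?\<gamma> l lam (k + 1) m)" if "k \<in> {1..l}" "j \<in> {1..k}" "m \<in> {1..k + 1}" for k j m
  proof -
    have "Im (?\<gamma> l lam k j) \<le> Max ((\<lambda>j. Im (?\<gamma> l lam k j)) ` {1..k})" using that by (intro Max_ge) auto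
    also have "\<dots> < Min ((\<lambda>m. Im (?\<gamma> l lam (k + 1) m)) ` {1..k + 1})"
      using assms that unfolding whittaker_contour_def by blast
    also have "\<dots> \<le> Im (?\<gamma> l lam (k + 1) m)" using that by (intro Min_le) auto
    finally show ?thesis .
  qed
  then show ?thesis
  proof (induction l arbitrary: lam)
    case (Suc l)
    define lam' where "lam' j = - \<i> * complex_of_real (\<epsilon> (Suc l) j)" for j
    have g: "?\<gamma> l lam' n j = ?\<gamma> (Suc l) lam n j" if "n \<le> l + 1" for n j
      using that by (auto simp: whittaker_gamma_def lam'_def)
    have "nested_heights (\<lambda>n a. \<epsilon> n (Suc a)) l (\<lambda>m. Im (lam' (Suc m)))"
    proof (rule Suc.IH)
      fix k j m assume "k \<in> {1..l}" "j \<in> {1..k}" "m \<in> {1..k + 1}"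
      then show "Im (?\<gamma> l lam' k j) < Im (?\<gamma> l lam' (k + 1) m)"
        using Suc.prems[of k j m] by (simp add: g)
    qed
    moreover have "- \<epsilon> (Suc l) (Suc a) < Im (lam (Suc m))" if "a < Suc l" "m \<le> Suc l" for a m
      using Suc.prems[of "Suc l" "Suc a" "Suc m"] that by (simp add: whittaker_gamma_def)
    ultimately show ?case by (simp add: lam'_def)
  qed simp
qed

lemma sum_atMost_nat: "(\<Sum>n\<le>l. n) = l * (l + 1) div (2::nat)"
  using gauss_sum_nat[of l] by (simp add: atLeast0AtMost)

lemma whittaker_elementary_limit:
  assumes "whittaker_contour l lam \<epsilon>"
  shows "((\<lambda>s. if dominant_pt (Suc l) (\<lambda>j. x (Suc j))
      then char_limit (Suc l) (shifted (\<lambda>m. lam (Suc m)) s) (\<lambda>j. x (Suc j)) else 0) \<longlongrightarrow>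
    whittaker_elementary l \<epsilon> lam x) (at_right 0)"
proof -
  let ?M = "\<Sum>n\<le>l. n"
  have c: "(\<Prod>(n, j)\<in>whittaker_index l. 1 / (2 * complex_of_real pi * \<i>)) = 1 / (2 * pi * \<i>) ^ ?M"
    by (simp add: case_prod_unfold card_whittaker_index power_divide)
  have "whittaker_elementary l \<epsilon> lam x =
     (LINT u|PiM (whittaker_index l) (\<lambda>_. lborel). nested_integrand (\<lambda>j. x (Suc j)) (\<lambda>n a. \<epsilon> n (Suc a)) l (\<lambda>m. lam (Suc m)) u) /
       ((2 * pi * \<i>) ^ ?M * \<i> ^ ?M)"
    unfolding whittaker_elementary_def whittaker_integrand_nested c integral_mult_left_zero sum_atMost_nat[symmetric]
    by (simp add: power_int_minus divide_inverse mult_ac del: of_nat_sum)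
  then show ?thesis
    using nested_integral_limit[OF whittaker_contour_nested[OF assms], of "\<lambda>j. x (Suc j)"] by simp
qed

text \<open>Only the arguments at \<open>1, ..., N\<close> matter; the value at \<open>0\<close> differs between the two indexings.\<close>

lemma whittaker_q0_cong:
  assumes "\<And>i. i \<in> {1..N} \<Longrightarrow> z i = z' i" "\<And>i. i \<in> {1..N} \<Longrightarrow> n i = n' i"
  shows "whittaker_q0 N z n = whittaker_q0 N z' n'"
proof -
  have "gl_highest_weight N d \<rho> n = gl_highest_weight N d \<rho> n'" for d \<rho>
    using assms(2) by (simp add: gl_highest_weight_def)
  then have "gl_irrep N n = gl_irrep N n'" by (simp add: gl_irrep_def)
  moreover have "gl_dominant N n = gl_dominant N n'" using assms(2) by (simp add: gl_dominant_def)
  moreover have "foldr (\<lambda>i M. mat_cpow (z i) (\<rho> (gl_unit N i i)) * M) [1..<N+1] (1\<^sub>m d) =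
      foldr (\<lambda>i M. mat_cpow (z' i) (\<rho> (gl_unit N i i)) * M) [1..<N+1] (1\<^sub>m d)" for d \<rho>
    by (rule foldr_cong) (use assms(1) in auto)
  ultimately show ?thesis by (simp add: whittaker_q0_def split: prod.split)
qed

theorem proposition4p1:
  fixes l :: nat
    and lam :: "nat \<Rightarrow> complex"
    and x :: "nat \<Rightarrow> real"
    and \<epsilon> :: "nat \<Rightarrow> nat \<Rightarrow> real"
  assumes "whittaker_contour l lam \<epsilon>"
  shows "((\<lambda>t::real. complex_of_real (ln t) ^ (l * (l + 1) div 2) *
            whittaker_q0 (l + 1)
              (\<lambda>i. complex_of_real t powr (\<i> * lam i))
              (\<lambda>j. \<lfloor>x j / ln t\<rfloor>))
          \<longlongrightarrow> whittaker_elementary l \<epsilon> lam x) (at_right 1)"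
proof -
  let ?lam = "\<lambda>m. lam (Suc m)" and ?x = "\<lambda>j. x (Suc j)"
  let ?M = "l * (l + 1) div 2"
  have M: "(\<Sum>j<Suc l. j) = ?M" by (simp only: lessThan_Suc_atMost sum_atMost_nat)
  have "((\<lambda>h. of_real h ^ ?M * q0_at (Suc l) ?lam ?x h) \<longlongrightarrow> whittaker_elementary l \<epsilon> lam x) (at_right 0)"
  proof (cases "dominant_pt (Suc l) ?x")
    case True
    then show ?thesis
      using q0_at_limit[OF True] whittaker_elementary_limit[OF assms, of x] unfolding M by simp
  next
    case False
    \<comment> \<open>Here both sides vanish; for the integral this is again a consequence of continuity.\<close>
    then have "((\<lambda>_. 0) \<longlongrightarrow> whittaker_elementary l \<epsilon> lam x) (at_right (0::real))"
      using whittaker_elementary_limit[OF assms, of x] by simp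
    then have "whittaker_elementary l \<epsilon> lam x = 0"
      using tendsto_unique[OF trivial_limit_at_right_real _ tendsto_const] by metis
    then show ?thesis using q0_at_nondominant[OF False] by simp
  qed
  moreover have "filterlim ln (at_right 0) (at_right (1::real))"
    unfolding filterlim_at
  proof (intro conjI)
    show "(ln \<longlongrightarrow> 0) (at_right (1::real))" by (auto intro!: tendsto_eq_intros)
    show "eventually (\<lambda>t::real. ln t \<in> {0<..} \<and> ln t \<noteq> 0) (at_right 1)"
      using eventually_at_right_less[of "1::real"] by eventually_elim auto
  qed
  ultimately have "((\<lambda>t. of_real (ln t) ^ ?M * q0_at (Suc l) ?lam ?x (ln t)) \<longlongrightarrow> whittaker_elementary l \<epsilon> lam x) (at_right 1)"
    by (rule filterlim_compose)
  moreover have "eventually (\<lambda>t. of_real (ln t) ^ ?M * q0_at (Suc l) ?lam ?x (ln t) =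
      complex_of_real (ln t) ^ ?M * whittaker_q0 (l + 1) (\<lambda>i. complex_of_real t powr (\<i> * lam i)) (\<lambda>j. \<lfloor>x j / ln t\<rfloor>)) (at_right 1)"
    using eventually_at_right_less[of "1::real"]
  proof eventually_elim
    case (elim t)
    have "exp (\<i> * lam (Suc (i - 1)) * of_real (ln t)) = complex_of_real t powr (\<i> * lam i)" if "i \<in> {1..Suc l}" for i
      using that elim by (simp add: powr_def Ln_of_real mult_ac)
    moreover have "floor_weight ?x (ln t) j = \<lfloor>x j / ln t\<rfloor>" if "j \<in> {1..Suc l}" for j
      using that by (simp add: floor_weight_def)
    ultimately have "q0_at (Suc l) ?lam ?x (ln t) = whittaker_q0 (Suc l) (\<lambda>i. complex_of_real t powr (\<i> * lam i)) (\<lambda>j. \<lfloor>x j / ln t\<rfloor>)"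
      unfolding q0_at_def by (rule whittaker_q0_cong)
    then show ?case by simp
  qed
  ultimately show ?thesis by (rule Lim_transform_eventually)
qed

end
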